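(* Let $d\ge 3$, let $(S,M)$ be an unpunctured marked surface with a $d$-angulation $D$, and let $i\in D$ be an arc. Let $(Q,W)$ be a quiver with superpotential associated to $(S,M,D)$. Then the mutation $\mu'_i(Q,W)=(\mu'_i(Q),\mu'_i(W))$ is a quiver with superpotential associated to the flipped $d$-angulation $(S,M,\mu_i(D))$ (where the vertex $i$ of $\mu'_i(Q)$ is identified with the flipped arc and every other vertex with the same arc of $D$).
   Context: $\mathbf k$ is an algebraically closed field and $d\ge 3$ is an integer. Paths are composed from left to right: $pq$ is "first $p$, then $q$"; $s(\cdot),t(\cdot)$ denote source and target. **Surfaces.** An unpunctured marked surface $(S,M)$ is a compact connected oriented Riemann surface $S$ with non-empty boundary and a finite set $M\subset\partial S$ of marked points meeting every boundary component. An arc is a curve $\gamma:[0,1]\to S$ with endpoints in $M$, interior in $S\setminus\partial S$, no self-intersection in its interior, neither null-homotopic nor homotopic to a boundary segment; arcs are taken up to isotopy. Arcs are compatible if they have representatives with disjoint interiors. A $d$-angulation $D$ is a set of compatible arcs cutting $(S,M)$ into (pseudo) $d$-gons $D_1,\dots,D_s$ (sides of one $d$-gon may be identified in $S$). An arc is self-folded if the two $d$-gons on its two sides coincide. The flip of $i\in D$ is the arc $\mu_D(i)$ obtained by moving both endpoints of $i$ anticlockwise, along the boundary segments and the arcs of $D\setminus\{i\}$, to the next marked points (i.e. rotating $i$ by one step anticlockwise in the $(2d-2)$-gon obtained by deleting $i$); $\mu_i(D)=(D\setminus\{i\})\cup\{\mu_D(i)\}$. **Quivers with superpotential (QsP).**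 A QsP is a pair $(Q,W)$ where: $Q$ is a finite graded quiver with arrows in degrees $0,-1,\dots,2-d$ such that each arrow $\varphi$ has (up to sign) an opposite arrow $\varphi^{op}$, going in the opposite direction, of degree $2-d-|\varphi|$, with $(\varphi^{op})^{op}=-(-1)^{|\varphi||\varphi^{op}|}\varphi$; $W$ is a linear combination of cycles, up to signed cyclic permutation, homogeneous of degree $3-d$, with vanishing necklace bracket $\{W,W\}=0$. For a cycle $c$, $\partial_\varphi c=\sum_{c=p\varphi q}(-1)^{|p||\varphi q|}qp$. The condition $\{W,W\}=0$ is equivalent to $\delta^2=0$ for the derivation $\delta$ of $\mathbf kQ$ (graded Leibniz rule $\delta(pq)=\delta(p)q+(-1)^{|p|}p\,\delta(q)$) given by $\delta\varphi=(-1)^{d(|\varphi|+1)}\partial_{\varphi^{op}}W$. **QsP associated to $D$.** For each $d$-gon $D_r$ let $Q(D_r)$ be the graded quiver whose vertices are the non-boundary sides of $D_r$ (a self-folded arc gives two vertices), with exactly one arrow in each direction between any two distinct vertices and no loops, where an arrow $\phi$ has degree $-n$, $n$ being the number of other sides of $D_r$ strictly between $s(\phi)$ and $t(\phi)$ in clockwise order. The two arrows between two vertices are opposite to each other up to sign. $W(D_r)$ is any sum with signs $\pm1$ of all 3-cycles of degree $3-d$ in $Q(D_r)$ such that $\{W(D_r),W(D_r)\}=0$. The pre-quiver ${}_pQ$ is the disjoint union of the $Q(D_r)$; each arc $k$ of $D$ gives exactly two vertices $k^+,k^-$ of ${}_pQ$. $Q=Q_D$ is obtained from ${}_pQ$ by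 gluing $k^+$ and $k^-$ for every arc $k$, and $W=W_D=\sum_r W(D_r)$. A QsP associated to $(S,M,D)$ is any $(Q_D,W_D)$ so obtained (all admissible sign choices are allowed). For vertices $u,v$ of one $Q(D_r)$, $a_{uv}$ denotes the arrow $u\to v$. **Mutation $\mu_i$ (Oppermann).** Let $(Q,W)$ be a QsP and $i$ a vertex without loops of degree $0$. Let $A=\{\alpha\in Q_1: t(\alpha)=i,\ |\alpha|=0\}$ and $\Delta=1-\sum_{\alpha\in A}\alpha^{-1}\alpha$, with formal inverses $\alpha^{-1}$. For a path $p$, $\operatorname{dec}(p)$ is obtained by inserting $\Delta$ between any two consecutive arrows $\varphi\psi$ of $p$ meeting at $i$ with $\varphi\notin A$, then expanding and reading $\alpha\varphi$, $\varphi\alpha^{-1}$, $\alpha\varphi\beta^{-1}$ as single formal composite arrows. The pair $\mu_i(Q,W)=(Q_M,W_M)$, with degrees in $Q_M$ written $\|\cdot\|$, is given by: (1) for arrows not in $A\cup A^{op}$, the degree is lowered by 1 if the source is $i$ and raised by 1 if the target is $i$ (loops at $i$ keep their degree); (2) each $\alpha\in A$ and $\alpha^{op}$ are replaced by $\alpha^*$ (same direction as $\alpha^{op}$, $\|\alpha^*\|=0$) and $(\alpha^* )^{op_M}$; (3) for $\alpha\in A$ and $\varphi\in Q_1$ with $s(\varphi)=i$, $|\varphi|\ge 3-d$, add an arrow $\alpha\varphi$ and its opposite $(\alpha\varphi)^{op_M}=-\varphi^{op}\alpha^{-1}$, with $\|\alpha\varphi\|=|\varphi|$ if $t(\varphi)\ne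 i$ and $\|\alpha\varphi\|=|\varphi|+1$ if $\varphi$ is a loop; (4) for each loop $\varphi$ at $i$ and $\alpha,\beta\in A$, add an arrow $\alpha\varphi\beta^{-1}$ of degree $|\varphi|$, with opposite $(\alpha\varphi\beta^{-1})^{op_M}=\beta\varphi^{op}\alpha^{-1}$; (5) $W_M=\operatorname{dec}_{cyc}W+\sum_{\alpha,\varphi}\alpha\operatorname{dec}(\varphi\varphi^{op_M})\alpha^*$, the sum over $\alpha\in A$ and $\varphi\in Q_1$ with $s(\varphi)=i$, $|\varphi|\ge3-d$. Here a cycle $c$ is written (by cyclic permutation) so that it does not end with an arrow of $A$, and $\operatorname{dec}_{cyc}c=\operatorname{dec}c$ if $c$ does not start and end in $i$, while $\operatorname{dec}_{cyc}c=(-1)^d\operatorname{dec}c-\sum_{\alpha\in A}\alpha(\operatorname{dec}c)\alpha^{-1}$ if it does. For arrows $\varphi$ common to $Q$ and $Q_M$: $\varphi^{op_M}=\varphi^{op}$ if $s(\varphi)\neq i$ and $\varphi^{op_M}=(-1)^{d+1}\varphi^{op}$ if $s(\varphi)=i$. **Mutation $\mu'_i$ for a QsP $(Q,W)$ associated to $D$ (here $|A|\in\{0,1,2\}$).** Step 1: let $\widetilde{{}_pQ}$ be obtained from ${}_pQ$ by gluing only $i^+,i^-$ into $i$ (keeping the names $a_{uv}$ of the arrows), and form $\mu_i(\widetilde{{}_pQ})$ by the rules above, with superpotential $\mu_i(W)=W_M$. Step 2: remove all superfluous arrows. If $|A|=0$ there are none. If $|A|=1$, write $A=\{a_{ki^+}\}$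 (interchanging the names $i^\pm$ if needed); the superfluous arrows are both arrows in each of the pairs $(a_{ki^+}a_{i^+j},\,a_{kj})$ (all $j$) and $(a_{ki^+}a_{i^+i^-}a_{ki^+}^{-1},\,a_{ki^-}a_{ki^+}^{-1})$, whenever they exist in $\mu_i(\widetilde{{}_pQ})$, together with their opposites. If $|A|=2$, write $A=\{a_{ki^+},a_{k'i^-}\}$; the superfluous arrows are those in the pairs $(a_{ki^+}a_{i^+j},a_{kj})$, $(a_{ki^+}a_{i^+i^-}a_{ki^+}^{-1},a_{ki^-}a_{ki^+}^{-1})$, $(a_{ki^+}a_{i^+i^-}a_{k'i^-}^{-1},a_{ki^-}a_{k'i^-}^{-1})$, $(a_{k'i^-}a_{i^-j},a_{k'j})$, $(a_{k'i^-}a_{i^-i^+}a_{k'i^-}^{-1},a_{k'i^+}a_{k'i^-}^{-1})$, $(a_{k'i^-}a_{i^-i^+}a_{ki^+}^{-1},a_{k'i^+}a_{ki^+}^{-1})$, whenever they exist, together with their opposites. Step 3: $\mu'_i(Q)$ is obtained by gluing $k^+,k^-$ into $k$ for all $k\ne i$. Step 4: $\mu'_i(W)$ is obtained from $\mu_i(W)$ by deleting all paths containing an arrow removed in Step 2. *)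

theory Defs
  imports
    "HOL-Complex_Analysis.Complex_Analysis"
    "HOL-Library.Poly_Mapping"
begin

section \<open>Marked surfaces and arcs\<close>

text \<open>
  A Riemann surface with boundary is a subspace \<open>S\<close> of some Hausdorff type together with an atlas
  \<open>\<A>\<close> of charts \<open>(U, \<phi>)\<close> onto relatively open subsets of the closed upper half plane.  Continuity
  of the transition maps is automatic; by Schwarz reflection, holomorphy on the open half plane is
  all that has to be required.  The surface carries the orientation given by the complex structure.
\<close>

definition riemann_surface :: "'a::t2_space set \<Rightarrow> ('a set \<times> ('a \<Rightarrow> complex)) set \<Rightarrow> bool" where
  "riemann_surface S \<A> \<longleftrightarrow>
     (\<forall>(U, \<phi>)\<in>\<A>. openin (top_of_set S) U \<and> openin (top_of_set {z. 0 \<le> Im z}) (\<phi> ` U) \<and>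
        (\<exists>\<psi>. homeomorphism U (\<phi> ` U) \<phi> \<psi>)) \<and>
     S = (\<Union>(U, \<phi>)\<in>\<A>. U) \<and>
     (\<forall>(U, \<phi>)\<in>\<A>. \<forall>(V, \<psi>)\<in>\<A>.
        (\<psi> \<circ> inv_into U \<phi>) holomorphic_on (\<phi> ` (U \<inter> V) \<inter> {z. 0 < Im z}))"

definition bdry :: "('a set \<times> ('a \<Rightarrow> complex)) set \<Rightarrow> 'a set" where
  "bdry \<A> = {x. \<exists>(U, \<phi>)\<in>\<A>. x \<in> U \<and> Im (\<phi> x) = 0}"

definition marked_surface ::
    "'a::t2_space set \<Rightarrow> ('a set \<times> ('a \<Rightarrow> complex)) set \<Rightarrow> 'a set \<Rightarrow> bool" where
  "marked_surface S \<A> M \<longleftrightarrow>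
     riemann_surface S \<A> \<and> compact S \<and> connected S \<and> bdry \<A> \<noteq> {} \<and>
     finite M \<and> M \<subseteq> bdry \<A> \<and> (\<forall>C\<in>components (bdry \<A>). M \<inter> C \<noteq> {})"

definition boundary_segment ::
    "('a::t2_space set \<times> ('a \<Rightarrow> complex)) set \<Rightarrow> 'a set \<Rightarrow> (real \<Rightarrow> 'a) \<Rightarrow> bool" where
  "boundary_segment \<A> M b \<longleftrightarrow>
     simple_path b \<and> path_image b \<subseteq> bdry \<A> \<and> pathstart b \<in> M \<and> pathfinish b \<in> M \<and>
     b ` {0<..<1} \<inter> M = {}"

definition marked_arc ::
    "'a::t2_space set \<Rightarrow> ('a set \<times> ('a \<Rightarrow> complex)) set \<Rightarrow> 'a set \<Rightarrow> (real \<Rightarrow> 'a) \<Rightarrow> bool" where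
  "marked_arc S \<A> M \<gamma> \<longleftrightarrow>
     simple_path \<gamma> \<and> pathstart \<gamma> \<in> M \<and> pathfinish \<gamma> \<in> M \<and> \<gamma> ` {0<..<1} \<subseteq> S - bdry \<A> \<and>
     \<not> homotopic_paths S \<gamma> (\<lambda>_. pathstart \<gamma>) \<and>
     (\<forall>b. boundary_segment \<A> M b \<longrightarrow> \<not> homotopic_paths S \<gamma> b)"

section \<open>\<open>d\<close>-angulations\<close>

text \<open>
  Every other corner lies strictly to the left of each directed edge, i.e. \<open>v 0, \<dots>, v (d - 1)\<close>
  are the corners of a strictly convex polygon, in anticlockwise order.
\<close>

definition convex_polygon :: "nat \<Rightarrow> (nat \<Rightarrow> complex) \<Rightarrow> bool" where
  "convex_polygon d v \<longleftrightarrow>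
     (\<forall>k<d. \<forall>j<d. j \<noteq> k \<and> j \<noteq> Suc k mod d \<longrightarrow>
        0 < Im (cnj (v (Suc k mod d) - v k) * (v j - v k)))"

text \<open>
  The map \<open>\<Phi>\<close> from a plane region to the surface has local degree \<open>1\<close> at every point of \<open>X\<close>,
  measured in the holomorphic charts of the surface.
\<close>

definition orientation_preserving ::
    "('a set \<times> ('a \<Rightarrow> complex)) set \<Rightarrow> (complex \<Rightarrow> 'a) \<Rightarrow> complex set \<Rightarrow> bool" where
  "orientation_preserving \<A> \<Phi> X \<longleftrightarrow>
     (\<forall>z\<in>X. \<forall>(U, \<phi>)\<in>\<A>. \<Phi> z \<in> U \<longrightarrow>
        (\<forall>\<^sub>F \<rho> in at_right 0. winding_number (\<phi> \<circ> \<Phi> \<circ> circlepath z \<rho>) (\<phi> (\<Phi> z)) = 1))"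

text \<open>
  The polygons \<open>D\<^sub>0, \<dots>, D\<^sub>s\<^sub>-\<^sub>1\<close> (\<open>s = npoly\<close>) into which a surface is cut: the polygon number \<open>r\<close> is
  parametrised by a map \<open>chart r\<close> from a convex polygon in the plane whose corners are \<open>vert r k\<close>.
  Its side number \<open>k\<close> runs from corner \<open>k\<close> to corner \<open>k + 1\<close>, so that sides are numbered
  anticlockwise.  \<open>side_arc r k\<close> is the label of the arc on that side, \<open>None\<close> for a boundary side.
\<close>

record ('a, 'v) polygons =
  npoly :: nat
  vert :: "nat \<Rightarrow> nat \<Rightarrow> complex"
  chart :: "nat \<Rightarrow> complex \<Rightarrow> 'a"
  side_arc :: "nat \<Rightarrow> nat \<Rightarrow> 'v option"

type_synonym side = "nat \<times> nat"

definition polygon_region :: "nat \<Rightarrow> ('a, 'v) polygons \<Rightarrow> nat \<Rightarrow> complex set" where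
  "polygon_region d P r = convex hull (vert P r ` {..<d})"

definition sides :: "nat \<Rightarrow> ('a, 'v) polygons \<Rightarrow> side set" where
  "sides d P = {..<npoly P} \<times> {..<d}"

definition next_side :: "nat \<Rightarrow> side \<Rightarrow> side" where
  "next_side d u = (fst u, Suc (snd u) mod d)"

definition label :: "('a, 'v) polygons \<Rightarrow> side \<Rightarrow> 'v option" where
  "label P u = side_arc P (fst u) (snd u)"

definition side_curve :: "nat \<Rightarrow> ('a, 'v) polygons \<Rightarrow> side \<Rightarrow> real \<Rightarrow> 'a" where
  "side_curve d P = (\<lambda>(r, k). chart P r \<circ> linepath (vert P r k) (vert P r (Suc k mod d)))"

definition left_side ::
    "nat \<Rightarrow> ('v \<Rightarrow> real \<Rightarrow> 'a) \<Rightarrow> ('a, 'v) polygons \<Rightarrow> 'v \<Rightarrow> side \<Rightarrow> bool" where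
  "left_side d \<gamma> P a u \<longleftrightarrow>
     u \<in> sides d P \<and> label P u = Some a \<and> (\<forall>t\<in>{0..1}. side_curve d P u t = \<gamma> a t)"

definition right_side ::
    "nat \<Rightarrow> ('v \<Rightarrow> real \<Rightarrow> 'a) \<Rightarrow> ('a, 'v) polygons \<Rightarrow> 'v \<Rightarrow> side \<Rightarrow> bool" where
  "right_side d \<gamma> P a u \<longleftrightarrow>
     u \<in> sides d P \<and> label P u = Some a \<and> (\<forall>t\<in>{0..1}. side_curve d P u t = \<gamma> a (1 - t))"

text \<open>
  The curves \<open>\<gamma> a\<close> (\<open>a \<in> I\<close>) are arcs with pairwise disjoint interiors, and \<open>P\<close> exhibits the pieces
  into which they cut the surface as \<open>d\<close>-gons.  Each arc bounds one polygon side to its left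
  (traversed along the arc) and one to its right (traversed against it); the two polygons coincide
  for a self-folded arc.  A chart is injective only on the interior of its polygon, since sides and
  corners may be identified in the surface.  The charts are normalised so that, on the sides, they
  are compatible with the parametrisations of the arcs.
\<close>

definition d_angulation ::
    "nat \<Rightarrow> 'a::t2_space set \<Rightarrow> ('a set \<times> ('a \<Rightarrow> complex)) set \<Rightarrow> 'a set \<Rightarrow>
     'v set \<Rightarrow> ('v \<Rightarrow> real \<Rightarrow> 'a) \<Rightarrow> ('a, 'v) polygons \<Rightarrow> bool" where
  "d_angulation d S \<A> M I \<gamma> P \<longleftrightarrow>
     finite I \<and> (\<forall>a\<in>I. marked_arc S \<A> M (\<gamma> a)) \<and>
     (\<forall>a\<in>I. \<forall>b\<in>I. a \<noteq> b \<longrightarrow> \<gamma> a ` {0<..<1} \<inter> \<gamma> b ` {0<..<1} = {}) \<and>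
     (\<forall>r<npoly P.
        convex_polygon d (vert P r) \<and>
        continuous_on (polygon_region d P r) (chart P r) \<and>
        chart P r ` polygon_region d P r \<subseteq> S \<and>
        inj_on (chart P r) (interior (polygon_region d P r)) \<and>
        orientation_preserving \<A> (chart P r) (interior (polygon_region d P r))) \<and>
     (\<forall>r<npoly P. \<forall>r'<npoly P. r \<noteq> r' \<longrightarrow>
        chart P r ` interior (polygon_region d P r) \<inter>
        chart P r' ` interior (polygon_region d P r') = {}) \<and>
     (\<Union>r<npoly P. chart P r ` interior (polygon_region d P r)) =
       S - bdry \<A> - (\<Union>a\<in>I. path_image (\<gamma> a)) \<and>
     (\<forall>u\<in>sides d P. case label P u of
          None \<Rightarrow> boundary_segment \<A> M (side_curve d P u)
        | Some a \<Rightarrow> a \<in> I \<and> (left_side d \<gamma> P a u \<or> right_side d \<gamma> P a u)) \<and>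
     (\<forall>a\<in>I. (\<exists>!u. left_side d \<gamma> P a u) \<and> (\<exists>!u. right_side d \<gamma> P a u)) \<and>
     (\<Union>u\<in>{u \<in> sides d P. label P u = None}. path_image (side_curve d P u)) = bdry \<A> \<and>
     (\<forall>u\<in>sides d P. \<forall>w\<in>sides d P. label P u = None \<and> label P w = None \<and> u \<noteq> w \<longrightarrow>
        side_curve d P u ` {0<..<1} \<inter> side_curve d P w ` {0<..<1} = {})"

text \<open>
  \<open>\<gamma>'\<close> is (a representative of) the flip of the arc \<open>i\<close>.  The end point \<open>\<gamma> i 1\<close> is the end of
  the side of \<open>i\<close> in the polygon to its left and moves along the next side anticlockwise; likewise
  for \<open>\<gamma> i 0\<close> in the polygon to its right.
\<close>

definition is_flip ::
    "nat \<Rightarrow> 'a::t2_space set \<Rightarrow> ('a set \<times> ('a \<Rightarrow> complex)) set \<Rightarrow> 'a set \<Rightarrow>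
     ('v \<Rightarrow> real \<Rightarrow> 'a) \<Rightarrow> ('a, 'v) polygons \<Rightarrow> 'v \<Rightarrow> (real \<Rightarrow> 'a) \<Rightarrow> bool" where
  "is_flip d S \<A> M \<gamma> P i \<gamma>' \<longleftrightarrow>
     marked_arc S \<A> M \<gamma>' \<and>
     (\<exists>u w. left_side d \<gamma> P i u \<and> right_side d \<gamma> P i w \<and>
        homotopic_paths S \<gamma>'
          (reversepath (side_curve d P (next_side d w)) +++
             (\<gamma> i +++ side_curve d P (next_side d u))))"

section \<open>Quivers with superpotential\<close>

text \<open>
  The opposite of an arrow \<open>\<phi>\<close> is an arrow up to sign: \<open>\<phi>\<^sup>o\<^sup>p = osgn \<phi> \<cdot> opp \<phi>\<close> with \<open>opp \<phi>\<close> an arrow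
  and \<open>osgn \<phi> = \<plusminus>1\<close>.
\<close>

record ('v, 'e) gquiver =
  verts :: "'v set"
  arrs :: "'e set"
  src :: "'e \<Rightarrow> 'v"
  tgt :: "'e \<Rightarrow> 'v"
  deg :: "'e \<Rightarrow> int"
  opp :: "'e \<Rightarrow> 'e"
  osgn :: "'e \<Rightarrow> int"

text \<open>
  Words form a monoid under concatenation, so \<open>'e list \<Rightarrow>\<^sub>0 'k\<close> is the free algebra on the arrows.
  Paths of positive length are identified with the words they spell.  The empty word stands for the
  trivial path at any vertex; it only ever occurs in elements whose end points are fixed.
\<close>

instantiation list :: (type) monoid_add
begin
definition zero_list :: "'a list" where "zero_list = []"
definition plus_list :: "'a list \<Rightarrow> 'a list \<Rightarrow> 'a list" where "plus_list = (@)"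
instance by standard (simp_all add: zero_list_def plus_list_def)
end

definition psign :: "int \<Rightarrow> 'k::ring_1" where
  "psign n = (if even n then 1 else - 1)"

definition scl :: "'k::ring_1 \<Rightarrow> ('e list \<Rightarrow>\<^sub>0 'k) \<Rightarrow> ('e list \<Rightarrow>\<^sub>0 'k)" where
  "scl c x = Poly_Mapping.single [] c * x"

definition word :: "'e list \<Rightarrow> ('e list \<Rightarrow>\<^sub>0 'k::ring_1)" where
  "word w = Poly_Mapping.single w 1"

definition lin :: "('e list \<Rightarrow> ('f list \<Rightarrow>\<^sub>0 'k::ring_1)) \<Rightarrow> ('e list \<Rightarrow>\<^sub>0 'k) \<Rightarrow> ('f list \<Rightarrow>\<^sub>0 'k)" where
  "lin f x = (\<Sum>w\<in>Poly_Mapping.keys x. scl (Poly_Mapping.lookup x w) (f w))"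

definition wdeg :: "('v, 'e) gquiver \<Rightarrow> 'e list \<Rightarrow> int" where
  "wdeg Q w = sum_list (map (deg Q) w)"

definition is_cycle :: "('v, 'e) gquiver \<Rightarrow> 'e list \<Rightarrow> bool" where
  "is_cycle Q w \<longleftrightarrow> w \<noteq> [] \<and> set w \<subseteq> arrs Q \<and>
     (\<forall>n<length w. tgt Q (w ! n) = src Q (w ! (Suc n mod length w)))"

text \<open>
  Superpotentials are given by representing linear combinations of cycles; two of them are the
  same superpotential if they agree up to signed cyclic permutation \<open>pq \<sim> (-1)\<^sup>|\<^sup>p\<^sup>|\<^sup>|\<^sup>q\<^sup>| qp\<close>.
\<close>

inductive_set cyc_null :: "('v, 'e) gquiver \<Rightarrow> ('e list \<Rightarrow>\<^sub>0 'k::ring_1) set"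
  for Q :: "('v, 'e) gquiver" where
  zero: "0 \<in> cyc_null Q"
| step: "\<lbrakk>x \<in> cyc_null Q; is_cycle Q (p @ q)\<rbrakk> \<Longrightarrow>
     x + scl c (word (p @ q) - scl (psign (wdeg Q p * wdeg Q q)) (word (q @ p))) \<in> cyc_null Q"

definition cyc_eq ::
    "('v, 'e) gquiver \<Rightarrow> ('e list \<Rightarrow>\<^sub>0 'k::ring_1) \<Rightarrow> ('e list \<Rightarrow>\<^sub>0 'k) \<Rightarrow> bool" where
  "cyc_eq Q W W' \<longleftrightarrow> W - W' \<in> cyc_null Q"

definition cyc_deriv ::
    "('v, 'e) gquiver \<Rightarrow> 'e \<Rightarrow> ('e list \<Rightarrow>\<^sub>0 'k::ring_1) \<Rightarrow> ('e list \<Rightarrow>\<^sub>0 'k)" where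
  "cyc_deriv Q \<phi> = lin (\<lambda>c. \<Sum>n\<in>{n. n < length c \<and> c ! n = \<phi>}.
     scl (psign (wdeg Q (take n c) * wdeg Q (drop n c))) (word (drop (Suc n) c @ take n c)))"

definition delta_arrow ::
    "nat \<Rightarrow> ('v, 'e) gquiver \<Rightarrow> ('e list \<Rightarrow>\<^sub>0 'k::ring_1) \<Rightarrow> 'e \<Rightarrow> ('e list \<Rightarrow>\<^sub>0 'k)" where
  "delta_arrow d Q W \<phi> =
     scl (psign (int d * (deg Q \<phi> + 1)) * of_int (osgn Q \<phi>)) (cyc_deriv Q (opp Q \<phi>) W)"

definition delta ::
    "nat \<Rightarrow> ('v, 'e) gquiver \<Rightarrow> ('e list \<Rightarrow>\<^sub>0 'k::ring_1) \<Rightarrow> ('e list \<Rightarrow>\<^sub>0 'k) \<Rightarrow> ('e list \<Rightarrow>\<^sub>0 'k)" where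
  "delta d Q W = lin (\<lambda>w. \<Sum>n<length w.
     scl (psign (wdeg Q (take n w)))
       (word (take n w) * delta_arrow d Q W (w ! n) * word (drop (Suc n) w)))"

text \<open>The vanishing of the necklace bracket is expressed by \<open>\<delta>\<^sup>2 = 0\<close>.\<close>

definition bracket_zero :: "nat \<Rightarrow> ('v, 'e) gquiver \<Rightarrow> ('e list \<Rightarrow>\<^sub>0 'k::ring_1) \<Rightarrow> bool" where
  "bracket_zero d Q W \<longleftrightarrow> (\<forall>\<phi>\<in>arrs Q. delta d Q W (delta d Q W (word [\<phi>])) = 0)"

definition graded_quiver :: "nat \<Rightarrow> ('v, 'e) gquiver \<Rightarrow> bool" where
  "graded_quiver d Q \<longleftrightarrow>
     finite (verts Q) \<and> finite (arrs Q) \<and>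
     (\<forall>\<phi>\<in>arrs Q. src Q \<phi> \<in> verts Q \<and> tgt Q \<phi> \<in> verts Q \<and> 2 - int d \<le> deg Q \<phi> \<and> deg Q \<phi> \<le> 0 \<and>
        opp Q \<phi> \<in> arrs Q \<and> opp Q (opp Q \<phi>) = \<phi> \<and>
        src Q (opp Q \<phi>) = tgt Q \<phi> \<and> tgt Q (opp Q \<phi>) = src Q \<phi> \<and>
        deg Q (opp Q \<phi>) = 2 - int d - deg Q \<phi> \<and>
        osgn Q \<phi> \<in> {1, - 1} \<and>
        osgn Q \<phi> * osgn Q (opp Q \<phi>) = - psign (deg Q \<phi> * deg Q (opp Q \<phi>)))"

definition qsp :: "nat \<Rightarrow> ('v, 'e) gquiver \<Rightarrow> ('e list \<Rightarrow>\<^sub>0 'k::ring_1) \<Rightarrow> bool" where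
  "qsp d Q W \<longleftrightarrow>
     graded_quiver d Q \<and>
     (\<forall>c\<in>Poly_Mapping.keys W. is_cycle Q c \<and> wdeg Q c = 3 - int d) \<and>
     bracket_zero d Q W"

definition qsp_iso ::
    "('e \<Rightarrow> 'f) \<Rightarrow> ('v, 'e) gquiver \<Rightarrow> ('e list \<Rightarrow>\<^sub>0 'k::ring_1) \<Rightarrow>
     ('v, 'f) gquiver \<Rightarrow> ('f list \<Rightarrow>\<^sub>0 'k) \<Rightarrow> bool" where
  "qsp_iso f Q W Q' W' \<longleftrightarrow>
     verts Q = verts Q' \<and> bij_betw f (arrs Q) (arrs Q') \<and>
     (\<forall>\<phi>\<in>arrs Q. src Q' (f \<phi>) = src Q \<phi> \<and> tgt Q' (f \<phi>) = tgt Q \<phi> \<and> deg Q' (f \<phi>) = deg Q \<phi> \<and>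
        opp Q' (f \<phi>) = f (opp Q \<phi>) \<and> osgn Q' (f \<phi>) = osgn Q \<phi>) \<and>
     cyc_eq Q' (lin (\<lambda>c. word (map f c)) W) W'"

definition glue :: "('v \<Rightarrow> 'w) \<Rightarrow> ('v, 'e) gquiver \<Rightarrow> ('w, 'e) gquiver" where
  "glue g Q = \<lparr>verts = g ` verts Q, arrs = arrs Q, src = g \<circ> src Q, tgt = g \<circ> tgt Q,
     deg = deg Q, opp = opp Q, osgn = osgn Q\<rparr>"

section \<open>The QsP of a \<open>d\<close>-angulation\<close>

text \<open>
  The arrow \<open>a\<^sub>u\<^sub>v\<close> is the pair \<open>(u, v)\<close> of sides.  Since sides are numbered anticlockwise, the sides
  met strictly between \<open>(r, k)\<close> and \<open>(r, l)\<close> in clockwise order are those at distance \<open>m\<close> before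
  \<open>k\<close> with \<open>0 < m < (k - l) mod d\<close>.  The function \<open>\<sigma>\<close> gives the signs of the opposites.
\<close>

definition polygon_quiver ::
    "nat \<Rightarrow> ('a, 'v) polygons \<Rightarrow> (side \<times> side \<Rightarrow> int) \<Rightarrow> nat \<Rightarrow> (side, side \<times> side) gquiver" where
  "polygon_quiver d P \<sigma> r =
     (let V = {(r, k) | k. k < d \<and> side_arc P r k \<noteq> None} in
      \<lparr>verts = V, arrs = {(u, v). u \<in> V \<and> v \<in> V \<and> u \<noteq> v}, src = fst, tgt = snd,
       deg = (\<lambda>(u, v). - int (card {m::nat. 0 < m \<and> m < (snd u + d - snd v) mod d})),
       opp = prod.swap, osgn = \<sigma>\<rparr>)"

definition polygon_potential ::
    "nat \<Rightarrow> ('a, 'v) polygons \<Rightarrow> (side \<times> side \<Rightarrow> int) \<Rightarrow> nat \<Rightarrow>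
     ((side \<times> side) list \<Rightarrow>\<^sub>0 'k::ring_1) \<Rightarrow> bool" where
  "polygon_potential d P \<sigma> r W \<longleftrightarrow>
     qsp d (polygon_quiver d P \<sigma> r) W \<and>
     (let C = {c. is_cycle (polygon_quiver d P \<sigma> r) c \<and> length c = 3 \<and>
                  wdeg (polygon_quiver d P \<sigma> r) c = 3 - int d} in
      \<comment> \<open>\<open>T\<close> picks one representative of each 3-cycle up to cyclic permutation\<close>
      \<exists>T \<epsilon>. T \<subseteq> C \<and> (\<forall>c\<in>C. \<exists>!c'. c' \<in> T \<and> (\<exists>n. c' = rotate n c)) \<and>
        (\<forall>c\<in>T. \<epsilon> c \<in> {1, - 1}) \<and> W = (\<Sum>c\<in>T. scl (\<epsilon> c) (word c)))"

definition pre_quiver ::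
    "nat \<Rightarrow> ('a, 'v) polygons \<Rightarrow> (side \<times> side \<Rightarrow> int) \<Rightarrow> (side, side \<times> side) gquiver" where
  "pre_quiver d P \<sigma> =
     \<lparr>verts = (\<Union>r<npoly P. verts (polygon_quiver d P \<sigma> r)),
      arrs = (\<Union>r<npoly P. arrs (polygon_quiver d P \<sigma> r)), src = fst, tgt = snd,
      deg = (\<lambda>a. deg (polygon_quiver d P \<sigma> (fst (fst a))) a), opp = prod.swap, osgn = \<sigma>\<rparr>"

definition surface_quiver ::
    "nat \<Rightarrow> ('a, 'v) polygons \<Rightarrow> (side \<times> side \<Rightarrow> int) \<Rightarrow> ('v, side \<times> side) gquiver" where
  "surface_quiver d P \<sigma> = glue (\<lambda>u. the (label P u)) (pre_quiver d P \<sigma>)"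

text \<open>\<open>(surface_quiver d P \<sigma>, W)\<close> is a QsP constructed from the polygons \<open>P\<close>.\<close>

definition surface_potential ::
    "nat \<Rightarrow> ('a, 'v) polygons \<Rightarrow> (side \<times> side \<Rightarrow> int) \<Rightarrow>
     ((side \<times> side) list \<Rightarrow>\<^sub>0 'k::ring_1) \<Rightarrow> bool" where
  "surface_potential d P \<sigma> W \<longleftrightarrow>
     (\<exists>Wr. (\<forall>r<npoly P. polygon_potential d P \<sigma> r (Wr r)) \<and> W = (\<Sum>r<npoly P. Wr r))"

text \<open>
  Arcs are taken up to homotopy relative to the end points (for arcs, this is the same as isotopy):
  the curves \<open>\<gamma> a\<close> represent the arcs, and the curves \<open>\<rho> a\<close> are representatives with disjoint
  interiors.
\<close>

definition associated_qsp ::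
    "nat \<Rightarrow> 'a::t2_space set \<Rightarrow> ('a set \<times> ('a \<Rightarrow> complex)) set \<Rightarrow> 'a set \<Rightarrow>
     'v set \<Rightarrow> ('v \<Rightarrow> real \<Rightarrow> 'a) \<Rightarrow> ('v, 'e) gquiver \<Rightarrow> ('e list \<Rightarrow>\<^sub>0 'k::ring_1) \<Rightarrow> bool" where
  "associated_qsp d S \<A> M I \<gamma> Q W \<longleftrightarrow>
     qsp d Q W \<and>
     (\<exists>\<rho> P \<sigma> W\<^sub>D f.
        (\<forall>a\<in>I. homotopic_paths S (\<rho> a) (\<gamma> a)) \<and> d_angulation d S \<A> M I \<rho> P \<and>
        surface_potential d P \<sigma> W\<^sub>D \<and> qsp_iso f Q W (surface_quiver d P \<sigma>) W\<^sub>D)"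

section \<open>Mutation\<close>

text \<open>
  Arrows of the mutated quiver.  \<open>Cmp l \<phi> r\<close> is the formal composite with optional outer factors:
  \<open>Cmp None \<phi> None\<close> is \<open>\<phi>\<close>, \<open>Cmp (Some \<alpha>) \<phi> None\<close> is \<open>\<alpha>\<phi>\<close>, \<open>Cmp None \<phi> (Some \<beta>)\<close> is \<open>\<phi>\<beta>\<^sup>-\<^sup>1\<close> and
  \<open>Cmp (Some \<alpha>) \<phi> (Some \<beta>)\<close> is \<open>\<alpha>\<phi>\<beta>\<^sup>-\<^sup>1\<close>; \<open>Dual \<alpha>\<close> is \<open>\<alpha>\<^sup>*\<close> and \<open>DualOp \<alpha>\<close> its opposite.
\<close>

datatype 'e marrow = Cmp "'e option" 'e "'e option" | Dual 'e | DualOp 'e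

definition mut_A :: "'v \<Rightarrow> ('v, 'e) gquiver \<Rightarrow> 'e set" where
  "mut_A i Q = {\<alpha> \<in> arrs Q. tgt Q \<alpha> = i \<and> deg Q \<alpha> = 0}"

definition mut_out :: "nat \<Rightarrow> 'v \<Rightarrow> ('v, 'e) gquiver \<Rightarrow> 'e set" where
  "mut_out d i Q = {\<phi> \<in> arrs Q. src Q \<phi> = i \<and> 3 - int d \<le> deg Q \<phi>}"

fun mut_src :: "('v, 'e) gquiver \<Rightarrow> 'e marrow \<Rightarrow> 'v" where
  "mut_src Q (Cmp None \<phi> r) = src Q \<phi>"
| "mut_src Q (Cmp (Some \<alpha>) \<phi> r) = src Q \<alpha>"
| "mut_src Q (Dual \<alpha>) = tgt Q \<alpha>"
| "mut_src Q (DualOp \<alpha>) = src Q \<alpha>"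

fun mut_tgt :: "('v, 'e) gquiver \<Rightarrow> 'e marrow \<Rightarrow> 'v" where
  "mut_tgt Q (Cmp l \<phi> None) = tgt Q \<phi>"
| "mut_tgt Q (Cmp l \<phi> (Some \<beta>)) = src Q \<beta>"
| "mut_tgt Q (Dual \<alpha>) = src Q \<alpha>"
| "mut_tgt Q (DualOp \<alpha>) = tgt Q \<alpha>"

text \<open>The degree of \<open>\<phi>\<beta>\<^sup>-\<^sup>1\<close> is the one forced by its opposite \<open>\<beta>\<phi>\<^sup>o\<^sup>p\<close>.\<close>

fun mut_deg :: "nat \<Rightarrow> 'v \<Rightarrow> ('v, 'e) gquiver \<Rightarrow> 'e marrow \<Rightarrow> int" where
  "mut_deg d i Q (Cmp None \<phi> None) =
     deg Q \<phi> - (if src Q \<phi> = i then 1 else 0) + (if tgt Q \<phi> = i then 1 else 0)"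
| "mut_deg d i Q (Cmp (Some \<alpha>) \<phi> None) = deg Q \<phi> + (if tgt Q \<phi> = i then 1 else 0)"
| "mut_deg d i Q (Cmp None \<phi> (Some \<beta>)) =
     2 - int d - (deg Q (opp Q \<phi>) + (if src Q \<phi> = i then 1 else 0))"
| "mut_deg d i Q (Cmp (Some \<alpha>) \<phi> (Some \<beta>)) = deg Q \<phi>"
| "mut_deg d i Q (Dual \<alpha>) = 0"
| "mut_deg d i Q (DualOp \<alpha>) = 2 - int d"

fun mut_opp :: "('v, 'e) gquiver \<Rightarrow> 'e marrow \<Rightarrow> 'e marrow" where
  "mut_opp Q (Cmp l \<phi> r) = Cmp r (opp Q \<phi>) l"
| "mut_opp Q (Dual \<alpha>) = DualOp \<alpha>"
| "mut_opp Q (DualOp \<alpha>) = Dual \<alpha>"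

text \<open>
  The signs of \<open>(\<phi>\<beta>\<^sup>-\<^sup>1)\<^sup>o\<^sup>p\<close> and \<open>((\<alpha>\<^sup>*)\<^sup>o\<^sup>p)\<^sup>o\<^sup>p\<close> are the ones forced by the rule for double opposites from
  \<open>(\<beta>\<phi>\<^sup>o\<^sup>p)\<^sup>o\<^sup>p\<close> and \<open>(\<alpha>\<^sup>*)\<^sup>o\<^sup>p\<close>.
\<close>

fun mut_osgn :: "nat \<Rightarrow> 'v \<Rightarrow> ('v, 'e) gquiver \<Rightarrow> 'e marrow \<Rightarrow> int" where
  "mut_osgn d i Q (Cmp None \<phi> None) = (if src Q \<phi> = i then psign (int d + 1) else 1) * osgn Q \<phi>"
| "mut_osgn d i Q (Cmp (Some \<alpha>) \<phi> None) = - osgn Q \<phi>"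
| "mut_osgn d i Q (Cmp None \<phi> (Some \<beta>)) =
     psign (mut_deg d i Q (Cmp None \<phi> (Some \<beta>)) * mut_deg d i Q (Cmp (Some \<beta>) (opp Q \<phi>) None)) *
     osgn Q (opp Q \<phi>)"
| "mut_osgn d i Q (Cmp (Some \<alpha>) \<phi> (Some \<beta>)) = osgn Q \<phi>"
| "mut_osgn d i Q (Dual \<alpha>) = 1"
| "mut_osgn d i Q (DualOp \<alpha>) = - 1"

definition mut_quiver :: "nat \<Rightarrow> 'v \<Rightarrow> ('v, 'e) gquiver \<Rightarrow> ('v, 'e marrow) gquiver" where
  "mut_quiver d i Q =
     (let A = mut_A i Q in
      \<lparr>verts = verts Q,
       arrs =
         {Cmp None \<phi> None | \<phi>. \<phi> \<in> arrs Q \<and> \<phi> \<notin> A \<and> opp Q \<phi> \<notin> A} \<union>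
         Dual ` A \<union> DualOp ` A \<union>
         {Cmp (Some \<alpha>) \<phi> None | \<alpha> \<phi>. \<alpha> \<in> A \<and> \<phi> \<in> mut_out d i Q} \<union>
         {Cmp None (opp Q \<phi>) (Some \<alpha>) | \<alpha> \<phi>. \<alpha> \<in> A \<and> \<phi> \<in> mut_out d i Q} \<union>
         {Cmp (Some \<alpha>) \<phi> (Some \<beta>) | \<alpha> \<phi> \<beta>.
            \<alpha> \<in> A \<and> \<beta> \<in> A \<and> \<phi> \<in> arrs Q \<and> src Q \<phi> = i \<and> tgt Q \<phi> = i},
       src = mut_src Q, tgt = mut_tgt Q, deg = mut_deg d i Q, opp = mut_opp Q,
       osgn = mut_osgn d i Q\<rparr>)"

text \<open>
  Decompositions are first expanded as words in the symbols \<open>\<phi>\<close>, \<open>\<alpha>\<^sup>-\<^sup>1\<close>, \<open>\<alpha>\<^sup>*\<close> and then read as words in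
  the arrows of the mutated quiver.
\<close>

datatype 'e symb = Arr 'e | Inv 'e | Star 'e

definition mut_Delta :: "'e set \<Rightarrow> ('e symb list \<Rightarrow>\<^sub>0 'k::ring_1)" where
  "mut_Delta A = 1 - (\<Sum>\<alpha>\<in>A. word [Inv \<alpha>, Arr \<alpha>])"

fun dec :: "'v \<Rightarrow> ('v, 'e) gquiver \<Rightarrow> 'e list \<Rightarrow> ('e symb list \<Rightarrow>\<^sub>0 'k::ring_1)" where
  "dec i Q [] = 1"
| "dec i Q [\<phi>] = word [Arr \<phi>]"
| "dec i Q (\<phi> # \<psi> # p) =
     word [Arr \<phi>] * (if tgt Q \<phi> = i \<and> \<phi> \<notin> mut_A i Q then mut_Delta (mut_A i Q) else 1) *
     dec i Q (\<psi> # p)"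

text \<open>
  If a cycle ends with an arrow of \<open>A\<close>, moving this arrow (of degree \<open>0\<close>) to the front does not
  change the sign, and the resulting cycle no longer ends with an arrow of \<open>A\<close>.
\<close>

definition dec_cyc :: "nat \<Rightarrow> 'v \<Rightarrow> ('v, 'e) gquiver \<Rightarrow> 'e list \<Rightarrow> ('e symb list \<Rightarrow>\<^sub>0 'k::ring_1)" where
  "dec_cyc d i Q c =
     (let A = mut_A i Q; c' = (if last c \<in> A then last c # butlast c else c) in
      if src Q (hd c') = i
      then scl (psign (int d)) (dec i Q c') -
           (\<Sum>\<alpha>\<in>A. word [Arr \<alpha>] * dec i Q c' * word [Inv \<alpha>])
      else dec i Q c')"

text \<open>
  The second argument of \<open>read_symbs\<close> is a pending left factor \<open>\<alpha> \<in> A\<close>.  An inverse without preceding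
  arrow (last equation) does not occur in decompositions.
\<close>

fun read_symbs :: "'e set \<Rightarrow> 'e option \<Rightarrow> 'e symb list \<Rightarrow> 'e marrow list" where
  "read_symbs A l [] = []"
| "read_symbs A l (Arr \<phi> # Inv \<beta> # w) = Cmp l \<phi> (Some \<beta>) # read_symbs A None w"
| "read_symbs A l (Arr \<phi> # w) =
     (if \<phi> \<in> A then read_symbs A (Some \<phi>) w else Cmp l \<phi> None # read_symbs A None w)"
| "read_symbs A l (Star \<alpha> # w) = Dual \<alpha> # read_symbs A None w"
| "read_symbs A l (Inv \<beta> # w) = read_symbs A None w"

definition mut_potential ::
    "nat \<Rightarrow> 'v \<Rightarrow> ('v, 'e) gquiver \<Rightarrow> ('e list \<Rightarrow>\<^sub>0 'k::ring_1) \<Rightarrow> ('e marrow list \<Rightarrow>\<^sub>0 'k)" where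
  "mut_potential d i Q W =
     lin (\<lambda>w. word (read_symbs (mut_A i Q) None w))
       (lin (dec_cyc d i Q) W +
        (\<Sum>\<alpha>\<in>mut_A i Q. \<Sum>\<phi>\<in>mut_out d i Q.
           scl (of_int (mut_osgn d i Q (Cmp None \<phi> None)))
             (word [Arr \<alpha>] * dec i Q [\<phi>, opp Q \<phi>] * word [Star \<alpha>])))"

section \<open>The mutation \<open>\<mu>'\<^sub>i\<close> of the QsP of a \<open>d\<close>-angulation\<close>

text \<open>The pre-quiver in which only the two sides of the arc \<open>i\<close> are glued, to the vertex \<open>Inr i\<close>.\<close>

definition glued_at ::
    "nat \<Rightarrow> ('a, 'v) polygons \<Rightarrow> (side \<times> side \<Rightarrow> int) \<Rightarrow> 'v \<Rightarrow> (side + 'v, side \<times> side) gquiver" where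
  "glued_at d P \<sigma> i =
     glue (\<lambda>u. if label P u = Some i then Inr i else Inl u) (pre_quiver d P \<sigma>)"

text \<open>
  For \<open>\<alpha> = (k, u) = a\<^sub>k\<^sub>u \<in> A\<close>, where \<open>u\<close> is one of the two sides \<open>i\<^sup>+, i\<^sup>-\<close> of \<open>i\<close>, and \<open>w\<close> the other
  side of \<open>i\<close>: both arrows of the pairs \<open>(\<alpha> a\<^sub>u\<^sub>j, a\<^sub>k\<^sub>j)\<close> and \<open>(\<alpha> a\<^sub>u\<^sub>w \<beta>\<^sup>-\<^sup>1, a\<^sub>k\<^sub>w \<beta>\<^sup>-\<^sup>1)\<close> with \<open>\<beta> \<in> A\<close> are
  superfluous, as far as they exist, together with their opposites.  This covers all three
  cases \<open>|A| = 0, 1, 2\<close>.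
\<close>

definition superfluous ::
    "nat \<Rightarrow> ('a, 'v) polygons \<Rightarrow> (side \<times> side \<Rightarrow> int) \<Rightarrow> 'v \<Rightarrow> (side \<times> side) marrow set" where
  "superfluous d P \<sigma> i =
     (let A = mut_A (Inr i) (glued_at d P \<sigma> i);
          Q\<^sub>M = mut_quiver d (Inr i) (glued_at d P \<sigma> i);
          B = {Cmp (Some (k, u)) (u, j) None | k u j. (k, u) \<in> A} \<union>
              {Cmp None (k, j) None | k u j. (k, u) \<in> A} \<union>
              {Cmp (Some (k, u)) (u, w) (Some \<beta>) | k u w \<beta>.
                 (k, u) \<in> A \<and> \<beta> \<in> A \<and> label P w = Some i \<and> w \<noteq> u} \<union>
              {Cmp None (k, w) (Some \<beta>) | k u w \<beta>.
                 (k, u) \<in> A \<and> \<beta> \<in> A \<and> label P w = Some i \<and> w \<noteq> u}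
      in (B \<inter> arrs Q\<^sub>M) \<union> opp Q\<^sub>M ` (B \<inter> arrs Q\<^sub>M))"

definition mutation'_quiver ::
    "nat \<Rightarrow> ('a, 'v) polygons \<Rightarrow> (side \<times> side \<Rightarrow> int) \<Rightarrow> 'v \<Rightarrow> ('v, (side \<times> side) marrow) gquiver" where
  "mutation'_quiver d P \<sigma> i =
     (let Q\<^sub>M = mut_quiver d (Inr i) (glued_at d P \<sigma> i) in
      glue (\<lambda>x. case x of Inl u \<Rightarrow> the (label P u) | Inr j \<Rightarrow> j)
        (Q\<^sub>M \<lparr>arrs := arrs Q\<^sub>M - superfluous d P \<sigma> i\<rparr>))"

definition mutation'_potential ::
    "nat \<Rightarrow> ('a, 'v) polygons \<Rightarrow> (side \<times> side \<Rightarrow> int) \<Rightarrow> 'v \<Rightarrow>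
     ((side \<times> side) list \<Rightarrow>\<^sub>0 'k::ring_1) \<Rightarrow> ((side \<times> side) marrow list \<Rightarrow>\<^sub>0 'k)" where
  "mutation'_potential d P \<sigma> i W =
     lin (\<lambda>c. if set c \<inter> superfluous d P \<sigma> i = {} then word c else 0)
       (mut_potential d (Inr i) (glued_at d P \<sigma> i) W)"

end

theory Submission
  imports Defs
begin

text \<open>
  The theorem has a topological half, the construction of a \<open>d\<close>-angulation that contains the flipped
  arc, and an algebraic half, the identification of the mutated quiver with the quiver of that
  \<open>d\<close>-angulation.

  Let \<open>u\<close> and \<open>w\<close> be the two polygon sides carrying the arc \<open>i\<close>. The ear at a side is the triangle
  spanned by this side and the next one. The ears at \<open>u\<close> and \<open>w\<close> meet along \<open>i\<close> and form a
  quadrilateral with diagonal \<open>i\<close>; the flipped arc is its other diagonal. So the new \<open>d\<close>-gons can be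
  given on the old polygonal regions: outside the ears the charts are kept, and on the ears they
  are changed piecewise affinely. This needs the two ears to be disjoint inside
  their polygons, that is, \<open>u\<close> and \<open>w\<close> must not be consecutive; otherwise the corner between
  them, a marked point on the boundary, would become an interior point of the surface
  (\<open>adjacent_sides_not_glued\<close>). That the new charts are injective and cover the complement of the new
  arcs is a bijection between cells (\<open>bij_flip_target\<close>). Their orientation is a statement about
  winding numbers of images of small circles, which may be checked on a dense set, where the
  new chart is an old chart after an affine map of positive determinant. The result is
  \<open>d_angulation_flip\<close>.

  For the algebra, arrows of the quiver of a polygon are ordered pairs of sides, and the potential
  is a sum over clockwise triples \<open>(x, y, z)\<close> of sides with coefficients \<open>om x y z\<close>. For any such
  triangle potential, \<open>\<delta>\<^sup>2\<close> of an arrow is a sum over clockwise quadruples of sides, so that the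
  necklace bracket vanishes if and only if one relation between the signs holds for each quadruple
  (\<open>bracket_zero_iff\<close>). After the removal of the superfluous arrows, the mutated quiver again has
  exactly one arrow for each ordered pair of sides of a new polygon (\<open>remaining_arrs\<close>), its
  degrees again count the sides in between, and its potential is again a triangle potential
  (\<open>mutation'_potential_triangles\<close>): triangles of the old polygons are lifted to the new ones, and
  the triangles containing both sides of an ear come from the terms with \<open>\<alpha>\<^sup>*\<close>. The new signs
  satisfy the quadruple relations because the old ones do (\<open>quad_flip\<close>). Hence the mutated
  quiver is isomorphic to the quiver of the flipped \<open>d\<close>-angulation, with admissible signs read off
  from the mutation.
\<close>

section \<open>Local degree of maps into a surface\<close>

lemma winding_number_image_loop:
  fixes F :: "complex \<Rightarrow> complex"
  assumes C: "closed C" "convex C" "z \<in> interior C"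
    and F: "continuous_on C F" "inj_on F C"
    and p: "path p" "pathfinish p = pathstart p" "path_image p \<subseteq> C - {z}"
    and q: "path q" "pathfinish q = pathstart q" "path_image q \<subseteq> C - {z}"
    and eq: "winding_number p z = winding_number q z"
  shows "winding_number (F \<circ> p) (F z) = winding_number (F \<circ> q) (F z)"
proof -
  have zC: "z \<in> C" using C(3) interior_subset by blast
  have hom: "homotopic_loops (- {z}) p q"
    using winding_number_homotopic_loops_eq[of p z q] p q eq by auto
  define R where "R = closest_point C"
  have RC: "R x \<in> C" for x unfolding R_def using C(1) zC closest_point_in_set by blast
  have Rid: "R x = x" if "x \<in> C" for x unfolding R_def using that closest_point_self by blast
  have Rz: "R x \<noteq> z" if "x \<noteq> z" for x
  proof (cases "x \<in> C")
    case True then show ?thesis using Rid that by simp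
  next
    case False
    moreover have "affine hull C = UNIV" "rel_interior C = interior C"
      using affine_hull_nonempty_interior rel_interior_nonempty_interior C(3) by auto
    ultimately have "x \<in> affine hull C - rel_interior C"
      using interior_subset by auto
    then have "closest_point C x \<in> rel_frontier C"
      using closest_point_in_rel_frontier[OF C(1)] zC by blast
    then show ?thesis unfolding R_def rel_frontier_def
      using C(3) \<open>rel_interior C = interior C\<close> by auto
  qed
  have contR: "continuous_on (- {z}) R"
    unfolding R_def using continuous_on_closest_point[OF C(2,1)] zC by blast
  have "continuous_on (- {z}) (F \<circ> R)"
    using contR F(1) RC by (intro continuous_on_compose) (auto intro: continuous_on_subset)
  moreover have "(F \<circ> R) \<in> (- {z}) \<rightarrow> - {F z}"
    using inj_on_eq_iff[OF F(2) RC zC] Rz by auto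
  ultimately have h: "homotopic_loops (- {F z}) (F \<circ> R \<circ> p) (F \<circ> R \<circ> q)"
    using homotopic_loops_continuous_image[OF hom, of "F \<circ> R" "- {F z}"] by (simp add: o_assoc)
  have pe: "homotopic_loops (- {F z}) (F \<circ> r) (F \<circ> R \<circ> r)"
    if r: "path r" "pathfinish r = pathstart r" "path_image r \<subseteq> C - {z}" for r
  proof (rule homotopic_loops_eq)
    show "path (F \<circ> r)" using r F(1)
      by (meson Diff_subset continuous_on_subset path_continuous_image subset_trans)
    show "path_image (F \<circ> r) \<subseteq> - {F z}"
      using r F(2) zC unfolding path_image_compose by (auto dest: inj_onD)
    show "pathfinish (F \<circ> r) = pathstart (F \<circ> r)" using r by (simp add: pathfinish_compose pathstart_compose)
    show "\<And>t. t \<in> {0..1} \<Longrightarrow> (F \<circ> r) t = (F \<circ> R \<circ> r) t"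
      using r(3) Rid unfolding path_image_def by force
  qed
  have "homotopic_loops (- {F z}) (F \<circ> p) (F \<circ> q)"
    using pe[OF p] pe[OF q] h homotopic_loops_sym homotopic_loops_trans by blast
  then show ?thesis by (rule winding_number_homotopic_loops)
qed

definition local_degree_one :: "(complex \<Rightarrow> complex) \<Rightarrow> complex \<Rightarrow> bool" where
  "local_degree_one F z \<longleftrightarrow>
     (\<forall>\<^sub>F \<rho> in at_right 0. winding_number (F \<circ> circlepath z \<rho>) (F z) = 1)"

text \<open>
  Winding numbers are integers and vary continuously with the centre of the circle, so the value
  one extends from nearby points.
\<close>

lemma local_degree_one_limit:
  fixes F :: "complex \<Rightarrow> complex"
  assumes F: "continuous_on (cball z r) F" "inj_on F (cball z r)"
    and z': "z' \<in> ball z r" "local_degree_one F z'"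
  shows "local_degree_one F z"
proof -
  have r0: "0 < r" using z'(1) by (metis ball_eq_empty empty_iff linorder_not_le)
  define e where "e = r - dist z z'"
  have e0: "0 < e" using z'(1) by (auto simp: e_def)
  have "\<forall>\<^sub>F \<rho>::real in at_right 0. \<rho> < e"
    using e0 by (intro eventually_at_rightI[of 0 e]) auto
  moreover have "\<forall>\<^sub>F \<rho>::real in at_right 0. 0 < \<rho>" by (simp add: eventually_at_right_less)
  ultimately have "\<forall>\<^sub>F \<rho> in at_right 0. 0 < \<rho> \<and> \<rho> < e \<and> winding_number (F \<circ> circlepath z' \<rho>) (F z') = 1"
    using z'(2) unfolding local_degree_one_def by eventually_elim auto
  then obtain \<rho>' where \<rho>': "0 < \<rho>'" "\<rho>' < e" "winding_number (F \<circ> circlepath z' \<rho>') (F z') = 1"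
    by (metis (mono_tags, lifting) eventually_happens trivial_limit_at_right_real)
  have int': "z' \<in> interior (cball z r)" using z'(1) by simp
  have sub': "path_image (circlepath z' \<rho>') \<subseteq> cball z r - {z'}"
  proof -
    have "dist z x \<le> r" if "dist z' x = \<rho>'" for x
      using dist_triangle[of z x z'] that \<rho>' by (simp add: e_def)
    then show ?thesis using \<rho>' by auto
  qed
  have sub: "path_image (circlepath z r) \<subseteq> cball z r - {z'}" using z'(1) r0 by auto
  have "winding_number (F \<circ> circlepath z r) (F z') = winding_number (F \<circ> circlepath z' \<rho>') (F z')"
    using z'(1) r0 \<rho>'(1) sub sub'
    by (intro winding_number_image_loop[OF closed_cball convex_cball int' F])
      (auto simp: winding_number_circlepath dist_norm norm_minus_commute)
  then have w1: "winding_number (F \<circ> circlepath z r) (F z') = 1" using \<rho>' by simp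
  have "winding_number (F \<circ> circlepath z r) (F z) = winding_number (F \<circ> circlepath z r) (F z')"
  proof (rule winding_number_eq[where S = "F ` ball z r"])
    show "path (F \<circ> circlepath z r)"
      using F(1) sub by (intro path_continuous_image) (auto intro: continuous_on_subset)
    show "pathfinish (F \<circ> circlepath z r) = pathstart (F \<circ> circlepath z r)"
      by (simp add: pathfinish_compose pathstart_compose)
    show "F z \<in> F ` ball z r" "F z' \<in> F ` ball z r" using z'(1) r0 by auto
    show "connected (F ` ball z r)"
      using F(1) by (intro connected_continuous_image connected_ball) (auto intro: continuous_on_subset)
    have "F ` ball z r \<inter> F ` sphere z r = {}"
      using F(2) by (subst inj_on_image_Int[symmetric, where C = "cball z r"]) auto
    then show "F ` ball z r \<inter> path_image (F \<circ> circlepath z r) = {}"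
      using r0 by (simp add: path_image_compose)
  qed
  then have wz: "winding_number (F \<circ> circlepath z r) (F z) = 1" using w1 by simp
  have "winding_number (F \<circ> circlepath z \<rho>) (F z) = 1" if "0 < \<rho>" "\<rho> < r" for \<rho>
  proof -
    have "winding_number (F \<circ> circlepath z \<rho>) (F z) = winding_number (F \<circ> circlepath z r) (F z)"
      using that r0
      by (intro winding_number_image_loop[OF closed_cball convex_cball _ F])
        (auto simp: winding_number_circlepath_centre)
    then show ?thesis using wz by simp
  qed
  then show ?thesis unfolding local_degree_one_def
    using r0 by (intro eventually_at_rightI[of 0 r]) auto
qed

text \<open>
  Since the second term is smaller than the first in norm, it can be scaled down to zero without
  crossing the centre.
\<close>

lemma winding_number_ellipse:
  fixes a b w0 z :: complex
  assumes "norm b < norm a" "0 < \<rho>"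
  defines "p \<equiv> (\<lambda>w. w0 + a * (w - z) + b * cnj (w - z)) \<circ> circlepath z \<rho>"
  shows "winding_number p w0 = 1"
proof -
  have a0: "a \<noteq> 0" using assms by auto
  define E where "E t = exp (2 * of_real pi * \<i> * of_real t)" for t :: real
  have nE: "norm (E t) = 1" for t by (simp add: E_def)
  have nE0: "E t \<noteq> 0" for t by (simp add: E_def)
  have contE: "continuous_on UNIV E" unfolding E_def by (intro continuous_intros)
  have E01: "E 1 = E 0" by (simp add: E_def exp_two_pi_i')
  have p: "p t = w0 + of_real \<rho> * (a * E t + b * cnj (E t))" for t
    by (simp add: p_def circlepath_def part_circlepath_def linepath_def E_def algebra_simps)
  define H where "H = (\<lambda>(s::real, t). w0 + of_real \<rho> *
    (of_real (norm a) * exp (\<i> * of_real ((1 - s) * Arg a)) * E t + of_real (1 - s) * b * cnj (E t)))"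
  have rot: "a = of_real (norm a) * exp (\<i> * of_real (Arg a))"
    using a0 by (metis Arg_eq)
  have "homotopic_loops (- {w0}) p (circlepath w0 (\<rho> * norm a))"
    unfolding homotopic_loops
  proof (intro exI conjI ballI)
    have "continuous_on UNIV H"
      unfolding H_def E_def split_beta by (intro continuous_intros)
    then show "continuous_on ({0..1} \<times> {0..1}) H" by (rule continuous_on_subset) simp
    show "H \<in> {0..1} \<times> {0..1} \<rightarrow> - {w0}"
    proof
      fix x :: "real \<times> real" assume "x \<in> {0..1} \<times> {0..1}"
      then obtain s t where x: "x = (s, t)" and st: "0 \<le> s" "s \<le> 1" by auto
      define X where "X = of_real (norm a) * exp (\<i> * of_real ((1 - s) * Arg a)) * E t"
      define Y where "Y = of_real (1 - s) * b * cnj (E t)"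
      have nX: "norm X = norm a" by (simp add: X_def norm_mult nE)
      have "norm Y = (1 - s) * norm b" using st unfolding Y_def norm_mult by (simp add: nE del: of_real_diff)
      also have "\<dots> \<le> norm b" using st by (simp add: mult_left_le_one_le)
      finally have "norm Y < norm X" using nX assms(1) by simp
      then have "X + Y \<noteq> 0" by (metis add_eq_0_iff norm_minus_cancel less_irrefl)
      then show "H x \<in> - {w0}" using assms(2) by (simp add: H_def x X_def Y_def)
    qed
    show "H (0, x) = p x" for x
      using rot by (simp add: H_def p)
    show "H (1, x) = circlepath w0 (\<rho> * norm a) x" for x
      by (simp add: H_def circlepath_def part_circlepath_def linepath_def E_def algebra_simps)
    show "pathfinish (H \<circ> Pair s) = pathstart (H \<circ> Pair s)" for s
      by (simp add: H_def pathfinish_def pathstart_def E01)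
  qed
  then have "winding_number p w0 = winding_number (circlepath w0 (\<rho> * norm a)) w0"
    by (rule winding_number_homotopic_loops)
  then show ?thesis using a0 assms(2) by (simp add: winding_number_circlepath_centre)
qed

lemma local_degree_one_affine:
  fixes F :: "complex \<Rightarrow> complex"
  assumes F: "continuous_on (cball w0 r) F" "inj_on F (cball w0 r)" "0 < r" "local_degree_one F w0"
    and ab: "norm b < norm a"
  shows "local_degree_one (\<lambda>w. F (w0 + a * (w - z) + b * cnj (w - z))) z"
proof -
  define L where "L = (\<lambda>w. w0 + a * (w - z) + b * cnj (w - z))"
  have a0: "0 < norm a + norm b" using ab norm_ge_zero[of b] by linarith
  have "\<forall>\<^sub>F \<rho>::real in at_right 0. \<rho> < r"
    using F(3) by (intro eventually_at_rightI[of 0 r]) auto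
  moreover have "\<forall>\<^sub>F \<rho>::real in at_right 0. 0 < \<rho>" by (simp add: eventually_at_right_less)
  ultimately have "\<forall>\<^sub>F \<rho> in at_right 0. 0 < \<rho> \<and> \<rho> < r \<and> winding_number (F \<circ> circlepath w0 \<rho>) (F w0) = 1"
    using F(4) unfolding local_degree_one_def by eventually_elim auto
  then obtain \<rho>' where \<rho>': "0 < \<rho>'" "\<rho>' < r" "winding_number (F \<circ> circlepath w0 \<rho>') (F w0) = 1"
    by (metis (mono_tags, lifting) eventually_happens trivial_limit_at_right_real)
  have "winding_number (F \<circ> L \<circ> circlepath z \<rho>) (F (L z)) = 1" if \<rho>: "0 < \<rho>" "\<rho> < r / (norm a + norm b)" for \<rho>
  proof -
    have \<rho>r: "\<rho> * (norm a + norm b) < r" using \<rho>(2) a0 by (simp add: pos_less_divide_eq)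
    have Lz: "L z = w0" by (simp add: L_def)
    have pL: "path (L \<circ> circlepath z \<rho>)"
      unfolding L_def by (intro path_continuous_image) (auto intro!: continuous_intros)
    have img: "path_image (L \<circ> circlepath z \<rho>) \<subseteq> cball w0 r - {w0}"
    proof -
      have *: "dist w0 (L x) \<le> r \<and> L x \<noteq> w0" if "dist z x = \<rho>" for x
      proof -
        have nx: "norm (x - z) = \<rho>" using that by (simp add: dist_norm norm_minus_commute)
        have n1: "norm (a * (x - z)) = \<rho> * norm a" and n2: "norm (b * cnj (x - z)) = \<rho> * norm b"
          by (simp_all add: norm_mult nx del: complex_cnj_diff)
        have "norm (L x - w0) \<le> \<rho> * norm a + \<rho> * norm b"
          using norm_triangle_ineq[of "a * (x - z)" "b * cnj (x - z)"] unfolding n1 n2 by (simp add: L_def)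
        then have "dist w0 (L x) \<le> r" using \<rho>r by (simp add: dist_norm norm_minus_commute distrib_left)
        moreover have "a * (x - z) + b * cnj (x - z) \<noteq> 0"
        proof
          assume "a * (x - z) + b * cnj (x - z) = 0"
          then have "norm (a * (x - z)) = norm (b * cnj (x - z))"
            by (metis add_eq_0_iff norm_minus_cancel)
          then show False unfolding n1 n2 using \<rho>(1) ab by simp
        qed
        ultimately show ?thesis by (simp add: L_def add.assoc)
      qed
      have "path_image (circlepath z \<rho>) = sphere z \<rho>" using \<rho>(1) by simp
      then show ?thesis using * unfolding path_image_compose by (metis (no_types, lifting) Diff_iff
        empty_iff image_subsetI insert_iff mem_cball mem_sphere)
    qed
    have "winding_number (F \<circ> (L \<circ> circlepath z \<rho>)) (F w0) = winding_number (F \<circ> circlepath w0 \<rho>') (F w0)"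
      using \<rho>' F(3) pL img winding_number_ellipse[OF ab \<rho>(1), of w0 z]
      by (intro winding_number_image_loop[OF closed_cball convex_cball _ F(1,2)])
        (auto simp: winding_number_circlepath_centre pathfinish_compose pathstart_compose L_def)
    then show ?thesis using \<rho>'(3) Lz by (simp add: o_assoc)
  qed
  then have "\<forall>\<^sub>F \<rho> in at_right 0. winding_number (F \<circ> L \<circ> circlepath z \<rho>) (F (L z)) = 1"
    using F(3) a0 by (intro eventually_at_rightI[of 0 "r / (norm a + norm b)"]) auto
  then show ?thesis unfolding local_degree_one_def L_def by (simp add: comp_def)
qed

lemma chart_inj_continuous:
  assumes "riemann_surface S \<A>" "(U, \<phi>) \<in> \<A>"
  shows "continuous_on U \<phi>" "inj_on \<phi> U" "openin (top_of_set S) U" "U \<subseteq> S"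
    "\<phi> ` U \<subseteq> {z. 0 \<le> Im z}"
proof -
  have *: "openin (top_of_set S) U" "openin (top_of_set {z. 0 \<le> Im z}) (\<phi> ` U)"
    "\<exists>\<psi>. homeomorphism U (\<phi> ` U) \<phi> \<psi>"
    using assms unfolding riemann_surface_def by fastforce+
  then show "continuous_on U \<phi>" "inj_on \<phi> U" "openin (top_of_set S) U" "U \<subseteq> S"
    "\<phi> ` U \<subseteq> {z. 0 \<le> Im z}"
    by (auto simp: homeomorphism_def openin_imp_subset intro: inj_on_inverseI dest: openin_imp_subset)
qed

lemma cball_into_chart:
  assumes rs: "riemann_surface S \<A>" and A: "(U, \<phi>) \<in> \<A>"
    and X: "open X" "continuous_on X \<Phi>" "inj_on \<Phi> X" "\<Phi> ` X \<subseteq> S"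
    and z: "z \<in> X" "\<Phi> z \<in> U"
  obtains r where "0 < r" "cball z r \<subseteq> X" "continuous_on (cball z r) (\<phi> \<circ> \<Phi>)"
    "inj_on (\<phi> \<circ> \<Phi>) (cball z r)"
proof -
  note c = chart_inj_continuous[OF rs A]
  have "openin (top_of_set X) (X \<inter> \<Phi> -` U)"
    using continuous_openin_preimage[OF X(2) _ c(3)] X(4) by auto
  then have "open (X \<inter> \<Phi> -` U)" using X(1) openin_open_trans by blast
  then obtain r where r: "0 < r" "cball z r \<subseteq> X \<inter> \<Phi> -` U"
    using z open_contains_cball by blast
  have "continuous_on (cball z r) (\<phi> \<circ> \<Phi>)"
    using r(2) by (intro continuous_on_compose continuous_on_subset[OF X(2)] continuous_on_subset[OF c(1)]) auto
  moreover have "inj_on (\<phi> \<circ> \<Phi>) (cball z r)"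
    using r(2) by (intro comp_inj_on inj_on_subset[OF X(3)] inj_on_subset[OF c(2)]) auto
  ultimately show ?thesis using that r by blast
qed

lemma local_degree_one_cong:
  assumes "open X" "z \<in> X" "\<And>w. w \<in> X \<Longrightarrow> F w = G w" "local_degree_one G z"
  shows "local_degree_one F z"
proof -
  obtain r where r: "0 < r" "cball z r \<subseteq> X" using assms(1,2) open_contains_cball by blast
  have "\<forall>\<^sub>F \<rho>::real in at_right 0. 0 < \<rho> \<and> \<rho> < r"
    using r by (intro eventually_at_rightI[of 0 r]) auto
  then show ?thesis using assms(4) unfolding local_degree_one_def
  proof eventually_elim
    case (elim \<rho>)
    have "path_image (circlepath z \<rho>) \<subseteq> cball z r" using elim(1) by auto
    then have e: "\<And>t. t \<in> {0..1} \<Longrightarrow> (F \<circ> circlepath z \<rho>) t = (G \<circ> circlepath z \<rho>) t"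
      using r(2) assms(3) unfolding path_image_def by fastforce
    have "winding_number (F \<circ> circlepath z \<rho>) (F z) = winding_number (G \<circ> circlepath z \<rho>) (F z)"
      by (rule winding_number_cong) (use e in auto)
    then show ?case using elim assms(2,3) by simp
  qed
qed

lemma orientation_preserving_iff:
  "orientation_preserving \<A> \<Phi> X \<longleftrightarrow>
     (\<forall>z\<in>X. \<forall>(U, \<phi>)\<in>\<A>. \<Phi> z \<in> U \<longrightarrow> local_degree_one (\<phi> \<circ> \<Phi>) z)"
  unfolding orientation_preserving_def local_degree_one_def by (simp add: o_assoc)

text \<open>
  For a piecewise defined chart this reduces orientation to the open pieces; the lines between
  them need no separate treatment.
\<close>

lemma orientation_preserving_if_dense:
  assumes rs: "riemann_surface S \<A>"
    and X: "open X" "continuous_on X \<Phi>" "inj_on \<Phi> X" "\<Phi> ` X \<subseteq> S"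
    and G: "G \<subseteq> X" "orientation_preserving \<A> \<Phi> G" "X \<subseteq> closure G"
  shows "orientation_preserving \<A> \<Phi> X"
  unfolding orientation_preserving_iff
proof (clarify)
  fix z U \<phi> assume z: "z \<in> X" and A: "(U, \<phi>) \<in> \<A>" and U: "\<Phi> z \<in> U"
  note c = chart_inj_continuous[OF rs A]
  have "openin (top_of_set X) (X \<inter> \<Phi> -` U)"
    using continuous_openin_preimage[OF X(2) _ c(3)] X(4) by auto
  then have oU: "open (X \<inter> \<Phi> -` U)" using X(1) openin_open_trans by blast
  obtain r where r: "0 < r" "cball z r \<subseteq> X \<inter> \<Phi> -` U" "continuous_on (cball z r) (\<phi> \<circ> \<Phi>)"
    "inj_on (\<phi> \<circ> \<Phi>) (cball z r)"
  proof (rule cball_into_chart[OF rs A oU])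
    show "continuous_on (X \<inter> \<Phi> -` U) \<Phi>" "inj_on \<Phi> (X \<inter> \<Phi> -` U)" "\<Phi> ` (X \<inter> \<Phi> -` U) \<subseteq> S"
      using X(2-4) by (auto intro: continuous_on_subset inj_on_subset)
    show "z \<in> X \<inter> \<Phi> -` U" "\<Phi> z \<in> U" using z U by auto
  qed
  have "z \<in> closure G" using z G(3) by blast
  then obtain z' where z': "z' \<in> G" "dist z' z < r" using r(1) closure_approachable by blast
  have "z' \<in> cball z r" using z' by (simp add: dist_commute)
  then have "\<Phi> z' \<in> U" using r(2) by blast
  then have "local_degree_one (\<phi> \<circ> \<Phi>) z'"
    using G(2) z'(1) A unfolding orientation_preserving_iff by blast
  then show "local_degree_one (\<phi> \<circ> \<Phi>) z"
    using z' by (intro local_degree_one_limit[OF r(3,4)]) (auto simp: dist_commute)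
qed

text \<open>Local orientation behaviour at a point is unchanged by an orientation-preserving affine map.\<close>

lemma orientation_preserving_affine_point:
  assumes rs: "riemann_surface S \<A>"
    and Y: "open Y" "continuous_on Y \<Psi>" "inj_on \<Psi> Y" "\<Psi> ` Y \<subseteq> S" "orientation_preserving \<A> \<Psi> Y"
    and X: "open X" "z \<in> X" "\<And>w. w \<in> X \<Longrightarrow> \<Phi> w = \<Psi> (w0 + a * (w - z) + b * cnj (w - z))"
    and ab: "norm b < norm a" and w0: "w0 \<in> Y"
  shows "orientation_preserving \<A> \<Phi> {z}"
  unfolding orientation_preserving_iff
proof (clarify)
  fix U \<phi> assume A: "(U, \<phi>) \<in> \<A>" and U: "\<Phi> z \<in> U"
  have U': "\<Psi> w0 \<in> U" using U X(3)[OF X(2)] by simp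
  obtain r where r: "0 < r" "continuous_on (cball w0 r) (\<phi> \<circ> \<Psi>)" "inj_on (\<phi> \<circ> \<Psi>) (cball w0 r)"
    using cball_into_chart[OF rs A Y(1-4) w0 U'] by blast
  have "local_degree_one (\<phi> \<circ> \<Psi>) w0"
    using Y(5) w0 A U' unfolding orientation_preserving_iff by blast
  from local_degree_one_affine[OF r(2,3,1) this ab]
  show "local_degree_one (\<phi> \<circ> \<Phi>) z"
    by (rule local_degree_one_cong[OF X(1,2), rotated]) (simp add: X(3))
qed

section \<open>Ears of convex polygons\<close>

text \<open>
  Affine coordinates \<open>ear_s\<close>, \<open>ear_t\<close> adapted to the ear at a side:
  within the polygon, \<open>ear_s\<close> is positive exactly on the tip side of the diagonal
  that cuts off the ear, and it vanishes on this diagonal.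
\<close>

definition edge1 :: "nat \<Rightarrow> ('a, 'v) polygons \<Rightarrow> side \<Rightarrow> complex" where
  "edge1 d P x = vert P (fst x) (Suc (snd x) mod d) - vert P (fst x) (snd x)"

definition edge2 :: "nat \<Rightarrow> ('a, 'v) polygons \<Rightarrow> side \<Rightarrow> complex" where
  "edge2 d P x = vert P (fst x) (Suc (Suc (snd x)) mod d) - vert P (fst x) (snd x)"

definition ear_point :: "nat \<Rightarrow> ('a, 'v) polygons \<Rightarrow> side \<Rightarrow> real \<Rightarrow> real \<Rightarrow> complex" where
  "ear_point d P x s t =
     vert P (fst x) (snd x) + of_real s * edge1 d P x + of_real t * edge2 d P x"

definition ear_det :: "nat \<Rightarrow> ('a, 'v) polygons \<Rightarrow> side \<Rightarrow> real" where
  "ear_det d P x = (\<i> * edge1 d P x) \<bullet> edge2 d P x"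

definition ear_s :: "nat \<Rightarrow> ('a, 'v) polygons \<Rightarrow> side \<Rightarrow> complex \<Rightarrow> real" where
  "ear_s d P x z = (- \<i> * edge2 d P x) \<bullet> (z - vert P (fst x) (snd x)) / ear_det d P x"

definition ear_t :: "nat \<Rightarrow> ('a, 'v) polygons \<Rightarrow> side \<Rightarrow> complex \<Rightarrow> real" where
  "ear_t d P x z = (\<i> * edge1 d P x) \<bullet> (z - vert P (fst x) (snd x)) / ear_det d P x"

lemma Im_cnj_mult_eq_inner: "Im (cnj a * b) = (\<i> * a) \<bullet> b"
  by (simp add: inner_complex_def)

context
  fixes d :: nat and P :: "('a, 'v) polygons" and r k :: nat
  assumes d3: "3 \<le> d" and conv: "convex_polygon d (vert P r)" and kd: "k < d"
begin

lemma convex_polygonD: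
  "\<lbrakk>a < d; j < d; j \<noteq> a; j \<noteq> Suc a mod d\<rbrakk> \<Longrightarrow>
     0 < (\<i> * (vert P r (Suc a mod d) - vert P r a)) \<bullet> (vert P r j - vert P r a)"
  using conv unfolding convex_polygon_def Im_cnj_mult_eq_inner by blast

lemma corner_indices: "Suc k mod d \<noteq> k" "Suc (Suc k) mod d \<noteq> k" "Suc (Suc k) mod d \<noteq> Suc k mod d"
  "Suc k mod d < d" "Suc (Suc k) mod d < d"
  using d3 kd by (auto simp: mod_Suc)

lemma ear_det_pos: "0 < ear_det d P (r, k)"
  using convex_polygonD[of k "Suc (Suc k) mod d"] corner_indices kd
  by (simp add: ear_det_def edge1_def edge2_def)

lemma ear_s_point [simp]: "ear_s d P (r, k) (ear_point d P (r, k) s t) = s"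
proof -
  have "(- \<i> * edge2 d P (r, k)) \<bullet> (ear_point d P (r, k) s t - vert P r k) = s * ear_det d P (r, k)"
    by (simp add: ear_point_def ear_det_def inner_complex_def algebra_simps)
  then show ?thesis using ear_det_pos by (simp add: ear_s_def)
qed

lemma ear_t_point [simp]: "ear_t d P (r, k) (ear_point d P (r, k) s t) = t"
proof -
  have "(\<i> * edge1 d P (r, k)) \<bullet> (ear_point d P (r, k) s t - vert P r k) = t * ear_det d P (r, k)"
    by (simp add: ear_point_def ear_det_def inner_complex_def algebra_simps)
  then show ?thesis using ear_det_pos by (simp add: ear_t_def)
qed

lemma ear_point_coords [simp]: "ear_point d P (r, k) (ear_s d P (r, k) z) (ear_t d P (r, k) z) = z"
proof -
  define e f w where "e = edge1 d P (r, k)" and "f = edge2 d P (r, k)" and "w = z - vert P r k"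
  have D: "ear_det d P (r, k) = Re e * Im f - Im e * Re f"
    by (simp add: ear_det_def inner_complex_def e_def f_def)
  have "of_real (ear_det d P (r, k)) * w = of_real ((- \<i> * f) \<bullet> w) * e + of_real ((\<i> * e) \<bullet> w) * f"
    unfolding D by (simp add: complex_eq_iff inner_complex_def algebra_simps)
  then have "w = of_real ((- \<i> * f) \<bullet> w / ear_det d P (r, k)) * e + of_real ((\<i> * e) \<bullet> w / ear_det d P (r, k)) * f"
    using ear_det_pos by (simp add: field_simps)
  then have "vert P r k + of_real ((- \<i> * f) \<bullet> w / ear_det d P (r, k)) * e
      + of_real ((\<i> * e) \<bullet> w / ear_det d P (r, k)) * f = vert P r k + w"
    by (metis add.assoc)
  then show ?thesis by (simp add: ear_point_def ear_s_def ear_t_def e_def f_def w_def)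
qed

lemma ear_st_affine:
  "ear_s d P (r, k) (of_real (1 - u) * z + of_real u * w) = (1 - u) * ear_s d P (r, k) z + u * ear_s d P (r, k) w"
  "ear_t d P (r, k) (of_real (1 - u) * z + of_real u * w) = (1 - u) * ear_t d P (r, k) z + u * ear_t d P (r, k) w"
  by (simp_all add: ear_s_def ear_t_def inner_complex_def add_divide_distrib[symmetric] algebra_simps
      diff_divide_distrib[symmetric])

lemma continuous_ear [continuous_intros]:
  "continuous_on A f \<Longrightarrow> continuous_on A (\<lambda>z. ear_s d P (r, k) (f z))"
  "continuous_on A f \<Longrightarrow> continuous_on A (\<lambda>z. ear_t d P (r, k) (f z))"
  unfolding ear_s_def ear_t_def by (intro continuous_intros; use ear_det_pos in simp)+

lemma ear_s_hyperplane: "{z. ear_s d P (r, k) z = c} = {z. (- \<i> * edge2 d P (r, k)) \<bullet> z =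
     c * ear_det d P (r, k) + (- \<i> * edge2 d P (r, k)) \<bullet> vert P r k}"
  and ear_s_t_hyperplane: "{z. ear_s d P (r, k) z = ear_t d P (r, k) z} = {z. (- \<i> * (edge1 d P (r, k) + edge2 d P (r, k))) \<bullet> z =
     (- \<i> * (edge1 d P (r, k) + edge2 d P (r, k))) \<bullet> vert P r k}"
  using ear_det_pos by (auto simp: ear_s_def ear_t_def field_simps inner_complex_def)

lemma negligible_ear_lines:
  "negligible {z. ear_s d P (r, k) z = c}" "negligible {z. ear_s d P (r, k) z = ear_t d P (r, k) z}"
proof -
  have "edge2 d P (r, k) \<noteq> 0" using ear_det_pos by (auto simp: ear_det_def)
  then show "negligible {z. ear_s d P (r, k) z = c}"
    unfolding ear_s_hyperplane by (intro negligible_hyperplane) auto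
  have "edge1 d P (r, k) + edge2 d P (r, k) \<noteq> 0"
  proof
    assume "edge1 d P (r, k) + edge2 d P (r, k) = 0"
    then have "edge2 d P (r, k) = - edge1 d P (r, k)" by (metis add_eq_0_iff)
    then show False using ear_det_pos by (simp add: ear_det_def inner_complex_def)
  qed
  then show "negligible {z. ear_s d P (r, k) z = ear_t d P (r, k) z}"
    unfolding ear_s_t_hyperplane by (intro negligible_hyperplane) auto
qed

lemma ear_t_corner: "j < d \<Longrightarrow> 0 \<le> ear_t d P (r, k) (vert P r j)"
  "\<lbrakk>j < d; j \<noteq> k; j \<noteq> Suc k mod d\<rbrakk> \<Longrightarrow> 0 < ear_t d P (r, k) (vert P r j)"
proof -
  show *: "0 < ear_t d P (r, k) (vert P r j)" if "j < d" "j \<noteq> k" "j \<noteq> Suc k mod d" for j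
    using convex_polygonD[OF kd that] ear_det_pos by (simp add: ear_t_def edge1_def)
  show "0 \<le> ear_t d P (r, k) (vert P r j)" if "j < d" for j
  proof (cases "j = k \<or> j = Suc k mod d")
    case True
    then show ?thesis by (auto simp: ear_t_def edge1_def inner_complex_def algebra_simps)
  qed (use * that in force)
qed

lemma one_minus_ear_st: "1 - ear_s d P (r, k) z - ear_t d P (r, k) z =
   (\<i> * (vert P r (Suc (Suc k) mod d) - vert P r (Suc k mod d))) \<bullet> (z - vert P r (Suc k mod d)) / ear_det d P (r, k)"
proof -
  have "(\<i> * (vert P r (Suc (Suc k) mod d) - vert P r (Suc k mod d))) \<bullet> (z - vert P r (Suc k mod d)) =
    ear_det d P (r, k) - (- \<i> * edge2 d P (r, k)) \<bullet> (z - vert P r k) - (\<i> * edge1 d P (r, k)) \<bullet> (z - vert P r k)"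
    by (simp add: ear_det_def edge1_def edge2_def inner_complex_def algebra_simps)
  moreover have "1 - a / D - b / D = (D - a - b) / D" if "0 < D" for a b D :: real
    using that by (simp add: field_simps)
  ultimately show ?thesis using ear_det_pos unfolding ear_s_def ear_t_def by (simp only: fst_conv snd_conv)
qed

lemma ear_st_corner: "j < d \<Longrightarrow> ear_s d P (r, k) (vert P r j) + ear_t d P (r, k) (vert P r j) \<le> 1"
  "\<lbrakk>j < d; j \<noteq> Suc k mod d; j \<noteq> Suc (Suc k) mod d\<rbrakk> \<Longrightarrow>
     ear_s d P (r, k) (vert P r j) + ear_t d P (r, k) (vert P r j) < 1"
proof -
  show *: "ear_s d P (r, k) (vert P r j) + ear_t d P (r, k) (vert P r j) < 1"
    if "j < d" "j \<noteq> Suc k mod d" "j \<noteq> Suc (Suc k) mod d" for j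
  proof -
    have "0 < 1 - ear_s d P (r, k) (vert P r j) - ear_t d P (r, k) (vert P r j)"
      unfolding one_minus_ear_st
      using convex_polygonD[of "Suc k mod d" j] that corner_indices ear_det_pos
      by (simp add: mod_Suc_eq)
    then show ?thesis by simp
  qed
  show "ear_s d P (r, k) (vert P r j) + ear_t d P (r, k) (vert P r j) \<le> 1" if "j < d" for j
  proof (cases "j = Suc k mod d \<or> j = Suc (Suc k) mod d")
    case True
    then have "1 - ear_s d P (r, k) (vert P r j) - ear_t d P (r, k) (vert P r j) = 0"
      unfolding one_minus_ear_st by (auto simp: inner_complex_def algebra_simps)
    then show ?thesis by simp
  qed (use * that in force)
qed

lemma ear_corners:
  "ear_point d P (r, k) 0 0 = vert P r k" "ear_point d P (r, k) 1 0 = vert P r (Suc k mod d)"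
  "ear_point d P (r, k) 0 1 = vert P r (Suc (Suc k) mod d)"
  by (simp_all add: ear_point_def edge1_def edge2_def)

text \<open>A corner is an extreme point of the polygon, since the edge starting there supports the
  polygon; so a corner outside the ear cannot lie on the ear's side of the diagonal.\<close>

lemma ear_s_corner:
  assumes "j < d" "j \<noteq> Suc k mod d"
  shows "ear_s d P (r, k) (vert P r j) \<le> 0"
proof (cases "j = k \<or> j = Suc (Suc k) mod d")
  case True
  then show ?thesis using ear_corners ear_s_point by (metis order_refl)
next
  case False
  define s t where "s = ear_s d P (r, k) (vert P r j)" and "t = ear_t d P (r, k) (vert P r j)"
  have t0: "0 < t" using ear_t_corner(2)[of j] assms False by (simp add: t_def)
  have st: "s + t < 1" using ear_st_corner(2)[of j] assms False by (simp add: s_def t_def)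
  define g where "g w = (\<i> * (vert P r (Suc j mod d) - vert P r j)) \<bullet> (w - vert P r j)" for w
  have g: "0 \<le> g (vert P r m) \<and> (m \<noteq> Suc j mod d \<longrightarrow> 0 < g (vert P r m))" if "m < d" "m \<noteq> j" for m
    using convex_polygonD[of j m] assms(1) that by (cases "m = Suc j mod d") (auto simp: g_def inner_complex_def algebra_simps)
  have v: "vert P r j = of_real (1 - s - t) * vert P r k + of_real s * vert P r (Suc k mod d)
      + of_real t * vert P r (Suc (Suc k) mod d)"
    using ear_point_coords[of "vert P r j"]
    by (simp add: s_def[symmetric] t_def[symmetric] ear_point_def edge1_def edge2_def algebra_simps)
  have "0 = g (of_real (1 - s - t) * vert P r k + of_real s * vert P r (Suc k mod d)
      + of_real t * vert P r (Suc (Suc k) mod d))"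
    using v by (simp add: g_def)
  also have "\<dots> = (1 - s - t) * g (vert P r k) + s * g (vert P r (Suc k mod d)) + t * g (vert P r (Suc (Suc k) mod d))"
    by (simp add: g_def inner_complex_def algebra_simps)
  finally have sum0: "(1 - s - t) * g (vert P r k) + s * g (vert P r (Suc k mod d)) + t * g (vert P r (Suc (Suc k) mod d)) = 0"
    by simp
  have "s < 0"
  proof (rule ccontr)
    assume "\<not> s < 0"
    then have "0 \<le> s * g (vert P r (Suc k mod d))"
      using g[of "Suc k mod d"] assms corner_indices by auto
    moreover have "0 \<le> (1 - s - t) * g (vert P r k)" "0 \<le> t * g (vert P r (Suc (Suc k) mod d))"
      using g[of k] g[of "Suc (Suc k) mod d"] False corner_indices kd t0 st by auto
    moreover have "0 < (1 - s - t) * g (vert P r k) \<or> 0 < t * g (vert P r (Suc (Suc k) mod d))"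
      using g[of k] g[of "Suc (Suc k) mod d"] False corner_indices kd t0 st
      by (cases "Suc j mod d = k") auto
    ultimately show False using sum0 by linarith
  qed
  then show ?thesis by (simp add: s_def)
qed

lemma region_ear_bounds:
  assumes "z \<in> polygon_region d P r"
  shows "0 \<le> ear_t d P (r, k) z" "ear_s d P (r, k) z + ear_t d P (r, k) z \<le> 1"
proof -
  have "polygon_region d P r \<subseteq> {z. 0 \<le> ear_t d P (r, k) z \<and> ear_s d P (r, k) z + ear_t d P (r, k) z \<le> 1}"
    unfolding polygon_region_def
  proof (rule hull_minimal)
    show "vert P r ` {..<d} \<subseteq> {z. 0 \<le> ear_t d P (r, k) z \<and> ear_s d P (r, k) z + ear_t d P (r, k) z \<le> 1}"
      using ear_t_corner(1) ear_st_corner(1) by auto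
    show "convex {z. 0 \<le> ear_t d P (r, k) z \<and> ear_s d P (r, k) z + ear_t d P (r, k) z \<le> 1}"
      unfolding convex_alt
    proof (intro ballI allI impI CollectI, elim conjE CollectE)
      fix z w u assume u: "0 \<le> (u::real)" "u \<le> 1"
        and z: "0 \<le> ear_t d P (r, k) z" "ear_s d P (r, k) z + ear_t d P (r, k) z \<le> 1"
        and w: "0 \<le> ear_t d P (r, k) w" "ear_s d P (r, k) w + ear_t d P (r, k) w \<le> 1"
      have "(1 - u) * (ear_s d P (r, k) z + ear_t d P (r, k) z) + u * (ear_s d P (r, k) w + ear_t d P (r, k) w) \<le> (1 - u) * 1 + u * 1"
        using u z w by (intro add_mono mult_left_mono) auto
      then show "0 \<le> ear_t d P (r, k) ((1 - u) *\<^sub>R z + u *\<^sub>R w) \<and>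
          ear_s d P (r, k) ((1 - u) *\<^sub>R z + u *\<^sub>R w) + ear_t d P (r, k) ((1 - u) *\<^sub>R z + u *\<^sub>R w) \<le> 1"
        using u z w unfolding scaleR_conv_of_real ear_st_affine
        by (auto simp: distrib_left intro!: add_nonneg_nonneg mult_nonneg_nonneg)
    qed
  qed
  then show "0 \<le> ear_t d P (r, k) z" "ear_s d P (r, k) z + ear_t d P (r, k) z \<le> 1" using assms by auto
qed

lemma ear_point_in_region:
  assumes "0 \<le> s" "0 \<le> t" "s + t \<le> 1"
  shows "ear_point d P (r, k) s t \<in> polygon_region d P r"
proof -
  have "ear_point d P (r, k) s t = (1 - s - t) *\<^sub>R vert P r k + s *\<^sub>R vert P r (Suc k mod d)
      + t *\<^sub>R vert P r (Suc (Suc k) mod d)"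
    by (simp add: ear_point_def edge1_def edge2_def scaleR_conv_of_real algebra_simps)
  also have "\<dots> \<in> convex hull {vert P r k, vert P r (Suc k mod d), vert P r (Suc (Suc k) mod d)}"
    unfolding convex_hull_3 using assms by (intro CollectI exI[of _ "1 - s - t"] exI[of _ s] exI[of _ t]) auto
  also have "\<dots> \<subseteq> polygon_region d P r" unfolding polygon_region_def using corner_indices kd by (intro hull_mono) auto
  finally show ?thesis .
qed

lemma continuous_ear_point [continuous_intros]:
  "\<lbrakk>continuous_on A f; continuous_on A g\<rbrakk> \<Longrightarrow> continuous_on A (\<lambda>z. ear_point d P (r, k) (f z) (g z))"
  unfolding ear_point_def by (intro continuous_intros)

lemma interior_region_ear_bounds:
  assumes "z \<in> interior (polygon_region d P r)"
  shows "0 < ear_t d P (r, k) z" "ear_s d P (r, k) z + ear_t d P (r, k) z < 1"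
proof -
  define s t where "s = ear_s d P (r, k) z" and "t = ear_t d P (r, k) z"
  have z: "z = ear_point d P (r, k) s t" by (simp add: s_def t_def)
  define q where "q \<delta> = ear_point d P (r, k) s (t + \<delta>)" for \<delta>
  have "isCont q 0" unfolding q_def ear_point_def by (intro continuous_intros)
  moreover have "q 0 \<in> interior (polygon_region d P r)" using assms z by (simp add: q_def)
  ultimately have "\<forall>\<^sub>F \<delta> in at 0. q \<delta> \<in> interior (polygon_region d P r)"
    using open_interior isCont_def topological_tendstoD by metis
  then obtain b where b: "0 < b" "\<And>\<delta>. \<delta> \<noteq> 0 \<Longrightarrow> \<bar>\<delta>\<bar> < b \<Longrightarrow> q \<delta> \<in> interior (polygon_region d P r)"
    unfolding eventually_at by (auto simp: dist_real_def)
  have "q (b/2) \<in> polygon_region d P r" "q (- b/2) \<in> polygon_region d P r" using b interior_subset by force+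
  from region_ear_bounds(2)[OF this(1)] region_ear_bounds(1)[OF this(2)]
  have "s + t < 1" "0 < t" using b(1) by (auto simp: q_def)
  then show "0 < ear_t d P (r, k) z" "ear_s d P (r, k) z + ear_t d P (r, k) z < 1" by (simp_all add: s_def t_def)
qed

lemma ear_point_in_interior:
  assumes "0 < s" "0 < t" "s + t < 1"
  shows "ear_point d P (r, k) s t \<in> interior (polygon_region d P r)"
proof (rule interiorI)
  let ?U = "{z. 0 < ear_s d P (r, k) z \<and> 0 < ear_t d P (r, k) z \<and> ear_s d P (r, k) z + ear_t d P (r, k) z < 1}"
  show "open ?U" by (intro open_Collect_conj open_Collect_less continuous_intros)
  show "ear_point d P (r, k) s t \<in> ?U" using assms by simp
  show "?U \<subseteq> polygon_region d P r"
  proof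
    fix z assume "z \<in> ?U"
    then show "z \<in> polygon_region d P r" using ear_point_in_region[of "ear_s d P (r, k) z" "ear_t d P (r, k) z"] by simp
  qed
qed

end

text \<open>The ears at two sides overlap only if one of the sides follows the other.\<close>

lemma ears_disjoint:
  assumes d3: "3 \<le> d" and conv: "convex_polygon d (vert P r)" and kl: "k < d" "l < d"
    "l \<noteq> k" "l \<noteq> Suc k mod d" "k \<noteq> Suc l mod d"
    and z: "z \<in> polygon_region d P r" and s0: "0 \<le> ear_s d P (r, l) z"
  shows "ear_s d P (r, k) z \<le> 0"
proof -
  note L = d3 conv kl(2) and K = d3 conv kl(1)
  define s t where "s = ear_s d P (r, l) z" and "t = ear_t d P (r, l) z"
  have st: "0 \<le> s" "0 \<le> t" "s + t \<le> 1" using s0 region_ear_bounds[OF L z] by (auto simp: s_def t_def)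
  have "z = ear_point d P (r, l) s t" by (simp add: ear_point_coords[OF L] s_def t_def)
  then have zc: "z = of_real (1 - s - t) * vert P r l + of_real s * vert P r (Suc l mod d)
      + of_real t * vert P r (Suc (Suc l) mod d)"
    by (simp add: ear_point_def edge1_def edge2_def algebra_simps)
  have "ear_s d P (r, k) z = (1 - s - t) * ear_s d P (r, k) (vert P r l)
      + s * ear_s d P (r, k) (vert P r (Suc l mod d)) + t * ear_s d P (r, k) (vert P r (Suc (Suc l) mod d))"
    unfolding zc using ear_det_pos[OF K] by (simp add: ear_s_def inner_complex_def field_simps)
  moreover have "ear_s d P (r, k) (vert P r l) \<le> 0"
    using ear_s_corner[OF K] kl by auto
  moreover have "ear_s d P (r, k) (vert P r (Suc l mod d)) \<le> 0"
    using kl by (intro ear_s_corner[OF K]) (auto simp: mod_Suc split: if_splits)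
  moreover have "ear_s d P (r, k) (vert P r (Suc (Suc l) mod d)) \<le> 0"
    using kl by (intro ear_s_corner[OF K]) (auto simp: mod_Suc split: if_splits)
  ultimately show ?thesis using st by (auto intro!: add_nonpos_nonpos mult_nonneg_nonpos)
qed

section \<open>Consecutive sides are not glued\<close>

text \<open>
  Folding two consecutive sides onto each other turns a neighbourhood of their common corner into
  a full neighbourhood of its image. But corners are marked points, which lie on the boundary of
  the surface.
\<close>

lemma adjacent_sides_not_glued:
  fixes P :: "('a::t2_space, 'v) polygons"
  assumes rs: "riemann_surface S \<A>"
    and d3: "3 \<le> d" and conv: "convex_polygon d (vert P r)" and kd: "k < d"
    and cont: "continuous_on (polygon_region d P r) (chart P r)"
    and S: "chart P r ` polygon_region d P r \<subseteq> S"
    and inj: "inj_on (chart P r) (interior (polygon_region d P r))"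
    and int: "chart P r ` interior (polygon_region d P r) \<subseteq> S - bdry \<A> - path_image \<gamma>"
    and simple: "simple_path \<gamma>" and \<gamma>int: "\<gamma> ` {0<..<1} \<subseteq> S - bdry \<A>" and \<gamma>1: "\<gamma> 1 \<in> bdry \<A>"
    and glue1: "\<And>s. s \<in> {0..1} \<Longrightarrow> chart P r (ear_point d P (r, k) s 0) = \<gamma> s"
    and glue2: "\<And>s. s \<in> {0..1} \<Longrightarrow> chart P r (ear_point d P (r, k) s (1 - s)) = \<gamma> s"
  shows False
proof -
  define R where "R = polygon_region d P r"
  define \<Psi> where "\<Psi> = chart P r"
  define pt where "pt = ear_point d P (r, k)"
  define cs where "cs = ear_s d P (r, k)"
  define ct where "ct = ear_t d P (r, k)"
  note K = d3 conv kd
  note [simp] = ear_s_point[OF K, folded pt_def cs_def] ear_t_point[OF K, folded pt_def ct_def]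
    ear_point_coords[OF K, folded pt_def cs_def ct_def]
  note ptR = ear_point_in_region[OF K, folded pt_def R_def]
  note ptI = ear_point_in_interior[OF K, folded pt_def R_def]
  note contc [continuous_intros] = continuous_ear[OF K, folded cs_def ct_def]
  have \<Psi>: "continuous_on R \<Psi>" "\<Psi> ` R \<subseteq> S" "inj_on \<Psi> (interior R)"
    "\<Psi> ` interior R \<subseteq> S - bdry \<A> - path_image \<gamma>"
    using cont S inj int by (simp_all add: R_def \<Psi>_def)
  have gl1: "\<Psi> (pt s 0) = \<gamma> s" and gl2: "\<Psi> (pt s (1 - s)) = \<gamma> s" if "0 \<le> s" "s \<le> 1" for s
    using glue1[of s] glue2[of s] that by (simp_all add: \<Psi>_def pt_def)
  obtain U \<phi> where A: "(U, \<phi>) \<in> \<A>" and U: "\<gamma> 1 \<in> U" and Im0: "Im (\<phi> (\<gamma> 1)) = 0"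
    using \<gamma>1 unfolding bdry_def by blast
  note c = chart_inj_continuous[OF rs A]
  have Impos: "0 < Im (\<phi> p)" if "p \<in> U" "p \<notin> bdry \<A>" for p
  proof -
    have "0 \<le> Im (\<phi> p)" using c(5) that by auto
    moreover have "Im (\<phi> p) \<noteq> 0" using that A unfolding bdry_def by blast
    ultimately show ?thesis by simp
  qed
  obtain \<epsilon> where \<epsilon>: "0 < \<epsilon>" "R \<inter> ball (pt 1 0) \<epsilon> \<subseteq> \<Psi> -` U"
  proof -
    have "openin (top_of_set R) (R \<inter> \<Psi> -` U)"
      using continuous_openin_preimage[OF \<Psi>(1) _ c(3)] \<Psi>(2) by auto
    moreover have "pt 1 0 \<in> R \<inter> \<Psi> -` U" using ptR[of 1 0] gl1[of 1] U by simp
    ultimately show thesis using that unfolding openin_contains_ball by (metis Int_commute le_inf_iff)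
  qed
  define N where "N = norm (edge1 d P (r, k)) + norm (edge2 d P (r, k)) + 1"
  have N0: "0 < N" unfolding N_def by (simp add: add_nonneg_pos)
  define \<delta> where "\<delta> = min (1/2) (\<epsilon> / (2 * N))"
  have \<delta>: "0 < \<delta>" "\<delta> < 1" using \<epsilon>(1) N0 by (auto simp: \<delta>_def)
  have \<delta>N: "\<delta> * N < \<epsilon>"
  proof -
    have "\<delta> * N \<le> \<epsilon> / (2 * N) * N" using N0 by (intro mult_right_mono) (auto simp: \<delta>_def)
    also have "\<dots> < \<epsilon>" using N0 \<epsilon>(1) by simp
    finally show ?thesis .
  qed
  define T where "T = {z. 1 - \<delta> \<le> cs z \<and> 0 \<le> ct z \<and> cs z + ct z \<le> 1}"
  define V where "V = {z. 1 - \<delta> < cs z \<and> 0 < ct z \<and> cs z + ct z < 1}"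
  have TR: "z \<in> R" if "z \<in> T" for z
    using ptR[of "cs z" "ct z"] that \<delta> by (simp add: T_def)
  have VI: "z \<in> interior R" if "0 < cs z" "0 < ct z" "cs z + ct z < 1" for z
    using ptI[of "cs z" "ct z"] that by simp
  have TU: "\<Psi> z \<in> U" if "z \<in> T" for z
  proof -
    have "z - pt 1 0 = of_real (cs z - 1) * edge1 d P (r, k) + of_real (ct z) * edge2 d P (r, k)"
    proof -
      have "z = pt (cs z) (ct z)" by simp
      then show ?thesis by (simp add: pt_def ear_point_def algebra_simps)
    qed
    then have "norm (z - pt 1 0) \<le> \<bar>cs z - 1\<bar> * norm (edge1 d P (r, k)) + \<bar>ct z\<bar> * norm (edge2 d P (r, k))"
      by (metis norm_triangle_ineq norm_mult norm_of_real)
    also have "\<dots> \<le> \<delta> * norm (edge1 d P (r, k)) + \<delta> * norm (edge2 d P (r, k))"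
      using that by (intro add_mono mult_right_mono) (auto simp: T_def)
    also have "\<dots> \<le> \<delta> * N" using \<delta> by (simp add: N_def algebra_simps)
    also have "\<dots> < \<epsilon>" by (rule \<delta>N)
    finally have "z \<in> ball (pt 1 0) \<epsilon>" by (simp add: dist_norm norm_minus_commute)
    then show ?thesis using \<epsilon>(2) TR[OF that] by auto
  qed
  define F where "F = \<phi> \<circ> \<Psi>"
  have VT: "V \<subseteq> T" by (auto simp: V_def T_def)
  have contF: "continuous_on T F" unfolding F_def
    using TR TU by (intro continuous_on_compose continuous_on_subset[OF \<Psi>(1)] continuous_on_subset[OF c(1)]) auto
  have cT: "compact T"
  proof -
    have "compact R" unfolding R_def polygon_region_def by (intro compact_convex_hull finite_imp_compact) auto
    moreover have "closed T" unfolding T_def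
      by (intro closed_Collect_conj closed_Collect_le continuous_intros)
    moreover have "T = R \<inter> T" using TR by auto
    ultimately show ?thesis by (metis compact_Int_closed)
  qed
  have oV: "open V" unfolding V_def by (intro open_Collect_conj open_Collect_less continuous_intros)
  have VR: "V \<subseteq> interior R" using VI \<delta> by (auto simp: V_def)
  have oO: "open (F ` V)"
  proof (rule invariance_of_domain)
    show "continuous_on V F" using contF VT continuous_on_subset by blast
    show "open V" by (rule oV)
    show "inj_on F V" unfolding F_def
      using VR VT TU by (intro comp_inj_on inj_on_subset[OF \<Psi>(3)] inj_on_subset[OF c(2)]) auto
  qed
  define L where "L = (\<phi> \<circ> \<gamma>) ` {1 - \<delta>..1}"
  define J where "J = F ` {z \<in> T. cs z = 1 - \<delta>}"
  have \<gamma>U: "\<gamma> s \<in> U" if "1 - \<delta> \<le> s" "s \<le> 1" for s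
    using TU[of "pt s 0"] gl1[of s] that \<delta> by (simp add: T_def)
  have edges: "F z \<in> L" if "z \<in> T" "ct z = 0 \<or> cs z + ct z = 1" for z
  proof -
    have "\<Psi> z = \<gamma> (cs z)"
    proof (cases "ct z = 0")
      case True
      then have "\<Psi> (pt (cs z) 0) = \<Psi> z" by (metis ear_point_coords[OF K, folded pt_def cs_def ct_def])
      then show ?thesis using gl1[of "cs z"] that \<delta> by (simp add: T_def)
    next
      case False
      then have "ct z = 1 - cs z" using that by simp
      then have "\<Psi> (pt (cs z) (1 - cs z)) = \<Psi> z" by (metis ear_point_coords[OF K, folded pt_def cs_def ct_def])
      then show ?thesis using gl2[of "cs z"] that \<delta> by (simp add: T_def)
    qed
    then show ?thesis using that \<delta> by (auto simp: F_def L_def T_def)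
  qed
  have int_not_L: "F z \<notin> L" if "z \<in> T" "z \<in> interior R" for z
  proof
    assume "F z \<in> L"
    then obtain s where s: "1 - \<delta> \<le> s" "s \<le> 1" "\<phi> (\<Psi> z) = \<phi> (\<gamma> s)" by (auto simp: L_def F_def)
    then have "\<Psi> z = \<gamma> s" using c(2) TU[OF that(1)] \<gamma>U by (auto dest: inj_onD)
    then have "\<Psi> z \<in> path_image \<gamma>" using s \<delta> by (auto simp: path_image_def)
    then show False using \<Psi>(4) that by auto
  qed
  have J_cases: "z \<in> interior R \<or> z = pt (1 - \<delta>) 0 \<or> z = pt (1 - \<delta>) \<delta>"
    if "z \<in> T" "cs z = 1 - \<delta>" for z
  proof -
    have "ct z = 0 \<or> ct z = \<delta> \<or> z \<in> interior R"
    proof (rule ccontr)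
      assume n: "\<not> ?thesis"
      have "0 \<le> ct z" "ct z \<le> \<delta>" using that by (auto simp: T_def)
      then have "0 < ct z" "ct z < \<delta>" using n by auto
      then show False using VI[of z] n that \<delta> by auto
    qed
    then show ?thesis using that by (metis ear_point_coords[OF K, folded pt_def cs_def ct_def])
  qed
  have O_disj: "F ` V \<inter> (J \<union> L) = {}"
  proof -
    have "F z \<noteq> F z'" if z: "z \<in> V" and z': "z' \<in> T" "cs z' = 1 - \<delta>" for z z'
    proof (cases "z' \<in> interior R")
      case True
      have "z \<noteq> z'" using z z' by (auto simp: V_def)
      then have "\<Psi> z \<noteq> \<Psi> z'" using True z VR \<Psi>(3) by (auto dest: inj_onD)
      then show ?thesis using c(2) TU[of z] TU[of z'] z z' VT by (auto simp: F_def dest: inj_onD)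
    next
      case False
      then have "F z' \<in> L" using J_cases[OF z'] z' \<delta> by (intro edges) auto
      then show ?thesis using int_not_L[OF subsetD[OF VT z] subsetD[OF VR z]] by metis
    qed
    moreover have "F z \<notin> L" if "z \<in> V" for z
      using int_not_L[OF subsetD[OF VT that] subsetD[OF VR that]] .
    ultimately show ?thesis by (auto simp: J_def)
  qed
  have cJ: "compact J" unfolding J_def
  proof (rule compact_continuous_image)
    show "continuous_on {z \<in> T. cs z = 1 - \<delta>} F" using contF by (rule continuous_on_subset) auto
    have "closed {z. cs z = 1 - \<delta>}" by (intro closed_Collect_eq continuous_intros)
    moreover have "{z \<in> T. cs z = 1 - \<delta>} = T \<inter> {z. cs z = 1 - \<delta>}" by auto
    ultimately show "compact {z \<in> T. cs z = 1 - \<delta>}" using cT by (metis compact_Int_closed)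
  qed
  have J_Im: "0 < Im q" if "q \<in> J" for q
  proof -
    obtain z where z: "z \<in> T" "cs z = 1 - \<delta>" "q = F z" using \<open>q \<in> J\<close> by (auto simp: J_def)
    have "\<Psi> z \<notin> bdry \<A>"
    proof (cases "z \<in> interior R")
      case True then show ?thesis using \<Psi>(4) by auto
    next
      case False
      then have "\<Psi> z = \<gamma> (1 - \<delta>)" using J_cases[OF z(1,2)] gl1[of "1 - \<delta>"] gl2[of "1 - \<delta>"] \<delta> by auto
      then show ?thesis using subsetD[OF \<gamma>int imageI, of "1 - \<delta>"] \<delta> by simp
    qed
    then show ?thesis using Impos TU[OF z(1)] z(3) by (simp add: F_def)
  qed
  have J0: "J \<noteq> {}"
    using \<delta> by (auto simp: J_def T_def intro!: exI[of _ "pt (1 - \<delta>) 0"])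
  obtain m where m: "0 < m" "\<And>q. q \<in> J \<Longrightarrow> m \<le> Im q"
  proof -
    have "continuous_on J Im" by (intro continuous_intros)
    from continuous_attains_inf[OF cJ J0 this] obtain q where "q \<in> J" "\<forall>y\<in>J. Im q \<le> Im y" by blast
    then show thesis using that J_Im by blast
  qed
  obtain z0 where z0: "z0 \<in> V" "Im (F z0) < m"
  proof -
    have v1: "pt 1 0 \<in> T" using \<delta> by (simp add: T_def)
    have "continuous_on T (\<lambda>z. Im (F z))" using contF by (intro continuous_intros)
    then have "\<exists>e>0. \<forall>z\<in>T. dist z (pt 1 0) < e \<longrightarrow> dist (Im (F z)) (Im (F (pt 1 0))) < m"
      using v1 m(1) unfolding continuous_on_iff by blast
    then obtain e where e: "0 < e" "\<And>z. z \<in> T \<Longrightarrow> dist z (pt 1 0) < e \<Longrightarrow> dist (Im (F z)) (Im (F (pt 1 0))) < m"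
      by blast
    have F1: "Im (F (pt 1 0)) = 0" using gl1[of 1] Im0 by (simp add: F_def)
    define q where "q \<eta> = pt (1 - 2 * \<eta>) \<eta>" for \<eta>
    have "isCont q 0" unfolding q_def pt_def ear_point_def by (intro continuous_intros)
    then have "\<forall>\<^sub>F \<eta> in at 0. dist (q \<eta>) (q 0) < e"
      using e(1) by (simp add: isCont_def tendsto_iff)
    then obtain b where b: "0 < b" "\<And>\<eta>. \<eta> \<noteq> 0 \<Longrightarrow> \<bar>\<eta>\<bar> < b \<Longrightarrow> dist (q \<eta>) (q 0) < e"
      unfolding eventually_at by (auto simp: dist_real_def)
    define \<eta> where "\<eta> = min (b/2) (\<delta>/4)"
    have \<eta>: "0 < \<eta>" "\<eta> < b" "2 * \<eta> < \<delta>" using b \<delta> by (auto simp: \<eta>_def)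
    have "q \<eta> \<in> V" using \<eta> by (simp add: V_def q_def)
    moreover have "dist (q \<eta>) (pt 1 0) < e" using b(2)[of \<eta>] \<eta> by (simp add: q_def)
    ultimately show thesis using that[of "q \<eta>"] e(2)[of "q \<eta>"] VT F1 by (auto simp: dist_real_def)
  qed
  define y where "y = Complex (Re (F z0)) (- 1)"
  have U_Im: "0 \<le> Im (\<phi> p)" if "p \<in> U" for p using subsetD[OF c(5) imageI[OF that]] by simp
  have F_Im: "0 \<le> Im (F z)" if "z \<in> T" for z using U_Im[OF TU[OF that]] by (simp add: F_def)
  have L_Im: "0 \<le> Im q" if "q \<in> L" for q using U_Im \<gamma>U that unfolding L_def by fastforce
  have "Im y = - 1" by (simp add: y_def)
  then have yO: "y \<notin> F ` V" "y \<notin> L" using F_Im subsetD[OF VT] L_Im by fastforce+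
  have ccJ: "connected_component (- J) (F z0) y"
    unfolding connected_component_def
  proof (intro exI conjI)
    show "connected {q. Im q < m}" by (intro convex_connected convex_halfspace_Im_lt)
    show "{q. Im q < m} \<subseteq> - J" using m(2) by force
    show "F z0 \<in> {q. Im q < m}" "y \<in> {q. Im q < m}" using z0 m by (auto simp: y_def)
  qed
  have ccL: "connected_component (- L) (F z0) y"
  proof -
    define g where "g = \<phi> \<circ> \<gamma> \<circ> linepath (1 - \<delta>) 1"
    have lp: "linepath (1 - \<delta>) 1 ` {0..1} = {1 - \<delta>..1}"
      using \<delta> by (simp add: path_image_def[symmetric] closed_segment_eq_real_ivl)
    have pi: "path_image g = L" unfolding g_def L_def path_image_def image_comp[symmetric] lp by simp
    have "path \<gamma>" using simple by (simp add: simple_path_def)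
    then have c\<gamma>: "continuous_on {1 - \<delta>..1} \<gamma>"
      unfolding path_def using \<delta> by (auto intro: continuous_on_subset)
    have inj\<gamma>: "inj_on \<gamma> {1 - \<delta>..1}"
    proof (rule inj_onI)
      fix a b assume "a \<in> {1 - \<delta>..1}" "b \<in> {1 - \<delta>..1}" "\<gamma> a = \<gamma> b"
      then show "a = b" using simple \<delta> unfolding simple_path_def loop_free_def by force
    qed
    have "arc g" unfolding arc_def path_def
    proof
      show "continuous_on {0..1} g" unfolding g_def using \<gamma>U lp
        by (intro continuous_on_compose continuous_on_subset[OF c\<gamma>] continuous_on_subset[OF c(1)]
            continuous_on_linepath) auto
      show "inj_on g {0..1}" unfolding g_def using \<gamma>U lp \<delta>
        by (intro comp_inj_on inj_on_subset[OF inj\<gamma>] inj_on_subset[OF c(2)] inj_on_linepath) auto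
    qed
    then have "connected (- L)" using connected_arc_complement[of g] pi by simp
    moreover have "F z0 \<in> - L" using O_disj z0 by auto
    ultimately show ?thesis using yO(2) connected_iff_connected_component by blast
  qed
  have "connected_component (- (J \<union> L)) (F z0) y"
  proof (rule Janiszewski[OF cJ _ _ ccJ ccL])
    have "compact L" unfolding L_def
    proof (rule compact_continuous_image)
      have "path \<gamma>" using simple by (simp add: simple_path_def)
      then show "continuous_on {1 - \<delta>..1} (\<phi> \<circ> \<gamma>)"
        unfolding path_def using \<delta> \<gamma>U
        by (intro continuous_on_compose continuous_on_subset[OF c(1)]) (auto intro: continuous_on_subset)
    qed simp
    then show "closed L" by (rule compact_imp_closed)
    have "J \<inter> L \<subseteq> {\<phi> (\<gamma> (1 - \<delta>))}"
    proof
      fix q assume q: "q \<in> J \<inter> L"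
      then obtain z where z: "z \<in> T" "cs z = 1 - \<delta>" "q = F z" by (auto simp: J_def)
      then have "z \<notin> interior R" using int_not_L q by auto
      then have "\<Psi> z = \<gamma> (1 - \<delta>)" using J_cases[OF z(1,2)] gl1[of "1 - \<delta>"] gl2[of "1 - \<delta>"] \<delta> by auto
      then show "q \<in> {\<phi> (\<gamma> (1 - \<delta>))}" using z by (simp add: F_def)
    qed
    then show "connected (J \<inter> L)" using connected_sing connected_empty subset_singletonD by metis
  qed
  then obtain C where C: "connected C" "C \<subseteq> - (J \<union> L)" "F z0 \<in> C" "y \<in> C"
    unfolding connected_component_def by blast
  have clO: "closure (F ` V) \<subseteq> F ` V \<union> (J \<union> L)"
  proof -
    have "closed (F ` T)" using cT contF by (intro compact_imp_closed compact_continuous_image)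
    then have "closure (F ` V) \<subseteq> F ` T" using VT by (intro closure_minimal image_mono)
    also have "\<dots> \<subseteq> F ` V \<union> (J \<union> L)"
    proof (rule image_subsetI)
      fix z assume z: "z \<in> T"
      show "F z \<in> F ` V \<union> (J \<union> L)"
      proof (cases "F z \<in> J \<union> L")
        case False
        then have "cs z \<noteq> 1 - \<delta>" "ct z \<noteq> 0" "cs z + ct z \<noteq> 1" using edges z by (auto simp: J_def)
        then have "z \<in> V" using z by (auto simp: T_def V_def)
        then show ?thesis by blast
      qed blast
    qed
    finally show ?thesis .
  qed
  have "F ` V \<inter> C = {} \<or> (- closure (F ` V)) \<inter> C = {}"
  proof (rule connectedD[OF C(1) oO])
    show "open (- closure (F ` V))" by (intro open_Compl closed_closure)
    show "F ` V \<inter> - closure (F ` V) \<inter> C = {}" using closure_subset[of "F ` V"] by auto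
    show "C \<subseteq> F ` V \<union> (- closure (F ` V))" using C(2) clO by auto
  qed
  moreover have "F z0 \<in> F ` V \<inter> C" using z0(1) C(3) by simp
  moreover have "y \<in> (- closure (F ` V)) \<inter> C" using C(2,4) yO(1) clO by auto
  ultimately show False by (metis empty_iff)
qed

section \<open>Charts of the flipped polygons\<close>

text \<open>
  The new chart on an ear, in ear coordinates: one half of the ear stays in its polygon, the other
  half moves across the arc \<open>i\<close> into the opposite ear.
\<close>

definition flip_ear :: "nat \<Rightarrow> ('a, 'v) polygons \<Rightarrow> side \<Rightarrow> side \<Rightarrow> complex \<Rightarrow> 'a" where
  "flip_ear d P x y z =
     (if ear_s d P x z \<le> ear_t d P x z
      then chart P (fst x) (ear_point d P x (ear_s d P x z) (ear_t d P x z - ear_s d P x z))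
      else chart P (fst y) (ear_point d P y (1 - ear_s d P x z) (ear_s d P x z - ear_t d P x z)))"

definition flip_chart :: "nat \<Rightarrow> ('a, 'v) polygons \<Rightarrow> side \<Rightarrow> side \<Rightarrow> nat \<Rightarrow> complex \<Rightarrow> 'a" where
  "flip_chart d P u w r z =
     (if fst u = r \<and> 0 < ear_s d P u z then flip_ear d P u w z
      else if fst w = r \<and> 0 < ear_s d P w z then flip_ear d P w u z
      else chart P r z)"

text \<open>
  The arc \<open>i\<close> moves from its side to the next one; the arc of that next side is left
  in the part of the ear that crosses over to the other polygon, where it appears at the side of
  \<open>i\<close>.
\<close>

definition flip_side :: "nat \<Rightarrow> side \<Rightarrow> side \<Rightarrow> side \<Rightarrow> side" where
  "flip_side d u w x =
     (if x = u then next_side d w else if x = next_side d u then u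
      else if x = w then next_side d u else if x = next_side d w then w else x)"

definition flip_polygons :: "nat \<Rightarrow> ('a, 'v) polygons \<Rightarrow> side \<Rightarrow> side \<Rightarrow> ('a, 'v) polygons" where
  "flip_polygons d P u w =
     P\<lparr>chart := flip_chart d P u w, side_arc := (\<lambda>r k. label P (flip_side d u w (r, k)))\<rparr>"

definition flip_arc :: "nat \<Rightarrow> ('a, 'v) polygons \<Rightarrow> side \<Rightarrow> side \<Rightarrow> real \<Rightarrow> 'a" where
  "flip_arc d P u w t =
     (if t \<le> 1/2 then chart P (fst w) (ear_point d P w t (1 - 2 * t))
      else chart P (fst u) (ear_point d P u (1 - t) (2 * t - 1)))"

lemma side_curve_ear:
  assumes "snd x < d"
  shows "side_curve d P x t = chart P (fst x) (ear_point d P x t 0)"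
    "side_curve d P (next_side d x) t = chart P (fst x) (ear_point d P x (1 - t) t)"
  using assms by (cases x; simp add: side_curve_def next_side_def ear_point_def edge1_def edge2_def
      linepath_def mod_Suc_eq scaleR_conv_of_real algebra_simps)+

locale flippable =
  fixes d :: nat and S :: "'a::t2_space set" and \<A> :: "('a set \<times> ('a \<Rightarrow> complex)) set" and M :: "'a set"
    and I :: "'v set" and \<gamma> :: "'v \<Rightarrow> real \<Rightarrow> 'a" and P :: "('a, 'v) polygons" and i :: 'v and u w :: side
  assumes d3: "3 \<le> d" and surface: "marked_surface S \<A> M" and dang: "d_angulation d S \<A> M I \<gamma> P"
    and iI: "i \<in> I" and left: "left_side d \<gamma> P i u" and right: "right_side d \<gamma> P i w"
begin

lemma dangD:
  shows "finite I" "\<And>a. a \<in> I \<Longrightarrow> marked_arc S \<A> M (\<gamma> a)"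
    "\<And>a b. \<lbrakk>a \<in> I; b \<in> I; a \<noteq> b\<rbrakk> \<Longrightarrow> \<gamma> a ` {0<..<1} \<inter> \<gamma> b ` {0<..<1} = {}"
    "\<And>r. r < npoly P \<Longrightarrow> convex_polygon d (vert P r)"
    "\<And>r. r < npoly P \<Longrightarrow> continuous_on (polygon_region d P r) (chart P r)"
    "\<And>r. r < npoly P \<Longrightarrow> chart P r ` polygon_region d P r \<subseteq> S"
    "\<And>r. r < npoly P \<Longrightarrow> inj_on (chart P r) (interior (polygon_region d P r))"
    "\<And>r. r < npoly P \<Longrightarrow> orientation_preserving \<A> (chart P r) (interior (polygon_region d P r))"
    "\<And>r r'. \<lbrakk>r < npoly P; r' < npoly P; r \<noteq> r'\<rbrakk> \<Longrightarrow>
        chart P r ` interior (polygon_region d P r) \<inter> chart P r' ` interior (polygon_region d P r') = {}"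
    "(\<Union>r<npoly P. chart P r ` interior (polygon_region d P r)) =
       S - bdry \<A> - (\<Union>a\<in>I. path_image (\<gamma> a))"
    "\<And>x. \<lbrakk>x \<in> sides d P; label P x = None\<rbrakk> \<Longrightarrow> boundary_segment \<A> M (side_curve d P x)"
    "\<And>x a. \<lbrakk>x \<in> sides d P; label P x = Some a\<rbrakk> \<Longrightarrow> a \<in> I \<and> (left_side d \<gamma> P a x \<or> right_side d \<gamma> P a x)"
    "\<And>a. a \<in> I \<Longrightarrow> \<exists>!x. left_side d \<gamma> P a x" "\<And>a. a \<in> I \<Longrightarrow> \<exists>!x. right_side d \<gamma> P a x"
    "(\<Union>x\<in>{x \<in> sides d P. label P x = None}. path_image (side_curve d P x)) = bdry \<A>"
    "\<And>x y. \<lbrakk>x \<in> sides d P; y \<in> sides d P; label P x = None; label P y = None; x \<noteq> y\<rbrakk> \<Longrightarrow>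
        side_curve d P x ` {0<..<1} \<inter> side_curve d P y ` {0<..<1} = {}"
proof -
  note D = dang[unfolded d_angulation_def]
  note polys = D[THEN conjunct2, THEN conjunct2, THEN conjunct2, THEN conjunct1] and lab = D[THEN conjunct2, THEN conjunct2, THEN conjunct2, THEN conjunct2, THEN conjunct2, THEN conjunct2, THEN conjunct1] and pairs = D[THEN conjunct2, THEN conjunct2, THEN conjunct2, THEN conjunct2, THEN conjunct2, THEN conjunct2, THEN conjunct2, THEN conjunct2, THEN conjunct2]
  show "finite I" by (rule D[THEN conjunct1])
  show "marked_arc S \<A> M (\<gamma> a)" if "a \<in> I" for a by (rule bspec[OF D[THEN conjunct2, THEN conjunct1] that])
  show "\<gamma> a ` {0<..<1} \<inter> \<gamma> b ` {0<..<1} = {}" if "a \<in> I" "b \<in> I" "a \<noteq> b" for a b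
    using bspec[OF bspec[OF D[THEN conjunct2, THEN conjunct2, THEN conjunct1] that(1)] that(2)] that(3) by (rule mp)
  show "convex_polygon d (vert P r)" "continuous_on (polygon_region d P r) (chart P r)"
    "chart P r ` polygon_region d P r \<subseteq> S" "inj_on (chart P r) (interior (polygon_region d P r))"
    "orientation_preserving \<A> (chart P r) (interior (polygon_region d P r))" if "r < npoly P" for r
    using mp[OF spec[OF polys] that] by simp_all
  show "chart P r ` interior (polygon_region d P r) \<inter> chart P r' ` interior (polygon_region d P r') = {}"
    if "r < npoly P" "r' < npoly P" "r \<noteq> r'" for r r'
    by (rule mp[OF mp[OF spec[OF mp[OF spec[OF D[THEN conjunct2, THEN conjunct2, THEN conjunct2, THEN conjunct2, THEN conjunct1]] that(1)]] that(2)] that(3)])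
  show "(\<Union>r<npoly P. chart P r ` interior (polygon_region d P r)) =
       S - bdry \<A> - (\<Union>a\<in>I. path_image (\<gamma> a))" by (rule D[THEN conjunct2, THEN conjunct2, THEN conjunct2, THEN conjunct2, THEN conjunct2, THEN conjunct1])
  show "boundary_segment \<A> M (side_curve d P x)" if "x \<in> sides d P" "label P x = None" for x
    using bspec[OF lab that(1)] that(2) by simp
  show "a \<in> I \<and> (left_side d \<gamma> P a x \<or> right_side d \<gamma> P a x)" if "x \<in> sides d P" "label P x = Some a" for x a
    using bspec[OF lab that(1)] that(2) by simp
  show "\<exists>!x. left_side d \<gamma> P a x" "\<exists>!x. right_side d \<gamma> P a x" if "a \<in> I" for a
    using bspec[OF D[THEN conjunct2, THEN conjunct2, THEN conjunct2, THEN conjunct2, THEN conjunct2, THEN conjunct2, THEN conjunct2, THEN conjunct1] that] by simp_all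
  show "(\<Union>x\<in>{x \<in> sides d P. label P x = None}. path_image (side_curve d P x)) = bdry \<A>"
    by (rule D[THEN conjunct2, THEN conjunct2, THEN conjunct2, THEN conjunct2, THEN conjunct2, THEN conjunct2, THEN conjunct2, THEN conjunct2, THEN conjunct1])
  show "side_curve d P x ` {0<..<1} \<inter> side_curve d P y ` {0<..<1} = {}"
    if "x \<in> sides d P" "y \<in> sides d P" "label P x = None" "label P y = None" "x \<noteq> y" for x y
    using bspec[OF bspec[OF pairs that(1)] that(2)] that(3-5) by simp
qed

lemma rs: "riemann_surface S \<A>" and M_bdry: "M \<subseteq> bdry \<A>"
  using surface unfolding marked_surface_def by auto

lemma bdry_S: "bdry \<A> \<subseteq> S"
  using chart_inj_continuous(4)[OF rs] unfolding bdry_def by blast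

lemma arc_facts:
  assumes "a \<in> I"
  shows "simple_path (\<gamma> a)" "\<gamma> a 0 \<in> M" "\<gamma> a 1 \<in> M" "\<gamma> a ` {0<..<1} \<subseteq> S - bdry \<A>" "path (\<gamma> a)"
    "path_image (\<gamma> a) \<subseteq> S" "path_image (\<gamma> a) = insert (\<gamma> a 0) (insert (\<gamma> a 1) (\<gamma> a ` {0<..<1}))"
proof -
  note m = dangD(2)[OF assms, unfolded marked_arc_def]
  show s: "simple_path (\<gamma> a)" "\<gamma> a 0 \<in> M" "\<gamma> a 1 \<in> M" "\<gamma> a ` {0<..<1} \<subseteq> S - bdry \<A>"
    using m by (auto simp: pathstart_def pathfinish_def)
  show "path (\<gamma> a)" using s(1) by (simp add: simple_path_def)
  have "{0..1} = insert 0 (insert 1 {0<..<1::real})" by auto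
  then show pi: "path_image (\<gamma> a) = insert (\<gamma> a 0) (insert (\<gamma> a 1) (\<gamma> a ` {0<..<1}))"
    unfolding path_image_def by (simp only: image_insert)
  show "path_image (\<gamma> a) \<subseteq> S" unfolding pi using s M_bdry bdry_S by auto
qed

lemma u_side: "u \<in> sides d P" "label P u = Some i" "\<And>t. t \<in> {0..1} \<Longrightarrow> side_curve d P u t = \<gamma> i t"
  and w_side: "w \<in> sides d P" "label P w = Some i" "\<And>t. t \<in> {0..1} \<Longrightarrow> side_curve d P w t = \<gamma> i (1 - t)"
  using left right unfolding left_side_def right_side_def by auto

lemma sidesD: "x \<in> sides d P \<Longrightarrow> fst x < npoly P \<and> snd x < d"
  by (auto simp: sides_def)

lemma next_in_sides: "x \<in> sides d P \<Longrightarrow> next_side d x \<in> sides d P"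
  using d3 by (auto simp: sides_def next_side_def)

lemma u_neq_w: "u \<noteq> w"
proof
  assume "u = w"
  then have "\<gamma> i (1/4) = \<gamma> i (3/4)" using u_side(3)[of "1/4"] w_side(3)[of "1/4"] by simp
  moreover have *: "\<forall>s\<in>{0..1}. \<forall>t\<in>{0..1}. \<gamma> i s = \<gamma> i t \<longrightarrow> s = t \<or> s = 0 \<and> t = 1 \<or> s = 1 \<and> t = 0"
    using arc_facts(1)[OF iI] by (simp add: simple_path_def loop_free_def)
  ultimately show False using bspec[OF bspec[OF *, of "1/4"], of "3/4"] by simp
qed

lemma chart_interior_disjoint_arcs:
  "r < npoly P \<Longrightarrow> chart P r ` interior (polygon_region d P r) \<subseteq> S - bdry \<A> - (\<Union>a\<in>I. path_image (\<gamma> a))"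
  unfolding dangD(10)[symmetric] by (rule UN_upper) simp

lemma next_u_neq_w: "next_side d u \<noteq> w"
proof
  assume n: "next_side d u = w"
  obtain r k where u: "u = (r, k)" by force
  have rk: "r < npoly P" "k < d" using sidesD[OF u_side(1)] u by auto
  have "chart P r ` interior (polygon_region d P r) \<subseteq> S - bdry \<A> - path_image (\<gamma> i)"
    using chart_interior_disjoint_arcs[OF rk(1)] iI by auto
  moreover have "chart P r (ear_point d P (r, k) s 0) = \<gamma> i s" if "s \<in> {0..1}" for s
    using u_side(3)[OF that] side_curve_ear(1)[of u d P s] u rk by simp
  moreover have "chart P r (ear_point d P (r, k) s (1 - s)) = \<gamma> i s" if "s \<in> {0..1}" for s
    using w_side(3)[of "1 - s"] side_curve_ear(2)[of u d P "1 - s"] u rk n that by simp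
  ultimately show False
    using arc_facts[OF iI] M_bdry
    by (intro adjacent_sides_not_glued[OF rs d3 dangD(4)[OF rk(1)] rk(2) dangD(5)[OF rk(1)] dangD(6)[OF rk(1)]
          dangD(7)[OF rk(1)], of "\<gamma> i"]) auto
qed

lemma next_w_neq_u: "next_side d w \<noteq> u"
proof
  assume n: "next_side d w = u"
  obtain r k where w: "w = (r, k)" by force
  have rk: "r < npoly P" "k < d" using sidesD[OF w_side(1)] w by auto
  let ?g = "reversepath (\<gamma> i)"
  have g: "?g s = \<gamma> i (1 - s)" for s by (simp add: reversepath_def)
  have "chart P r ` interior (polygon_region d P r) \<subseteq> S - bdry \<A> - path_image ?g"
    using chart_interior_disjoint_arcs[OF rk(1)] iI by auto
  moreover have "chart P r (ear_point d P (r, k) s 0) = ?g s" if "s \<in> {0..1}" for s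
    using w_side(3)[OF that] side_curve_ear(1)[of w d P s] w rk by (simp add: g)
  moreover have "chart P r (ear_point d P (r, k) s (1 - s)) = ?g s" if "s \<in> {0..1}" for s
    using u_side(3)[of "1 - s"] side_curve_ear(2)[of w d P "1 - s"] w rk n that by (simp add: g)
  moreover have "?g ` {0<..<1} \<subseteq> S - bdry \<A>"
  proof (rule image_subsetI)
    fix s :: real assume "s \<in> {0<..<1}"
    then have "1 - s \<in> {0<..<1}" by auto
    then show "?g s \<in> S - bdry \<A>" unfolding g using arc_facts(4)[OF iI] by blast
  qed
  moreover have "?g 1 \<in> bdry \<A>" using arc_facts(2)[OF iI] M_bdry by (auto simp: g)
  ultimately show False
    using simple_path_reversepath[OF arc_facts(1)[OF iI]]
    by (intro adjacent_sides_not_glued[OF rs d3 dangD(4)[OF rk(1)] rk(2) dangD(5)[OF rk(1)] dangD(6)[OF rk(1)]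
          dangD(7)[OF rk(1)], of ?g]) auto
qed

text \<open>The two orders of the sides of \<open>i\<close>, so that both ears can be treated at once.\<close>

definition opposite :: "side \<Rightarrow> side \<Rightarrow> bool" where
  "opposite x y \<longleftrightarrow> (x, y) = (u, w) \<or> (x, y) = (w, u)"

lemma opposite_sym: "opposite x y \<Longrightarrow> opposite y x"
  by (auto simp: opposite_def)

lemma opposite_side: "opposite x y \<Longrightarrow> x \<in> sides d P"
  and opposite_poly: "opposite x y \<Longrightarrow> fst x < npoly P"
  and opposite_index: "opposite x y \<Longrightarrow> snd x < d"
  and opposite_conv: "opposite x y \<Longrightarrow> convex_polygon d (vert P (fst x))"
  and opposite_neq: "opposite x y \<Longrightarrow> x \<noteq> y" "opposite x y \<Longrightarrow> next_side d x \<noteq> y"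
  and opposite_label: "opposite x y \<Longrightarrow> label P x = Some i"
  using u_side w_side sidesD[OF u_side(1)] sidesD[OF w_side(1)] dangD(4) u_neq_w next_u_neq_w next_w_neq_u unfolding opposite_def by auto

lemma ear_coords:
  assumes "opposite x y"
  shows "ear_s d P x (ear_point d P x s t) = s" "ear_t d P x (ear_point d P x s t) = t"
    "ear_point d P x (ear_s d P x z) (ear_t d P x z) = z"
    "z \<in> polygon_region d P (fst x) \<Longrightarrow> 0 \<le> ear_t d P x z"
    "z \<in> polygon_region d P (fst x) \<Longrightarrow> ear_s d P x z + ear_t d P x z \<le> 1"
    "z \<in> interior (polygon_region d P (fst x)) \<Longrightarrow> 0 < ear_t d P x z"
    "z \<in> interior (polygon_region d P (fst x)) \<Longrightarrow> ear_s d P x z + ear_t d P x z < 1"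
    "\<lbrakk>0 \<le> s; 0 \<le> t; s + t \<le> 1\<rbrakk> \<Longrightarrow> ear_point d P x s t \<in> polygon_region d P (fst x)"
    "\<lbrakk>0 < s; 0 < t; s + t < 1\<rbrakk> \<Longrightarrow> ear_point d P x s t \<in> interior (polygon_region d P (fst x))"
    "0 < ear_det d P x"
    "\<And>A f. continuous_on A f \<Longrightarrow> continuous_on A (\<lambda>z. ear_s d P x (f z))"
    "\<And>A f. continuous_on A f \<Longrightarrow> continuous_on A (\<lambda>z. ear_t d P x (f z))"
    "negligible {z. ear_s d P x z = c}" "negligible {z. ear_s d P x z = ear_t d P x z}"
proof -
  note K = d3 opposite_conv[OF assms] opposite_index[OF assms]
  show "ear_s d P x (ear_point d P x s t) = s" by (rule ear_s_point[OF K, unfolded prod.collapse])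
  show "ear_t d P x (ear_point d P x s t) = t" by (rule ear_t_point[OF K, unfolded prod.collapse])
  show "ear_point d P x (ear_s d P x z) (ear_t d P x z) = z"
    by (rule ear_point_coords[OF K, unfolded prod.collapse])
  show "0 \<le> ear_t d P x z" "ear_s d P x z + ear_t d P x z \<le> 1" if "z \<in> polygon_region d P (fst x)"
    by (rule region_ear_bounds[OF K that, unfolded prod.collapse])+
  show "0 < ear_t d P x z" "ear_s d P x z + ear_t d P x z < 1" if "z \<in> interior (polygon_region d P (fst x))"
    by (rule interior_region_ear_bounds[OF K that, unfolded prod.collapse])+
  show "ear_point d P x s t \<in> polygon_region d P (fst x)" if "0 \<le> s" "0 \<le> t" "s + t \<le> 1"
    by (rule ear_point_in_region[OF K that, unfolded prod.collapse])
  show "ear_point d P x s t \<in> interior (polygon_region d P (fst x))" if "0 < s" "0 < t" "s + t < 1"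
    by (rule ear_point_in_interior[OF K that, unfolded prod.collapse])
  show "0 < ear_det d P x" by (rule ear_det_pos[OF K, unfolded prod.collapse])
  show "continuous_on A (\<lambda>z. ear_s d P x (f z))" "continuous_on A (\<lambda>z. ear_t d P x (f z))"
    if "continuous_on A f" for A :: "'z::topological_space set" and f
    using continuous_ear[OF K that, unfolded prod.collapse] .
  show "negligible {z. ear_s d P x z = c}" "negligible {z. ear_s d P x z = ear_t d P x z}"
    by (rule negligible_ear_lines[OF K, unfolded prod.collapse])+
qed

lemma opposite_ears_disjoint:
  assumes o: "opposite x y" "fst x = fst y" and z: "z \<in> polygon_region d P (fst x)" and s: "0 \<le> ear_s d P x z"
  shows "ear_s d P y z \<le> 0"
proof -
  obtain r k l where xy: "x = (r, l)" "y = (r, k)" using o(2) by (metis prod.collapse)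
  have kl: "k < d" "l < d" using opposite_index o opposite_sym xy by fastforce+
  have "l \<noteq> k" "l \<noteq> Suc k mod d" "k \<noteq> Suc l mod d"
    using opposite_neq[OF o(1)] opposite_neq[OF opposite_sym[OF o(1)]] xy by (auto simp: next_side_def)
  then show ?thesis
    using ears_disjoint[OF d3 _ kl] opposite_conv[OF o(1)] z s xy by simp
qed

lemma flip_chart_ear:
  assumes o: "opposite x y" and z: "z \<in> polygon_region d P (fst x)" and s: "0 < ear_s d P x z"
  shows "flip_chart d P u w (fst x) z = flip_ear d P x y z"
proof -
  have "\<not> (fst y = fst x \<and> 0 < ear_s d P y z)"
    using opposite_ears_disjoint[OF o _ z] s by force
  then show ?thesis using o s unfolding flip_chart_def opposite_def by auto
qed

lemma flip_chart_no_ear: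
  assumes "\<And>x y. opposite x y \<Longrightarrow> fst x = r \<Longrightarrow> ear_s d P x z \<le> 0"
  shows "flip_chart d P u w r z = chart P r z"
  using assms[of u w] assms[of w u] unfolding flip_chart_def opposite_def by auto

text \<open>The chart of the flip agrees with the formula of an ear on the closed ear.\<close>

lemma flip_chart_closed_ear:
  assumes o: "opposite x y" and z: "z \<in> polygon_region d P (fst x)" and s: "0 \<le> ear_s d P x z"
  shows "flip_chart d P u w (fst x) z = flip_ear d P x y z"
proof (cases "ear_s d P x z = 0")
  case True
  have "ear_s d P x' z \<le> 0" if "opposite x' y'" "fst x' = fst x" for x' y'
    using that o opposite_ears_disjoint[OF o _ z s] True unfolding opposite_def by auto
  then have "flip_chart d P u w (fst x) z = chart P (fst x) z" by (rule flip_chart_no_ear)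
  moreover have "ear_point d P x 0 (ear_t d P x z) = z" using ear_coords(3)[OF o, of z] True by simp
  ultimately show ?thesis using True ear_coords(4)[OF o z] by (simp add: flip_ear_def)
qed (use flip_chart_ear[OF o z] s in auto)

lemma glue:
  assumes "opposite x y" "0 \<le> s" "s \<le> 1"
  shows "chart P (fst x) (ear_point d P x s 0) = chart P (fst y) (ear_point d P y (1 - s) 0)"
  using assms u_side(3)[of s] w_side(3)[of s] u_side(3)[of "1 - s"] w_side(3)[of "1 - s"]
    side_curve_ear(1)[of u d P] side_curve_ear(1)[of w d P] sidesD u_side(1) w_side(1)
  unfolding opposite_def by auto

lemma continuous_on_ear_point [continuous_intros]:
  "\<lbrakk>continuous_on A f; continuous_on A g\<rbrakk> \<Longrightarrow> continuous_on A (\<lambda>z. ear_point d P x (f z) (g z))"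
  unfolding ear_point_def by (intro continuous_intros)

lemma continuous_flip_chart:
  assumes r: "r < npoly P"
  shows "continuous_on (polygon_region d P r) (flip_chart d P u w r)"
proof -
  let ?R = "polygon_region d P r"
  have cR: "closed ?R" unfolding polygon_region_def
    by (intro compact_imp_closed compact_convex_hull finite_imp_compact) auto
  define N where "N = {z \<in> ?R. (fst u = r \<longrightarrow> ear_s d P u z \<le> 0) \<and> (fst w = r \<longrightarrow> ear_s d P w z \<le> 0)}"
  define E where "E x = {z \<in> ?R. fst x = r \<and> 0 \<le> ear_s d P x z}" for x
  have cl_half: "closed {z \<in> ?R. Q z}" if "closed {z. Q z}" for Q
    using closed_Int[OF cR that] by (simp add: Int_def)
  have clE: "closed (E x)" if o: "opposite x y" for x y
    unfolding E_def by (intro cl_half closed_Collect_conj closed_Collect_const closed_Collect_le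
        continuous_intros ear_coords(11)[OF o])
  have ouw: "opposite u w" "opposite w u" by (simp_all add: opposite_def)
  have clN: "closed N"
    unfolding N_def by (intro cl_half closed_Collect_conj closed_Collect_imp open_Collect_const
        closed_Collect_le continuous_intros ear_coords(11)[OF ouw(1)] ear_coords(11)[OF ouw(2)])
  have cN: "continuous_on N (flip_chart d P u w r)"
  proof (rule continuous_on_eq)
    show "continuous_on N (chart P r)" using dangD(5)[OF r] by (rule continuous_on_subset) (auto simp: N_def)
    show "\<And>z. z \<in> N \<Longrightarrow> chart P r z = flip_chart d P u w r z"
      by (rule flip_chart_no_ear[symmetric]) (auto simp: N_def opposite_def)
  qed
  have cE: "continuous_on (E x) (flip_chart d P u w r)" if o: "opposite x y" for x y
  proof (cases "fst x = r")
    case False then show ?thesis by (simp add: E_def)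
  next
    case True
    note o' = opposite_sym[OF o]
    note [continuous_intros] = ear_coords(11,12)[OF o]
    define B where "B = {z \<in> E x. ear_s d P x z \<le> ear_t d P x z}"
    define C where "C = {z \<in> E x. ear_t d P x z \<le> ear_s d P x z}"
    have "closed B" "closed C" unfolding B_def C_def
      using closed_Int[OF clE[OF o] closed_Collect_le, of "ear_s d P x" "ear_t d P x"]
        closed_Int[OF clE[OF o] closed_Collect_le, of "ear_t d P x" "ear_s d P x"]
      by (simp_all add: Int_def continuous_intros)
    moreover have "continuous_on B (flip_chart d P u w r)"
    proof (rule continuous_on_eq)
      show "continuous_on B (\<lambda>z. chart P (fst x) (ear_point d P x (ear_s d P x z) (ear_t d P x z - ear_s d P x z)))"
      proof (rule continuous_on_compose2[OF dangD(5)[OF opposite_poly[OF o]]])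
        show "continuous_on B (\<lambda>z. ear_point d P x (ear_s d P x z) (ear_t d P x z - ear_s d P x z))"
          by (intro continuous_intros)
        show "(\<lambda>z. ear_point d P x (ear_s d P x z) (ear_t d P x z - ear_s d P x z)) ` B \<subseteq> polygon_region d P (fst x)"
          using ear_coords(5)[OF o] True by (intro image_subsetI ear_coords(8)[OF o]) (force simp: B_def E_def)+
      qed
      show "chart P (fst x) (ear_point d P x (ear_s d P x z) (ear_t d P x z - ear_s d P x z)) = flip_chart d P u w r z"
        if "z \<in> B" for z
        using flip_chart_closed_ear[OF o, of z] that True by (simp add: B_def E_def flip_ear_def)
    qed
    moreover have "continuous_on C (flip_chart d P u w r)"
    proof (rule continuous_on_eq)
      show "continuous_on C (\<lambda>z. chart P (fst y) (ear_point d P y (1 - ear_s d P x z) (ear_s d P x z - ear_t d P x z)))"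
      proof (rule continuous_on_compose2[OF dangD(5)[OF opposite_poly[OF o']]])
        show "continuous_on C (\<lambda>z. ear_point d P y (1 - ear_s d P x z) (ear_s d P x z - ear_t d P x z))"
          by (intro continuous_intros)
        show "(\<lambda>z. ear_point d P y (1 - ear_s d P x z) (ear_s d P x z - ear_t d P x z)) ` C \<subseteq> polygon_region d P (fst y)"
        proof (rule image_subsetI)
          fix z assume "z \<in> C"
          then show "ear_point d P y (1 - ear_s d P x z) (ear_s d P x z - ear_t d P x z) \<in> polygon_region d P (fst y)"
            using ear_coords(4,5)[OF o, of z] True by (intro ear_coords(8)[OF o']) (auto simp: C_def E_def)
        qed
      qed
      show "chart P (fst y) (ear_point d P y (1 - ear_s d P x z) (ear_s d P x z - ear_t d P x z)) = flip_chart d P u w r z"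
        if "z \<in> C" for z
      proof -
        have z: "z \<in> polygon_region d P (fst x)" "0 \<le> ear_s d P x z" "ear_t d P x z \<le> ear_s d P x z"
          using that True by (auto simp: C_def E_def)
        show ?thesis
        proof (cases "ear_s d P x z = ear_t d P x z")
          case eq: True
          have "ear_s d P x z \<le> 1" using ear_coords(4,5)[OF o z(1)] by simp
          then show ?thesis
            using flip_chart_closed_ear[OF o z(1,2)] glue[OF o z(2)] True eq by (simp add: flip_ear_def)
        next
          case False
          then show ?thesis
            using flip_chart_closed_ear[OF o z(1,2)] z(3) True by (simp add: flip_ear_def)
        qed
      qed
    qed
    moreover have "E x = B \<union> C" by (auto simp: B_def C_def)
    ultimately show ?thesis using continuous_on_closed_Un by metis
  qed
  have "?R = N \<union> (E u \<union> E w)"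
    unfolding N_def E_def by auto
  moreover have "continuous_on (N \<union> (E u \<union> E w)) (flip_chart d P u w r)"
    by (intro continuous_on_closed_Un closed_Un clN clE[OF ouw(1)] clE[OF ouw(2)] cN cE[OF ouw(1)] cE[OF ouw(2)])
  ultimately show ?thesis by simp
qed

lemma flip_chart_in_S:
  assumes r: "r < npoly P"
  shows "flip_chart d P u w r ` polygon_region d P r \<subseteq> S"
proof (rule image_subsetI)
  fix z assume z: "z \<in> polygon_region d P r"
  show "flip_chart d P u w r z \<in> S"
  proof (cases "\<exists>x y. opposite x y \<and> fst x = r \<and> 0 < ear_s d P x z")
    case False
    then have "flip_chart d P u w r z = chart P r z" by (intro flip_chart_no_ear) force
    then show ?thesis using dangD(6)[OF r] z by auto
  next
    case True
    then obtain x y where o: "opposite x y" and x: "fst x = r" "0 < ear_s d P x z" by blast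
    note o' = opposite_sym[OF o]
    have b: "0 \<le> ear_t d P x z" "ear_s d P x z + ear_t d P x z \<le> 1" using ear_coords(4,5)[OF o] z x by auto
    show ?thesis
    proof (cases "ear_s d P x z \<le> ear_t d P x z")
      case True
      then have "ear_point d P x (ear_s d P x z) (ear_t d P x z - ear_s d P x z) \<in> polygon_region d P (fst x)"
        using b x by (intro ear_coords(8)[OF o]) auto
      then show ?thesis using flip_chart_ear[OF o] z x True dangD(6)[OF opposite_poly[OF o]]
        by (auto simp: flip_ear_def)
    next
      case False
      then have "ear_point d P y (1 - ear_s d P x z) (ear_s d P x z - ear_t d P x z) \<in> polygon_region d P (fst y)"
        using b x by (intro ear_coords(8)[OF o']) auto
      then show ?thesis using flip_chart_ear[OF o] z x False dangD(6)[OF opposite_poly[OF o']]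
        by (auto simp: flip_ear_def)
    qed
  qed
qed

end

section \<open>Bijectivity and orientation of the new charts\<close>

context flippable
begin

text \<open>
  Points of the surface away from the boundary and from the arcs other than \<open>i\<close> are
  represented by points in the interior of a polygon and by parameters of the arc
  \<open>i\<close>. In these terms the new charts become a rearrangement of points, whose
  bijectivity can be checked in coordinates.
\<close>

definition cells :: "(nat \<times> complex) set" where
  "cells = {(r, z). r < npoly P \<and> z \<in> interior (polygon_region d P r)}"

fun cell_point :: "(nat \<times> complex) + real \<Rightarrow> 'a" where
  "cell_point (Inl p) = chart P (fst p) (snd p)"
| "cell_point (Inr t) = \<gamma> i t"

definition open_cells :: "((nat \<times> complex) + real) set" where
  "open_cells = Inl ` cells \<union> Inr ` {0<..<1}"

definition in_ear :: "side \<Rightarrow> nat \<times> complex \<Rightarrow> bool" where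
  "in_ear x p \<longleftrightarrow> fst x = fst p \<and> 0 < ear_s d P x (snd p)"

definition ear_target :: "side \<Rightarrow> side \<Rightarrow> complex \<Rightarrow> (nat \<times> complex) + real" where
  "ear_target x y z = (let s = ear_s d P x z; t = ear_t d P x z in
     if s < t then Inl (fst x, ear_point d P x s (t - s))
     else if s = t then Inr (if x = u then s else 1 - s)
     else Inl (fst y, ear_point d P y (1 - s) (s - t)))"

definition flip_target :: "nat \<times> complex \<Rightarrow> (nat \<times> complex) + real" where
  "flip_target p = (if in_ear u p then ear_target u w (snd p)
     else if in_ear w p then ear_target w u (snd p) else Inl p)"

definition ear_source :: "side \<Rightarrow> side \<Rightarrow> complex \<Rightarrow> nat \<times> complex" where
  "ear_source x y z = (let s = ear_s d P x z; t = ear_t d P x z in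
     if 2 * s + t < 1 then (fst x, ear_point d P x s (s + t))
     else (fst y, ear_point d P y (1 - s) (1 - s - t)))"

fun flip_source :: "(nat \<times> complex) + real \<Rightarrow> nat \<times> complex" where
  "flip_source (Inl p) = (if in_ear u p then ear_source u w (snd p)
     else if in_ear w p then ear_source w u (snd p) else p)"
| "flip_source (Inr t) = (if t < 1/2 then (fst u, ear_point d P u t t)
     else (fst w, ear_point d P w (1 - t) (1 - t)))"

definition new_arc_cells :: "((nat \<times> complex) + real) set" where
  "new_arc_cells = insert (Inr (1/2)) (Inl ` {p \<in> cells. \<exists>x y. opposite x y \<and> in_ear x p \<and>
     2 * ear_s d P x (snd p) + ear_t d P x (snd p) = 1})"

lemma ear_unique:
  assumes "opposite x y" "in_ear x p" "p \<in> cells"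
  shows "\<not> in_ear y p"
proof
  assume "in_ear y p"
  then have "fst x = fst y" "0 < ear_s d P y (snd p)" using assms(2) by (auto simp: in_ear_def)
  moreover have "snd p \<in> interior (polygon_region d P (fst x))" "0 \<le> ear_s d P x (snd p)"
    using assms by (auto simp: in_ear_def cells_def)
  then have "snd p \<in> polygon_region d P (fst x)" "0 \<le> ear_s d P x (snd p)"
    using interior_subset by blast+
  ultimately show False using opposite_ears_disjoint[OF assms(1)] by force
qed

lemma ear_cases:
  assumes "p \<in> cells"
  obtains (none) "\<And>x y. opposite x y \<Longrightarrow> \<not> in_ear x p"
  | (ear) x y z where "opposite x y" "p = (fst x, z)" "in_ear x p" "z \<in> interior (polygon_region d P (fst x))"
      "0 < ear_s d P x z" "0 < ear_t d P x z" "ear_s d P x z + ear_t d P x z < 1"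
proof (cases "\<exists>x y. opposite x y \<and> in_ear x p")
  case True
  then obtain x y where o: "opposite x y" "in_ear x p" by blast
  then have p: "p = (fst x, snd p)" by (metis in_ear_def prod.collapse)
  then have z: "snd p \<in> interior (polygon_region d P (fst x))"
    using assms by (metis (mono_tags, lifting) case_prodD cells_def mem_Collect_eq)
  show ?thesis using ear(1)[OF o(1) p o(2) z] o(2) ear_coords(6,7)[OF o(1) z] by (simp add: in_ear_def)
qed (use none in blast)

lemma in_ear_point: "opposite x y \<Longrightarrow> in_ear x (fst x, ear_point d P x s t) \<longleftrightarrow> 0 < s"
  using ear_coords(1) by (simp add: in_ear_def)

lemma ear_point_cell:
  "\<lbrakk>opposite x y; 0 < s; 0 < t; s + t < 1\<rbrakk> \<Longrightarrow> (fst x, ear_point d P x s t) \<in> cells"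
  using ear_coords(9) opposite_poly by (simp add: cells_def)

lemma flip_target_ear: "\<lbrakk>opposite x y; in_ear x p; p \<in> cells\<rbrakk> \<Longrightarrow> flip_target p = ear_target x y (snd p)"
  and flip_source_ear: "\<lbrakk>opposite x y; in_ear x p; p \<in> cells\<rbrakk> \<Longrightarrow> flip_source (Inl p) = ear_source x y (snd p)"
  using ear_unique[of x y p] unfolding flip_target_def opposite_def by auto

lemma flip_target_point:
  assumes o: "opposite x y" and st: "0 < s" "0 < t" "s + t < 1"
  shows "flip_target (fst x, ear_point d P x s t) =
     (if s < t then Inl (fst x, ear_point d P x s (t - s))
      else if s = t then Inr (if x = u then s else 1 - s)
      else Inl (fst y, ear_point d P y (1 - s) (s - t)))"
  using flip_target_ear[OF o _ ear_point_cell[OF o st]] in_ear_point[OF o] st ear_coords(1,2)[OF o]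
  by (simp add: ear_target_def)

lemma flip_source_point:
  assumes o: "opposite x y" and st: "0 < s" "0 < t" "s + t < 1"
  shows "flip_source (Inl (fst x, ear_point d P x s t)) =
     (if 2 * s + t < 1 then (fst x, ear_point d P x s (s + t))
      else (fst y, ear_point d P y (1 - s) (1 - s - t)))"
  using flip_source_ear[OF o _ ear_point_cell[OF o st]] in_ear_point[OF o] st ear_coords(1,2)[OF o]
  by (simp add: ear_source_def)

lemma flip_no_ear:
  assumes "\<And>x y. opposite x y \<Longrightarrow> \<not> in_ear x p"
  shows "flip_target p = Inl p" "flip_source (Inl p) = p" "Inl p \<notin> new_arc_cells"
  using assms[of u w] assms[of w u] assms
  by (auto simp: flip_target_def new_arc_cells_def opposite_def)

lemma new_arc_cells_point:
  assumes o: "opposite x y" and st: "0 < s" "0 < t" "s + t < 1"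
  shows "Inl (fst x, ear_point d P x s t) \<in> new_arc_cells \<longleftrightarrow> 2 * s + t = 1"
proof -
  let ?p = "(fst x, ear_point d P x s t)"
  have p: "?p \<in> cells" "in_ear x ?p" using ear_point_cell[OF o st] in_ear_point[OF o] st by auto
  have un: "x' = x" if "opposite x' y'" "in_ear x' ?p" for x' y'
    using ear_unique[OF o p(2,1)] that o unfolding opposite_def by auto
  show ?thesis
  proof
    assume "Inl ?p \<in> new_arc_cells"
    then obtain x' y' where x': "opposite x' y'" "in_ear x' ?p"
        "2 * ear_s d P x' (snd ?p) + ear_t d P x' (snd ?p) = 1"
      by (auto simp: new_arc_cells_def)
    have "x' = x" by (rule un[OF x'(1,2)])
    then show "2 * s + t = 1" using x'(3) ear_coords(1,2)[OF o] by simp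
  next
    assume "2 * s + t = 1"
    then show "Inl ?p \<in> new_arc_cells" using p o ear_coords(1,2)[OF o]
      unfolding new_arc_cells_def by (intro insertI2 imageI CollectI conjI exI) auto
  qed
qed

lemma half_points_opposite: "opposite u w" "opposite w u" "u \<noteq> w" "w \<noteq> u"
  using u_neq_w by (auto simp: opposite_def)

text \<open>
  An explicit inverse treats the two ears separately: a point of an ear comes back to the ear from
  whose half it was sent, and the points that are missed are those of the new arc.
\<close>

lemma bij_flip_target: "bij_betw flip_target cells (open_cells - new_arc_cells)"
proof (rule bij_betw_byWitness[where f' = flip_source])
  have A: "flip_source (flip_target p) = p \<and> flip_target p \<in> open_cells - new_arc_cells" if p: "p \<in> cells" for p
    using p
  proof (cases rule: ear_cases)
    case none
    then show ?thesis using flip_no_ear[of p] p by (auto simp: open_cells_def)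
  next
    case (ear x y z)
    note o = \<open>opposite x y\<close>
    note o' = opposite_sym[OF o]
    define s t where "s = ear_s d P x z" and "t = ear_t d P x z"
    have st: "0 < s" "0 < t" "s + t < 1" using ear by (auto simp: s_def t_def)
    have pp: "p = (fst x, ear_point d P x s t)" using ear ear_coords(3)[OF o] by (simp add: s_def t_def)
    consider "s < t" | "s = t" | "t < s" by linarith
    then show ?thesis
    proof cases
      case 1
      then have "flip_target p = Inl (fst x, ear_point d P x s (t - s))"
        using flip_target_point[OF o st] pp by simp
      moreover have b: "0 < s" "0 < t - s" "s + (t - s) < 1" using 1 st by auto
      ultimately show ?thesis
        using flip_source_point[OF o b] new_arc_cells_point[OF o b] ear_point_cell[OF o b] st pp
        by (auto simp: open_cells_def)
    next
      case 2
      then have "flip_target p = Inr (if x = u then s else 1 - s)"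
        using flip_target_point[OF o st] pp by simp
      then show ?thesis using 2 st pp o half_points_opposite
        by (auto simp: open_cells_def new_arc_cells_def opposite_def)
    next
      case 3
      then have "flip_target p = Inl (fst y, ear_point d P y (1 - s) (s - t))"
        using flip_target_point[OF o st] pp by simp
      moreover have b: "0 < 1 - s" "0 < s - t" "(1 - s) + (s - t) < 1" using 3 st by auto
      ultimately show ?thesis
        using flip_source_point[OF o' b] new_arc_cells_point[OF o' b] ear_point_cell[OF o' b] st pp
        by (auto simp: open_cells_def)
    qed
  qed
  have B: "flip_target (flip_source q) = q \<and> flip_source q \<in> cells" if q: "q \<in> open_cells - new_arc_cells" for q
  proof (cases q)
    case (Inr t)
    then have t: "0 < t" "t < 1" "t \<noteq> 1/2" using q by (auto simp: open_cells_def new_arc_cells_def)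
    show ?thesis
    proof (cases "t < 1/2")
      case True
      then show ?thesis
        using flip_target_point[OF half_points_opposite(1), of t t] ear_point_cell[OF half_points_opposite(1), of t t] t Inr
        by simp
    next
      case False
      then show ?thesis
        using flip_target_point[OF half_points_opposite(2), of "1 - t" "1 - t"]
          ear_point_cell[OF half_points_opposite(2), of "1 - t" "1 - t"] t Inr half_points_opposite(3)
        by simp
    qed
  next
    case (Inl p)
    then have p: "p \<in> cells" using q by (auto simp: open_cells_def)
    then show ?thesis
    proof (cases rule: ear_cases)
      case none
      then show ?thesis using flip_no_ear[of p] p Inl by auto
    next
      case (ear x y z)
      note o = \<open>opposite x y\<close>
      note o' = opposite_sym[OF o]
      define s t where "s = ear_s d P x z" and "t = ear_t d P x z"
      have st: "0 < s" "0 < t" "s + t < 1" using ear by (auto simp: s_def t_def)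
      have pp: "p = (fst x, ear_point d P x s t)" using ear ear_coords(3)[OF o] by (simp add: s_def t_def)
      have "2 * s + t \<noteq> 1" using new_arc_cells_point[OF o st] q Inl pp by simp
      then consider "2 * s + t < 1" | "2 * s + t > 1" by linarith
      then show ?thesis
      proof cases
        case 1
        then have "flip_source q = (fst x, ear_point d P x s (s + t))"
          using flip_source_point[OF o st] pp Inl by simp
        moreover have b: "0 < s" "0 < s + t" "s + (s + t) < 1" using 1 st by auto
        ultimately show ?thesis
          using flip_target_point[OF o b] ear_point_cell[OF o b] st pp Inl by simp
      next
        case 2
        then have "flip_source q = (fst y, ear_point d P y (1 - s) (1 - s - t))"
          using flip_source_point[OF o st] pp Inl by simp
        moreover have b: "0 < 1 - s" "0 < 1 - s - t" "(1 - s) + (1 - s - t) < 1" using 2 st by auto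
        ultimately show ?thesis
          using flip_target_point[OF o' b] ear_point_cell[OF o' b] st pp Inl by simp
      qed
    qed
  qed
  show "\<forall>p\<in>cells. flip_source (flip_target p) = p" "flip_target ` cells \<subseteq> open_cells - new_arc_cells"
    using A by auto
  show "\<forall>q\<in>open_cells - new_arc_cells. flip_target (flip_source q) = q"
    "flip_source ` (open_cells - new_arc_cells) \<subseteq> cells"
    using B by auto
qed

lemma ear_base:
  assumes "opposite x y" "0 \<le> s" "s \<le> 1"
  shows "chart P (fst x) (ear_point d P x s 0) = \<gamma> i (if x = u then s else 1 - s)"
  using assms u_side(3)[of s] w_side(3)[of s] side_curve_ear(1)[of u d P] side_curve_ear(1)[of w d P]
    sidesD[OF u_side(1)] sidesD[OF w_side(1)] u_neq_w
  unfolding opposite_def by auto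

lemma flip_chart_cell_point:
  assumes p: "p \<in> cells"
  shows "flip_chart d P u w (fst p) (snd p) = cell_point (flip_target p)"
  using p
proof (cases rule: ear_cases)
  case none
  then have "flip_chart d P u w (fst p) (snd p) = chart P (fst p) (snd p)"
    by (intro flip_chart_no_ear) (force simp: in_ear_def)
  then show ?thesis using flip_no_ear(1)[OF none] by simp
next
  case (ear x y z)
  note o = \<open>opposite x y\<close>
  have "z \<in> polygon_region d P (fst x)" using ear(4) interior_subset by blast
  then have "flip_chart d P u w (fst p) (snd p) = flip_ear d P x y z"
    using flip_chart_ear[OF o] ear by simp
  also have "\<dots> = cell_point (ear_target x y z)"
  proof -
    have "chart P (fst x) (ear_point d P x (ear_s d P x z) 0) =
        \<gamma> i (if x = u then ear_s d P x z else 1 - ear_s d P x z)"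
      using ear by (intro ear_base[OF o]) auto
    then show ?thesis by (auto simp: flip_ear_def ear_target_def Let_def)
  qed
  also have "\<dots> = cell_point (flip_target p)" using flip_target_ear[OF o ear(3) p] ear(2) by simp
  finally show ?thesis .
qed

lemma arc_interior_inj: "inj_on (\<gamma> a) {0<..<1}" if "a \<in> I"
proof (rule inj_onI)
  fix s t :: real assume st: "s \<in> {0<..<1}" "t \<in> {0<..<1}" "\<gamma> a s = \<gamma> a t"
  have *: "\<forall>s\<in>{0..1}. \<forall>t\<in>{0..1}. \<gamma> a s = \<gamma> a t \<longrightarrow> s = t \<or> s = 0 \<and> t = 1 \<or> s = 1 \<and> t = 0"
    using arc_facts(1)[OF that] by (simp add: simple_path_def loop_free_def)
  show "s = t" using bspec[OF bspec[OF *, of s], of t] st by auto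
qed

lemma chart_not_on_arc:
  assumes "p \<in> cells" "a \<in> I"
  shows "chart P (fst p) (snd p) \<notin> path_image (\<gamma> a)" "chart P (fst p) (snd p) \<in> S - bdry \<A>"
proof -
  have "chart P (fst p) (snd p) \<in> chart P (fst p) ` interior (polygon_region d P (fst p))" "fst p < npoly P"
    using assms(1) by (auto simp: cells_def)
  then have "chart P (fst p) (snd p) \<in> S - bdry \<A> - (\<Union>a\<in>I. path_image (\<gamma> a))"
    using chart_interior_disjoint_arcs by blast
  then show "chart P (fst p) (snd p) \<notin> path_image (\<gamma> a)" "chart P (fst p) (snd p) \<in> S - bdry \<A>"
    using assms(2) by auto
qed

lemma inj_cell_point: "inj_on cell_point open_cells"
proof (rule inj_onI)
  have pi: "\<gamma> i t \<in> path_image (\<gamma> i)" if "0 < t" "t < 1" for t using that by (auto simp: path_image_def)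
  fix q q' assume q: "q \<in> open_cells" "q' \<in> open_cells" "cell_point q = cell_point q'"
  show "q = q'"
  proof (cases q; cases q')
    fix p p' assume qp: "q = Inl p" "q' = Inl p'"
    then have p: "p \<in> cells" "p' \<in> cells" "chart P (fst p) (snd p) = chart P (fst p') (snd p')"
      using q by (auto simp: open_cells_def)
    have "fst p = fst p'"
    proof (rule ccontr)
      assume "fst p \<noteq> fst p'"
      then have "chart P (fst p) ` interior (polygon_region d P (fst p)) \<inter>
          chart P (fst p') ` interior (polygon_region d P (fst p')) = {}"
        using p by (intro dangD(9)[of "fst p" "fst p'"]) (auto simp: cells_def)
      moreover have "chart P (fst p) (snd p) \<in> chart P (fst p) ` interior (polygon_region d P (fst p))"
        using p(1) by (auto simp: cells_def)
      moreover have "chart P (fst p) (snd p) \<in> chart P (fst p') ` interior (polygon_region d P (fst p'))"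
        unfolding p(3) using p(2) by (auto simp: cells_def)
      ultimately show False by blast
    qed
    moreover have "fst p < npoly P" "snd p \<in> interior (polygon_region d P (fst p))"
        "snd p' \<in> interior (polygon_region d P (fst p'))"
      using p by (auto simp: cells_def)
    ultimately have "snd p = snd p'" using inj_onD[OF dangD(7)[of "fst p"], of "snd p" "snd p'"] p(3) by simp
    then show ?thesis using \<open>fst p = fst p'\<close> qp by (simp add: prod_eq_iff)
  next
    fix p t assume "q = Inl p" "q' = Inr t"
    then show ?thesis using q chart_not_on_arc(1)[of p i] iI pi[of t] by (auto simp: open_cells_def)
  next
    fix p t assume "q = Inr t" "q' = Inl p"
    then show ?thesis using q chart_not_on_arc(1)[of p i] iI pi[of t] by (fastforce simp: open_cells_def)
  next
    fix s t assume "q = Inr s" "q' = Inr t"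
    then show ?thesis using q inj_onD[OF arc_interior_inj[OF iI], of s t] by (auto simp: open_cells_def)
  qed
qed

lemma inj_flip_cells: "inj_on (\<lambda>p. flip_chart d P u w (fst p) (snd p)) cells"
proof -
  have "inj_on (cell_point \<circ> flip_target) cells"
    using bij_flip_target inj_cell_point
    by (intro comp_inj_on) (auto simp: bij_betw_def intro: inj_on_subset)
  then show ?thesis using flip_chart_cell_point by (subst inj_on_cong[of _ _ "cell_point \<circ> flip_target"]) auto
qed

lemma flip_chart_inj:
  assumes "r < npoly P"
  shows "inj_on (flip_chart d P u w r) (interior (polygon_region d P r))"
  using inj_onD[OF inj_flip_cells, of "(r, _)" "(r, _)"] assms
  by (intro inj_onI) (auto simp: cells_def)

lemma flip_chart_disjoint:
  assumes "r < npoly P" "r' < npoly P" "r \<noteq> r'"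
  shows "flip_chart d P u w r ` interior (polygon_region d P r) \<inter>
         flip_chart d P u w r' ` interior (polygon_region d P r') = {}"
  using inj_onD[OF inj_flip_cells, of "(r, _)" "(r', _)"] assms
  by (auto simp: cells_def)

lemma cells_image: "(\<Union>r<npoly P. f r ` interior (polygon_region d P r)) = (\<lambda>p. f (fst p) (snd p)) ` cells"
  by (force simp: cells_def)

lemma new_arc_subset: "new_arc_cells \<subseteq> open_cells"
  by (auto simp: new_arc_cells_def open_cells_def)

lemma flip_chart_union:
  "(\<Union>r<npoly P. flip_chart d P u w r ` interior (polygon_region d P r)) =
     cell_point ` open_cells - cell_point ` new_arc_cells"
proof -
  have "(\<Union>r<npoly P. flip_chart d P u w r ` interior (polygon_region d P r)) = (cell_point \<circ> flip_target) ` cells"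
    unfolding cells_image using flip_chart_cell_point by (intro image_cong) auto
  also have "\<dots> = cell_point ` (open_cells - new_arc_cells)"
    unfolding image_comp[symmetric] using bij_flip_target by (simp only: bij_betw_def)
  also have "\<dots> = cell_point ` open_cells - cell_point ` new_arc_cells"
    using inj_cell_point new_arc_subset by (intro inj_on_image_set_diff) auto
  finally show ?thesis .
qed

lemma cell_point_image:
  "cell_point ` open_cells = S - bdry \<A> - (\<Union>a\<in>I - {i}. path_image (\<gamma> a))"
proof -
  have e: "cell_point ` open_cells = (S - bdry \<A> - (\<Union>a\<in>I. path_image (\<gamma> a))) \<union> \<gamma> i ` {0<..<1}"
    unfolding open_cells_def dangD(10)[symmetric] cells_image by (auto simp: image_Un image_image)
  have "\<gamma> i ` {0<..<1} \<inter> path_image (\<gamma> a) = {}" if "a \<in> I - {i}" for a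
    using dangD(3)[of i a] arc_facts(2,3,7)[of a] arc_facts(4)[OF iI] M_bdry that iI by auto
  moreover have "(\<Union>a\<in>I. path_image (\<gamma> a)) = path_image (\<gamma> i) \<union> (\<Union>a\<in>I - {i}. path_image (\<gamma> a))"
    using iI by auto
  moreover have "path_image (\<gamma> i) \<subseteq> bdry \<A> \<union> \<gamma> i ` {0<..<1}"
    using arc_facts(2,3,7)[OF iI] M_bdry by auto
  moreover have "\<gamma> i ` {0<..<1} \<subseteq> path_image (\<gamma> i)" using arc_facts(7)[OF iI] by auto
  ultimately show ?thesis unfolding e using arc_facts(4)[OF iI] by blast
qed

text \<open>An affine change of the ear coordinates with positive determinant, in complex notation.\<close>

lemma affine_frame_change:
  fixes e f e' f' :: complex
  assumes "0 < (\<i> * e) \<bullet> f" "0 < (\<i> * e') \<bullet> f'"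
  obtains a b where "norm b < norm a"
    "\<And>s t. a * (of_real s * e + of_real t * f) + b * cnj (of_real s * e + of_real t * f) =
       of_real s * e' + of_real t * f'"
proof -
  define D where "D = e * cnj f - f * cnj e"
  define a b where "a = (e' * cnj f - f' * cnj e) / D" and "b = (e * f' - f * e') / D"
  have D: "D = - 2 * \<i> * of_real ((\<i> * e) \<bullet> f)"
    by (simp add: D_def complex_eq_iff inner_complex_def algebra_simps)
  then have D0: "D \<noteq> 0" using assms(1) by simp
  have ae: "a * e + b * cnj e = e'"
  proof -
    have "(e' * cnj f - f' * cnj e) * e + (e * f' - f * e') * cnj e = e' * D"
      by (simp add: D_def algebra_simps)
    then show ?thesis using D0 by (simp add: a_def b_def field_simps)
  qed
  have af: "a * f + b * cnj f = f'"
  proof -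
    have "(e' * cnj f - f' * cnj e) * f + (e * f' - f * e') * cnj f = f' * D"
      by (simp add: D_def algebra_simps)
    then show ?thesis using D0 by (simp add: a_def b_def field_simps)
  qed
  have "(\<i> * e') \<bullet> f' = ((norm a)\<^sup>2 - (norm b)\<^sup>2) * ((\<i> * e) \<bullet> f)"
    unfolding ae[symmetric] af[symmetric] cmod_power2
    by (simp add: inner_complex_def algebra_simps power2_eq_square)
  then have "0 < (norm a)\<^sup>2 - (norm b)\<^sup>2" using assms by (simp add: zero_less_mult_iff)
  then have "norm b < norm a" using power2_less_imp_less by fastforce
  moreover have "a * (of_real s * e + of_real t * f) + b * cnj (of_real s * e + of_real t * f) =
       of_real s * (a * e + b * cnj e) + of_real t * (a * f + b * cnj f)" for s t
    by (simp add: algebra_simps)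
  ultimately show thesis using that unfolding ae af by blast
qed

text \<open>
  At such a point the new chart is an old chart after an affine map, which has positive
  determinant because all ears are oriented alike.
\<close>

lemma flip_chart_oriented_at:
  assumes p: "(r, z) \<in> cells"
    and gen: "\<And>x y. opposite x y \<Longrightarrow> fst x = r \<Longrightarrow> ear_s d P x z \<noteq> 0 \<and> ear_s d P x z \<noteq> ear_t d P x z"
  shows "orientation_preserving \<A> (flip_chart d P u w r) {z}"
proof -
  let ?int = "\<lambda>r. interior (polygon_region d P r)"
  have r: "r < npoly P" and z: "z \<in> ?int r" using p by (auto simp: cells_def)
  have chart: "open (?int r)" "continuous_on (?int r) (chart P r)" "inj_on (chart P r) (?int r)"
    "chart P r ` ?int r \<subseteq> S" "orientation_preserving \<A> (chart P r) (?int r)" if "r < npoly P" for r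
    using continuous_on_subset[OF dangD(5)[OF that] interior_subset] dangD(6-8)[OF that]
      interior_subset[of "polygon_region d P r"] by (auto intro: open_interior)
  show ?thesis
    using p
  proof (cases rule: ear_cases)
    case none
    define X where "X = {z' \<in> ?int r. (fst u = r \<longrightarrow> ear_s d P u z' < 0) \<and> (fst w = r \<longrightarrow> ear_s d P w z' < 0)}"
    have "X = ?int r \<inter> {z'. (fst u = r \<longrightarrow> ear_s d P u z' < 0) \<and> (fst w = r \<longrightarrow> ear_s d P w z' < 0)}"
      by (auto simp: X_def)
    moreover have "open {z'. (fst u = r \<longrightarrow> ear_s d P u z' < 0) \<and> (fst w = r \<longrightarrow> ear_s d P w z' < 0)}"
      by (intro open_Collect_conj open_Collect_imp closed_Collect_const open_Collect_less continuous_intros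
          ear_coords(11)[OF half_points_opposite(1)] ear_coords(11)[OF half_points_opposite(2)])
    ultimately have "open X" by (simp add: open_Int)
    moreover have "z \<in> X" using z none[OF half_points_opposite(1)] none[OF half_points_opposite(2)]
        gen[OF half_points_opposite(1)] gen[OF half_points_opposite(2)]
      by (auto simp: X_def in_ear_def)
    moreover have "flip_chart d P u w r z' = chart P r (z + 1 * (z' - z) + 0 * cnj (z' - z))" if "z' \<in> X" for z'
      using that by (simp, intro flip_chart_no_ear) (auto simp: X_def opposite_def)
    ultimately show ?thesis
      using z by (intro orientation_preserving_affine_point[OF rs chart[OF r], where a = 1 and b = 0 and X = X and ?w0.0 = z])
        simp_all
  next
    case (ear x y z0)
    note o = \<open>opposite x y\<close>
    note o' = opposite_sym[OF o]
    note [continuous_intros] = ear_coords(11,12)[OF o]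
    have xr: "fst x = r" "z0 = z" using ear(2) by auto
    define s t where "s = ear_s d P x z" and "t = ear_t d P x z"
    have st: "0 < s" "0 < t" "s + t < 1" using ear xr by (auto simp: s_def t_def)
    have ne: "s \<noteq> t" using gen[OF o xr(1)] by (simp add: s_def t_def)
    define e f where "e = edge1 d P x" and "f = edge2 d P x"
    have det: "0 < (\<i> * e) \<bullet> f" using ear_coords(10)[OF o] by (simp add: ear_det_def e_def f_def)
    have diff: "z' - z = of_real (ear_s d P x z' - s) * e + of_real (ear_t d P x z' - t) * f" for z'
    proof -
      have "z' = ear_point d P x (ear_s d P x z') (ear_t d P x z')" "z = ear_point d P x s t"
        using ear_coords(3)[OF o] by (simp_all add: s_def t_def)
      then have "z' - z = ear_point d P x (ear_s d P x z') (ear_t d P x z') - ear_point d P x s t" by metis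
      then show ?thesis by (simp add: ear_point_def e_def f_def algebra_simps)
    qed
    have oX: "open (?int r \<inter> {z'. 0 < ear_s d P x z' \<and> ear_s d P x z' < ear_t d P x z'})"
      "open (?int r \<inter> {z'. 0 < ear_s d P x z' \<and> ear_t d P x z' < ear_s d P x z'})"
      by (intro open_Int open_interior open_Collect_conj open_Collect_less continuous_intros)+
    show ?thesis
    proof (cases "s < t")
      case True
      define X where "X = ?int r \<inter> {z'. 0 < ear_s d P x z' \<and> ear_s d P x z' < ear_t d P x z'}"
      have det': "0 < (\<i> * (e - f)) \<bullet> f" using det by (simp add: inner_complex_def algebra_simps)
      obtain a b where ab: "norm b < norm a"
        "\<And>s t. a * (of_real s * e + of_real t * f) + b * cnj (of_real s * e + of_real t * f) =
          of_real s * (e - f) + of_real t * f"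
        by (rule affine_frame_change[OF det det'], rule that)
      show ?thesis
      proof (rule orientation_preserving_affine_point[OF rs chart[OF opposite_poly[OF o]] _ _ _ ab(1)])
        show "open X" using oX(1) by (simp add: X_def)
        show "z \<in> X" using z st True by (simp add: X_def s_def t_def)
        show "ear_point d P x s (t - s) \<in> ?int (fst x)" using st True by (intro ear_coords(9)[OF o]) auto
        fix z' assume z': "z' \<in> X"
        then have "z' \<in> polygon_region d P (fst x)" using xr interior_subset by (auto simp: X_def)
        then have "flip_chart d P u w r z' =
            chart P (fst x) (ear_point d P x (ear_s d P x z') (ear_t d P x z' - ear_s d P x z'))"
          using flip_chart_ear[OF o] z' xr by (simp add: X_def flip_ear_def)
        also have "ear_point d P x (ear_s d P x z') (ear_t d P x z' - ear_s d P x z') =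
            ear_point d P x s (t - s) + a * (z' - z) + b * cnj (z' - z)"
          unfolding diff add.assoc ab(2) by (simp add: ear_point_def e_def f_def algebra_simps)
        finally show "flip_chart d P u w r z' = chart P (fst x) (ear_point d P x s (t - s) + a * (z' - z) + b * cnj (z' - z))" .
      qed
    next
      case False
      define X where "X = ?int r \<inter> {z'. 0 < ear_s d P x z' \<and> ear_t d P x z' < ear_s d P x z'}"
      define e' f' where "e' = edge1 d P y" and "f' = edge2 d P y"
      have "0 < (\<i> * e') \<bullet> f'" using ear_coords(10)[OF o'] by (simp add: ear_det_def e'_def f'_def)
      then have det': "0 < (\<i> * (f' - e')) \<bullet> (- f')" by (simp add: inner_complex_def algebra_simps)
      obtain a b where ab: "norm b < norm a"
        "\<And>s t. a * (of_real s * e + of_real t * f) + b * cnj (of_real s * e + of_real t * f) =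
          of_real s * (f' - e') + of_real t * (- f')"
        by (rule affine_frame_change[OF det det'], rule that)
      show ?thesis
      proof (rule orientation_preserving_affine_point[OF rs chart[OF opposite_poly[OF o']] _ _ _ ab(1)])
        show "open X" using oX(2) by (simp add: X_def)
        show "z \<in> X" using z st False ne by (simp add: X_def s_def t_def)
        show "ear_point d P y (1 - s) (s - t) \<in> ?int (fst y)" using st False ne by (intro ear_coords(9)[OF o']) auto
        fix z' assume z': "z' \<in> X"
        then have "z' \<in> polygon_region d P (fst x)" using xr interior_subset by (auto simp: X_def)
        then have "flip_chart d P u w r z' =
            chart P (fst y) (ear_point d P y (1 - ear_s d P x z') (ear_s d P x z' - ear_t d P x z'))"
          using flip_chart_ear[OF o] z' xr by (simp add: X_def flip_ear_def)
        also have "ear_point d P y (1 - ear_s d P x z') (ear_s d P x z' - ear_t d P x z') =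
            ear_point d P y (1 - s) (s - t) + a * (z' - z) + b * cnj (z' - z)"
          unfolding diff add.assoc ab(2) by (simp add: ear_point_def e'_def f'_def algebra_simps)
        finally show "flip_chart d P u w r z' =
          chart P (fst y) (ear_point d P y (1 - s) (s - t) + a * (z' - z) + b * cnj (z' - z))" .
      qed
    qed
  qed
qed

lemma flip_chart_oriented:
  assumes r: "r < npoly P"
  shows "orientation_preserving \<A> (flip_chart d P u w r) (interior (polygon_region d P r))"
proof -
  let ?X = "interior (polygon_region d P r)"
  define B where "B x = {z. ear_s d P x z = 0} \<union> {z. ear_s d P x z = ear_t d P x z}" for x
  define G where "G = ?X - (B u \<union> B w)"
  show ?thesis
  proof (rule orientation_preserving_if_dense[OF rs open_interior])
    show "continuous_on ?X (flip_chart d P u w r)"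
      using continuous_flip_chart[OF r] interior_subset by (rule continuous_on_subset)
    show "inj_on (flip_chart d P u w r) ?X" by (rule flip_chart_inj[OF r])
    show "flip_chart d P u w r ` ?X \<subseteq> S" using flip_chart_in_S[OF r] interior_subset by blast
    show "G \<subseteq> ?X" by (auto simp: G_def)
    have "orientation_preserving \<A> (flip_chart d P u w r) {z}" if "z \<in> G" for z
      using that r by (intro flip_chart_oriented_at) (auto simp: cells_def G_def B_def opposite_def)
    then show "orientation_preserving \<A> (flip_chart d P u w r) G"
      unfolding orientation_preserving_def by blast
    have neg: "negligible (B u \<union> B w)" unfolding B_def
      using ear_coords(13,14)[OF half_points_opposite(1)] ear_coords(13,14)[OF half_points_opposite(2)]
      by (intro negligible_Un) auto
    show "?X \<subseteq> closure G"
    proof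
      fix z assume z: "z \<in> ?X"
      show "z \<in> closure G"
        unfolding closure_approachable
      proof (intro allI impI)
        fix \<epsilon> :: real assume "0 < \<epsilon>"
        then have "?X \<inter> ball z \<epsilon> \<noteq> {}" using z by auto
        moreover have "open (?X \<inter> ball z \<epsilon>)" by auto
        ultimately have "\<not> negligible (?X \<inter> ball z \<epsilon>)" using open_not_negligible by blast
        then have "\<not> ?X \<inter> ball z \<epsilon> \<subseteq> B u \<union> B w" using neg negligible_subset by blast
        then show "\<exists>y\<in>G. dist y z < \<epsilon>" by (auto simp: G_def dist_commute)
      qed
    qed
  qed
qed

end

section \<open>The flipped d-angulation\<close>

lemma boundary_segment_cong:
  assumes "\<And>t. t \<in> {0..1} \<Longrightarrow> b t = c t" "boundary_segment \<A> M b"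
  shows "boundary_segment \<A> M c"
proof -
  have pi: "path_image c = path_image b" unfolding path_image_def using assms(1) by (intro image_cong) auto
  have "continuous_on {0..1} c \<longleftrightarrow> continuous_on {0..1} b"
    using assms(1) by (intro continuous_on_cong) auto
  moreover have "loop_free c \<longleftrightarrow> loop_free b"
    unfolding loop_free_def using assms(1) by (intro ball_cong) auto
  moreover have "c ` {0<..<1} = b ` {0<..<1}" using assms(1) by (intro image_cong) auto
  moreover have "c 0 = b 0" "c 1 = b 1" using assms(1) by auto
  ultimately show ?thesis using assms(2)
    unfolding boundary_segment_def simple_path_def path_def pathstart_def pathfinish_def pi by simp
qed

text \<open>
  A triangle is contractible, so two of its sides are homotopic to the third; this is applied in
  each of the two ears.
\<close>

lemma homotopic_paths_triangle:
  fixes a b c :: complex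
  assumes "convex R" "a \<in> R" "b \<in> R" "c \<in> R" "continuous_on R \<Psi>" "\<Psi> ` R \<subseteq> S"
  shows "homotopic_paths S (\<Psi> \<circ> linepath a c) ((\<Psi> \<circ> linepath a b) +++ (\<Psi> \<circ> linepath b c))"
proof -
  have "homotopic_paths R (linepath a c) (linepath a b +++ linepath b c)"
  proof (rule homotopic_paths_linear)
    fix t :: real assume t: "t \<in> {0..1}"
    have "linepath a c t \<in> path_image (linepath a c)"
      "(linepath a b +++ linepath b c) t \<in> path_image (linepath a b +++ linepath b c)"
      using t by (auto simp: path_image_def)
    moreover have "path_image (linepath a c) \<subseteq> R" "path_image (linepath a b +++ linepath b c) \<subseteq> R"
      using assms(1-4) by (auto simp: path_image_join closed_segment_subset)
    ultimately show "closed_segment (linepath a c t) ((linepath a b +++ linepath b c) t) \<subseteq> R"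
      using assms(1) by (intro closed_segment_subset) auto
  qed auto
  from homotopic_paths_continuous_image[OF this assms(5), of S] show ?thesis
    using assms(6) by (auto simp: path_compose_join)
qed

lemma linepath_ear_point:
  "linepath (ear_point d P x a b) (ear_point d P x a' b') t =
     ear_point d P x ((1 - t) * a + t * a') ((1 - t) * b + t * b')"
  by (simp add: linepath_def ear_point_def scaleR_conv_of_real algebra_simps)

context flippable
begin

abbreviation "arc' \<equiv> flip_arc d P u w"
abbreviation "P' \<equiv> flip_polygons d P u w"

definition arc_cell :: "real \<Rightarrow> (nat \<times> complex) + real" where
  "arc_cell t = (if t < 1/2 then Inl (fst w, ear_point d P w t (1 - 2 * t))
     else if t = 1/2 then Inr (1/2) else Inl (fst u, ear_point d P u (1 - t) (2 * t - 1)))"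

lemma flip_arc_cell: "arc' t = cell_point (arc_cell t)"
proof (cases "t = 1/2")
  case True
  show ?thesis unfolding True using ear_base[OF half_points_opposite(2), of "1/2"] half_points_opposite(4)
    by (simp add: flip_arc_def arc_cell_def)
qed (auto simp: flip_arc_def arc_cell_def)

lemma arc_cell_image: "arc_cell ` {0<..<1} = new_arc_cells"
proof (intro equalityI subsetI)
  fix q assume "q \<in> arc_cell ` {0<..<1}"
  then obtain t where t: "0 < t" "t < 1" "q = arc_cell t" by auto
  consider "t < 1/2" | "t = 1/2" | "t > 1/2" by linarith
  then show "q \<in> new_arc_cells"
  proof cases
    case 1
    then show ?thesis using new_arc_cells_point[OF half_points_opposite(2), of t "1 - 2 * t"] t
      by (simp add: arc_cell_def)
  next
    case 2
    then show ?thesis using t by (simp add: arc_cell_def new_arc_cells_def)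
  next
    case 3
    then show ?thesis using new_arc_cells_point[OF half_points_opposite(1), of "1 - t" "2 * t - 1"] t
      by (simp add: arc_cell_def)
  qed
next
  fix q assume q: "q \<in> new_arc_cells"
  show "q \<in> arc_cell ` {0<..<1}"
  proof (cases "q = Inr (1/2)")
    case True
    then show ?thesis by (intro image_eqI[of _ _ "1/2"]) (auto simp: arc_cell_def)
  next
    case False
    then obtain p x y where p: "q = Inl p" "p \<in> cells" "opposite x y" "in_ear x p"
      "2 * ear_s d P x (snd p) + ear_t d P x (snd p) = 1"
      using q by (auto simp: new_arc_cells_def)
    define s where "s = ear_s d P x (snd p)"
    have t: "ear_t d P x (snd p) = 1 - 2 * s" using p(5) by (simp add: s_def)
    have "fst p = fst x" "0 < s" using p(4) by (auto simp: in_ear_def s_def)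
    moreover have "0 < 1 - 2 * s"
      using ear_coords(6)[OF p(3), of "snd p"] p(2) \<open>fst p = fst x\<close> t by (auto simp: cells_def)
    moreover have "snd p = ear_point d P x s (1 - 2 * s)"
      using ear_coords(3)[OF p(3), of "snd p"] t by (simp add: s_def)
    ultimately have pp: "p = (fst x, ear_point d P x s (1 - 2 * s))" and s: "0 < s" "s < 1/2"
      by (auto simp: prod_eq_iff)
    show ?thesis
    proof (cases "x = w")
      case True
      then show ?thesis using pp s p(1) by (intro image_eqI[of _ _ s]) (auto simp: arc_cell_def)
    next
      case False
      then have "x = u" using p(3) by (auto simp: opposite_def)
      then show ?thesis using pp s p(1) by (intro image_eqI[of _ _ "1 - s"]) (auto simp: arc_cell_def)
    qed
  qed
qed

lemma inj_arc_cell: "inj_on arc_cell {0<..<1}"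
proof (rule linorder_inj_onI')
  fix s t :: real assume st: "s \<in> {0<..<1}" "t \<in> {0<..<1}" "s < t"
  note W = half_points_opposite(2) and U = half_points_opposite(1)
  show "arc_cell s \<noteq> arc_cell t"
  proof
    assume eq: "arc_cell s = arc_cell t"
    consider "t < 1/2" | "s > 1/2" | "s < 1/2" "1/2 < t" | "s = 1/2" | "t = 1/2" by linarith
    then show False
    proof cases
      case 1
      then have "ear_point d P w s (1 - 2 * s) = ear_point d P w t (1 - 2 * t)" using eq st by (simp add: arc_cell_def)
      then show False using ear_coords(1)[OF W] st by (metis less_irrefl)
    next
      case 2
      then have "ear_point d P u (1 - s) (2 * s - 1) = ear_point d P u (1 - t) (2 * t - 1)"
        using eq st by (simp add: arc_cell_def)
      then have "1 - s = 1 - t" using ear_coords(1)[OF U] by metis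
      then show False using st by simp
    next
      case 3
      let ?p = "(fst w, ear_point d P w s (1 - 2 * s))"
      have "?p = (fst u, ear_point d P u (1 - t) (2 * t - 1))" using eq st 3 by (simp add: arc_cell_def)
      then have "in_ear u ?p" using in_ear_point[OF U, of "1 - t"] st by simp
      moreover have "in_ear w ?p" using in_ear_point[OF W, of s] st by simp
      moreover have "?p \<in> cells" using ear_point_cell[OF W, of s "1 - 2 * s"] st 3 by simp
      ultimately show False using ear_unique[OF W] by blast
    qed (use eq st in \<open>auto simp: arc_cell_def split: if_splits\<close>)
  qed
qed

lemma flip_arc_image: "arc' ` {0<..<1} = cell_point ` new_arc_cells"
  unfolding arc_cell_image[symmetric] image_image flip_arc_cell ..

lemma inj_flip_arc: "inj_on arc' {0<..<1}"
proof -
  have "inj_on (cell_point \<circ> arc_cell) {0<..<1}"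
    using inj_arc_cell inj_on_subset[OF inj_cell_point new_arc_subset] arc_cell_image
    by (intro comp_inj_on) auto
  then show ?thesis by (simp add: comp_def flip_arc_cell[symmetric])
qed

lemma side_ends:
  assumes "x \<in> sides d P"
  shows "side_curve d P x 0 \<in> M" "side_curve d P x 1 \<in> M"
proof -
  have "side_curve d P x 0 \<in> M \<and> side_curve d P x 1 \<in> M"
  proof (cases "label P x")
    case None
    then show ?thesis using dangD(11)[OF assms]
      by (simp add: boundary_segment_def pathstart_def pathfinish_def)
  next
    case (Some a)
    from dangD(12)[OF assms this] show ?thesis
      using arc_facts(2,3)[of a] by (auto simp: left_side_def right_side_def)
  qed
  then show "side_curve d P x 0 \<in> M" "side_curve d P x 1 \<in> M" by auto
qed

lemma flip_arc_ends: "arc' 0 = side_curve d P (next_side d w) 1" "arc' 1 = side_curve d P (next_side d u) 1"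
  using side_curve_ear(2)[of w d P 1] side_curve_ear(2)[of u d P 1] sidesD[OF u_side(1)] sidesD[OF w_side(1)]
  by (simp_all add: flip_arc_def)

text \<open>
  The diagonal of the quadrilateral formed by the ears is deformed onto the path along its sides
  and \<open>i\<close> that defines the flip.
\<close>

lemma flip_arc_homotopic:
  "homotopic_paths S arc'
     (reversepath (side_curve d P (next_side d w)) +++ (\<gamma> i +++ side_curve d P (next_side d u)))"
proof -
  note W = half_points_opposite(2) and U = half_points_opposite(1)
  define cw where "cw = chart P (fst w)"
  define cu where "cu = chart P (fst u)"
  define pw where "pw = ear_point d P w"
  define pu where "pu = ear_point d P u"
  define A where "A = cw \<circ> linepath (pw 0 1) (pw 1 0)"
  define B where "B = cw \<circ> linepath (pw 1 0) (pw (1/2) 0)"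
  define C where "C = cu \<circ> linepath (pu (1/2) 0) (pu 1 0)"
  define E where "E = cu \<circ> linepath (pu 1 0) (pu 0 1)"
  have A: "reversepath (side_curve d P (next_side d w)) = A"
    using side_curve_ear(2)[of w d P] sidesD[OF w_side(1)]
    by (auto simp: fun_eq_iff reversepath_def A_def cw_def pw_def linepath_ear_point)
  have E: "side_curve d P (next_side d u) = E"
    using side_curve_ear(2)[of u d P] sidesD[OF u_side(1)]
    by (auto simp: fun_eq_iff E_def cu_def pu_def linepath_ear_point)
  have ini: "pw 0 1 \<in> polygon_region d P (fst w)" "pw 1 0 \<in> polygon_region d P (fst w)"
    "pw (1/2) 0 \<in> polygon_region d P (fst w)" "pu 0 1 \<in> polygon_region d P (fst u)"
    "pu 1 0 \<in> polygon_region d P (fst u)" "pu (1/2) 0 \<in> polygon_region d P (fst u)"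
    unfolding pw_def pu_def by (intro ear_coords(8)[OF W] ear_coords(8)[OF U]; simp)+
  have cvx: "convex (polygon_region d P r)" for r by (simp add: polygon_region_def)
  note triW = homotopic_paths_triangle[OF cvx _ _ _ dangD(5)[OF opposite_poly[OF W]] dangD(6)[OF opposite_poly[OF W]]]
    and triU = homotopic_paths_triangle[OF cvx _ _ _ dangD(5)[OF opposite_poly[OF U]] dangD(6)[OF opposite_poly[OF U]]]
  have h1: "homotopic_paths S (cw \<circ> linepath (pw 0 1) (pw (1/2) 0)) (A +++ B)"
    unfolding A_def B_def cw_def by (intro triW ini)
  have h2: "homotopic_paths S (cu \<circ> linepath (pu (1/2) 0) (pu 0 1)) (C +++ E)"
    unfolding C_def E_def cu_def by (intro triU ini)
  have mid: "cw (pw (1/2) 0) = cu (pu (1/2) 0)"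
    using glue[OF W, of "1/2"] by (simp add: cw_def cu_def pw_def pu_def)
  have arc: "arc' = (cw \<circ> linepath (pw 0 1) (pw (1/2) 0)) +++ (cu \<circ> linepath (pu (1/2) 0) (pu 0 1))"
    by (auto simp: fun_eq_iff joinpaths_def flip_arc_def cw_def cu_def pw_def pu_def linepath_ear_point algebra_simps)
  have pathpw: "path (cw \<circ> linepath a b) \<and> path_image (cw \<circ> linepath a b) \<subseteq> S"
    if "a \<in> polygon_region d P (fst w)" "b \<in> polygon_region d P (fst w)" for a b
  proof -
    have s: "path_image (linepath a b) \<subseteq> polygon_region d P (fst w)" using cvx that by (simp add: closed_segment_subset)
    then show ?thesis
      using dangD(5,6)[OF opposite_poly[OF W]] continuous_on_subset[OF dangD(5)[OF opposite_poly[OF W]] s]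
      unfolding cw_def by (auto simp: path_image_compose intro!: path_continuous_image)
  qed
  have pathpu: "path (cu \<circ> linepath a b) \<and> path_image (cu \<circ> linepath a b) \<subseteq> S"
    if "a \<in> polygon_region d P (fst u)" "b \<in> polygon_region d P (fst u)" for a b
  proof -
    have s: "path_image (linepath a b) \<subseteq> polygon_region d P (fst u)" using cvx that by (simp add: closed_segment_subset)
    then show ?thesis
      using dangD(5,6)[OF opposite_poly[OF U]] continuous_on_subset[OF dangD(5)[OF opposite_poly[OF U]] s]
      unfolding cu_def by (auto simp: path_image_compose intro!: path_continuous_image)
  qed
  have pA: "path A" "path_image A \<subseteq> S" and pB: "path B" "path_image B \<subseteq> S"
    and pC: "path C" "path_image C \<subseteq> S" and pE: "path E" "path_image E \<subseteq> S"
    unfolding A_def B_def C_def E_def using pathpw pathpu ini by blast+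
  have ends: "pathfinish A = pathstart B" "pathfinish B = pathstart C" "pathfinish C = pathstart E"
    using mid by (simp_all add: A_def B_def C_def E_def pathfinish_compose pathstart_compose)
  have "homotopic_paths S arc' ((A +++ B) +++ (C +++ E))"
    unfolding arc using mid by (intro homotopic_paths_join h1 h2) (simp add: pathfinish_compose pathstart_compose)
  also have "homotopic_paths S ((A +++ B) +++ (C +++ E)) (A +++ (B +++ (C +++ E)))"
    using pA pB pC pE ends
    by (intro homotopic_paths_sym[OF homotopic_paths_assoc]) (auto simp: path_image_join)
  also have "homotopic_paths S (A +++ (B +++ (C +++ E))) (A +++ ((B +++ C) +++ E))"
    using pA pB pC pE ends
    by (intro homotopic_paths_join homotopic_paths_assoc) auto
  also have "homotopic_paths S (A +++ ((B +++ C) +++ E)) (A +++ (\<gamma> i +++ E))"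
  proof (intro homotopic_paths_join)
    show "homotopic_paths S (B +++ C) (\<gamma> i)"
    proof (rule homotopic_paths_eq)
      show "path (B +++ C)" "path_image (B +++ C) \<subseteq> S" using pB pC ends by (auto simp: path_image_join)
      fix t :: real assume t: "t \<in> {0..1}"
      show "(B +++ C) t = \<gamma> i t"
      proof (cases "t \<le> 1/2")
        case True
        then have "(B +++ C) t = cw (pw (1 - t) 0)"
          by (simp add: joinpaths_def B_def pw_def linepath_ear_point algebra_simps)
        then show ?thesis using ear_base[OF W, of "1 - t"] t half_points_opposite(4) by (simp add: cw_def pw_def)
      next
        case False
        then have "(B +++ C) t = cu (pu t 0)"
          by (simp add: joinpaths_def C_def pu_def linepath_ear_point algebra_simps)
        then show ?thesis using ear_base[OF U, of t] t by (simp add: cu_def pu_def)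
      qed
    qed
  qed (use pA pB pC pE ends in auto)
  finally show ?thesis unfolding A E .
qed

lemma flip_arc_marked:
  assumes "homotopic_paths S arc' g" "marked_arc S \<A> M g"
  shows "marked_arc S \<A> M arc'"
proof -
  have p: "path arc'" using assms(1) homotopic_paths_imp_path by blast
  have int: "arc' ` {0<..<1} \<subseteq> S - bdry \<A>"
    unfolding flip_arc_image using cell_point_image new_arc_subset by blast
  have ends: "arc' 0 \<in> M" "arc' 1 \<in> M"
    unfolding flip_arc_ends using side_ends next_in_sides u_side(1) w_side(1) by auto
  have lf: "loop_free arc'"
    unfolding loop_free_def
  proof (intro ballI impI)
    fix s t :: real assume st: "s \<in> {0..1}" "t \<in> {0..1}" "arc' s = arc' t"
    have c: "s \<in> {0<..<1} \<or> s = 0 \<or> s = 1" "t \<in> {0<..<1} \<or> t = 0 \<or> t = 1" using st by auto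
    have ne: "arc' s' \<noteq> arc' 0" "arc' s' \<noteq> arc' 1" if "s' \<in> {0<..<1}" for s'
    proof -
      have "arc' s' \<notin> bdry \<A>" using subsetD[OF int imageI[OF that]] by simp
      moreover have "arc' 0 \<in> bdry \<A>" "arc' 1 \<in> bdry \<A>" using ends M_bdry by auto
      ultimately show "arc' s' \<noteq> arc' 0" "arc' s' \<noteq> arc' 1" by metis+
    qed
    show "s = t \<or> s = 0 \<and> t = 1 \<or> s = 1 \<and> t = 0"
    proof (cases "s \<in> {0<..<1}")
      case True
      then have "t \<in> {0<..<1}" using ne[OF True] c(2) st(3) by auto
      then show ?thesis using inj_onD[OF inj_flip_arc st(3) True] by simp
    next
      case False
      then have "s = 0 \<or> s = 1" using c(1) by blast
      moreover have "t \<notin> {0<..<1}" using ne[of t] calculation st(3) by auto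
      ultimately show ?thesis using c(2) by auto
    qed
  qed
  have eq: "homotopic_paths S arc' b \<longleftrightarrow> homotopic_paths S g b" for b
    using assms(1) homotopic_paths_sym homotopic_paths_trans by blast
  have "pathstart arc' = pathstart g" using assms(1) homotopic_paths_imp_pathstart by blast
  then show ?thesis
    using assms(2) p lf int ends
    unfolding marked_arc_def simple_path_def eq by (simp add: pathstart_def pathfinish_def)
qed

lemma next_side_inj: "\<lbrakk>x \<in> sides d P; y \<in> sides d P; next_side d x = next_side d y\<rbrakk> \<Longrightarrow> x = y"
  by (cases x; cases y) (auto simp: sides_def next_side_def mod_Suc split: if_splits)

lemma distinct_sides: "u \<noteq> w" "next_side d u \<noteq> u" "next_side d w \<noteq> w" "next_side d u \<noteq> w"
  "next_side d w \<noteq> u" "next_side d u \<noteq> next_side d w"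
  using u_neq_w next_u_neq_w next_w_neq_u next_side_inj[OF u_side(1) w_side(1)] d3
    sidesD[OF u_side(1)] sidesD[OF w_side(1)]
  by (auto simp: next_side_def mod_Suc prod_eq_iff split: if_splits)

lemma flip_side_simps [simp]:
  "flip_side d u w u = next_side d w" "flip_side d u w w = next_side d u"
  "flip_side d u w (next_side d u) = u" "flip_side d u w (next_side d w) = w"
  "\<lbrakk>x \<noteq> u; x \<noteq> w; x \<noteq> next_side d u; x \<noteq> next_side d w\<rbrakk> \<Longrightarrow> flip_side d u w x = x"
  using distinct_sides distinct_sides[symmetric] by (auto simp: flip_side_def)

lemma bij_flip_side: "bij_betw (flip_side d u w) (sides d P) (sides d P)"
proof -
  have into: "flip_side d u w ` sides d P \<subseteq> sides d P"
    using u_side(1) w_side(1) next_in_sides[OF u_side(1)] next_in_sides[OF w_side(1)]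
    by (auto simp: flip_side_def)
  moreover have "inj_on (flip_side d u w) (sides d P)"
    using distinct_sides distinct_sides[symmetric] by (auto simp: inj_on_def flip_side_def)
  moreover have "finite (sides d P)" by (simp add: sides_def)
  ultimately show ?thesis using endo_inj_surj[of "sides d P" "flip_side d u w"] by (simp add: bij_betw_def)
qed

lemma flip_polygons_simps [simp]:
  "npoly P' = npoly P" "vert P' = vert P" "chart P' = flip_chart d P u w" "sides d P' = sides d P"
  "polygon_region d P' = polygon_region d P" "label P' x = label P (flip_side d u w x)"
  "ear_point d P' = ear_point d P"
  by (auto simp: flip_polygons_def sides_def polygon_region_def label_def ear_point_def edge1_def edge2_def fun_eq_iff)

lemma flip_side_curve:
  assumes x: "x \<in> sides d P" and t: "0 \<le> t" "t \<le> 1"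
  shows "side_curve d P' (next_side d u) t = arc' t" "side_curve d P' (next_side d w) t = arc' (1 - t)"
    "\<lbrakk>x \<noteq> next_side d u; x \<noteq> next_side d w\<rbrakk> \<Longrightarrow> side_curve d P' x t = side_curve d P (flip_side d u w x) t"
proof -
  have new: "side_curve d P' (next_side d x) t =
      (if x = u then arc' t else arc' (1 - t))" if o: "opposite x y" for x y
  proof -
    have x: "side_curve d P' (next_side d x) t = flip_chart d P u w (fst x) (ear_point d P x (1 - t) t)"
      using side_curve_ear(2)[OF opposite_index[OF o], of P' t] by simp
    also have "\<dots> = flip_ear d P x y (ear_point d P x (1 - t) t)"
      using t by (intro flip_chart_closed_ear[OF o] ear_coords(8)[OF o]) (auto simp: ear_coords(1)[OF o])
    also have "\<dots> = (if x = u then arc' t else arc' (1 - t))"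
    proof (cases "t = 1/2")
      case True
      show ?thesis unfolding True using ear_coords(1,2)[OF o] ear_base[OF o, of "1/2"] ear_base[OF half_points_opposite(2), of "1/2"]
          half_points_opposite(4)
        by (simp add: flip_ear_def flip_arc_def)
    next
      case False
      then show ?thesis using ear_coords(1,2)[OF o] o half_points_opposite(3)
        by (auto simp: flip_ear_def flip_arc_def opposite_def algebra_simps)
    qed
    finally show ?thesis .
  qed
  show "side_curve d P' (next_side d u) t = arc' t" "side_curve d P' (next_side d w) t = arc' (1 - t)"
    using new[OF half_points_opposite(1)] new[OF half_points_opposite(2)] half_points_opposite(4) by auto
  have old: "side_curve d P' x t = side_curve d P (next_side d y) t" if o: "opposite x y" for x y
  proof -
    note o' = opposite_sym[OF o]
    have x: "side_curve d P' x t = flip_chart d P u w (fst x) (ear_point d P x t 0)"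
      using side_curve_ear(1)[OF opposite_index[OF o], of P' t] by simp
    also have "\<dots> = flip_ear d P x y (ear_point d P x t 0)"
      using t by (intro flip_chart_closed_ear[OF o] ear_coords(8)[OF o]) (auto simp: ear_coords(1)[OF o])
    also have "\<dots> = chart P (fst y) (ear_point d P y (1 - t) t)"
      using ear_coords(1,2)[OF o] t glue[OF o, of 0] by (auto simp: flip_ear_def)
    also have "\<dots> = side_curve d P (next_side d y) t"
      using side_curve_ear(2)[OF opposite_index[OF o'], of P t] by simp
    finally show ?thesis .
  qed
  assume n: "x \<noteq> next_side d u" "x \<noteq> next_side d w"
  show "side_curve d P' x t = side_curve d P (flip_side d u w x) t"
  proof (cases "x = u \<or> x = w")
    case True
    then show ?thesis using old[OF half_points_opposite(1)] old[OF half_points_opposite(2)] by auto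
  next
    case False
    obtain r j where rj: "x = (r, j)" by force
    have r: "r < npoly P" "j < d" using sidesD[OF x] rj by auto
    have "side_curve d P' x t = flip_chart d P u w r (linepath (vert P r j) (vert P r (Suc j mod d)) t)"
      by (simp add: side_curve_def rj)
    also have "\<dots> = chart P r (linepath (vert P r j) (vert P r (Suc j mod d)) t)"
    proof (rule flip_chart_no_ear)
      fix y z assume o: "opposite y z" and fy: "fst y = r"
      obtain k where y: "y = (r, k)" using fy by (metis prod.collapse)
      have K: "3 \<le> d" "convex_polygon d (vert P r)" "k < d"
        using d3 opposite_conv[OF o] opposite_index[OF o] y by auto
      have "j \<noteq> k" "j \<noteq> Suc k mod d" using False n o rj y by (auto simp: opposite_def next_side_def)
      moreover have "Suc j mod d \<noteq> Suc k mod d"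
        using \<open>j \<noteq> k\<close> r K(3) by (auto simp: mod_Suc split: if_splits)
      ultimately have "ear_s d P y (vert P r j) \<le> 0" "ear_s d P y (vert P r (Suc j mod d)) \<le> 0"
        using ear_s_corner[OF K] r K by (auto simp: y)
      then show "ear_s d P y (linepath (vert P r j) (vert P r (Suc j mod d)) t) \<le> 0"
        using t ear_st_affine(1)[OF K, of t] unfolding linepath_def scaleR_conv_of_real y
        by (simp add: add_nonpos_nonpos mult_nonneg_nonpos)
    qed
    also have "\<dots> = side_curve d P x t" by (simp add: side_curve_def rj)
    finally show ?thesis using False n by simp
  qed
qed

lemma left_right_unique: "left_side d \<gamma> P i x \<Longrightarrow> x = u" "right_side d \<gamma> P i x \<Longrightarrow> x = w"
  using dangD(13)[OF iI] dangD(14)[OF iI] left right by (metis (full_types))+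

lemma labelled_sides: "\<lbrakk>x \<in> sides d P; label P x = Some i\<rbrakk> \<Longrightarrow> x = u \<or> x = w"
  using dangD(12)[of x i] left_right_unique by metis

lemma flip_preimage_label:
  assumes "x \<in> sides d P" "label P (flip_side d u w x) = Some i"
  shows "x = next_side d u \<or> x = next_side d w"
proof -
  have "flip_side d u w x \<in> sides d P" using bij_flip_side assms(1) by (auto simp: bij_betw_def)
  then have "flip_side d u w x = flip_side d u w (next_side d u) \<or> flip_side d u w x = flip_side d u w (next_side d w)"
    using labelled_sides assms(2) by auto
  then show ?thesis
    using inj_onD[OF bij_betw_imp_inj_on[OF bij_flip_side] _ assms(1) next_in_sides[OF u_side(1)]]
      inj_onD[OF bij_betw_imp_inj_on[OF bij_flip_side] _ assms(1) next_in_sides[OF w_side(1)]] by metis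
qed

lemma flip_side_curve_other:
  assumes "x \<in> sides d P" "label P (flip_side d u w x) \<noteq> Some i" "t \<in> {0..1}"
  shows "side_curve d P' x t = side_curve d P (flip_side d u w x) t"
proof -
  have "x \<noteq> next_side d u" "x \<noteq> next_side d w" using assms(2) u_side(2) w_side(2) by auto
  then show ?thesis using flip_side_curve(3)[OF assms(1)] assms(3) by auto
qed

lemma flip_left_right:
  assumes x: "x \<in> sides d P" and a: "a \<noteq> i"
  shows "left_side d (\<gamma>(i := arc')) P' a x \<longleftrightarrow> left_side d \<gamma> P a (flip_side d u w x)"
    "right_side d (\<gamma>(i := arc')) P' a x \<longleftrightarrow> right_side d \<gamma> P a (flip_side d u w x)"
  using x a flip_side_curve_other[OF x] bij_flip_side
  unfolding left_side_def right_side_def by (auto simp: bij_betw_def)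

lemma flip_left_right_i:
  shows "left_side d (\<gamma>(i := arc')) P' i x \<longleftrightarrow> x = next_side d u"
    "right_side d (\<gamma>(i := arc')) P' i x \<longleftrightarrow> x = next_side d w"
proof -
  have nu: "next_side d u \<in> sides d P" and nw: "next_side d w \<in> sides d P"
    using next_in_sides u_side(1) w_side(1) by auto
  have ne: "arc' (1/4) \<noteq> arc' (3/4)" using inj_onD[OF inj_flip_arc, of "1/4" "3/4"] by auto
  have l: "left_side d (\<gamma>(i := arc')) P' i (next_side d u)"
    and r: "right_side d (\<gamma>(i := arc')) P' i (next_side d w)"
    using nu nw flip_side_curve(1)[OF nu] flip_side_curve(2)[OF nu] u_side(2) w_side(2)
    by (auto simp: left_side_def right_side_def)
  have nl: "\<not> left_side d (\<gamma>(i := arc')) P' i (next_side d w)"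
  proof
    assume "left_side d (\<gamma>(i := arc')) P' i (next_side d w)"
    then have "side_curve d P' (next_side d w) (1/4) = arc' (1/4)" by (simp add: left_side_def)
    then show False using flip_side_curve(2)[OF nu, of "1/4"] ne by simp
  qed
  have nr: "\<not> right_side d (\<gamma>(i := arc')) P' i (next_side d u)"
  proof
    assume "right_side d (\<gamma>(i := arc')) P' i (next_side d u)"
    then have "side_curve d P' (next_side d u) (1/4) = arc' (1 - 1/4)" by (simp add: right_side_def)
    then show False using flip_side_curve(1)[OF nu, of "1/4"] ne by simp
  qed
  have "x = next_side d u \<or> x = next_side d w"
    if "left_side d (\<gamma>(i := arc')) P' i x \<or> right_side d (\<gamma>(i := arc')) P' i x"
    using that flip_preimage_label[of x] by (auto simp: left_side_def right_side_def)
  then show "left_side d (\<gamma>(i := arc')) P' i x \<longleftrightarrow> x = next_side d u"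
    "right_side d (\<gamma>(i := arc')) P' i x \<longleftrightarrow> x = next_side d w"
    using l r nl nr by blast+
qed

lemma d_angulation_flip:
  assumes "is_flip d S \<A> M \<gamma> P i g"
  shows "homotopic_paths S arc' g" "d_angulation d S \<A> M I (\<gamma>(i := arc')) P'"
proof -
  obtain u' w' where "left_side d \<gamma> P i u'" "right_side d \<gamma> P i w'" and mg: "marked_arc S \<A> M g" and
    "homotopic_paths S g (reversepath (side_curve d P (next_side d w')) +++ (\<gamma> i +++ side_curve d P (next_side d u')))"
    using assms unfolding is_flip_def by blast
  moreover have "u' = u" "w' = w" using calculation(1,2) left_right_unique by auto
  ultimately show h: "homotopic_paths S arc' g"
    using flip_arc_homotopic homotopic_paths_sym homotopic_paths_trans by blast
  note marked = flip_arc_marked[OF h mg]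
  let ?\<gamma> = "\<gamma>(i := arc')"
  note bij = bij_flip_side
  have arc_disj: "arc' ` {0<..<1} \<inter> path_image (\<gamma> a) = {}" if "a \<in> I" "a \<noteq> i" for a
    unfolding flip_arc_image using cell_point_image new_arc_subset that by blast
  have sub: "\<gamma> a ` {0<..<1} \<subseteq> path_image (\<gamma> a)" for a by (auto simp: path_image_def)
  have union: "(\<Union>r<npoly P. flip_chart d P u w r ` interior (polygon_region d P r)) =
       S - bdry \<A> - (\<Union>a\<in>I. path_image (?\<gamma> a))"
  proof -
    have "{0..1} = insert 0 (insert 1 {0<..<1::real})" by auto
    then have pi: "path_image arc' = insert (arc' 0) (insert (arc' 1) (arc' ` {0<..<1}))"
      unfolding path_image_def by (simp only: image_insert)
    have "arc' 0 \<in> bdry \<A>" "arc' 1 \<in> bdry \<A>"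
      using marked M_bdry by (auto simp: marked_arc_def pathstart_def pathfinish_def)
    then have e: "path_image arc' \<subseteq> bdry \<A> \<union> arc' ` {0<..<1}" "arc' ` {0<..<1} \<subseteq> path_image arc'"
      unfolding pi by auto
    have "(\<Union>a\<in>I. path_image (?\<gamma> a)) = path_image (?\<gamma> i) \<union> (\<Union>a\<in>I - {i}. path_image (?\<gamma> a))"
      using iI by blast
    also have "\<dots> = path_image arc' \<union> (\<Union>a\<in>I - {i}. path_image (\<gamma> a))" by simp
    finally have eq: "(\<Union>a\<in>I. path_image (?\<gamma> a)) = path_image arc' \<union> (\<Union>a\<in>I - {i}. path_image (\<gamma> a))" .
    show ?thesis unfolding flip_chart_union cell_point_image flip_arc_image[symmetric] eq using e by blast
  qed
  have lab: "case label P (flip_side d u w x) of None \<Rightarrow> boundary_segment \<A> M (side_curve d P' x)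
      | Some a \<Rightarrow> a \<in> I \<and> (left_side d ?\<gamma> P' a x \<or> right_side d ?\<gamma> P' a x)" if x: "x \<in> sides d P" for x
  proof -
    have fx: "flip_side d u w x \<in> sides d P" using bij x by (auto simp: bij_betw_def)
    show ?thesis
    proof (cases "label P (flip_side d u w x)")
      case None
      then have "boundary_segment \<A> M (side_curve d P' x)"
        using flip_side_curve_other[OF x] by (intro boundary_segment_cong[OF _ dangD(11)[OF fx]]) auto
      then show ?thesis using None by simp
    next
      case (Some a)
      show ?thesis
      proof (cases "a = i")
        case True
        then have "x = next_side d u \<or> x = next_side d w" using flip_preimage_label[OF x] Some by simp
        then show ?thesis using True Some iI flip_left_right_i by auto
      next
        case False
        then show ?thesis using Some flip_left_right[OF x False] dangD(12)[OF fx Some] by simp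
      qed
    qed
  qed
  have ex1: "(\<exists>!x. left_side d ?\<gamma> P' a x) \<and> (\<exists>!x. right_side d ?\<gamma> P' a x)" if a: "a \<in> I" for a
  proof (cases "a = i")
    case True
    then show ?thesis using flip_left_right_i by simp
  next
    case False
    have tr: "\<exists>!x. Q' x" if ex: "\<exists>!x. Q x" and Q: "\<And>x. Q x \<Longrightarrow> x \<in> sides d P"
      and Q': "\<And>x. Q' x \<Longrightarrow> x \<in> sides d P" and iff: "\<And>x. x \<in> sides d P \<Longrightarrow> Q' x \<longleftrightarrow> Q (flip_side d u w x)"
      for Q Q'
    proof -
      obtain x where x: "Q x" "\<And>y. Q y \<Longrightarrow> y = x" using ex by (auto simp: Ex1_def)
      have "x \<in> flip_side d u w ` sides d P" using Q[OF x(1)] bij_betw_imp_surj_on[OF bij] by simp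
      then obtain x' where x': "x' \<in> sides d P" "flip_side d u w x' = x" by auto
      show ?thesis
      proof (rule ex1I)
        show "Q' x'" using iff[OF x'(1)] x(1) x'(2) by simp
        fix y assume y: "Q' y"
        then have "flip_side d u w y = flip_side d u w x'" using iff[OF Q'[OF y]] x(2) x'(2) by simp
        then show "y = x'" using inj_onD[OF bij_betw_imp_inj_on[OF bij]] Q'[OF y] x'(1) by blast
      qed
    qed
    show ?thesis
    proof
      show "\<exists>!x. left_side d ?\<gamma> P' a x"
        by (rule tr[OF dangD(13)[OF a]]) (use flip_left_right(1)[OF _ False] in \<open>auto simp: left_side_def\<close>)
      show "\<exists>!x. right_side d ?\<gamma> P' a x"
        by (rule tr[OF dangD(14)[OF a]]) (use flip_left_right(2)[OF _ False] in \<open>auto simp: right_side_def\<close>)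
    qed
  qed
  have bd_img: "path_image (side_curve d P' x) = path_image (side_curve d P (flip_side d u w x))"
      "side_curve d P' x ` {0<..<1} = side_curve d P (flip_side d u w x) ` {0<..<1}"
    if "x \<in> sides d P" "label P (flip_side d u w x) = None" for x
    unfolding path_image_def using flip_side_curve_other[OF that(1)] that(2) by (auto intro!: image_cong)
  have bdry: "(\<Union>x\<in>{x \<in> sides d P. label P (flip_side d u w x) = None}. path_image (side_curve d P' x)) = bdry \<A>"
  proof -
    have "{x \<in> sides d P. label P x = None} = flip_side d u w ` {x \<in> sides d P. label P (flip_side d u w x) = None}"
      (is "?L = ?R")
    proof
      show "?L \<subseteq> ?R"
      proof
        fix x assume x: "x \<in> ?L"
        then have "x \<in> flip_side d u w ` sides d P" using bij_betw_imp_surj_on[OF bij] by simp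
        then show "x \<in> ?R" using x by auto
      qed
      show "?R \<subseteq> ?L" using bij_betw_imp_surj_on[OF bij] by auto
    qed
    then show ?thesis unfolding dangD(15)[symmetric] using bd_img(1) by simp
  qed
  have pairs: "side_curve d P' x ` {0<..<1} \<inter> side_curve d P' y ` {0<..<1} = {}"
    if x: "x \<in> sides d P" and y: "y \<in> sides d P" and n: "label P (flip_side d u w x) = None"
      "label P (flip_side d u w y) = None" "x \<noteq> y" for x y
  proof -
    have "flip_side d u w x \<in> sides d P" "flip_side d u w y \<in> sides d P" "flip_side d u w x \<noteq> flip_side d u w y"
      using bij x y n(3) by (auto simp: bij_betw_def inj_on_def)
    then show ?thesis using dangD(16) n bd_img(2) x y by simp
  qed
  show "d_angulation d S \<A> M I ?\<gamma> P'"
    unfolding d_angulation_def flip_polygons_simps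
  proof (intro conjI ballI allI impI)
    show "finite I" by (rule dangD(1))
    show "marked_arc S \<A> M (?\<gamma> a)" if "a \<in> I" for a using marked dangD(2) that by simp
    show "?\<gamma> a ` {0<..<1} \<inter> ?\<gamma> b ` {0<..<1} = {}" if "a \<in> I" "b \<in> I" "a \<noteq> b" for a b
    proof (cases "a = i \<or> b = i")
      case True
      then show ?thesis
      proof
        assume "a = i"
        then have "arc' ` {0<..<1} \<inter> \<gamma> b ` {0<..<1} = {}" using arc_disj[of b] sub[of b] that by blast
        then show ?thesis using \<open>a = i\<close> that by simp
      next
        assume "b = i"
        then have "\<gamma> a ` {0<..<1} \<inter> arc' ` {0<..<1} = {}" using arc_disj[of a] sub[of a] that by blast
        then show ?thesis using \<open>b = i\<close> that by simp
      qed
    qed (use dangD(3) that in simp)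
    show "(\<Union>r<npoly P. flip_chart d P u w r ` interior (polygon_region d P r)) =
       S - bdry \<A> - (\<Union>a\<in>I. path_image (?\<gamma> a))" by (rule union)
    show "(\<Union>x\<in>{x \<in> sides d P. label P (flip_side d u w x) = None}. path_image (side_curve d P' x)) = bdry \<A>"
      by (rule bdry)
    show "case label P (flip_side d u w x) of None \<Rightarrow> boundary_segment \<A> M (side_curve d P' x)
      | Some a \<Rightarrow> a \<in> I \<and> (left_side d ?\<gamma> P' a x \<or> right_side d ?\<gamma> P' a x)" if "x \<in> sides d P" for x
      by (rule lab[OF that])
    show "\<exists>!x. left_side d ?\<gamma> P' a x" "\<exists>!x. right_side d ?\<gamma> P' a x" if "a \<in> I" for a
      using ex1[OF that] by (auto simp only:)
    fix r assume r: "r < npoly P"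
    show "convex_polygon d (vert P r)" by (rule dangD(4)[OF r])
    show "continuous_on (polygon_region d P r) (flip_chart d P u w r)" by (rule continuous_flip_chart[OF r])
    show "flip_chart d P u w r ` polygon_region d P r \<subseteq> S" by (rule flip_chart_in_S[OF r])
    show "inj_on (flip_chart d P u w r) (interior (polygon_region d P r))" by (rule flip_chart_inj[OF r])
    show "orientation_preserving \<A> (flip_chart d P u w r) (interior (polygon_region d P r))"
      by (rule flip_chart_oriented[OF r])
  next
    fix r r' assume "r < npoly P" "r' < npoly P" "r \<noteq> r'"
    then show "flip_chart d P u w r ` interior (polygon_region d P r) \<inter>
        flip_chart d P u w r' ` interior (polygon_region d P r') = {}" by (rule flip_chart_disjoint)
  next
    fix x y assume "x \<in> sides d P" "y \<in> sides d P"
      "label P (flip_side d u w x) = None \<and> label P (flip_side d u w y) = None \<and> x \<noteq> y"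
    then show "side_curve d P' x ` {0<..<1} \<inter> side_curve d P' y ` {0<..<1} = {}" by (intro pairs) auto
  qed
qed

end

section \<open>The free algebra and the cyclic order of sides\<close>

abbreviation monom_word :: "'e list \<Rightarrow> 'k::zero \<Rightarrow> ('e list \<Rightarrow>\<^sub>0 'k)" where
  "monom_word \<equiv> Poly_Mapping.single"

lemma single_times_word: "monom_word v a * monom_word w b = monom_word (v @ w) (a * b)"
  by (simp add: mult_single plus_list_def)

lemma scl_single [simp]: "scl c (monom_word w a) = monom_word w (c * a)"
  by (simp add: scl_def mult_single plus_list_def)

lemma word_Nil: "word [] = 1"
  by (metis word_def single_one zero_list_def)

lemma scl_simps [simp]: "scl c 0 = 0" "scl 0 x = 0" "scl 1 x = x"
  by (simp_all add: scl_def word_Nil[unfolded word_def])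

lemma scl_add: "scl c (x + y) = scl c x + scl c y"
  and scl_add_left: "scl (b + c) x = scl b x + scl c x"
  and scl_uminus: "scl c (- x) = - scl c x"
  and scl_diff: "scl c (x - y) = scl c x - scl c y"
  by (simp_all add: scl_def distrib_left distrib_right single_add right_diff_distrib)

lemma scl_sum: "scl c (sum f A) = (\<Sum>x\<in>A. scl c (f x))"
  by (induction A rule: infinite_finite_induct) (simp_all add: scl_add)

lemma scl_scl: "scl b (scl c x) = scl (b * c) x"
  by (simp add: scl_def mult.assoc[symmetric] mult_single plus_list_def)

lemma word_single: "word w = monom_word w 1"
  by (simp add: word_def)

lemma lin_superset:
  assumes "finite K" "Poly_Mapping.keys x \<subseteq> K"
  shows "lin f x = (\<Sum>w\<in>K. scl (Poly_Mapping.lookup x w) (f w))"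
  unfolding lin_def using assms by (intro sum.mono_neutral_left) (auto simp: in_keys_iff)

lemma lin_add: "lin f (x + y) = lin f x + lin f y"
proof -
  let ?K = "Poly_Mapping.keys x \<union> Poly_Mapping.keys y"
  have "lin f (x + y) = (\<Sum>w\<in>?K. scl (Poly_Mapping.lookup (x + y) w) (f w))"
    using keys_add[of x y] by (intro lin_superset) auto
  also have "\<dots> = (\<Sum>w\<in>?K. scl (Poly_Mapping.lookup x w) (f w)) + (\<Sum>w\<in>?K. scl (Poly_Mapping.lookup y w) (f w))"
    by (simp add: lookup_add scl_add_left sum.distrib)
  also have "\<dots> = lin f x + lin f y"
    by (subst (1 2) lin_superset[of ?K]) auto
  finally show ?thesis .
qed

lemma lin_single [simp]: "lin f (monom_word w c) = scl c (f w)"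
  by (simp add: lin_def)

lemma lin_zero [simp]: "lin f 0 = 0"
  by (simp add: lin_def)

lemma lin_sum: "lin f (sum g A) = (\<Sum>x\<in>A. lin f (g x))"
  by (induction A rule: infinite_finite_induct) (simp_all add: lin_add)

lemma psign_add: "psign (m + n) = (psign m * psign n :: 'k::ring_1)"
  by (auto simp: psign_def)

lemma psign_cong: "even (m - n) \<Longrightarrow> psign m = psign n"
  by (auto simp: psign_def)

lemma of_int_psign [simp]: "of_int (psign n) = psign n"
  by (simp add: psign_def)

section \<open>Triangle potentials\<close>

text \<open>The number of steps from side \<open>x\<close> clockwise to side \<open>y\<close> of the same polygon.\<close>

definition clock_dist :: "nat \<Rightarrow> side \<Rightarrow> side \<Rightarrow> nat" where
  "clock_dist d x y = (snd x + d - snd y) mod d"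

definition clockwise :: "nat \<Rightarrow> side \<Rightarrow> side \<Rightarrow> side \<Rightarrow> bool" where
  "clockwise d x y z \<longleftrightarrow> fst x = fst y \<and> fst x = fst z \<and>
     0 < clock_dist d x y \<and> clock_dist d x y < clock_dist d x z"

lemma clock_dist_alt: "\<lbrakk>snd x < d; snd y < d\<rbrakk> \<Longrightarrow>
   clock_dist d x y = (if snd y \<le> snd x then snd x - snd y else snd x + d - snd y)"
proof (cases "snd y \<le> snd x")
  case True
  assume "snd x < d"
  have e: "snd x + d - snd y = (snd x - snd y) + d" using True by simp
  have "(snd x - snd y + d) mod d = (snd x - snd y) mod d" by (rule mod_add_self2)
  also have "\<dots> = snd x - snd y" using \<open>snd x < d\<close> by (intro mod_less) simp
  finally show ?thesis unfolding clock_dist_def e by (simp only: True if_True)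
next
  case False
  assume "snd x < d" "snd y < d"
  then have "snd x + d - snd y < d" using False by simp
  then show ?thesis using False by (simp add: clock_dist_def)
qed

lemma clockwise_rotate: "\<lbrakk>snd x < d; snd y < d; snd z < d; clockwise d x y z\<rbrakk> \<Longrightarrow> clockwise d y z x"
  by (auto simp: clockwise_def clock_dist_alt split: if_splits)

lemma clockwise_quad:
  assumes "snd x < d" "snd p < d" "snd q < d" "snd z < d"
  shows "clockwise d x q z \<and> clockwise d x p q \<longleftrightarrow> clockwise d x p z \<and> clockwise d p q z"
  using assms by (cases x; cases p; cases q; cases z) (auto simp: clockwise_def clock_dist_alt split: if_splits)

lemma clockwise_distinct:
  assumes "snd x < d" "snd y < d" "snd z < d" "clockwise d x y z"
  shows "x \<noteq> y" "y \<noteq> z" "x \<noteq> z" "fst x = fst y" "fst y = fst z"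
  using assms by (auto simp: clockwise_def clock_dist_alt split: if_splits)

lemma clock_dist_add:
  assumes "snd x < d" "snd y < d" "snd z < d" "clockwise d x y z"
  shows "clock_dist d x y + clock_dist d y z = clock_dist d x z"
    "clock_dist d x z + clock_dist d z x = d"
  using assms by (auto simp: clockwise_def clock_dist_alt split: if_splits)

text \<open>The coefficient of the cycle through \<open>x, y, z\<close> when it is rotated to start with \<open>a x y\<close>.\<close>

definition cyc_coeff :: "nat \<Rightarrow> (side \<Rightarrow> side \<Rightarrow> side \<Rightarrow> 'k::comm_ring_1) \<Rightarrow> side \<Rightarrow> side \<Rightarrow> side \<Rightarrow> 'k" where
  "cyc_coeff d om x y z = om x y z + psign (int d * (1 - int (clock_dist d x y))) * om y z x
     + psign (int d * (1 - int (clock_dist d z x))) * om z x y"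

text \<open>
  The coefficient of \<open>a x y\<close> followed by \<open>a y z\<close> in \<open>\<delta> (a x
  z)\<close>.
\<close>

definition struct_coeff ::
    "nat \<Rightarrow> (side \<Rightarrow> side \<Rightarrow> int) \<Rightarrow> (side \<Rightarrow> side \<Rightarrow> side \<Rightarrow> 'k::comm_ring_1) \<Rightarrow> side \<Rightarrow> side \<Rightarrow> side \<Rightarrow> 'k" where
  "struct_coeff d sg om x y z =
     psign (int d * (2 - int (clock_dist d x z))) * of_int (sg x z) * cyc_coeff d om z x y"

text \<open>
  The coefficient of the path through \<open>x, p, q, z\<close> in \<open>\<delta>\<^sup>2 (a x
  z)\<close>.
\<close>

definition quad_coeff ::
    "nat \<Rightarrow> (side \<Rightarrow> side \<Rightarrow> int) \<Rightarrow> (side \<Rightarrow> side \<Rightarrow> side \<Rightarrow> 'k::comm_ring_1) \<Rightarrow> side \<Rightarrow> side \<Rightarrow> side \<Rightarrow> side \<Rightarrow> 'k" where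
  "quad_coeff d sg om x p q z = struct_coeff d sg om x q z * struct_coeff d sg om x p q
     + psign (1 - int (clock_dist d x p)) * (struct_coeff d sg om x p z * struct_coeff d sg om p q z)"

text \<open>
  The common shape of the quivers of polygons and of the mutated quiver. Sides of several polygons
  may occur; only sides of the same polygon are joined by arrows.
\<close>

locale triangle_quiver =
  fixes d :: nat and Q :: "('v, 'e) gquiver" and V :: "side set" and a :: "side \<Rightarrow> side \<Rightarrow> 'e"
  assumes finV: "finite V" and snd_less: "x \<in> V \<Longrightarrow> snd x < d"
    and arrs_eq: "arrs Q = {a x y | x y. x \<in> V \<and> y \<in> V \<and> x \<noteq> y \<and> fst x = fst y}"
    and a_inj: "\<lbrakk>x \<in> V; y \<in> V; x \<noteq> y; fst x = fst y; x' \<in> V; y' \<in> V; x' \<noteq> y'; fst x' = fst y'; a x y = a x' y'\<rbrakk>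
      \<Longrightarrow> x = x' \<and> y = y'"
    and deg_a: "\<lbrakk>x \<in> V; y \<in> V; x \<noteq> y; fst x = fst y\<rbrakk> \<Longrightarrow> deg Q (a x y) = 1 - int (clock_dist d x y)"
    and opp_a: "\<lbrakk>x \<in> V; y \<in> V; x \<noteq> y; fst x = fst y\<rbrakk> \<Longrightarrow> opp Q (a x y) = a y x"
begin

definition triples :: "(side \<times> side \<times> side) set" where
  "triples = {(x, y, z). x \<in> V \<and> y \<in> V \<and> z \<in> V \<and> clockwise d x y z}"

definition tri_potential :: "(side \<Rightarrow> side \<Rightarrow> side \<Rightarrow> 'k) \<Rightarrow> ('e list \<Rightarrow>\<^sub>0 'k::comm_ring_1)" where
  "tri_potential om = (\<Sum>(x, y, z)\<in>triples. monom_word [a x y, a y z, a z x] (om x y z))"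

abbreviation sg :: "side \<Rightarrow> side \<Rightarrow> int" where
  "sg x y \<equiv> osgn Q (a x y)"

lemma a_eq_iff: "\<lbrakk>x \<in> V; y \<in> V; x \<noteq> y; fst x = fst y; x' \<in> V; y' \<in> V; x' \<noteq> y'; fst x' = fst y'\<rbrakk>
      \<Longrightarrow> a x y = a x' y' \<longleftrightarrow> (x, y) = (x', y')"
  by (rule iffI, drule a_inj, assumption+, simp_all)

lemma finite_triples: "finite triples"
  by (rule finite_subset[of _ "V \<times> V \<times> V"]) (auto simp: triples_def finV)

lemma triplesD:
  assumes "(x, y, z) \<in> triples"
  shows "x \<in> V" "y \<in> V" "z \<in> V" "x \<noteq> y" "y \<noteq> z" "z \<noteq> x" "fst x = fst y" "fst y = fst z" "fst z = fst x"
    "(y, z, x) \<in> triples" "(z, x, y) \<in> triples"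
proof -
  have V: "x \<in> V" "y \<in> V" "z \<in> V" and c: "clockwise d x y z" using assms by (auto simp: triples_def)
  note s = V[THEN snd_less]
  show "x \<in> V" "y \<in> V" "z \<in> V" by fact+
  show "x \<noteq> y" "y \<noteq> z" "z \<noteq> x" "fst x = fst y" "fst y = fst z" "fst z = fst x"
    using clockwise_distinct[OF s c] by auto
  have r: "clockwise d y z x" using clockwise_rotate[OF s c] .
  then have "clockwise d z x y" using clockwise_rotate[OF s(2,3,1)] by simp
  then show "(y, z, x) \<in> triples" "(z, x, y) \<in> triples" using r V by (auto simp: triples_def)
qed

lemma triple_degrees:
  assumes "(x, y, z) \<in> triples"
  shows "deg Q (a x y) = 1 - int (clock_dist d x y)" "deg Q (a y z) = 1 - int (clock_dist d y z)"
    "deg Q (a z x) = 1 - int (clock_dist d z x)"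
    "clock_dist d x y + clock_dist d y z + clock_dist d z x = d"
  using triplesD[OF assms] clock_dist_add[of x d y z] snd_less assms by (auto simp: deg_a triples_def)

lemma triple_cycle_degree: "(x, y, z) \<in> triples \<Longrightarrow> wdeg Q [a x y, a y z, a z x] = 3 - int d"
  using triple_degrees[of x y z] by (simp add: wdeg_def)

lemma cyc_deriv_cycle:
  fixes c :: "'k::comm_ring_1"
  assumes t: "(p, q, r) \<in> triples" and xy: "x \<in> V" "y \<in> V" "x \<noteq> y" "fst x = fst y"
  shows "cyc_deriv Q (a x y) (monom_word [a p q, a q r, a r p] c) =
      (if (p, q) = (x, y) then monom_word [a q r, a r p] c else 0) +
      (if (q, r) = (x, y) then monom_word [a r p, a p q] (psign (int d * (1 - int (clock_dist d p q))) * c) else 0) +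
      (if (r, p) = (x, y) then monom_word [a p q, a q r] (psign (int d * (1 - int (clock_dist d r p))) * c) else 0)"
proof -
  note D = triplesD[OF t] and deg = triple_degrees[OF t]
  let ?c = "[a p q, a q r, a r p]"
  define h where "h n = scl (psign (wdeg Q (take n ?c) * wdeg Q (drop n ?c)))
     (word (drop (Suc n) ?c @ take n ?c) :: 'e list \<Rightarrow>\<^sub>0 'k)" for n
  have sgn: "psign (m * ((3 - int d) - m)) = (psign (int d * m) :: 'k)" for m
    by (rule psign_cong) (auto simp: algebra_simps)
  have h: "h 0 = word [a q r, a r p]"
    "h 1 = scl (psign (int d * (1 - int (clock_dist d p q)))) (word [a r p, a p q])"
    "h 2 = scl (psign (int d * (1 - int (clock_dist d r p)))) (word [a p q, a q r])"
  proof -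
    have e1: "wdeg Q [a q r, a r p] = (3 - int d) - (1 - int (clock_dist d p q))"
      and e2: "wdeg Q [a p q, a q r] = (3 - int d) - (1 - int (clock_dist d r p))"
      using deg by (simp_all add: wdeg_def)
    have e3: "wdeg Q [a p q] = 1 - int (clock_dist d p q)" "wdeg Q [a r p] = 1 - int (clock_dist d r p)"
      using deg by (simp_all add: wdeg_def)
    show "h 0 = word [a q r, a r p]" by (simp add: h_def wdeg_def psign_def)
    show "h 1 = scl (psign (int d * (1 - int (clock_dist d p q)))) (word [a r p, a p q])"
      using sgn[of "1 - int (clock_dist d p q)"] by (simp add: h_def e1 e3 numeral_2_eq_2)
    show "h 2 = scl (psign (int d * (1 - int (clock_dist d r p)))) (word [a p q, a q r])"
      using sgn[of "1 - int (clock_dist d r p)"] by (simp add: h_def e2 e3 numeral_2_eq_2 mult.commute)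
  qed
  have set: "{n. n < length ?c \<and> ?c ! n = \<phi>} = {n \<in> {0, 1, 2}. ?c ! n = \<phi>}" for \<phi>
    by (auto simp: less_Suc_eq numeral_2_eq_2)
  have sum: "(\<Sum>n\<in>{n. n < length ?c \<and> ?c ! n = \<phi>}. h n) =
      (if a p q = \<phi> then h 0 else 0) + (if a q r = \<phi> then h 1 else 0) + (if a r p = \<phi> then h 2 else 0)" for \<phi>
    unfolding set by (subst sum.inter_filter) (simp_all add: add.assoc)
  note iffs = a_eq_iff[OF D(1,2,4,7) xy] a_eq_iff[OF D(2,3,5,8) xy] a_eq_iff[OF D(3,1,6,9) xy]
  have c: "scl c (h 0) = monom_word [a q r, a r p] c"
    "scl c (h 1) = monom_word [a r p, a p q] (psign (int d * (1 - int (clock_dist d p q))) * c)"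
    "scl c (h 2) = monom_word [a p q, a q r] (psign (int d * (1 - int (clock_dist d r p))) * c)"
    unfolding h by (simp_all add: word_single mult.commute)
  show ?thesis
    unfolding cyc_deriv_def lin_single h_def[symmetric] sum iffs scl_add
    by (simp only: if_distrib[of "scl c"] c scl_simps)
qed

lemma triple_sum_fibre:
  "(\<Sum>(p, q, r)\<in>triples. if (p, q) = (x, y) then f p q r else 0) = (\<Sum>z | (x, y, z) \<in> triples. f x y z)"
    "(\<Sum>(p, q, r)\<in>triples. if (q, r) = (x, y) then f p q r else 0) = (\<Sum>z | (x, y, z) \<in> triples. f z x y)"
    "(\<Sum>(p, q, r)\<in>triples. if (r, p) = (x, y) then f p q r else 0) = (\<Sum>z | (x, y, z) \<in> triples. f y z x)"
proof -
  have "(\<Sum>(p, q, r)\<in>triples. if (p, q) = (x, y) then f p q r else 0) =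
      (\<Sum>t\<in>{t \<in> triples. case t of (p, q, r) \<Rightarrow> (p, q) = (x, y)}. case t of (p, q, r) \<Rightarrow> f p q r)"
    unfolding sum.inter_filter[OF finite_triples] by (intro sum.cong refl) (simp add: split_beta)
  also have "\<dots> = (\<Sum>z | (x, y, z) \<in> triples. f x y z)"
    by (rule sum.reindex_bij_witness[of _ "\<lambda>z. (x, y, z)" "\<lambda>(p, q, r). r"]) (auto dest: triplesD(10,11))
  finally show "(\<Sum>(p, q, r)\<in>triples. if (p, q) = (x, y) then f p q r else 0) = (\<Sum>z | (x, y, z) \<in> triples. f x y z)" .
  have "(\<Sum>(p, q, r)\<in>triples. if (q, r) = (x, y) then f p q r else 0) =
      (\<Sum>t\<in>{t \<in> triples. case t of (p, q, r) \<Rightarrow> (q, r) = (x, y)}. case t of (p, q, r) \<Rightarrow> f p q r)"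
    unfolding sum.inter_filter[OF finite_triples] by (intro sum.cong refl) (simp add: split_beta)
  also have "\<dots> = (\<Sum>z | (x, y, z) \<in> triples. f z x y)"
    by (rule sum.reindex_bij_witness[of _ "\<lambda>z. (z, x, y)" "\<lambda>(p, q, r). p"]) (auto dest: triplesD(10,11))
  finally show "(\<Sum>(p, q, r)\<in>triples. if (q, r) = (x, y) then f p q r else 0) = (\<Sum>z | (x, y, z) \<in> triples. f z x y)" .
  have "(\<Sum>(p, q, r)\<in>triples. if (r, p) = (x, y) then f p q r else 0) =
      (\<Sum>t\<in>{t \<in> triples. case t of (p, q, r) \<Rightarrow> (r, p) = (x, y)}. case t of (p, q, r) \<Rightarrow> f p q r)"
    unfolding sum.inter_filter[OF finite_triples] by (intro sum.cong refl) (simp add: split_beta)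
  also have "\<dots> = (\<Sum>z | (x, y, z) \<in> triples. f y z x)"
    by (rule sum.reindex_bij_witness[of _ "\<lambda>z. (y, z, x)" "\<lambda>(p, q, r). q"]) (auto dest: triplesD(10,11))
  finally show "(\<Sum>(p, q, r)\<in>triples. if (r, p) = (x, y) then f p q r else 0) = (\<Sum>z | (x, y, z) \<in> triples. f y z x)" .
qed

lemma cyc_deriv_tri:
  assumes xy: "x \<in> V" "y \<in> V" "x \<noteq> y" "fst x = fst y"
  shows "cyc_deriv Q (a x y) (tri_potential om) =
     (\<Sum>z | (x, y, z) \<in> triples. monom_word [a y z, a z x] (cyc_coeff d om x y z))"
proof -
  have "cyc_deriv Q (a x y) (tri_potential om) =
     (\<Sum>t\<in>triples. cyc_deriv Q (a x y) (case t of (p, q, r) \<Rightarrow> monom_word [a p q, a q r, a r p] (om p q r)))"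
    by (simp add: tri_potential_def cyc_deriv_def lin_sum)
  also have "\<dots> = (\<Sum>(p, q, r)\<in>triples.
      (if (p, q) = (x, y) then monom_word [a q r, a r p] (om p q r) else 0) +
      (if (q, r) = (x, y) then monom_word [a r p, a p q] (psign (int d * (1 - int (clock_dist d p q))) * om p q r) else 0) +
      (if (r, p) = (x, y) then monom_word [a p q, a q r] (psign (int d * (1 - int (clock_dist d r p))) * om p q r) else 0))"
  proof (intro sum.cong refl)
    fix t assume t: "t \<in> triples"
    obtain p q r where pqr: "t = (p, q, r)" by (cases t)
    show "cyc_deriv Q (a x y) (case t of (p, q, r) \<Rightarrow> monom_word [a p q, a q r, a r p] (om p q r)) =
      (case t of (p, q, r) \<Rightarrow> (if (p, q) = (x, y) then monom_word [a q r, a r p] (om p q r) else 0) +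
      (if (q, r) = (x, y) then monom_word [a r p, a p q] (psign (int d * (1 - int (clock_dist d p q))) * om p q r) else 0) +
      (if (r, p) = (x, y) then monom_word [a p q, a q r] (psign (int d * (1 - int (clock_dist d r p))) * om p q r) else 0))"
      unfolding pqr prod.case by (rule cyc_deriv_cycle[OF t[unfolded pqr] xy])
  qed
  also have "\<dots> = (\<Sum>(p, q, r)\<in>triples. if (p, q) = (x, y) then monom_word [a q r, a r p] (om p q r) else 0) +
      (\<Sum>(p, q, r)\<in>triples. if (q, r) = (x, y) then monom_word [a r p, a p q] (psign (int d * (1 - int (clock_dist d p q))) * om p q r) else 0) +
      (\<Sum>(p, q, r)\<in>triples. if (r, p) = (x, y) then monom_word [a p q, a q r] (psign (int d * (1 - int (clock_dist d r p))) * om p q r) else 0)"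
    by (simp only: case_prod_unfold sum.distrib)
  also have "\<dots> = (\<Sum>z | (x, y, z) \<in> triples. monom_word [a y z, a z x] (om x y z)) +
      (\<Sum>z | (x, y, z) \<in> triples. monom_word [a y z, a z x] (psign (int d * (1 - int (clock_dist d z x))) * om z x y)) +
      (\<Sum>z | (x, y, z) \<in> triples. monom_word [a y z, a z x] (psign (int d * (1 - int (clock_dist d x y))) * om y z x))"
    by (simp only: triple_sum_fibre)
  also have "\<dots> = (\<Sum>z | (x, y, z) \<in> triples. monom_word [a y z, a z x] (cyc_coeff d om x y z))"
    by (simp add: cyc_coeff_def single_add sum.distrib[symmetric] add.assoc add.commute add.left_commute)
  finally show ?thesis .
qed

lemma delta_arrow_tri:
  assumes xz: "x \<in> V" "z \<in> V" "x \<noteq> z" "fst x = fst z"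
  shows "delta_arrow d Q (tri_potential om) (a x z) =
     (\<Sum>y | (x, y, z) \<in> triples. monom_word [a x y, a y z] (struct_coeff d sg om x y z))"
proof -
  have set: "{y. (z, x, y) \<in> triples} = {y. (x, y, z) \<in> triples}" using triplesD(10,11) by blast
  have e: "deg Q (a x z) + 1 = 2 - int (clock_dist d x z)" using deg_a[OF xz] by simp
  show ?thesis
    unfolding delta_arrow_def opp_a[OF xz] cyc_deriv_tri[OF xz(2,1) xz(3)[symmetric] xz(4)[symmetric]] set scl_sum e
    by (intro sum.cong refl) (simp only: scl_single struct_coeff_def)
qed

lemma delta_word2:
  "delta d Q W (monom_word [\<alpha>, \<beta>] c) =
     scl c (delta_arrow d Q W \<alpha> * word [\<beta>] + scl (psign (deg Q \<alpha>)) (word [\<alpha>] * delta_arrow d Q W \<beta>))"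
  by (simp add: delta_def wdeg_def psign_def word_Nil lessThan_Suc add.commute numeral_2_eq_2)

lemma delta_word1: "delta d Q W (word [\<alpha>]) = delta_arrow d Q W \<alpha>"
  by (simp add: delta_def wdeg_def psign_def word_Nil word_single[of "[\<alpha>]"])

definition quads :: "side \<Rightarrow> side \<Rightarrow> (side \<times> side) set" where
  "quads x z = {(p, q). (x, q, z) \<in> triples \<and> (x, p, q) \<in> triples}"

lemma finite_quads: "finite (quads x z)"
  by (rule finite_subset[of _ "V \<times> V"]) (auto simp: quads_def finV dest: triplesD)

lemma quads_alt: "(p, q) \<in> quads x z \<longleftrightarrow> (x, p, z) \<in> triples \<and> (p, q, z) \<in> triples"
proof (cases "x \<in> V \<and> p \<in> V \<and> q \<in> V \<and> z \<in> V")
  case True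
  then have "clockwise d x q z \<and> clockwise d x p q \<longleftrightarrow> clockwise d x p z \<and> clockwise d p q z"
    using snd_less by (intro clockwise_quad) blast+
  then show ?thesis using True by (simp add: quads_def triples_def)
qed (auto simp: quads_def triples_def)

lemma delta_squared_tri:
  assumes xz: "x \<in> V" "z \<in> V" "x \<noteq> z" "fst x = fst z"
  shows "delta d Q (tri_potential om) (delta d Q (tri_potential om) (word [a x z])) =
     (\<Sum>(p, q)\<in>quads x z. monom_word [a x p, a p q, a q z] (quad_coeff d sg om x p q z))"
proof -
  let ?W = "tri_potential om" and ?s = "struct_coeff d sg om"
  let ?B = "\<lambda>x z. {y. (x, y, z) \<in> triples}"
  have fin: "finite (?B x z)" for x z by (rule finite_subset[of _ V]) (auto simp: finV dest: triplesD)
  have "delta d Q ?W (delta d Q ?W (word [a x z])) =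
      (\<Sum>y\<in>?B x z. delta d Q ?W (monom_word [a x y, a y z] (?s x y z)))"
    unfolding delta_word1 delta_arrow_tri[OF xz] by (simp add: delta_def lin_sum)
  also have "\<dots> = (\<Sum>y\<in>?B x z. (\<Sum>p\<in>?B x y. monom_word [a x p, a p y, a y z] (?s x y z * ?s x p y)) +
      (\<Sum>q\<in>?B y z. monom_word [a x y, a y q, a q z] (psign (1 - int (clock_dist d x y)) * (?s x y z * ?s y q z))))"
  proof (intro sum.cong refl)
    fix y assume "y \<in> ?B x z"
    then have t: "(x, y, z) \<in> triples" by simp
    note D = triplesD[OF t]
    have "delta_arrow d Q ?W (a x y) * word [a y z] = (\<Sum>p\<in>?B x y. monom_word [a x p, a p y, a y z] (?s x p y))"
      using D by (subst delta_arrow_tri) (auto simp: sum_distrib_right word_single single_times_word)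
    moreover have "word [a x y] * delta_arrow d Q ?W (a y z) = (\<Sum>q\<in>?B y z. monom_word [a x y, a y q, a q z] (?s y q z))"
      using D by (subst delta_arrow_tri) (auto simp: sum_distrib_left word_single single_times_word)
    ultimately show "delta d Q ?W (monom_word [a x y, a y z] (?s x y z)) =
      (\<Sum>p\<in>?B x y. monom_word [a x p, a p y, a y z] (?s x y z * ?s x p y)) +
      (\<Sum>q\<in>?B y z. monom_word [a x y, a y q, a q z] (psign (1 - int (clock_dist d x y)) * (?s x y z * ?s y q z)))"
      unfolding delta_word2 using triple_degrees(1)[OF t] by (simp add: scl_add scl_sum scl_scl mult_ac)
  qed
  also have "\<dots> = (\<Sum>(y, p)\<in>Sigma (?B x z) (?B x). monom_word [a x p, a p y, a y z] (?s x y z * ?s x p y)) +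
      (\<Sum>(y, q)\<in>Sigma (?B x z) (\<lambda>y. ?B y z). monom_word [a x y, a y q, a q z] (psign (1 - int (clock_dist d x y)) * (?s x y z * ?s y q z)))"
    using fin by (simp add: sum.distrib sum.Sigma)
  also have "(\<Sum>(y, p)\<in>Sigma (?B x z) (?B x). monom_word [a x p, a p y, a y z] (?s x y z * ?s x p y)) =
      (\<Sum>(p, q)\<in>quads x z. monom_word [a x p, a p q, a q z] (?s x q z * ?s x p q))"
    by (rule sum.reindex_bij_witness[of _ prod.swap prod.swap]) (auto simp: quads_def)
  also have "Sigma (?B x z) (\<lambda>y. ?B y z) = quads x z"
    by (rule set_eqI, case_tac xa) (simp only: mem_Sigma_iff mem_Collect_eq quads_alt)
  finally show ?thesis by (simp add: quad_coeff_def single_add sum.distrib[symmetric] split_beta)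
qed

text \<open>
  A path through a clockwise quadruple \<open>x, p, q, z\<close> arises in \<open>\<delta>\<^sup>2
  (a x z)\<close> in exactly two ways, from the triangles \<open>(x, q, z)\<close>, \<open>(x, p,
  q)\<close> and from the triangles \<open>(x, p, z)\<close>, \<open>(p, q, z)\<close>. Different
  quadruples give different words, so no cancellation takes place between them.
\<close>

theorem bracket_zero_iff:
  "bracket_zero d Q (tri_potential om) \<longleftrightarrow>
     (\<forall>x z p q. (x, q, z) \<in> triples \<longrightarrow> (x, p, q) \<in> triples \<longrightarrow> quad_coeff d sg om x p q z = 0)"
proof -
  have eq0: "(\<Sum>(p, q)\<in>quads x z. monom_word [a x p, a p q, a q z] (quad_coeff d sg om x p q z)) = 0 \<longleftrightarrow>
      (\<forall>(p, q)\<in>quads x z. quad_coeff d sg om x p q z = 0)" for x z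
  proof
    assume 0: "(\<Sum>(p, q)\<in>quads x z. monom_word [a x p, a p q, a q z] (quad_coeff d sg om x p q z)) = 0"
    show "\<forall>(p, q)\<in>quads x z. quad_coeff d sg om x p q z = 0"
    proof (clarify)
      fix p q assume pq: "(p, q) \<in> quads x z"
      then have t: "(x, q, z) \<in> triples" "(x, p, q) \<in> triples" by (auto simp: quads_def)
      have "0 = (\<Sum>(p', q')\<in>quads x z. Poly_Mapping.lookup (monom_word [a x p', a p' q', a q' z] (quad_coeff d sg om x p' q' z))
          [a x p, a p q, a q z])"
        using arg_cong[OF 0, of "\<lambda>X. Poly_Mapping.lookup X [a x p, a p q, a q z]"]
        by (simp add: lookup_sum split_beta)
      also have "\<dots> = (\<Sum>pq'\<in>quads x z. if pq' = (p, q) then quad_coeff d sg om x p q z else 0)"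
      proof (intro sum.cong refl)
        fix pq' assume "pq' \<in> quads x z"
        then obtain p' q' where pq': "pq' = (p', q')" "(x, q', z) \<in> triples" "(x, p', q') \<in> triples"
          by (auto simp: quads_def)
        have "[a x p', a p' q', a q' z] = [a x p, a p q, a q z] \<longleftrightarrow> (p', q') = (p, q)"
          using a_eq_iff[OF triplesD(1,2,4,7)[OF pq'(3)] triplesD(1,2,4,7)[OF t(2)]]
            a_eq_iff[OF triplesD(2,3,5,8)[OF pq'(2)] triplesD(2,3,5,8)[OF t(1)]] by auto
        then show "(case pq' of (p', q') \<Rightarrow> Poly_Mapping.lookup (monom_word [a x p', a p' q', a q' z] (quad_coeff d sg om x p' q' z))
          [a x p, a p q, a q z]) = (if pq' = (p, q) then quad_coeff d sg om x p q z else 0)"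
          unfolding pq'(1) by (auto simp: lookup_single when_def)
      qed
      also have "\<dots> = quad_coeff d sg om x p q z" using pq finite_quads by simp
      finally show "quad_coeff d sg om x p q z = 0" by simp
    qed
  qed (auto intro!: sum.neutral)
  have *: "delta d Q (tri_potential om) (delta d Q (tri_potential om) (word [a x z])) = 0 \<longleftrightarrow>
      (\<forall>(p, q)\<in>quads x z. quad_coeff d sg om x p q z = 0)" if "x \<in> V" "z \<in> V" "x \<noteq> z" "fst x = fst z" for x z
    unfolding delta_squared_tri[OF that] by (rule eq0)
  show ?thesis
  proof
    assume b: "bracket_zero d Q (tri_potential om)"
    show "\<forall>x z p q. (x, q, z) \<in> triples \<longrightarrow> (x, p, q) \<in> triples \<longrightarrow> quad_coeff d sg om x p q z = 0"
    proof (intro allI impI)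
      fix x z p q assume t: "(x, q, z) \<in> triples" "(x, p, q) \<in> triples"
      note D = triplesD[OF t(1)]
      have xz: "x \<in> V" "z \<in> V" "x \<noteq> z" "fst x = fst z" using D by simp_all
      then have "a x z \<in> arrs Q" unfolding arrs_eq by blast
      then have "\<forall>(p, q)\<in>quads x z. quad_coeff d sg om x p q z = 0"
        using b *[OF xz] unfolding bracket_zero_def by blast
      from bspec[OF this, of "(p, q)"] show "quad_coeff d sg om x p q z = 0" using t by (simp add: quads_def)
    qed
  next
    assume q: "\<forall>x z p q. (x, q, z) \<in> triples \<longrightarrow> (x, p, q) \<in> triples \<longrightarrow> quad_coeff d sg om x p q z = 0"
    show "bracket_zero d Q (tri_potential om)"
      unfolding bracket_zero_def
    proof
      fix \<phi> assume "\<phi> \<in> arrs Q"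
      then obtain x z where \<phi>: "\<phi> = a x z" and xz: "x \<in> V" "z \<in> V" "x \<noteq> z" "fst x = fst z"
        unfolding arrs_eq by blast
      have "\<forall>(p, q)\<in>quads x z. quad_coeff d sg om x p q z = 0" unfolding quads_def using q by blast
      then show "delta d Q (tri_potential om) (delta d Q (tri_potential om) (word [\<phi>])) = 0"
        unfolding \<phi> using *[OF xz] by simp
    qed
  qed
qed

end

section \<open>Signs under the flip\<close>

lemma psign_mult: "psign m * psign n = psign (m + n)"
  by (simp add: psign_add)

lemma psign_mult_left: "psign m * (psign n * x) = psign (m + n) * x"
  by (simp add: psign_add mult.assoc)

lemma psign_Suc: "psign (m + 1) = - psign m" "psign (1 + m) = - psign m"
  by (simp_all add: psign_def)

locale flip_sides =
  fixes d :: nat and u w :: side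
  assumes d3: "3 \<le> d" and uw: "snd u < d" "snd w < d"
    and dist: "u \<noteq> w" "next_side d u \<noteq> w" "next_side d w \<noteq> u"
begin

text \<open>The side of the old polygons at which an arrow of the flipped polygons is read off.\<close>

definition core :: "side \<Rightarrow> side" where
  "core x = (if x = next_side d u then u else if x = next_side d w then w else x)"

definition step :: "side \<Rightarrow> int" where
  "step x = (if x = next_side d u \<or> x = next_side d w then 1 else 0)"

text \<open>
  The sign with which factors from \<open>A\<close> enter through \<open>\<Delta>\<close>: they
  occur exactly at the new sides \<open>u\<close> and \<open>w\<close>.
\<close>

definition ear_sign :: "side \<Rightarrow> 'k::comm_ring_1" where
  "ear_sign x = (if x = u \<or> x = w then - 1 else 1)"

abbreviation cd :: "side \<Rightarrow> side \<Rightarrow> int" where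
  "cd x y \<equiv> int (clock_dist d x y)"

lemma next_facts: "snd (next_side d u) < d" "snd (next_side d w) < d" "fst (next_side d x) = fst x"
  "next_side d u \<noteq> u" "next_side d w \<noteq> w" "next_side d u \<noteq> next_side d w"
proof -
  show "snd (next_side d u) < d" "snd (next_side d w) < d" "fst (next_side d x) = fst x"
    using d3 by (simp_all add: next_side_def)
  have ne: "Suc m mod d \<noteq> m" if "m < d" for m using that d3 by (auto simp: mod_Suc)
  show "next_side d u \<noteq> u" "next_side d w \<noteq> w"
    using ne uw by (auto simp: next_side_def prod_eq_iff)
  show "next_side d u \<noteq> next_side d w"
  proof
    assume e: "next_side d u = next_side d w"
    then have "Suc (snd u) mod d = Suc (snd w) mod d" "fst u = fst w" by (simp_all add: next_side_def)
    moreover from this(1) have "snd u = snd w" using uw by (simp add: mod_Suc split: if_splits)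
    ultimately show False using dist(1) by (simp add: prod_eq_iff)
  qed
qed

lemma core_simps [simp]:
  "core u = u" "core w = w" "core (next_side d u) = u" "core (next_side d w) = w"
  "step u = 0" "step w = 0" "step (next_side d u) = 1" "step (next_side d w) = 1"
  "fst (core x) = fst x"
  using next_facts dist next_facts(3)[of u] next_facts(3)[of w] by (auto simp: core_def step_def)

lemma core_snd: "snd x < d \<Longrightarrow> snd (core x) < d"
  using uw by (simp add: core_def)

lemma step_cases: "step x = 0 \<and> core x = x \<or> step x = 1 \<and> x = next_side d (core x) \<and> (core x = u \<or> core x = w)"
  by (auto simp: core_def step_def)

lemma clock_dist_eq_iff: "\<lbrakk>snd x < d; snd y < d; snd z < d; fst x = fst y; fst x = fst z\<rbrakk> \<Longrightarrow>
   cd x y = cd x z \<longleftrightarrow> y = z"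
  by (auto simp: clock_dist_alt prod_eq_iff split: if_splits)

lemma clock_dist_pos: "\<lbrakk>snd x < d; snd y < d; fst x = fst y; x \<noteq> y\<rbrakk> \<Longrightarrow> 0 < clock_dist d x y \<and> clock_dist d x y < d"
  by (auto simp: clock_dist_alt prod_eq_iff split: if_splits)

lemma clock_dist_sum: "\<lbrakk>snd x < d; snd y < d; fst x = fst y; x \<noteq> y\<rbrakk> \<Longrightarrow> cd x y + cd y x = int d"
  by (auto simp: clock_dist_alt prod_eq_iff split: if_splits)

lemma clock_dist_next:
  assumes "snd x < d" "snd y < d" "fst x = fst y"
  shows "y \<noteq> next_side d x \<Longrightarrow> cd (next_side d x) y = cd x y + 1"
    "x \<noteq> y \<Longrightarrow> cd x (next_side d y) = cd x y - 1"
proof -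
  have n: "snd (next_side d z) = (if Suc (snd z) = d then 0 else Suc (snd z))" if "snd z < d" for z
    using that by (auto simp: next_side_def)
  have nd: "snd (next_side d z) < d" for z using d3 by (simp add: next_side_def)
  show "cd (next_side d x) y = cd x y + 1" if "y \<noteq> next_side d x"
  proof -
    have "snd y \<noteq> snd (next_side d x)" using that assms(3) by (auto simp: next_side_def prod_eq_iff)
    then show ?thesis using assms n[OF assms(1)] nd
      by (auto simp: clock_dist_alt split: if_splits)
  qed
  show "cd x (next_side d y) = cd x y - 1" if "x \<noteq> y"
  proof -
    have "snd x \<noteq> snd y" using that assms(3) by (auto simp: prod_eq_iff)
    then show ?thesis using assms n[OF assms(2)] nd
      by (auto simp: clock_dist_alt split: if_splits)
  qed
qed

lemma clock_dist_core:
  assumes "snd x < d" "snd y < d" "fst x = fst y" "core x \<noteq> core y"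
  shows "cd x y = cd (core x) (core y) + step x - step y"
proof -
  have c: "snd (core x) < d" "snd (core y) < d" "fst (core x) = fst (core y)"
    using core_snd assms by auto
  have 1: "cd x y = cd (core x) y + step x"
    using step_cases[of x]
  proof
    assume s: "step x = 1 \<and> x = next_side d (core x) \<and> (core x = u \<or> core x = w)"
    then have "y \<noteq> next_side d (core x)" using assms(4) by auto
    then show ?thesis using clock_dist_next(1)[of "core x" y] c assms s by simp
  qed simp
  have 2: "cd (core x) y = cd (core x) (core y) - step y"
    using step_cases[of y]
  proof
    assume s: "step y = 1 \<and> y = next_side d (core y) \<and> (core y = u \<or> core y = w)"
    then show ?thesis using clock_dist_next(2)[of "core x" "core y"] c assms by simp
  qed simp
  show ?thesis using 1 2 by simp
qed

lemma clockwise_core: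
  assumes s: "snd x < d" "snd y < d" "snd z < d"
    and n: "core x \<noteq> core y" "core y \<noteq> core z" "core x \<noteq> core z"
  shows "clockwise d x y z \<longleftrightarrow> clockwise d (core x) (core y) (core z)"
proof (cases "fst x = fst y \<and> fst x = fst z")
  case True
  have c: "snd (core x) < d" "snd (core y) < d" "snd (core z) < d"
    "fst (core x) = fst (core y)" "fst (core x) = fst (core z)"
    using core_snd s True by auto
  have xy: "cd x y = cd (core x) (core y) + step x - step y" and xz: "cd x z = cd (core x) (core z) + step x - step z"
    using clock_dist_core s True n by auto
  have p: "0 < clock_dist d x y" "0 < clock_dist d (core x) (core y)"
    using clock_dist_pos s c True n by (metis)+
  have ne: "cd (core x) (core y) \<noteq> cd (core x) (core z)" "cd x y \<noteq> cd x z"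
    using clock_dist_eq_iff[of "core x" "core y" "core z"] clock_dist_eq_iff[of x y z] c s True n by auto
  have "step y = 0 \<or> step y = 1" "step z = 0 \<or> step z = 1" using step_cases by blast+
  then show ?thesis using True p ne xy xz by (auto simp: clockwise_def)
qed (auto simp: clockwise_def)

lemma same_core_next:
  assumes "snd x < d" "snd y < d" "x \<noteq> y" "core x = core y"
  shows "\<exists>X. (X = u \<or> X = w) \<and> (x = next_side d X \<and> y = X \<or> x = X \<and> y = next_side d X)"
  using step_cases[of x] step_cases[of y] assms by metis

text \<open>Same-core sides are neighbours, so in a clockwise quadruple they can only be cyclically consecutive.\<close>

lemma same_core_clockwise:
  assumes s: "snd x < d" "snd y < d" "snd z < d" and cw: "clockwise d x y z" and c: "core x = core y"
  shows "\<exists>X. (X = u \<or> X = w) \<and> x = next_side d X \<and> y = X"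
proof -
  have "x \<noteq> y" using clockwise_distinct[OF s cw] by simp
  then obtain X where X: "X = u \<or> X = w" "x = next_side d X \<and> y = X \<or> x = X \<and> y = next_side d X"
    using same_core_next[OF s(1,2) _ c] by blast
  have sX: "snd X < d" using X(1) uw by auto
  have "cd x y < cd x z" "cd x z < int d"
    using cw clock_dist_pos[OF s(1,3)] clockwise_distinct[OF s cw] by (simp_all add: clockwise_def)
  moreover have "cd X (next_side d X) = int d - 1"
    using clock_dist_next(1)[OF sX sX] clock_dist_sum[of "next_side d X" X] next_facts sX X(1) clock_dist_alt[OF sX sX]
    by auto
  ultimately have "\<not> (x = X \<and> y = next_side d X)" by auto
  then show ?thesis using X by blast
qed

end

text \<open>
  The signs of the mutated quiver in terms of the old ones, separated from the quivers so that the
  quadruple relations become a matter of arithmetic.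
\<close>

locale flip_signs = flip_sides +
  fixes V V' :: "side set" and sg sg' :: "side \<Rightarrow> side \<Rightarrow> int"
    and om om' :: "side \<Rightarrow> side \<Rightarrow> side \<Rightarrow> 'k::comm_ring_1"
  assumes sndV: "x \<in> V \<Longrightarrow> snd x < d" and sndV': "x \<in> V' \<Longrightarrow> snd x < d"
    and coreV: "x \<in> V' \<Longrightarrow> core x \<in> V"
    and sg_one: "\<lbrakk>x \<in> V; y \<in> V; x \<noteq> y; fst x = fst y\<rbrakk> \<Longrightarrow> sg x y = 1 \<or> sg x y = - 1"
    and sg_op: "\<lbrakk>x \<in> V; y \<in> V; x \<noteq> y; fst x = fst y\<rbrakk> \<Longrightarrow>
        sg x y * sg y x = - psign ((1 - int (clock_dist d x y)) * (1 - int (clock_dist d y x)))"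
    and sg'_core: "\<lbrakk>x \<in> V'; y \<in> V'; core x \<noteq> core y; fst x = fst y\<rbrakk> \<Longrightarrow>
        sg' x y = ear_sign x * ear_sign y * psign ((int d + 1) * step x) * sg (core x) (core y)"
    and sg'_ear: "X = u \<or> X = w \<Longrightarrow> sg' (next_side d X) X = 1" "X = u \<or> X = w \<Longrightarrow> sg' X (next_side d X) = - 1"
    and om'_core: "\<lbrakk>x \<in> V'; y \<in> V'; z \<in> V'; core x \<noteq> core y; core y \<noteq> core z; core x \<noteq> core z; clockwise d x y z\<rbrakk> \<Longrightarrow>
        om' x y z = ear_sign x * ear_sign y * ear_sign z * psign (int d * step x) * om (core x) (core y) (core z)"
    and om'_ear: "\<lbrakk>X = u \<or> X = w; X \<in> V'; y \<in> V'; core y \<noteq> X; fst y = fst X\<rbrakk> \<Longrightarrow>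
        om' X y (next_side d X) = psign (int d + 1) * of_int (sg X (core y)) * ear_sign y"
      "\<lbrakk>X = u \<or> X = w; X \<in> V'; y \<in> V'; core y \<noteq> X; fst y = fst X\<rbrakk> \<Longrightarrow> om' (next_side d X) X y = 0"
      "\<lbrakk>X = u \<or> X = w; X \<in> V'; y \<in> V'; core y \<noteq> X; fst y = fst X\<rbrakk> \<Longrightarrow> om' y (next_side d X) X = 0"
    and old: "\<lbrakk>x \<in> V; p \<in> V; q \<in> V; z \<in> V; clockwise d x q z; clockwise d x p q\<rbrakk> \<Longrightarrow> quad_coeff d sg om x p q z = 0"
begin

abbreviation (input) "st \<equiv> struct_coeff d sg om"
abbreviation (input) "st' \<equiv> struct_coeff d sg' om'"

lemma ear_sign_sq: "ear_sign x * ear_sign x = (1 :: 'k)" "ear_sign x * (ear_sign x * c) = (c :: 'k)"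
  by (auto simp: ear_sign_def)

lemma of_int_ear_sign [simp]: "of_int (ear_sign x) = (ear_sign x :: 'k)"
  by (auto simp: ear_sign_def)

lemma sg_sq: "\<lbrakk>x \<in> V; y \<in> V; x \<noteq> y; fst x = fst y\<rbrakk> \<Longrightarrow> of_int (sg x y) * of_int (sg x y) = (1 :: 'k)"
  using sg_one[of x y] by auto

lemma cyc_coeff_rotate:
  assumes "snd x < d" "snd y < d" "snd z < d" "clockwise d x y z"
  shows "cyc_coeff d om y z x = psign (int d * (1 - cd x y)) * cyc_coeff d om x y z"
proof -
  have "cd x y + cd y z + cd z x = int d"
    using clock_dist_add[OF assms] by linarith
  then have "cd y z = int d - cd x y - cd z x" by simp
  then show ?thesis
    by (simp add: cyc_coeff_def distrib_left psign_mult psign_mult_left)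
      (auto simp: psign_def algebra_simps)
qed

lemma cyc_coeff_core:
  assumes V: "x \<in> V'" "y \<in> V'" "z \<in> V'" and c: "core x \<noteq> core y" "core y \<noteq> core z" "core x \<noteq> core z"
    and cw: "clockwise d x y z"
  shows "cyc_coeff d om' x y z =
     ear_sign x * ear_sign y * ear_sign z * psign (int d * step x) * cyc_coeff d om (core x) (core y) (core z)"
proof -
  note s = sndV'[OF V(1)] sndV'[OF V(2)] sndV'[OF V(3)]
  have cw2: "clockwise d y z x" using clockwise_rotate[OF s cw] .
  have cw3: "clockwise d z x y" using clockwise_rotate[OF s(2,3,1) cw2] .
  have f: "fst x = fst y" "fst z = fst x" using cw by (auto simp: clockwise_def)
  have xy: "cd x y = cd (core x) (core y) + step x - step y"
    using clock_dist_core[OF s(1,2) f(1) c(1)] .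
  have zx: "cd z x = cd (core z) (core x) + step z - step x"
    using clock_dist_core[OF s(3,1) f(2) c(3)[symmetric]] .
  have p1: "psign (int d * (1 - cd x y)) * (psign (int d * step y) * t) =
      psign (int d * step x) * (psign (int d * (1 - cd (core x) (core y))) * t)" for t :: 'k
    unfolding psign_mult_left xy by (intro arg_cong2[of _ _ _ _ "(*)"] psign_cong refl) (simp add: algebra_simps)
  have p2: "psign (int d * (1 - cd z x)) * (psign (int d * step z) * t) =
      psign (int d * step x) * (psign (int d * (1 - cd (core z) (core x))) * t)" for t :: 'k
    unfolding psign_mult_left zx by (intro arg_cong2[of _ _ _ _ "(*)"] psign_cong refl) (simp add: algebra_simps)
  have o2: "om' y z x = ear_sign x * (ear_sign y * (ear_sign z * (psign (int d * step y) * om (core y) (core z) (core x))))"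
    using om'_core[OF V(2,3,1) c(2) c(3)[symmetric] c(1)[symmetric] cw2] by (simp add: mult_ac)
  have o3: "om' z x y = ear_sign x * (ear_sign y * (ear_sign z * (psign (int d * step z) * om (core z) (core x) (core y))))"
    using om'_core[OF V(3,1,2) c(3)[symmetric] c(1) c(2)[symmetric] cw3] by (simp add: mult_ac)
  have "psign (int d * (1 - cd x y)) * om' y z x =
     ear_sign x * (ear_sign y * (ear_sign z * (psign (int d * step x) * (psign (int d * (1 - cd (core x) (core y))) * om (core y) (core z) (core x)))))"
    unfolding o2 p1[symmetric] by (simp only: mult_ac)
  moreover have "psign (int d * (1 - cd z x)) * om' z x y =
     ear_sign x * (ear_sign y * (ear_sign z * (psign (int d * step x) * (psign (int d * (1 - cd (core z) (core x))) * om (core z) (core x) (core y)))))"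
    unfolding o3 p2[symmetric] by (simp only: mult_ac)
  moreover have "om' x y z = ear_sign x * (ear_sign y * (ear_sign z * (psign (int d * step x) * om (core x) (core y) (core z))))"
    using om'_core[OF V c cw] by (simp add: mult.assoc)
  ultimately show ?thesis unfolding cyc_coeff_def by (simp only: distrib_left mult.assoc)
qed

lemma struct_core:
  assumes V: "x \<in> V'" "y \<in> V'" "z \<in> V'" and c: "core x \<noteq> core y" "core y \<noteq> core z" "core x \<noteq> core z"
    and cw: "clockwise d x y z"
  shows "st' x y z = ear_sign y * psign (step x) * st (core x) (core y) (core z)"
proof -
  note s = sndV'[OF V(1)] sndV'[OF V(2)] sndV'[OF V(3)]
  have cw2: "clockwise d y z x" using clockwise_rotate[OF s cw] .
  have cw3: "clockwise d z x y" using clockwise_rotate[OF s(2,3,1) cw2] .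
  have f: "fst x = fst z" using cw by (auto simp: clockwise_def)
  have xz: "cd x z = cd (core x) (core z) + step x - step z"
    using clock_dist_core[OF s(1,3) f c(3)] .
  have ps: "psign (int d * (2 - cd x z)) * (psign ((int d + 1) * step x) * (psign (int d * step z) * t)) =
      psign (step x) * (psign (int d * (2 - cd (core x) (core z))) * t)" for t :: 'k
    unfolding psign_mult_left xz by (intro arg_cong2[of _ _ _ _ "(*)"] psign_cong refl) (simp add: algebra_simps)
  have "st' x y z = psign (int d * (2 - cd x z)) *
      of_int (ear_sign x * ear_sign z * psign ((int d + 1) * step x) * sg (core x) (core z)) *
      (ear_sign z * ear_sign x * ear_sign y * psign (int d * step z) * cyc_coeff d om (core z) (core x) (core y))"
    unfolding struct_coeff_def sg'_core[OF V(1,3) c(3) f]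
      cyc_coeff_core[OF V(3,1,2) c(3)[symmetric] c(1) c(2)[symmetric] cw3] ..
  also have "\<dots> = (ear_sign x * ear_sign x) * (ear_sign z * ear_sign z) * ear_sign y *
      (psign (int d * (2 - cd x z)) * (psign ((int d + 1) * step x) * (psign (int d * step z) *
      (of_int (sg (core x) (core z)) * cyc_coeff d om (core z) (core x) (core y)))))"
    by (simp add: mult_ac)
  also have "\<dots> = ear_sign y * psign (step x) * st (core x) (core y) (core z)"
    unfolding ps ear_sign_sq by (simp add: struct_coeff_def mult_ac)
  finally show ?thesis .
qed

lemma ear_dist:
  assumes X: "X = u \<or> X = w" and y: "snd y < d" "fst y = fst X" "core y \<noteq> X"
  shows "cd (next_side d X) X = 1" "cd X (next_side d X) = int d - 1"
    "cd (next_side d X) y = cd X y + 1" "cd y X = cd y (next_side d X) + 1"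
    "cd X y + cd y X = int d" "clockwise d (next_side d X) X y" "clockwise d X y (next_side d X)"
    "clockwise d y (next_side d X) X"
proof -
  have sX: "snd X < d" and nX: "snd (next_side d X) < d" "next_side d X \<noteq> X" using X uw next_facts by auto
  have yX: "y \<noteq> X" "y \<noteq> next_side d X" using X y(3) by auto
  have XX: "cd X X = 0" using sX by (simp add: clock_dist_alt)
  show 1: "cd (next_side d X) X = 1" using clock_dist_next(1)[OF sX sX] nX XX by simp
  show 2: "cd (next_side d X) y = cd X y + 1" using clock_dist_next(1)[OF sX y(1)] y yX by simp
  show "cd y X = cd y (next_side d X) + 1" using clock_dist_next(2)[OF y(1) sX] y yX by simp
  have pos: "0 < cd X y" using clock_dist_pos[OF sX y(1)] y yX by simp
  note add = clock_dist_sum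
  show "cd X (next_side d X) = int d - 1" using add[OF sX nX(1)] nX(2) 1 next_facts(3)[of X] by simp
  show "cd X y + cd y X = int d" using add[OF sX y(1)] y yX by simp
  show c: "clockwise d (next_side d X) X y" using 1 2 pos y next_facts(3)[of X] by (simp add: clockwise_def)
  show c2: "clockwise d X y (next_side d X)" using clockwise_rotate[OF nX(1) sX y(1) c] .
  show "clockwise d y (next_side d X) X" using clockwise_rotate[OF sX y(1) nX(1) c2] .
qed

lemma struct_ear:
  assumes X: "X = u \<or> X = w" and V: "X \<in> V'" "next_side d X \<in> V'" "y \<in> V'" and y: "fst y = fst X" "core y \<noteq> X"
  shows "st' (next_side d X) X y = 1"
    "st' X y (next_side d X) = psign (int d) * of_int (sg X (core y)) * ear_sign y"
    "st' y (next_side d X) X = psign (cd y X)"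
proof -
  let ?n = "next_side d X"
  have sy: "snd y < d" using sndV' V by blast
  note D = ear_dist[OF X sy y]
  have cX: "core X = X" "core ?n = X" "step ?n = 1" "step X = 0" using X by auto
  have XV: "X \<in> V" "core y \<in> V" "X \<noteq> core y" "fst X = fst (core y)"
    using coreV[OF V(1)] coreV[OF V(3)] y(1) y(2)[symmetric] cX(1) by simp_all
  define t :: 'k where "t = psign (int d + 1) * of_int (sg X (core y)) * ear_sign y"
  have om: "om' X y ?n = t" "om' ?n X y = 0" "om' y ?n X = 0"
    using om'_ear[OF X V(1,3) y(2,1)] by (auto simp: t_def)
  have e: "cyc_coeff d om' ?n X y = t" "cyc_coeff d om' X y ?n = t"
    "cyc_coeff d om' y ?n X = psign (int d * (1 - cd X y)) * t"
    unfolding cyc_coeff_def om D(1) by (simp_all add: psign_def)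
  have sq: "t * t = 1"
    unfolding t_def using sg_sq[OF XV] ear_sign_sq by (simp add: psign_def mult_ac)
  have nX: "?n \<noteq> u" "?n \<noteq> w" using X next_facts(4,5) dist(2,3) by (elim disjE; simp)+
  have en: "ear_sign ?n = (1 :: int)" "ear_sign X = (- 1 :: int)" using nX X by (simp_all add: ear_sign_def)
  have fn: "fst ?n = fst y" using y(1) next_facts(3)[of X] by simp
  have "sg' ?n y = ear_sign y * psign (int d + 1) * sg X (core y)"
    using sg'_core[OF V(2,3) _ fn] y(2) cX en(1) by simp
  then have sgnX: "of_int (sg' ?n y) = t" by (simp add: t_def mult_ac)
  have "st' ?n X y = psign (int d * (2 - (cd X y + 1))) * psign (int d * (1 - cd X y)) * (t * t)"
    unfolding struct_coeff_def e sgnX D(3) by (simp add: mult_ac)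
  then show "st' ?n X y = 1" unfolding sq psign_mult by (simp add: psign_def algebra_simps)
  show "st' X y ?n = psign (int d) * of_int (sg X (core y)) * ear_sign y"
    unfolding struct_coeff_def e D(2) sg'_ear(2)[OF X] t_def by (auto simp: psign_def)
  have sgyX: "sg' y X = - ear_sign y * psign ((int d + 1) * step y) * sg (core y) X"
    using sg'_core[OF V(3,1) _ y(1)] cX y(2) en(2) by simp
  have op: "of_int (sg X (core y)) * of_int (sg (core y) X) =
      (- psign ((1 - cd X (core y)) * (1 - cd (core y) X)) :: 'k)"
    using arg_cong[OF sg_op[OF XV], of "of_int :: int \<Rightarrow> 'k"] by simp
  have "cd y X = cd (core y) X + step y - step X"
    using clock_dist_core[of y X, OF sy sndV'[OF V(1)] y(1)] cX y(2) by simp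
  then have cy: "cd (core y) X = cd y X - step y" using cX by simp
  have cy': "cd X (core y) = int d - cd y X + step y"
    using clock_dist_sum[OF sndV'[OF V(1)] core_snd[OF sy] XV(4,3)] cy by simp
  have "st' y ?n X = psign (int d * (2 - cd y X)) * of_int (sg' y X) * t"
    unfolding struct_coeff_def e ..
  also have "\<dots> = - (ear_sign y * ear_sign y) * (psign (int d * (2 - cd y X)) * psign ((int d + 1) * step y) * psign (int d + 1)
      * (of_int (sg X (core y)) * of_int (sg (core y) X)))"
    unfolding sgyX t_def by (simp add: mult_ac)
  also have "\<dots> = psign (cd y X)"
    unfolding op cy cy' ear_sign_sq using step_cases[of y] by (auto simp: psign_def)
  finally show "st' y ?n X = psign (cd y X)" .
qed

lemma ear_sign_next: "X = u \<or> X = w \<Longrightarrow> ear_sign (next_side d X) = (1 :: 'k)" "X = u \<or> X = w \<Longrightarrow> ear_sign X = (- 1 :: 'k)"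
  using next_facts(4,5) dist(2,3) by (auto simp: ear_sign_def)

text \<open>
  For four different cores the new relation is the old one up to a common sign. Otherwise both
  sides of an ear occur as cyclic neighbours, and the formulas for the coefficients at an ear make
  the two products cancel.
\<close>

lemma quad_flip:
  assumes V: "x \<in> V'" "p \<in> V'" "q \<in> V'" "z \<in> V'"
    and cw1: "clockwise d x q z" and cw2: "clockwise d x p q"
  shows "quad_coeff d sg' om' x p q z = 0"
proof -
  note s = sndV'[OF V(1)] sndV'[OF V(2)] sndV'[OF V(3)] sndV'[OF V(4)]
  have cw3: "clockwise d x p z" and cw4: "clockwise d p q z"
    using clockwise_quad[OF s] cw1 cw2 by auto
  have f: "fst p = fst x" "fst q = fst x" "fst z = fst x"
    using cw1 cw2 by (auto simp: clockwise_def)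
  have nxt: "cd (next_side d X) X = 1" if "X = u \<or> X = w" for X
  proof -
    have "snd X < d" "next_side d X \<noteq> X" using that uw next_facts by auto
    then show ?thesis using clock_dist_next(1)[of X X] by (simp add: clock_dist_alt)
  qed
  have xq: "core x \<noteq> core q"
  proof
    assume "core x = core q"
    then have "cd x q = 1" using same_core_clockwise[OF s(1,3,4) cw1] nxt by auto
    then show False using cw2 by (auto simp: clockwise_def)
  qed
  have pz: "core p \<noteq> core z"
  proof
    assume "core p = core z"
    moreover have "clockwise d p z x" using clockwise_rotate[OF s(1,2,4) cw3] .
    ultimately have "cd p z = 1" using same_core_clockwise[OF s(2,4,1)] nxt by auto
    then show False using cw4 by (auto simp: clockwise_def)
  qed
  have cq: "quad_coeff d sg' om' x p q z = st' x q z * st' x p q + psign (1 - cd x p) * (st' x p z * st' p q z)"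
    by (simp add: quad_coeff_def)
  have add: "cd x p + cd p z = cd x z" "cd x p + cd p q = cd x q"
    using clock_dist_add(1)[OF s(1,2,4) cw3] clock_dist_add(1)[OF s(1,2,3) cw2] by linarith+
  consider (E1) "core x = core p" | (E3) "core x \<noteq> core p" "core q = core z"
    | (E2) "core x \<noteq> core p" "core q \<noteq> core z" "core p = core q"
    | (E4) "core x \<noteq> core p" "core q \<noteq> core z" "core p \<noteq> core q" "core z = core x"
    | (E0) "core x \<noteq> core p" "core q \<noteq> core z" "core p \<noteq> core q" "core z \<noteq> core x" by blast
  then show ?thesis
  proof cases
    case E1
    then obtain X where X: "X = u \<or> X = w" "x = next_side d X" "p = X"
      using same_core_clockwise[OF s(1,2,3) cw2] by blast
    have cX: "core (next_side d X) = X" "core X = X" "step (next_side d X) = 1" "step X = 0" using X by auto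
    have nX: "next_side d X \<in> V'" "X \<in> V'" using V X by auto
    have nq: "core q \<noteq> X" "core z \<noteq> X" using xq pz X cX by auto
    have fX: "fst q = fst X" "fst z = fst X" using f X by simp_all
    have 1: "st' x p q = 1" "st' x p z = 1"
      using struct_ear(1)[OF X(1) nX(2,1) V(3) fX(1) nq(1)] struct_ear(1)[OF X(1) nX(2,1) V(4) fX(2) nq(2)] X by auto
    have "st' x q z + st' p q z = 0"
    proof (cases "core q = core z")
      case True
      obtain Y where Y: "Y = u \<or> Y = w" "q = next_side d Y" "z = Y"
        using same_core_clockwise[OF s(3,4,1) clockwise_rotate[OF s(1,3,4) cw1] True] by blast
      have "core x \<noteq> Y" "core p \<noteq> Y" "Y \<in> V'" "next_side d Y \<in> V'" using nq Y cX X V by auto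
      moreover have "fst x = fst Y" "fst p = fst Y" using f Y by simp_all
      ultimately have "st' x q z = psign (cd x Y)" "st' p q z = psign (cd p Y)"
        using struct_ear(3)[OF Y(1)] V Y by auto
      moreover have "cd x Y = 1 + cd p Y" using add(1) nxt[OF X(1)] X Y by simp
      ultimately show ?thesis by (simp add: psign_def)
    next
      case False
      have "st' x q z = ear_sign q * psign 1 * st X (core q) (core z)"
        using struct_core[OF V(1,3,4) xq False _ cw1] nq X cX by auto
      moreover have "st' p q z = ear_sign q * psign 0 * st X (core q) (core z)"
        using struct_core[OF V(2,3,4) _ False pz cw4] nq X cX by auto
      ultimately show ?thesis by (simp add: psign_def)
    qed
    then show ?thesis unfolding cq 1 using nxt[OF X(1)] X by (simp add: psign_def)
  next
    case E3
    obtain Y where Y: "Y = u \<or> Y = w" "q = next_side d Y" "z = Y"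
      using same_core_clockwise[OF s(3,4,1) clockwise_rotate[OF s(1,3,4) cw1] E3(2)] by blast
    have cY: "core (next_side d Y) = Y" "core Y = Y" using Y by auto
    have n: "core x \<noteq> Y" "core p \<noteq> Y" "Y \<in> V'" "next_side d Y \<in> V'" using xq pz Y cY V by auto
    have fY: "fst x = fst Y" "fst p = fst Y" using f Y by simp_all
    have 1: "st' x q z = psign (cd x Y)" "st' p q z = psign (cd p Y)"
      using struct_ear(3)[OF Y(1) n(3,4) V(1) fY(1) n(1)] struct_ear(3)[OF Y(1) n(3,4) V(2) fY(2) n(2)] Y by auto
    have pq: "core p \<noteq> core q" "core x \<noteq> core z" using n Y cY by auto
    have 2: "st' x p q = ear_sign p * psign (step x) * st (core x) (core p) Y"
      "st' x p z = ear_sign p * psign (step x) * st (core x) (core p) Y"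
      using struct_core[OF V(1,2,3) E3(1) pq(1) xq cw2] struct_core[OF V(1,2,4) E3(1) pz pq(2) cw3] Y cY by auto
    have "psign (1 - cd x p) * psign (cd p Y) = (- psign (cd x Y) :: 'k)"
    proof -
      have e: "cd x Y = cd x p + cd p Y" using add(1) Y by simp
      have "psign (1 - a + b) = (psign (1 + (a + b)) :: 'k)" for a b by (auto simp: psign_def)
      then have "psign (1 - cd x p + cd p Y) = (psign (1 + cd x Y) :: 'k)" unfolding e .
      then show ?thesis by (simp only: psign_mult psign_Suc)
    qed
    then have "psign (1 - cd x p) * (t * psign (cd p Y)) = - (psign (cd x Y) * t)" for t :: 'k
      by (metis mult.assoc mult.commute mult_minus_left)
    then show ?thesis unfolding cq 1 2 by simp
  next
    case E2
    then obtain X where X: "X = u \<or> X = w" "p = next_side d X" "q = X"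
      using same_core_clockwise[OF s(2,3,4) cw4] by blast
    have cX: "core (next_side d X) = X" "core X = X" "step (next_side d X) = 1" "step X = 0" using X by auto
    have nX: "next_side d X \<in> V'" "X \<in> V'" using V X by auto
    have nq: "core x \<noteq> X" "core z \<noteq> X" using xq pz X cX by auto
    have fX: "fst x = fst X" "fst z = fst X" using f X by simp_all
    have 1: "st' x p q = psign (cd x X)" "st' p q z = 1"
      using struct_ear(3)[OF X(1) nX(2,1) V(1) fX(1) nq(1)] struct_ear(1)[OF X(1) nX(2,1) V(4) fX(2) nq(2)] X by auto
    have 2: "st' x q z = - st' x p z"
    proof (cases "core z = core x")
      case True
      obtain Y where Y: "Y = u \<or> Y = w" "z = next_side d Y" "x = Y"
        using same_core_clockwise[OF s(4,1,3) clockwise_rotate[OF s(3,4,1) clockwise_rotate[OF s(1,3,4) cw1]] True] by blast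
      have n: "core q \<noteq> Y" "core p \<noteq> Y" "Y \<in> V'" "next_side d Y \<in> V'" using nq Y cX X V by auto
      have fY: "fst q = fst Y" "fst p = fst Y" using f Y by simp_all
      show ?thesis
        using struct_ear(2)[OF Y(1) n(3,4) V(3) fY(1) n(1)] struct_ear(2)[OF Y(1) n(3,4) V(2) fY(2) n(2)] X Y cX
          ear_sign_next[OF X(1)] by simp
    next
      case False
      show ?thesis
        using struct_core[OF V(1,3,4) xq E2(2) False[symmetric] cw1] struct_core[OF V(1,2,4) E2(1) pz False[symmetric] cw3]
          X cX ear_sign_next[OF X(1)] by simp
    qed
    have "cd x X = cd x p + 1" using add(2) nxt[OF X(1)] X by simp
    then show ?thesis unfolding cq 1 2 by (auto simp: psign_def)
  next
    case E4
    obtain X where X: "X = u \<or> X = w" "z = next_side d X" "x = X"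
      using same_core_clockwise[OF s(4,1,3) clockwise_rotate[OF s(3,4,1) clockwise_rotate[OF s(1,3,4) cw1]] E4(4)] by blast
    have cX: "core (next_side d X) = X" "core X = X" "step (next_side d X) = 1" "step X = 0" using X by auto
    have nX: "next_side d X \<in> V'" "X \<in> V'" using V X by auto
    have nq: "core p \<noteq> X" "core q \<noteq> X" using xq pz X cX by auto
    have fX: "fst p = fst X" "fst q = fst X" using f X by simp_all
    define y where "y = core p"
    define v where "v = core q"
    have V4: "X \<in> V" "y \<in> V" "v \<in> V" using coreV[OF nX(2)] coreV[OF V(2)] coreV[OF V(3)] cX by (simp_all add: y_def v_def)
    note s4 = V4[THEN sndV]
    have ne: "X \<noteq> y" "X \<noteq> v" "y \<noteq> v" "y \<noteq> X" "v \<noteq> X" using nq E4 by (auto simp: y_def v_def)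
    have f4: "fst X = fst y" "fst X = fst v" "fst y = fst X" using fX by (simp_all add: y_def v_def)
    have cwXyv: "clockwise d X y v"
      using clockwise_core[OF s(1,2,3)] cw2 E4 xq X cX by (simp add: y_def v_def)
    have cwvXy: "clockwise d v X y"
      using clockwise_rotate[OF s4(2,3,1) clockwise_rotate[OF s4 cwXyv]] .
    define e where "e = cyc_coeff d om v X y"
    have rot: "cyc_coeff d om X y v = psign (int d * (1 - cd v X)) * e"
      using cyc_coeff_rotate[OF s4(3,1,2) cwvXy] by (simp add: e_def)
    have a1: "st' x q z = psign (int d) * of_int (sg X v) * ear_sign q"
      using struct_ear(2)[OF X(1) nX(2,1) V(3) fX(2) nq(2)] X by (simp add: v_def)
    have a2: "st' x p q = ear_sign p * (psign (int d * (2 - cd X v)) * of_int (sg X v) * e)"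
      using struct_core[OF V(1,2,3) E4(1,3) xq cw2] X cX by (simp add: y_def v_def e_def struct_coeff_def psign_def)
    have a3: "st' x p z = psign (int d) * of_int (sg X y) * ear_sign p"
      using struct_ear(2)[OF X(1) nX(2,1) V(2) fX(1) nq(1)] X by (simp add: y_def)
    have a4: "st' p q z = ear_sign q * psign (step p) *
        (psign (int d * (2 - cd y X)) * of_int (sg y X) * (psign (int d * (1 - cd v X)) * e))"
      using struct_core[OF V(2,3,4) E4(3,2) pz cw4] rot X cX by (simp add: y_def v_def struct_coeff_def)
    have Xp: "cd x p = cd X y - step p"
      using clock_dist_core[OF s(1,2) f(1)[symmetric] E4(1)] X cX by (simp add: y_def)
    have sums: "cd y X = int d - cd X y" "cd v X = int d - cd X v"
      using clock_dist_sum[OF s4(1,2) f4(1) ne(1)] clock_dist_sum[OF s4(1,3) f4(2) ne(2)] by simp_all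
    have op: "of_int (sg X y) * of_int (sg y X) = (- psign ((1 - cd X y) * (1 - cd y X)) :: 'k)"
      using arg_cong[OF sg_op[OF V4(1,2) ne(1) f4(1)], of "of_int :: int \<Rightarrow> 'k"] by simp
    have "quad_coeff d sg' om' x p q z = ear_sign p * ear_sign q * psign (int d) * e *
        (psign (int d * (2 - cd X v)) * (of_int (sg X v) * of_int (sg X v)) +
         psign (1 - cd x p) * psign (step p) * psign (int d * (2 - cd y X)) * psign (int d * (1 - cd v X)) *
           (of_int (sg X y) * of_int (sg y X)))"
      unfolding cq a1 a2 a3 a4 by (simp add: algebra_simps)
    also have "\<dots> = 0"
      unfolding op sg_sq[OF V4(1,3) ne(2) f4(2)] Xp sums using step_cases[of p]
      by (auto simp: psign_def)
    finally show ?thesis .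
  next
    case E0
    have S: "st' x q z = ear_sign q * psign (step x) * st (core x) (core q) (core z)"
      "st' x p q = ear_sign p * psign (step x) * st (core x) (core p) (core q)"
      "st' x p z = ear_sign p * psign (step x) * st (core x) (core p) (core z)"
      "st' p q z = ear_sign q * psign (step p) * st (core p) (core q) (core z)"
      using struct_core[OF V(1,3,4) xq E0(2) E0(4)[symmetric] cw1] struct_core[OF V(1,2,3) E0(1,3) xq cw2]
        struct_core[OF V(1,2,4) E0(1) pz E0(4)[symmetric] cw3] struct_core[OF V(2,3,4) E0(3,2) pz cw4] .
    have xp: "cd x p = cd (core x) (core p) + step x - step p"
      using clock_dist_core[OF s(1,2) f(1)[symmetric] E0(1)] .
    have "clockwise d (core x) (core q) (core z)" "clockwise d (core x) (core p) (core q)"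
      using clockwise_core[OF s(1,3,4) xq E0(2) E0(4)[symmetric]] clockwise_core[OF s(1,2,3) E0(1,3) xq] cw1 cw2 by auto
    then have o: "quad_coeff d sg om (core x) (core p) (core q) (core z) = 0"
      using old coreV V by blast
    have sq: "psign n * psign n = (1 :: 'k)" for n by (simp add: psign_def)
    have ps: "psign (1 - cd x p) * (psign (step x) * psign (step p)) = (psign (1 - cd (core x) (core p)) :: 'k)"
      unfolding psign_mult xp by (rule psign_cong) simp
    have "quad_coeff d sg' om' x p q z = ear_sign p * ear_sign q *
        ((psign (step x) * psign (step x)) * (st (core x) (core q) (core z) * st (core x) (core p) (core q)) +
         (psign (1 - cd x p) * (psign (step x) * psign (step p))) * (st (core x) (core p) (core z) * st (core p) (core q) (core z)))"
      unfolding cq S by (simp add: algebra_simps)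
    also have "\<dots> = ear_sign p * ear_sign q * quad_coeff d sg om (core x) (core p) (core q) (core z)"
      unfolding sq ps quad_coeff_def by simp
    finally show ?thesis unfolding o by simp
  qed
qed

end

section \<open>Arrows of the mutated quiver\<close>

locale flip_quiver = flip_sides +
  fixes P :: "('a, 'v) polygons" and i :: 'v and \<sigma> :: "side \<times> side \<Rightarrow> int"
  assumes uw_sides: "u \<in> sides d P" "w \<in> sides d P"
    and label_i: "x \<in> sides d P \<Longrightarrow> label P x = Some i \<longleftrightarrow> x = u \<or> x = w"
    and graded: "graded_quiver d (pre_quiver d P \<sigma>)"
begin

definition V :: "side set" where
  "V = {x \<in> sides d P. label P x \<noteq> None}"

text \<open>
  The non-boundary sides of the flipped polygons.
\<close>

definition V' :: "side set" where
  "V' = {x \<in> sides d P. label P (flip_side d u w x) \<noteq> None}"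

definition ear :: "side \<Rightarrow> bool" where
  "ear X \<longleftrightarrow> X = u \<or> X = w"

definition other :: "side \<Rightarrow> side" where
  "other X = (if X = u then w else u)"

text \<open>
  The arrow of degree \<open>0\<close> into the other side of \<open>i\<close>; it belongs to
  \<open>A\<close> unless its source is a boundary side.
\<close>

definition apex :: "side \<Rightarrow> side \<times> side" where
  "apex X = (next_side d (other X), other X)"

text \<open>
  The formal factor that an arrow acquires at the new side \<open>x\<close>.
\<close>

definition fac :: "side \<Rightarrow> (side \<times> side) option" where
  "fac x = (if ear x then Some (apex x) else None)"

text \<open>
  The arrow of the mutated quiver that joins two sides of a flipped polygon.
\<close>

definition g :: "side \<Rightarrow> side \<Rightarrow> (side \<times> side) marrow" where
  "g x y = (if core x = core y then (if step x = 1 then Dual (apex y) else DualOp (apex x))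
     else Cmp (fac x) (core x, core y) (fac y))"

text \<open>
  The sources of the arrows in \<open>A\<close>; all other arrows at such a side are superfluous.
\<close>

definition dead :: "side \<Rightarrow> bool" where
  "dead x \<longleftrightarrow> x \<in> V \<and> (x = next_side d u \<or> x = next_side d w)"

abbreviation "G \<equiv> glued_at d P \<sigma> i"
abbreviation "A \<equiv> mut_A (Inr i) G"
abbreviation "QM \<equiv> mut_quiver d (Inr i) G"
abbreviation "killed \<equiv> superfluous d P \<sigma> i"

lemma ear_simps [simp]: "ear u" "ear w" "other u = w" "other w = u"
  using dist by (simp_all add: ear_def other_def)

lemma ear_other: "ear X \<Longrightarrow> ear (other X)" "ear X \<Longrightarrow> other (other X) = X" "ear X \<Longrightarrow> other X \<noteq> X"
  "\<lbrakk>ear X; ear Y; X \<noteq> Y\<rbrakk> \<Longrightarrow> Y = other X"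
  using dist by (auto simp: ear_def other_def)

lemma ear_V: "ear X \<Longrightarrow> X \<in> V"
  using uw_sides label_i[OF uw_sides(1)] label_i[OF uw_sides(2)] by (auto simp: ear_def V_def)

lemma ear_core: "ear X \<Longrightarrow> core X = X" "ear X \<Longrightarrow> core (next_side d X) = X" "ear X \<Longrightarrow> step X = 0"
  "ear X \<Longrightarrow> step (next_side d X) = 1" "ear X \<Longrightarrow> \<not> ear (next_side d X)" "ear X \<Longrightarrow> next_side d X \<noteq> X"
  "\<lbrakk>ear X; ear Y\<rbrakk> \<Longrightarrow> next_side d X \<noteq> Y" "\<lbrakk>ear X; ear Y; next_side d X = next_side d Y\<rbrakk> \<Longrightarrow> X = Y"
  using dist next_facts by (auto simp: ear_def)

lemma next_sides: "x \<in> sides d P \<Longrightarrow> next_side d x \<in> sides d P"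
  using d3 by (auto simp: sides_def next_side_def)

lemma V_snd: "x \<in> V \<Longrightarrow> snd x < d" and V'_snd: "x \<in> V' \<Longrightarrow> snd x < d"
  by (auto simp: V_def V'_def sides_def)

lemma finite_V: "finite V" and finite_V': "finite V'"
  by (simp_all add: V_def V'_def sides_def)

lemma flip_side_simps: "ear X \<Longrightarrow> flip_side d u w X = next_side d (other X)"
  "ear X \<Longrightarrow> flip_side d u w (next_side d X) = X"
  "\<lbrakk>\<not> ear x; step x = 0\<rbrakk> \<Longrightarrow> flip_side d u w x = x"
  using dist next_facts by (auto simp: flip_side_def ear_def other_def step_def)

lemma side_kinds:
  obtains (ear) "ear x" "core x = x" "step x = 0" "fac x = Some (apex x)"
  | (nxt) X where "ear X" "x = next_side d X" "core x = X" "step x = 1" "\<not> ear x" "fac x = None"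
  | (ord) "\<not> ear x" "core x = x" "step x = 0" "fac x = None" "x \<noteq> next_side d u" "x \<noteq> next_side d w"
proof (cases "ear x")
  case True
  then show ?thesis using ear ear_core by (simp add: fac_def)
next
  case False
  show ?thesis
  proof (cases "x = next_side d u \<or> x = next_side d w")
    case True
    then obtain X where X: "ear X" "x = next_side d X" using ear_simps by blast
    then show ?thesis using nxt[of X] ear_core False by (simp add: fac_def)
  next
    case n: False
    then show ?thesis using ord False by (simp add: fac_def core_def step_def)
  qed
qed

lemma V'_ear: "ear X \<Longrightarrow> X \<in> V' \<longleftrightarrow> next_side d (other X) \<in> V"
  and V'_next: "ear X \<Longrightarrow> next_side d X \<in> V'"
  and V'_ord: "\<lbrakk>\<not> ear x; step x = 0\<rbrakk> \<Longrightarrow> x \<in> V' \<longleftrightarrow> x \<in> V"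
proof -
  assume e: "ear X"
  have "X \<in> sides d P" "next_side d X \<in> sides d P" "other X \<in> sides d P"
    using ear_V[OF e] ear_V[OF ear_other(1)[OF e]] next_sides by (auto simp: V_def)
  then show "X \<in> V' \<longleftrightarrow> next_side d (other X) \<in> V" "next_side d X \<in> V'"
    using flip_side_simps(1,2)[OF e] ear_V[OF e] next_sides by (simp_all add: V_def V'_def)
next
  show "\<lbrakk>\<not> ear x; step x = 0\<rbrakk> \<Longrightarrow> x \<in> V' \<longleftrightarrow> x \<in> V"
    using flip_side_simps by (simp add: V_def V'_def)
qed

lemma ear_not_dead: "ear X \<Longrightarrow> \<not> dead X"
  using ear_core(7)[of u X] ear_core(7)[of w X] by (auto simp: dead_def)

lemma core_V: "x \<in> V' \<Longrightarrow> core x \<in> V" and core_not_dead: "x \<in> V' \<Longrightarrow> \<not> dead (core x)"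
proof -
  assume x: "x \<in> V'"
  show "core x \<in> V"
  proof (cases x rule: side_kinds)
    case ord then show ?thesis using V'_ord x by simp
  qed (use ear_V in auto)
  show "\<not> dead (core x)"
  proof (cases x rule: side_kinds)
    case ord then show ?thesis by (simp add: dead_def)
  qed (use ear_not_dead in simp_all)
qed

lemma pre_arrs: "arrs (pre_quiver d P \<sigma>) = {(x, y). x \<in> V \<and> y \<in> V \<and> x \<noteq> y \<and> fst x = fst y}"
proof -
  have "arrs (pre_quiver d P \<sigma>) = (\<Union>r<npoly P. {(x, y). x \<in> V \<and> y \<in> V \<and> x \<noteq> y \<and> fst x = r \<and> fst y = r})"
    unfolding pre_quiver_def by (auto simp: polygon_quiver_def Let_def V_def label_def sides_def)
  also have "\<dots> = {(x, y). x \<in> V \<and> y \<in> V \<and> x \<noteq> y \<and> fst x = fst y}"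
    by (auto simp: V_def sides_def)
  finally show ?thesis .
qed

lemma arr_iff: "(x, y) \<in> arrs G \<longleftrightarrow> x \<in> V \<and> y \<in> V \<and> x \<noteq> y \<and> fst x = fst y"
proof -
  have "arrs G = arrs (pre_quiver d P \<sigma>)" by (simp add: glued_at_def glue_def)
  then show ?thesis by (simp add: pre_arrs)
qed

lemma pre_deg:
  assumes "x \<in> V" "y \<in> V" "x \<noteq> y" "fst x = fst y"
  shows "deg (pre_quiver d P \<sigma>) (x, y) = 1 - cd x y"
proof -
  have c: "card {m::nat. 0 < m \<and> m < n} = n - 1" for n
  proof -
    have "{m::nat. 0 < m \<and> m < n} = {0<..<n}" by auto
    then show ?thesis by simp
  qed
  have "0 < clock_dist d x y" using clock_dist_pos[OF V_snd[OF assms(1)] V_snd[OF assms(2)] assms(4,3)] by simp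
  then show ?thesis by (simp add: pre_quiver_def polygon_quiver_def Let_def c clock_dist_def)
qed

lemma G_simps: "deg G = deg (pre_quiver d P \<sigma>)" "opp G (x, y) = (y, x)" "osgn G = \<sigma>"
  "src G (x, y) = (if label P x = Some i then Inr i else Inl x)"
  "tgt G (x, y) = (if label P y = Some i then Inr i else Inl y)"
  by (simp_all add: glued_at_def glue_def pre_quiver_def)

lemma label_ear: "x \<in> V \<Longrightarrow> label P x = Some i \<longleftrightarrow> ear x"
  using label_i by (auto simp: V_def ear_def)

lemma G_src: "x \<in> V \<Longrightarrow> src G (x, y) = (if ear x then Inr i else Inl x)"
  and G_tgt: "y \<in> V \<Longrightarrow> tgt G (x, y) = (if ear y then Inr i else Inl y)"
  using label_ear by (simp_all add: G_simps)

lemma G_deg: "(x, y) \<in> arrs G \<Longrightarrow> deg G (x, y) = 1 - cd x y"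
  using pre_deg by (simp add: arr_iff G_simps)

lemma \<sigma>_pre:
  assumes "\<phi> \<in> arrs (pre_quiver d P \<sigma>)"
  shows "\<sigma> \<phi> \<in> {1, - 1}"
    "\<sigma> \<phi> * \<sigma> (prod.swap \<phi>) = - psign (deg (pre_quiver d P \<sigma>) \<phi> * deg (pre_quiver d P \<sigma>) (prod.swap \<phi>))"
proof -
  have pre: "osgn (pre_quiver d P \<sigma>) = \<sigma>" "opp (pre_quiver d P \<sigma>) = prod.swap" by (simp_all add: pre_quiver_def)
  note gr = bspec[OF graded[unfolded graded_quiver_def pre, THEN conjunct2, THEN conjunct2] assms]
  show "\<sigma> \<phi> \<in> {1, - 1}" using gr by blast
  show "\<sigma> \<phi> * \<sigma> (prod.swap \<phi>) = - psign (deg (pre_quiver d P \<sigma>) \<phi> * deg (pre_quiver d P \<sigma>) (prod.swap \<phi>))"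
    using gr by blast
qed

lemma \<sigma>_one: "(x, y) \<in> arrs G \<Longrightarrow> \<sigma> (x, y) = 1 \<or> \<sigma> (x, y) = - 1"
  and \<sigma>_op: "(x, y) \<in> arrs G \<Longrightarrow> \<sigma> (x, y) * \<sigma> (y, x) = - psign ((1 - cd x y) * (1 - cd y x))"
proof -
  assume a: "(x, y) \<in> arrs G"
  then have V: "x \<in> V" "y \<in> V" "x \<noteq> y" "fst x = fst y" unfolding arr_iff by simp_all
  then have p: "(x, y) \<in> arrs (pre_quiver d P \<sigma>)" by (simp add: pre_arrs)
  show "\<sigma> (x, y) = 1 \<or> \<sigma> (x, y) = - 1" using \<sigma>_pre(1)[OF p] by simp
  show "\<sigma> (x, y) * \<sigma> (y, x) = - psign ((1 - cd x y) * (1 - cd y x))"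
    using \<sigma>_pre(2)[OF p] pre_deg[OF V] pre_deg[OF V(2,1) V(3)[symmetric] V(4)[symmetric]] by simp
qed

lemma A_iff: "(x, y) \<in> A \<longleftrightarrow> ear y \<and> x = next_side d y \<and> x \<in> V"
proof
  assume "(x, y) \<in> A"
  then have a: "(x, y) \<in> arrs G" "tgt G (x, y) = Inr i" "deg G (x, y) = 0" by (simp_all add: mut_A_def)
  then have V: "x \<in> V" "y \<in> V" "x \<noteq> y" "fst x = fst y" and c: "cd x y = 1"
    using G_deg[OF a(1)] by (simp_all add: arr_iff)
  have e: "ear y" using a(2) G_tgt[OF V(2)] by (simp split: if_splits)
  have "cd x (next_side d y) = 0"
    using clock_dist_next(2)[OF V_snd[OF V(1)] V_snd[OF V(2)] V(4,3)] c by simp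
  moreover have "snd (next_side d y) < d" "fst x = fst (next_side d y)"
    using e next_facts(1,2) next_facts(3)[of y] V(4) by (auto simp: ear_def)
  ultimately have "x = next_side d y"
    using clock_dist_pos[OF V_snd[OF V(1)], of "next_side d y"] by fastforce
  then show "ear y \<and> x = next_side d y \<and> x \<in> V" using e V by simp
next
  assume a: "ear y \<and> x = next_side d y \<and> x \<in> V"
  then have V: "x \<in> V" "y \<in> V" "x \<noteq> y" "fst x = fst y"
    using ear_V[of y] ear_core(6)[of y] next_facts(3)[of y] by auto
  have "cd y y = 0" using V_snd[OF V(2)] by (simp add: clock_dist_alt)
  then have "cd x y = 1" using clock_dist_next(1)[OF V_snd[OF V(2)] V_snd[OF V(2)]] a V by simp
  then show "(x, y) \<in> A" using V a G_deg[of x y] G_tgt[of y x] by (simp add: mut_A_def arr_iff)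
qed

lemma apex_A: "ear X \<Longrightarrow> apex X \<in> A \<longleftrightarrow> X \<in> V'"
  using ear_other by (simp add: apex_def A_iff V'_ear)

lemma A_apex: "\<alpha> \<in> A \<Longrightarrow> \<exists>X. ear X \<and> X \<in> V' \<and> \<alpha> = apex X"
proof -
  assume \<alpha>: "\<alpha> \<in> A"
  obtain x y where xy: "\<alpha> = (x, y)" by (cases \<alpha>)
  then have y: "ear y" "x = next_side d y" "x \<in> V" using \<alpha>[unfolded xy A_iff] by blast+
  have o: "ear (other y)" "other (other y) = y" using ear_other(1,2)[OF y(1)] .
  have "other y \<in> V'" using V'_ear[OF o(1)] y(3) unfolding o(2) y(2) by simp
  moreover have "\<alpha> = apex (other y)" unfolding apex_def o(2) xy using y(2) by simp
  ultimately show ?thesis using o(1) by blast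
qed

lemma A_eq: "A = apex ` {X \<in> V'. ear X}"
  using A_apex apex_A by blast

lemma apex_inj: "\<lbrakk>ear X; ear Y; apex X = apex Y\<rbrakk> \<Longrightarrow> X = Y"
  using ear_other(2)[of X] ear_other(2)[of Y] unfolding apex_def by (metis prod.inject)

lemma out_iff: "(x, y) \<in> mut_out d (Inr i) G \<longleftrightarrow> (x, y) \<in> arrs G \<and> ear x \<and> y \<noteq> next_side d x"
proof (cases "(x, y) \<in> arrs G")
  case True
  then have V: "x \<in> V" "y \<in> V" "x \<noteq> y" "fst x = fst y" by (auto simp: arr_iff)
  have "cd x y \<noteq> int d - 1 \<longleftrightarrow> y \<noteq> next_side d x" if "ear x"
  proof -
    have n: "snd (next_side d x) < d" "next_side d x \<noteq> x" using that next_facts(1,2) ear_core(6) by (auto simp: ear_def)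
    have "cd x x = 0" using V_snd[OF V(1)] by (simp add: clock_dist_alt)
    then have "cd (next_side d x) x = 1" using clock_dist_next(1)[OF V_snd[OF V(1)] V_snd[OF V(1)]] n by simp
    then have "cd x (next_side d x) = int d - 1"
      using clock_dist_sum[OF n(1) V_snd[OF V(1)] next_facts(3) n(2)] by simp
    then show ?thesis
      using clock_dist_eq_iff[OF V_snd[OF V(1)] V_snd[OF V(2)] n(1)] V next_facts(3)[of x] by auto
  qed
  moreover have "cd x y < int d" using clock_dist_pos[OF V_snd[OF V(1)] V_snd[OF V(2)] V(4,3)] by simp
  ultimately show ?thesis using True G_deg[OF True] G_src[OF V(1)] by (auto simp: mut_out_def)
qed (simp add: mut_out_def)

lemma QM_simps: "src QM = mut_src G" "tgt QM = mut_tgt G" "deg QM = mut_deg d (Inr i) G"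
  "opp QM = mut_opp G" "osgn QM = mut_osgn d (Inr i) G" "verts QM = verts G"
  by (simp_all add: mut_quiver_def Let_def)

lemma QM_Dual: "Dual \<alpha> \<in> arrs QM \<longleftrightarrow> \<alpha> \<in> A" "DualOp \<alpha> \<in> arrs QM \<longleftrightarrow> \<alpha> \<in> A"
  by (simp_all add: mut_quiver_def Let_def image_iff)

lemma QM_Cmp:
  "Cmp None (x, y) None \<in> arrs QM \<longleftrightarrow> (x, y) \<in> arrs G \<and> (x, y) \<notin> A \<and> (y, x) \<notin> A"
  "Cmp (Some \<alpha>) (x, y) None \<in> arrs QM \<longleftrightarrow> \<alpha> \<in> A \<and> (x, y) \<in> mut_out d (Inr i) G"
  "Cmp None (x, y) (Some \<beta>) \<in> arrs QM \<longleftrightarrow> \<beta> \<in> A \<and> (y, x) \<in> mut_out d (Inr i) G"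
  "Cmp (Some \<alpha>) (x, y) (Some \<beta>) \<in> arrs QM \<longleftrightarrow> \<alpha> \<in> A \<and> \<beta> \<in> A \<and> (x, y) \<in> arrs G \<and> ear x \<and> ear y"
proof -
  show "Cmp None (x, y) None \<in> arrs QM \<longleftrightarrow> (x, y) \<in> arrs G \<and> (x, y) \<notin> A \<and> (y, x) \<notin> A"
    "Cmp (Some \<alpha>) (x, y) None \<in> arrs QM \<longleftrightarrow> \<alpha> \<in> A \<and> (x, y) \<in> mut_out d (Inr i) G"
    by (simp_all add: mut_quiver_def Let_def image_iff G_simps(2) del: split_paired_Ex split_paired_All)
  have op: "(x, y) = opp G \<phi> \<longleftrightarrow> \<phi> = (y, x)" for \<phi> by (cases \<phi>) (auto simp: G_simps(2))
  show "Cmp None (x, y) (Some \<beta>) \<in> arrs QM \<longleftrightarrow> \<beta> \<in> A \<and> (y, x) \<in> mut_out d (Inr i) G"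
    by (simp add: mut_quiver_def Let_def image_iff op del: split_paired_Ex split_paired_All)
  have "(x, y) \<in> arrs G \<Longrightarrow> src G (x, y) = Inr i \<longleftrightarrow> ear x" "(x, y) \<in> arrs G \<Longrightarrow> tgt G (x, y) = Inr i \<longleftrightarrow> ear y"
    using G_src[of x y] G_tgt[of y x] by (simp_all add: arr_iff)
  then show "Cmp (Some \<alpha>) (x, y) (Some \<beta>) \<in> arrs QM \<longleftrightarrow> \<alpha> \<in> A \<and> \<beta> \<in> A \<and> (x, y) \<in> arrs G \<and> ear x \<and> ear y"
    by (simp add: mut_quiver_def Let_def image_iff cong: conj_cong del: split_paired_Ex split_paired_All)
qed

lemma arrs_sym: "(x, y) \<in> arrs G \<longleftrightarrow> (y, x) \<in> arrs G"
  by (auto simp: arr_iff)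

lemma QM_opp: "m \<in> arrs QM \<Longrightarrow> mut_opp G m \<in> arrs QM" "mut_opp G (mut_opp G m) = m"
proof -
  show "mut_opp G (mut_opp G m) = m"
    by (cases m) (auto simp: G_simps(2))
  assume m: "m \<in> arrs QM"
  show "mut_opp G m \<in> arrs QM"
  proof (cases m)
    case (Cmp l \<phi> r)
    obtain x y where \<phi>: "\<phi> = (x, y)" by (cases \<phi>)
    show ?thesis using m arrs_sym[of x y] unfolding Cmp \<phi>
      by (cases l; cases r) (simp_all add: G_simps(2) QM_Cmp)
  qed (use m in \<open>simp_all add: QM_Dual\<close>)
qed

definition sup_base :: "(side \<times> side) marrow \<Rightarrow> bool" where
  "sup_base m \<longleftrightarrow> (\<exists>k u j. m = Cmp (Some (k, u)) (u, j) None \<and> (k, u) \<in> A) \<or>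
     (\<exists>k u j. m = Cmp None (k, j) None \<and> (k, u) \<in> A) \<or>
     (\<exists>k u w \<beta>. m = Cmp (Some (k, u)) (u, w) (Some \<beta>) \<and> (k, u) \<in> A \<and> \<beta> \<in> A \<and> label P w = Some i \<and> w \<noteq> u) \<or>
     (\<exists>k u w \<beta>. m = Cmp None (k, w) (Some \<beta>) \<and> (k, u) \<in> A \<and> \<beta> \<in> A \<and> label P w = Some i \<and> w \<noteq> u)"

lemma sup_iff: "m \<in> killed \<longleftrightarrow> m \<in> arrs QM \<and> (sup_base m \<or> sup_base (mut_opp G m))"
proof -
  have B: "killed = (Collect sup_base \<inter> arrs QM) \<union> opp QM ` (Collect sup_base \<inter> arrs QM)"
    unfolding superfluous_def Let_def sup_base_def by (intro arg_cong2[of _ _ _ _ "(\<union>)"] arg_cong2[of _ _ _ _ "(\<inter>)"]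
        arg_cong2[of _ _ _ _ "(`)"] refl) blast+
  show ?thesis
  proof
    assume "m \<in> killed"
    then consider "sup_base m" "m \<in> arrs QM" | m' where "m = opp QM m'" "sup_base m'" "m' \<in> arrs QM"
      unfolding B by blast
    then show "m \<in> arrs QM \<and> (sup_base m \<or> sup_base (mut_opp G m))"
      by cases (use QM_opp in \<open>auto simp: QM_simps\<close>)
  next
    assume m: "m \<in> arrs QM \<and> (sup_base m \<or> sup_base (mut_opp G m))"
    have "m = opp QM (mut_opp G m)" using QM_opp(2) by (simp add: QM_simps)
    then show "m \<in> killed" using m QM_opp(1) unfolding B by blast
  qed
qed

lemma dead_iff: "dead x \<longleftrightarrow> (\<exists>y. (x, y) \<in> A)"
  unfolding dead_def A_iff ear_def by blast

lemma sup_base_Cmp: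
  "sup_base (Cmp None (x, y) None) \<longleftrightarrow> dead x"
  "sup_base (Cmp (Some \<alpha>) (x, y) None) \<longleftrightarrow> \<alpha> \<in> A \<and> x = snd \<alpha>"
  "sup_base (Cmp None (x, y) (Some \<beta>)) \<longleftrightarrow> \<beta> \<in> A \<and> label P y = Some i \<and> (\<exists>z. z \<noteq> y \<and> (x, z) \<in> A)"
  "sup_base (Cmp (Some \<alpha>) (x, y) (Some \<beta>)) \<longleftrightarrow> \<alpha> \<in> A \<and> \<beta> \<in> A \<and> x = snd \<alpha> \<and> label P y = Some i \<and> y \<noteq> x"
  "\<not> sup_base (Dual \<alpha>)" "\<not> sup_base (DualOp \<alpha>)"
proof -
  show "sup_base (Cmp None (x, y) None) \<longleftrightarrow> dead x"
    unfolding sup_base_def dead_iff by blast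
  show "sup_base (Cmp (Some \<alpha>) (x, y) None) \<longleftrightarrow> \<alpha> \<in> A \<and> x = snd \<alpha>"
    "sup_base (Cmp (Some \<alpha>) (x, y) (Some \<beta>)) \<longleftrightarrow> \<alpha> \<in> A \<and> \<beta> \<in> A \<and> x = snd \<alpha> \<and> label P y = Some i \<and> y \<noteq> x"
    by (cases \<alpha>; auto simp: sup_base_def)+
  show "sup_base (Cmp None (x, y) (Some \<beta>)) \<longleftrightarrow> \<beta> \<in> A \<and> label P y = Some i \<and> (\<exists>z. z \<noteq> y \<and> (x, z) \<in> A)"
    unfolding sup_base_def by (simp del: split_paired_Ex split_paired_All, metis)
  show "\<not> sup_base (Dual \<alpha>)" "\<not> sup_base (DualOp \<alpha>)" by (auto simp: sup_base_def)
qed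

text \<open>The factors that can be attached to a vertex, and those that survive the removal.\<close>

definition facs :: "side \<Rightarrow> (side \<times> side) option set" where
  "facs x = (if ear x then insert None (Some ` A) else {None})"

definition live :: "(side \<times> side) option \<Rightarrow> side \<Rightarrow> bool" where
  "live l x \<longleftrightarrow> \<not> dead x \<and> (\<forall>\<alpha>. l = Some \<alpha> \<longrightarrow> snd \<alpha> \<noteq> x)"

lemma Cmp_facs_iff:
  assumes xy: "(x, y) \<in> arrs G" and n: "(x, y) \<notin> A" "(y, x) \<notin> A" and l: "l \<in> facs x" and r: "r \<in> facs y"
  shows "Cmp l (x, y) r \<in> arrs QM" "Cmp l (x, y) r \<in> killed \<longleftrightarrow> \<not> (live l x \<and> live r y)"
proof -
  have V: "x \<in> V" "y \<in> V" "x \<noteq> y" using xy by (auto simp: arr_iff)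
  have out: "(x, y) \<in> mut_out d (Inr i) G" if "ear x" using that xy n(2) V A_iff out_iff by auto
  have out': "(y, x) \<in> mut_out d (Inr i) G" if "ear y" using that xy n(1) V A_iff out_iff arrs_sym by auto
  note nd = ear_not_dead
  have lr: "l = None \<or> (\<exists>\<alpha>. l = Some \<alpha> \<and> \<alpha> \<in> A \<and> ear x)" "r = None \<or> (\<exists>\<beta>. r = Some \<beta> \<and> \<beta> \<in> A \<and> ear y)"
    using l r by (auto simp: facs_def split: if_splits)
  show QM: "Cmp l (x, y) r \<in> arrs QM"
    using lr xy n out out' by (elim disjE exE conjE) (simp_all add: QM_Cmp)
  have ex: "(\<exists>z. z \<noteq> b \<and> (a, z) \<in> A) \<longleftrightarrow> dead a" if "(a, b) \<notin> A" for a b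
    unfolding dead_iff using that by metis
  show "Cmp l (x, y) r \<in> killed \<longleftrightarrow> \<not> (live l x \<and> live r y)"
    unfolding sup_iff using lr
  proof (elim disjE exE conjE)
    assume "l = None" "r = None"
    then show "(Cmp l (x, y) r \<in> arrs QM \<and> (sup_base (Cmp l (x, y) r) \<or> sup_base (mut_opp G (Cmp l (x, y) r)))) \<longleftrightarrow> \<not> (live l x \<and> live r y)"
      using QM by (simp add: G_simps(2) sup_base_Cmp live_def)
  next
    fix \<beta> assume "l = None" "r = Some \<beta>" "\<beta> \<in> A" "ear y"
    then show "(Cmp l (x, y) r \<in> arrs QM \<and> (sup_base (Cmp l (x, y) r) \<or> sup_base (mut_opp G (Cmp l (x, y) r)))) \<longleftrightarrow> \<not> (live l x \<and> live r y)"
      using QM nd[of y] label_ear[OF V(2)] ex[OF n(1)] by (auto simp: G_simps(2) sup_base_Cmp live_def)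
  next
    fix \<alpha> assume "l = Some \<alpha>" "\<alpha> \<in> A" "ear x" "r = None"
    then show "(Cmp l (x, y) r \<in> arrs QM \<and> (sup_base (Cmp l (x, y) r) \<or> sup_base (mut_opp G (Cmp l (x, y) r)))) \<longleftrightarrow> \<not> (live l x \<and> live r y)"
      using QM nd[of x] label_ear[OF V(1)] ex[OF n(2)] by (auto simp: G_simps(2) sup_base_Cmp live_def)
  next
    fix \<alpha> \<beta> assume "l = Some \<alpha>" "\<alpha> \<in> A" "ear x" "r = Some \<beta>" "\<beta> \<in> A" "ear y"
    then show "(Cmp l (x, y) r \<in> arrs QM \<and> (sup_base (Cmp l (x, y) r) \<or> sup_base (mut_opp G (Cmp l (x, y) r)))) \<longleftrightarrow> \<not> (live l x \<and> live r y)"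
      using QM nd[of x] nd[of y] label_ear[OF V(1)] label_ear[OF V(2)] V(3)
      by (auto simp: G_simps(2) sup_base_Cmp live_def)
  qed
qed

lemma fac_facs: "x \<in> V' \<Longrightarrow> fac x \<in> facs (core x)" and fac_live: "x \<in> V' \<Longrightarrow> live (fac x) (core x)"
proof -
  assume x: "x \<in> V'"
  note nd = core_not_dead[OF x]
  have "fac x \<in> facs (core x) \<and> live (fac x) (core x)"
  proof (cases x rule: side_kinds)
    case ear
    then have "apex x \<in> A" using apex_A x by simp
    then show ?thesis
      using ear nd ear_other(3)[of x] by (auto simp: facs_def live_def apex_def)
  next
    case (nxt X)
    show ?thesis using nd unfolding nxt(6) by (simp add: facs_def live_def)
  next
    case ord
    show ?thesis using nd unfolding ord(4) by (simp add: facs_def live_def)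
  qed
  then show "fac x \<in> facs (core x)" "live (fac x) (core x)" by auto
qed

lemma fac_inj: "\<lbrakk>core x = core y; fac x = fac y\<rbrakk> \<Longrightarrow> x = y"
proof -
  assume c: "core x = core y" and f: "fac x = fac y"
  have e: "ear x \<longleftrightarrow> ear y" using f by (simp add: fac_def split: if_splits)
  have n: "ear x \<Longrightarrow> core x = x" "ear y \<Longrightarrow> core y = y" using ear_core(1) by auto
  have s: "ear (core z) \<Longrightarrow> \<not> ear z \<Longrightarrow> z = next_side d (core z)" for z
    by (cases z rule: side_kinds) (simp_all only: simp_thms)
  have o: "\<not> ear (core z) \<Longrightarrow> core z = z" for z
    by (cases z rule: side_kinds) (simp_all only: simp_thms)
  show "x = y"
  proof (cases "ear x")
    case True
    then show ?thesis using n e c by metis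
  next
    case False
    then show ?thesis using e c s[of x] s[of y] o[of x] o[of y] by metis
  qed
qed

lemma fac_surj:
  assumes "x \<in> V" "l \<in> facs x" "live l x"
  obtains x' where "x' \<in> V'" "core x' = x" "fac x' = l"
proof (cases "ear x")
  case True
  show ?thesis
  proof (cases l)
    case None
    then show ?thesis using that[of "next_side d x"] True V'_next ear_core by (simp add: fac_def)
  next
    case (Some \<alpha>)
    then have "\<alpha> \<in> A" "snd \<alpha> \<noteq> x" using assms True by (auto simp: facs_def live_def)
    then obtain X where X: "ear X" "X \<in> V'" "\<alpha> = apex X" using A_apex by blast
    then have "other X \<noteq> x" using \<open>snd \<alpha> \<noteq> x\<close> by (simp add: apex_def)
    then have "X = x" using ear_other True X by metis
    then show ?thesis using that[of x] True X Some ear_core by (simp add: fac_def)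
  qed
next
  case False
  then have l: "l = None" using assms by (simp add: facs_def)
  have "step x = 0" using assms(1,3) False by (auto simp: live_def dead_def step_def)
  then show ?thesis using that[of x] l False assms(1) V'_ord step_cases[of x] by (auto simp: fac_def)
qed

lemma same_core:
  assumes "x \<noteq> y" "core x = core y"
  obtains X where "ear X" "x = next_side d X \<and> y = X \<or> x = X \<and> y = next_side d X"
  using step_cases[of x] step_cases[of y] assms unfolding ear_def by metis

lemma core_arrs:
  assumes "x \<in> V'" "y \<in> V'" "core x \<noteq> core y" "fst x = fst y"
  shows "(core x, core y) \<in> arrs G" "(core x, core y) \<notin> A" "(core y, core x) \<notin> A"
proof -
  have V: "core x \<in> V" "core y \<in> V" using core_V assms by auto
  then show "(core x, core y) \<in> arrs G" using assms by (simp add: arr_iff)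
  show "(core x, core y) \<notin> A" "(core y, core x) \<notin> A"
    using core_not_dead assms dead_iff by blast+
qed

lemma g_ear: "ear X \<Longrightarrow> g (next_side d X) X = Dual (apex X)" "ear X \<Longrightarrow> g X (next_side d X) = DualOp (apex X)"
  using ear_core by (simp_all add: g_def)

lemma A_not_ear: "(x, y) \<in> A \<Longrightarrow> \<not> ear x" "(x, y) \<in> A \<Longrightarrow> x = next_side d y"
  using ear_core(7)[of y x] A_iff[of x y] by auto

text \<open>
  A composite survives exactly if its factors are live at both ends, and the live factors at an
  old side correspond to the new sides with this core. The arrows \<open>\<alpha>\<^sup>*\<close>
  and their opposites join the two new sides that share a core.
\<close>

lemma remaining_arrs: "arrs QM - killed = {g x y | x y. x \<in> V' \<and> y \<in> V' \<and> x \<noteq> y \<and> fst x = fst y}"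
proof (intro equalityI subsetI)
  fix m assume m: "m \<in> arrs QM - killed"
  show "m \<in> {g x y | x y. x \<in> V' \<and> y \<in> V' \<and> x \<noteq> y \<and> fst x = fst y}"
  proof (cases m)
    case (Cmp l \<phi> r)
    obtain x y where \<phi>: "\<phi> = (x, y)" by (cases \<phi>)
    have props: "(x, y) \<in> arrs G \<and> (x, y) \<notin> A \<and> (y, x) \<notin> A \<and> l \<in> facs x \<and> r \<in> facs y"
    proof -
      have "m \<in> arrs QM" using m by simp
      moreover have "(x, y) \<in> mut_out d (Inr i) G \<Longrightarrow> (x, y) \<notin> A \<and> (y, x) \<notin> A"
        "(y, x) \<in> mut_out d (Inr i) G \<Longrightarrow> (x, y) \<notin> A \<and> (y, x) \<notin> A"
        using A_not_ear[of x y] A_not_ear[of y x] unfolding out_iff by blast+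
      moreover have "ear x \<Longrightarrow> ear y \<Longrightarrow> (x, y) \<notin> A \<and> (y, x) \<notin> A"
        using A_not_ear(1)[of x y] A_not_ear(1)[of y x] by blast
      ultimately show ?thesis unfolding Cmp \<phi> using arrs_sym[of x y]
        by (cases l; cases r) (auto simp: QM_Cmp facs_def out_iff)
    qed
    then have "live l x" "live r y" using Cmp_facs_iff(2)[of x y l r] m Cmp \<phi> by auto
    moreover have V: "x \<in> V" "y \<in> V" "x \<noteq> y" "fst x = fst y" using props by (auto simp: arr_iff)
    ultimately obtain x' y' where x': "x' \<in> V'" "core x' = x" "fac x' = l" "y' \<in> V'" "core y' = y" "fac y' = r"
      using fac_surj props by metis
    have "fst x' = fst y'" using V x' core_simps(9) by metis
    moreover have "m = g x' y'" using V(3) x' Cmp \<phi> by (simp add: g_def)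
    ultimately show ?thesis using x' V(3) by blast
  next
    case (Dual \<alpha>)
    then have "\<alpha> \<in> A" using m QM_Dual by blast
    then obtain X where X: "ear X" "X \<in> V'" "\<alpha> = apex X" using A_apex by blast
    then have "m = g (next_side d X) X" using Dual g_ear(1) by simp
    then show ?thesis using X V'_next[OF X(1)] ear_core(6)[OF X(1)] next_facts(3)[of X] by blast
  next
    case (DualOp \<alpha>)
    then have "\<alpha> \<in> A" using m QM_Dual by blast
    then obtain X where X: "ear X" "X \<in> V'" "\<alpha> = apex X" using A_apex by blast
    then have "m = g X (next_side d X)" using DualOp g_ear(2) by simp
    then show ?thesis using X V'_next[OF X(1)] ear_core(6)[OF X(1)] next_facts(3)[of X, symmetric]
      ear_core(6)[OF X(1), THEN not_sym] by blast
  qed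
next
  fix m assume "m \<in> {g x y | x y. x \<in> V' \<and> y \<in> V' \<and> x \<noteq> y \<and> fst x = fst y}"
  then obtain x y where m: "m = g x y" and xy: "x \<in> V'" "y \<in> V'" "x \<noteq> y" "fst x = fst y" by blast
  show "m \<in> arrs QM - killed"
  proof (cases "core x = core y")
    case True
    then obtain X where X: "ear X" "x = next_side d X \<and> y = X \<or> x = X \<and> y = next_side d X"
      using same_core xy by blast
    then have "X \<in> V'" using xy by auto
    then have "apex X \<in> A" using apex_A X by simp
    then have "m \<in> arrs QM" "m = Dual (apex X) \<or> m = DualOp (apex X)"
      using X m g_ear[OF X(1)] \<open>apex X \<in> A\<close> by (auto simp: QM_Dual)
    then show ?thesis by (auto simp: sup_iff sup_base_Cmp)
  next
    case False
    then have "m = Cmp (fac x) (core x, core y) (fac y)" using m by (simp add: g_def)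
    then show ?thesis
      using Cmp_facs_iff[OF core_arrs[OF xy(1,2) False xy(4)] fac_facs[OF xy(1)] fac_facs[OF xy(2)]]
        fac_live xy by simp
  qed
qed

lemma g_inj:
  assumes "x \<noteq> y" "x' \<noteq> y'" "g x y = g x' y'"
  shows "x = x' \<and> y = y'"
proof (cases "core x = core y")
  case True
  then obtain X where X: "ear X" "x = next_side d X \<and> y = X \<or> x = X \<and> y = next_side d X"
    using same_core assms by blast
  have gd: "g x y = Dual (apex X) \<or> g x y = DualOp (apex X)" using X(2) g_ear[OF X(1)] by auto
  have "core x' = core y'"
  proof (rule ccontr)
    assume "core x' \<noteq> core y'"
    then have "g x' y' = Cmp (fac x') (core x', core y') (fac y')" by (simp add: g_def)
    then show False using gd assms(3) by auto
  qed
  then obtain Y where Y: "ear Y" "x' = next_side d Y \<and> y' = Y \<or> x' = Y \<and> y' = next_side d Y"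
    using same_core assms by blast
  have "apex X = apex Y" using X(2) Y(2) assms(3) g_ear[OF X(1)] g_ear[OF Y(1)] by auto
  then have XY: "X = Y" using apex_inj[OF X(1) Y(1)] by blast
  show ?thesis using X(2) Y(2)[folded XY] assms(3) g_ear[OF X(1)] by auto
next
  case False
  then have g1: "g x y = Cmp (fac x) (core x, core y) (fac y)" by (simp add: g_def)
  then have "core x' \<noteq> core y'" using assms(3) by (auto simp: g_def[of x' y'] split: if_splits)
  then have "g x' y' = Cmp (fac x') (core x', core y') (fac y')" by (simp add: g_def)
  then show ?thesis using assms(3) g1 fac_inj by auto
qed

lemma src_ear: "x \<in> V' \<Longrightarrow> src G (core x, y) = Inr i \<longleftrightarrow> ear (core x)"
  and tgt_ear: "x \<in> V' \<Longrightarrow> tgt G (y, core x) = Inr i \<longleftrightarrow> ear (core x)"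
  using G_src[OF core_V] G_tgt[OF core_V] by simp_all

lemma step01: "step x = 0 \<or> step x = 1"
  using step_cases by blast

lemma ear_core_step: "fac x = None \<Longrightarrow> (if ear (core x) then 1 else 0) = step x"
  "fac x = Some \<alpha> \<Longrightarrow> step x = 0" "fac x = Some \<alpha> \<Longrightarrow> ear (core x)"
  by (cases x rule: side_kinds; simp)+

lemma ear_pair:
  assumes "ear X"
  shows "cd (next_side d X) X = 1" "cd X (next_side d X) = int d - 1"
proof -
  have n: "snd (next_side d X) < d" "next_side d X \<noteq> X" using assms next_facts(1,2) ear_core(6) by (auto simp: ear_def)
  have s: "snd X < d" using V_snd ear_V assms by blast
  then have "cd X X = 0" by (simp add: clock_dist_alt)
  then show 1: "cd (next_side d X) X = 1" using clock_dist_next(1)[OF s s] n by simp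
  show "cd X (next_side d X) = int d - 1" using clock_dist_sum[OF n(1) s next_facts(3) n(2)] 1 by simp
qed

lemma deg_g:
  assumes xy: "x \<in> V'" "y \<in> V'" "x \<noteq> y" "fst x = fst y"
  shows "mut_deg d (Inr i) G (g x y) = 1 - cd x y"
proof (cases "core x = core y")
  case True
  then obtain X where X: "ear X" "x = next_side d X \<and> y = X \<or> x = X \<and> y = next_side d X"
    using same_core xy by blast
  then show ?thesis using g_ear[OF X(1)] ear_pair[OF X(1)] by auto
next
  case False
  note a = core_arrs[OF xy(1,2) False xy(4)]
  have V: "core x \<in> V" "core y \<in> V" and f: "fst (core x) = fst (core y)" using core_V xy by auto
  have D: "deg G (core x, core y) = 1 - cd (core x) (core y)" "deg G (core y, core x) = 1 - cd (core y) (core x)"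
    using G_deg a(1) arrs_sym by blast+
  have sum: "cd (core x) (core y) + cd (core y) (core x) = int d"
    using clock_dist_sum[OF V_snd[OF V(1)] V_snd[OF V(2)] f False] .
  have c: "cd x y = cd (core x) (core y) + step x - step y"
    using clock_dist_core[OF V'_snd[OF xy(1)] V'_snd[OF xy(2)] xy(4) False] .
  have s: "src G (core x, core y) = Inr i \<longleftrightarrow> ear (core x)" "tgt G (core x, core y) = Inr i \<longleftrightarrow> ear (core y)"
    using src_ear tgt_ear xy by auto
  show ?thesis
  proof (cases "fac x"; cases "fac y")
    assume "fac x = None" "fac y = None"
    then show ?thesis using False c D s ear_core_step(1)[of x] ear_core_step(1)[of y] by (simp add: g_def)
  next
    fix \<beta> assume "fac x = None" "fac y = Some \<beta>"
    then show ?thesis using False c D s sum ear_core_step(1)[of x] ear_core_step(2)[of y] by (simp add: g_def G_simps(2))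
  next
    fix \<alpha> assume "fac x = Some \<alpha>" "fac y = None"
    then show ?thesis using False c D s ear_core_step(2)[of x] ear_core_step(1)[of y] by (simp add: g_def)
  next
    fix \<alpha> \<beta> assume "fac x = Some \<alpha>" "fac y = Some \<beta>"
    then show ?thesis using False c D ear_core_step(2)[of x] ear_core_step(2)[of y] by (simp add: g_def)
  qed
qed

lemma opp_g: "\<lbrakk>x \<noteq> y\<rbrakk> \<Longrightarrow> mut_opp G (g x y) = g y x"
proof (cases "core x = core y")
  case True
  assume "x \<noteq> y"
  then obtain X where X: "ear X" "x = next_side d X \<and> y = X \<or> x = X \<and> y = next_side d X"
    using same_core True by blast
  then show ?thesis using g_ear[OF X(1)] by auto
qed (simp add: g_def G_simps(2))

lemma osgn_g_ear: "ear X \<Longrightarrow> mut_osgn d (Inr i) G (g (next_side d X) X) = 1"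
  "ear X \<Longrightarrow> mut_osgn d (Inr i) G (g X (next_side d X)) = - 1"
  using g_ear by simp_all

lemma ear_sign_fac: "ear_sign x = (if fac x = None then 1 else - 1)"
  by (simp add: ear_sign_def fac_def ear_def)

lemma osgn_g:
  assumes xy: "x \<in> V'" "y \<in> V'" "core x \<noteq> core y" "fst x = fst y"
  shows "mut_osgn d (Inr i) G (g x y) = ear_sign x * ear_sign y * psign ((int d + 1) * step x) * \<sigma> (core x, core y)"
proof -
  note a = core_arrs[OF xy]
  have V: "core x \<in> V" "core y \<in> V" and f: "fst (core x) = fst (core y)" using core_V xy by auto
  have s: "src G (core x, core y) = Inr i \<longleftrightarrow> ear (core x)" using src_ear xy by auto
  have ne: "x \<noteq> y" using xy(3) by auto
  have gxy: "g x y = Cmp (fac x) (core x, core y) (fac y)" "g y x = Cmp (fac y) (core y, core x) (fac x)"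
    using xy(3) by (simp_all add: g_def)
  show ?thesis
  proof (cases "fac x"; cases "fac y")
    assume "fac x = None" "fac y = None"
    then show ?thesis using s ear_core_step(1)[of x] gxy by (auto simp: ear_sign_fac G_simps(3) psign_def)
  next
    fix \<beta> assume fxy: "fac x = None" "fac y = Some \<beta>"
    have "mut_osgn d (Inr i) G (g x y) = psign (mut_deg d (Inr i) G (g x y) * mut_deg d (Inr i) G (g y x)) * \<sigma> (core y, core x)"
      unfolding gxy fxy by (simp add: G_simps)
    also have "\<dots> = psign ((1 - cd x y) * (1 - cd y x)) * \<sigma> (core y, core x)"
      using deg_g[OF xy(1,2) ne xy(4)] deg_g[OF xy(2,1) ne[symmetric] xy(4)[symmetric]] by simp
    finally have e: "mut_osgn d (Inr i) G (g x y) = psign ((1 - cd x y) * (1 - cd y x)) * \<sigma> (core y, core x)" .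
    have y0: "step y = 0" using ear_core_step(2) fxy by simp
    have c1: "cd x y = cd (core x) (core y) + step x"
      using clock_dist_core[OF V'_snd[OF xy(1)] V'_snd[OF xy(2)] xy(4,3)] y0 by simp
    have c2: "cd y x = int d - (cd (core x) (core y) + step x)"
      using clock_dist_sum[OF V'_snd[OF xy(1)] V'_snd[OF xy(2)] xy(4) ne] c1 by simp
    have c3: "cd (core y) (core x) = int d - cd (core x) (core y)"
      using clock_dist_sum[OF V_snd[OF V(1)] V_snd[OF V(2)] f xy(3)] by simp
    have par: "psign ((1 - (a + t)) * (1 - (D - (a + t)))) = (psign ((D + 1) * t) * psign ((1 - a) * (1 - (D - a))) :: int)"
      if "t = 0 \<or> t = 1" for a t D :: int
      using that by (elim disjE) (simp_all add: psign_def)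
    have ee: "psign ((1 - cd x y) * (1 - cd y x)) =
        (psign ((int d + 1) * step x) * psign ((1 - cd (core x) (core y)) * (1 - cd (core y) (core x))) :: int)"
      unfolding c2 c3 unfolding c1 by (rule par[OF step01])
    have "\<sigma> (core x, core y) * \<sigma> (core y, core x) = - psign ((1 - cd (core x) (core y)) * (1 - cd (core y) (core x)))"
      by (rule \<sigma>_op[OF a(1)])
    then have "psign ((1 - cd (core x) (core y)) * (1 - cd (core y) (core x))) * \<sigma> (core y, core x) = - \<sigma> (core x, core y)"
      using \<sigma>_one[OF a(1)] \<sigma>_one[of "core y" "core x"] a(1) arrs_sym[of "core x" "core y"] by auto
    then show ?thesis unfolding e ee by (simp add: ear_sign_fac fxy mult.assoc)
  next
    fix \<alpha> assume "fac x = Some \<alpha>" "fac y = None"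
    then show ?thesis using gxy ear_core_step(2)[of x] by (simp add: ear_sign_fac G_simps(3) psign_def)
  next
    fix \<alpha> \<beta> assume "fac x = Some \<alpha>" "fac y = Some \<beta>"
    then show ?thesis using gxy ear_core_step(2)[of x] by (simp add: ear_sign_fac G_simps(3) psign_def)
  qed
qed

end

section \<open>The mutated potential\<close>

lemma poly_mapping_sum_single: "x = (\<Sum>w\<in>Poly_Mapping.keys x. Poly_Mapping.single w (Poly_Mapping.lookup x w))"
proof (rule poly_mapping_eqI)
  fix k
  have "Poly_Mapping.lookup (\<Sum>w\<in>Poly_Mapping.keys x. Poly_Mapping.single w (Poly_Mapping.lookup x w)) k =
      (\<Sum>w\<in>Poly_Mapping.keys x. if w = k then Poly_Mapping.lookup x k else 0)"
    unfolding lookup_sum by (intro sum.cong refl) (simp add: lookup_single when_def)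
  also have "\<dots> = Poly_Mapping.lookup x k" by (simp add: in_keys_iff)
  finally show "Poly_Mapping.lookup x k = Poly_Mapping.lookup (\<Sum>w\<in>Poly_Mapping.keys x. Poly_Mapping.single w (Poly_Mapping.lookup x w)) k" ..
qed

lemma lin_scl: "lin f (scl c x) = scl c (lin f x)"
proof -
  have "lin f (scl c x) = lin f (\<Sum>w\<in>Poly_Mapping.keys x. monom_word w (c * Poly_Mapping.lookup x w))"
    by (subst (1) poly_mapping_sum_single[of x]) (simp add: scl_sum)
  also have "\<dots> = scl c (lin f x)" by (simp add: lin_sum lin_def[of f x] scl_sum scl_scl)
  finally show ?thesis .
qed

lemma lin_lin: "lin f (lin h x) = lin (\<lambda>w. lin f (h w)) x"
  by (simp add: lin_def[of h x] lin_def[of "\<lambda>w. lin f (h w)" x] lin_sum lin_scl)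

lemma scl_neg_one: "scl (- 1) x = - x"
  using scl_add_left[of 1 "- 1" x] by (simp add: eq_neg_iff_add_eq_0 add.commute)

context flip_quiver
begin

lemma finite_A: "finite A"
  unfolding A_eq using finite_V' by simp

definition reading :: "(side \<times> side) symb list \<Rightarrow> ((side \<times> side) marrow list \<Rightarrow>\<^sub>0 'k::comm_ring_1)" where
  "reading v = (if set (read_symbs A None v) \<inter> killed = {} then word (read_symbs A None v) else 0)"

text \<open>
  Decomposing, reading and deleting are linear, so they can be carried out cycle by cycle.
\<close>

lemma mutation'_potential_lin:
  fixes W :: "(side \<times> side) list \<Rightarrow>\<^sub>0 'k::comm_ring_1"
  shows "mutation'_potential d P \<sigma> i W = lin (\<lambda>c. lin reading (dec_cyc d (Inr i) G c)) W +
     (\<Sum>\<alpha>\<in>A. \<Sum>\<phi>\<in>mut_out d (Inr i) G. scl (of_int (mut_osgn d (Inr i) G (Cmp None \<phi> None)))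
        (lin reading (word [Arr \<alpha>] * dec (Inr i) G [\<phi>, opp G \<phi>] * word [Star \<alpha>])))"
proof -
  have "lin (\<lambda>c. if set c \<inter> killed = {} then word c else 0) (lin (\<lambda>w. word (read_symbs A None w)) X) = lin reading X"
    for X :: "(side \<times> side) symb list \<Rightarrow>\<^sub>0 'k"
    unfolding lin_lin reading_def[abs_def] word_single lin_single by simp
  then show ?thesis
    unfolding mutation'_potential_def mut_potential_def
    by (simp add: lin_add lin_sum lin_scl lin_lin)
qed

definition insertion :: "(side \<times> side) option \<Rightarrow> (side \<times> side) symb list" where
  "insertion l = (case l of None \<Rightarrow> [] | Some \<beta> \<Rightarrow> [Inv \<beta>, Arr \<beta>])"

definition insertion_sign :: "(side \<times> side) option \<Rightarrow> 'k::comm_ring_1" where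
  "insertion_sign l = (case l of None \<Rightarrow> 1 | Some \<beta> \<Rightarrow> - 1)"

lemma finite_facs: "finite (facs x)"
  using finite_A by (simp add: facs_def)

lemma sum_facs: "(\<Sum>l\<in>facs x. F l) = (if ear x then F None + (\<Sum>\<alpha>\<in>A. F (Some \<alpha>)) else F None)"
  using finite_A by (simp add: facs_def sum.reindex comp_def image_iff)

text \<open>
  The element \<open>\<Delta>\<close> is a signed sum over the factors available at a side of
  \<open>i\<close>; at other sides nothing is inserted. So expanding a path means choosing a
  factor at each of its vertices.
\<close>

lemma insertion_sum:
  "(if ear y then mut_Delta A else 1) = (\<Sum>l\<in>facs y. monom_word (insertion l) (insertion_sign l))"
  unfolding sum_facs by (simp add: mut_Delta_def insertion_def insertion_sign_def word_single single_uminus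
      sum_negf word_Nil[unfolded word_single])

lemma dec2:
  assumes "(x, y) \<in> arrs G" "(x, y) \<notin> A"
  shows "dec (Inr i) G ((x, y) # \<psi> # p) =
    (\<Sum>m\<in>facs y. monom_word (Arr (x, y) # insertion m) (insertion_sign m) * dec (Inr i) G (\<psi> # p))"
proof -
  have "tgt G (x, y) = Inr i \<longleftrightarrow> ear y" using assms(1) G_tgt[of y x] by (simp add: arr_iff)
  then have "dec (Inr i) G ((x, y) # \<psi> # p) =
      word [Arr (x, y)] * (if ear y then mut_Delta A else 1) * dec (Inr i) G (\<psi> # p)"
    using assms(2) by simp
  also have "\<dots> = (\<Sum>m\<in>facs y. monom_word (Arr (x, y) # insertion m) (insertion_sign m) * dec (Inr i) G (\<psi> # p))"
    unfolding insertion_sum by (simp add: sum_distrib_left sum_distrib_right word_single single_times_word)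
  finally show ?thesis .
qed

definition prefix :: "(side \<times> side) option \<Rightarrow> (side \<times> side) symb list" where
  "prefix l = (case l of None \<Rightarrow> [] | Some \<alpha> \<Rightarrow> [Arr \<alpha>])"

definition suffix :: "(side \<times> side) option \<Rightarrow> (side \<times> side) symb list" where
  "suffix l = (case l of None \<Rightarrow> [] | Some \<alpha> \<Rightarrow> [Inv \<alpha>])"

definition front_sign :: "side \<Rightarrow> (side \<times> side) option \<Rightarrow> 'k::comm_ring_1" where
  "front_sign x l = (case l of None \<Rightarrow> if ear x then psign (int d) else 1 | Some \<alpha> \<Rightarrow> - 1)"

lemma dec_cyc_facs:
  assumes "(x, y) \<in> arrs G" "last ((x, y) # p) \<notin> A"
  shows "dec_cyc d (Inr i) G ((x, y) # p) = (\<Sum>l\<in>facs x. scl (front_sign x l)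
     (word (prefix l) * dec (Inr i) G ((x, y) # p) * word (suffix l)))"
proof -
  have "src G (x, y) = Inr i \<longleftrightarrow> ear x" using assms(1) G_src[of x y] by (simp add: arr_iff)
  then show ?thesis using assms(2)
    by (simp add: dec_cyc_def Let_def sum_facs prefix_def suffix_def front_sign_def word_Nil sum_negf scl_neg_one del: dec.simps)
qed

lemma facs_A: "Some \<alpha> \<in> facs x \<Longrightarrow> \<alpha> \<in> A"
  by (auto simp: facs_def split: if_splits)

lemma facs_cases:
  assumes "l \<in> facs x"
  obtains "l = None" | \<alpha> where "l = Some \<alpha>" "\<alpha> \<in> A"
  using assms facs_A by (cases l) blast+

lemma read_cycle:
  assumes "l \<in> facs x" "m \<in> facs y" "n \<in> facs z" "\<phi> \<notin> A" "\<psi> \<notin> A" "\<xi> \<notin> A"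
  shows "read_symbs A None (prefix l @ (Arr \<phi> # insertion m) @ (Arr \<psi> # insertion n) @ [Arr \<xi>] @ suffix l) =
     [Cmp l \<phi> m, Cmp m \<psi> n, Cmp n \<xi> l]"
  using assms(1)
proof (cases rule: facs_cases)
  case 1
  show ?thesis using assms(2)
    by (cases rule: facs_cases; use assms(3) in \<open>cases rule: facs_cases\<close>)
      (simp_all add: 1 assms(4-6) prefix_def suffix_def insertion_def)
next
  case (2 \<alpha>)
  show ?thesis using assms(2)
    by (cases rule: facs_cases; use assms(3) in \<open>cases rule: facs_cases\<close>)
      (simp_all add: 2 assms(4-6) prefix_def suffix_def insertion_def)
qed

text \<open>
  After deletion, choosing a live factor at \<open>x\<close> is the same as choosing a new side
  over \<open>x\<close>.
\<close>

definition lifts :: "side \<Rightarrow> side set" where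
  "lifts x = {x' \<in> V'. core x' = x}"

lemma sum_lifts:
  assumes "x \<in> V"
  shows "(\<Sum>l\<in>facs x. if live l x then F l else 0) = (\<Sum>x'\<in>lifts x. F (fac x'))"
proof -
  have "(\<Sum>l\<in>facs x. if live l x then F l else 0) = (\<Sum>l\<in>{l \<in> facs x. live l x}. F l)"
    using finite_facs by (simp add: sum.inter_filter)
  also have "\<dots> = (\<Sum>x'\<in>lifts x. F (fac x'))"
  proof (rule sum.reindex_bij_betw[symmetric], rule bij_betwI')
    show "fac x' = fac y' \<longleftrightarrow> x' = y'" if "x' \<in> lifts x" "y' \<in> lifts x" for x' y'
      using that fac_inj[of x' y'] by (auto simp: lifts_def)
    show "fac x' \<in> {l \<in> facs x. live l x}" if "x' \<in> lifts x" for x'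
      using that fac_facs[of x'] fac_live[of x'] by (auto simp: lifts_def)
    show "\<exists>x'\<in>lifts x. l = fac x'" if "l \<in> {l \<in> facs x. live l x}" for l
    proof -
      have "l \<in> facs x" "live l x" using that by auto
      then obtain x' where "x' \<in> V'" "core x' = x" "fac x' = l" by (rule fac_surj[OF assms])
      then show ?thesis by (intro bexI[of _ x']) (simp_all add: lifts_def)
    qed
  qed
  finally show ?thesis .
qed

lemma lifts_dead: "dead x \<Longrightarrow> lifts x = {}"
  using core_not_dead by (auto simp: lifts_def)

lemma insertion_sign_fac: "insertion_sign (fac x) = ear_sign x"
  by (simp add: insertion_sign_def fac_def ear_sign_def ear_def)

lemma front_sign_fac: "front_sign (core x) (fac x) = ear_sign x * psign (int d * step x)"
proof (cases x rule: side_kinds)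
  case ear
  then show ?thesis by (simp add: front_sign_def ear_sign_def ear_def psign_def)
next
  case (nxt X)
  show ?thesis unfolding front_sign_def ear_sign_fac nxt(3,4,6) using nxt(1) by simp
next
  case ord
  show ?thesis unfolding front_sign_def ear_sign_fac ord(2,3,4) using ord(1) by (simp add: psign_def)
qed

definition lifted_cycles :: "side \<Rightarrow> side \<Rightarrow> side \<Rightarrow> ((side \<times> side) marrow list \<Rightarrow>\<^sub>0 'k::comm_ring_1)" where
  "lifted_cycles x y z = (\<Sum>x'\<in>lifts x. \<Sum>y'\<in>lifts y. \<Sum>z'\<in>lifts z. monom_word [g x' y', g y' z', g z' x']
     (ear_sign x' * ear_sign y' * ear_sign z' * psign (int d * step x')))"

text \<open>
  Each vertex of the triangle is lifted independently, and the signs of the choices multiply.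
\<close>

lemma reading_cycle_generic:
  assumes V: "x \<in> V" "y \<in> V" "z \<in> V" "x \<noteq> y" "y \<noteq> z" "z \<noteq> x" and f: "fst x = fst y" "fst y = fst z"
    and n: "(x, y) \<notin> A" "(y, z) \<notin> A" "(z, x) \<notin> A" "(y, x) \<notin> A" "(z, y) \<notin> A" "(x, z) \<notin> A"
  shows "lin reading (dec_cyc d (Inr i) G [(x, y), (y, z), (z, x)]) = (lifted_cycles x y z :: _ \<Rightarrow>\<^sub>0 'b::comm_ring_1)"
proof -
  have a: "(x, y) \<in> arrs G" "(y, z) \<in> arrs G" "(z, x) \<in> arrs G" using V f by (simp_all add: arr_iff)
  let ?v = "\<lambda>l m n. prefix l @ (Arr (x, y) # insertion m) @ (Arr (y, z) # insertion n) @ [Arr (z, x)] @ suffix l"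
  let ?c = "\<lambda>l m n. [Cmp l (x, y) m, Cmp m (y, z) n, Cmp n (z, x) l]"
  let ?s = "\<lambda>l m n. front_sign x l * (insertion_sign m * insertion_sign n) :: 'b"
  have dec: "dec (Inr i) G [(x, y), (y, z), (z, x)] =
      (\<Sum>m\<in>facs y. \<Sum>n\<in>facs z. monom_word ((Arr (x, y) # insertion m) @ (Arr (y, z) # insertion n) @ [Arr (z, x)])
        (insertion_sign m * insertion_sign n :: 'b))"
    by (simp add: dec2[OF a(1) n(1)] dec2[OF a(2) n(2)] sum_distrib_left word_single single_times_word
        del: dec.simps(3))
  have "lin reading (dec_cyc d (Inr i) G [(x, y), (y, z), (z, x)]) =
      (\<Sum>l\<in>facs x. \<Sum>m\<in>facs y. \<Sum>n\<in>facs z. scl (?s l m n) (reading (?v l m n)))"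
    using n(3) by (simp add: dec_cyc_facs[OF a(1)] dec lin_sum scl_sum sum_distrib_left sum_distrib_right word_single
        single_times_word del: dec.simps(3))
  also have "\<dots> = (\<Sum>l\<in>facs x. \<Sum>m\<in>facs y. \<Sum>n\<in>facs z. if live l x then if live m y then if live n z then
      monom_word (?c l m n) (?s l m n) else 0 else 0 else 0)"
  proof (intro sum.cong refl)
    fix l m k assume lmk: "l \<in> facs x" "m \<in> facs y" "k \<in> facs z"
    note rd = read_cycle[OF lmk n(1-3)]
    have "set (?c l m k) \<inter> killed = {} \<longleftrightarrow> live l x \<and> live m y \<and> live k z"
      using Cmp_facs_iff(2)[OF a(1) n(1,4) lmk(1,2)] Cmp_facs_iff(2)[OF a(2) n(2,5) lmk(2,3)]
        Cmp_facs_iff(2)[OF a(3) n(3,6) lmk(3,1)] by auto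
    then show "scl (?s l m k) (reading (?v l m k)) = (if live l x then if live m y then if live k z then
      monom_word (?c l m k) (?s l m k) else 0 else 0 else 0)"
      unfolding reading_def rd by (simp add: word_single)
  qed
  also have "\<dots> = (\<Sum>l\<in>facs x. if live l x then \<Sum>m\<in>facs y. if live m y then \<Sum>n\<in>facs z. if live n z then
      monom_word (?c l m n) (?s l m n) else 0 else 0 else 0)"
    by (intro sum.cong refl) (auto intro!: sum.neutral sum.cong)
  also have "\<dots> = (\<Sum>x'\<in>lifts x. \<Sum>y'\<in>lifts y. \<Sum>z'\<in>lifts z. monom_word (?c (fac x') (fac y') (fac z')) (?s (fac x') (fac y') (fac z')))"
    by (simp only: sum_lifts[OF V(1)] sum_lifts[OF V(2)] sum_lifts[OF V(3)])
  also have "\<dots> = lifted_cycles x y z"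
    unfolding lifted_cycles_def
  proof (intro sum.cong refl)
    fix x' y' z' assume "x' \<in> lifts x" "y' \<in> lifts y" "z' \<in> lifts z"
    then have c: "core x' = x" "core y' = y" "core z' = z" by (auto simp: lifts_def)
    have "?s (fac x') (fac y') (fac z') = ear_sign x' * ear_sign y' * ear_sign z' * psign (int d * step x')"
      unfolding c(1)[symmetric] front_sign_fac insertion_sign_fac by (simp only: mult_ac)
    then show "monom_word (?c (fac x') (fac y') (fac z')) (?s (fac x') (fac y') (fac z')) =
        monom_word [g x' y', g y' z', g z' x'] (ear_sign x' * ear_sign y' * ear_sign z' * psign (int d * step x'))"
      using V(4-6) c by (simp add: g_def)
  qed
  finally show ?thesis .
qed

lemma reading_dead:
  assumes "m \<in> set (read_symbs A None v)" "m \<in> killed"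
  shows "reading v = 0"
  using assms by (auto simp: reading_def)

text \<open>
  A triangle that uses an arrow of \<open>A\<close> passes through the dead source of this arrow,
  and the arrow entering there is superfluous in every reading. This matches the absence of new
  sides over a dead side.
\<close>

lemma reading_cycle_apex:
  assumes V: "X \<in> V" "z \<in> V" "k \<in> V" "X \<noteq> z" "z \<noteq> k" and f: "fst X = fst z" "fst k = fst X"
    and kX: "(k, X) \<in> A"
  shows "lin reading (dec (Inr i) G [(k, X), (X, z), (z, k)]) = (0 :: _ \<Rightarrow>\<^sub>0 'b::comm_ring_1)"
    "lin reading (dec_cyc d (Inr i) G [(z, k), (k, X), (X, z)]) = (0 :: _ \<Rightarrow>\<^sub>0 'b)"
proof -
  have k: "ear X" "k = next_side d X" using kX A_iff by auto
  have ek: "\<not> ear k" using A_not_ear(1)[OF kX] .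
  have dk: "dead k" using kX dead_iff by blast
  have fk: "None \<in> facs k" by (simp add: facs_def)
  have nA: "(X, z) \<notin> A" "(z, k) \<notin> A" "(k, z) \<notin> A"
    using A_not_ear(1)[of X z] A_iff[of z k] A_iff[of k z] ear_core(8)[of X z] k ek V(4) by auto
  have a: "(X, z) \<in> arrs G" "(z, k) \<in> arrs G" using V f by (simp_all add: arr_iff)
  have kill: "Cmp n (z, k) None \<in> killed" if "n \<in> facs z" for n
    using Cmp_facs_iff(2)[OF a(2) nA(2,3) that fk] dk by (simp add: live_def)
  have "dec (Inr i) G [(k, X), (X, z), (z, k)] = (\<Sum>n\<in>facs z. monom_word
      ([Arr (k, X), Arr (X, z)] @ insertion n @ [Arr (z, k)]) (insertion_sign n :: 'b))"
    by (subst dec.simps(3)) (simp add: kX dec2[OF a(1) nA(1)] sum_distrib_left word_single single_times_word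
        del: dec.simps(3))
  moreover have "reading ([Arr (k, X), Arr (X, z)] @ insertion n @ [Arr (z, k)]) = (0 :: _ \<Rightarrow>\<^sub>0 'b)" if n: "n \<in> facs z" for n
  proof (rule reading_dead[OF _ kill[OF n]])
    show "Cmp n (z, k) None \<in> set (read_symbs A None ([Arr (k, X), Arr (X, z)] @ insertion n @ [Arr (z, k)]))"
      using n by (cases rule: facs_cases) (simp_all add: kX nA insertion_def)
  qed
  ultimately show "lin reading (dec (Inr i) G [(k, X), (X, z), (z, k)]) = (0 :: _ \<Rightarrow>\<^sub>0 'b)"
    by (simp add: lin_sum del: dec.simps(3))
  have tk: "tgt G (z, k) \<noteq> Inr i" using G_tgt[OF V(3)] ek by simp
  have "dec (Inr i) G [(z, k), (k, X), (X, z)] = monom_word [Arr (z, k), Arr (k, X), Arr (X, z)] (1 :: 'b)"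
    using kX tk by (simp add: word_single single_times_word)
  then have "lin reading (dec_cyc d (Inr i) G [(z, k), (k, X), (X, z)]) =
      (\<Sum>l\<in>facs z. scl (front_sign z l) (reading (prefix l @ [Arr (z, k), Arr (k, X), Arr (X, z)] @ suffix l) :: _ \<Rightarrow>\<^sub>0 'b))"
    using nA(1) by (simp add: dec_cyc_facs[OF a(2)] lin_sum word_single single_times_word del: dec.simps(3))
  also have "\<dots> = 0"
  proof (rule sum.neutral, rule ballI)
    fix l assume l: "l \<in> facs z"
    have "reading (prefix l @ [Arr (z, k), Arr (k, X), Arr (X, z)] @ suffix l) = (0 :: _ \<Rightarrow>\<^sub>0 'b)"
    proof (rule reading_dead[OF _ kill[OF l]])
      show "Cmp l (z, k) None \<in> set (read_symbs A None (prefix l @ [Arr (z, k), Arr (k, X), Arr (X, z)] @ suffix l))"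
        using l by (cases rule: facs_cases) (simp_all add: kX nA prefix_def suffix_def)
    qed
    then show "scl (front_sign z l) (reading (prefix l @ [Arr (z, k), Arr (k, X), Arr (X, z)] @ suffix l) :: _ \<Rightarrow>\<^sub>0 'b) = 0"
      by simp
  qed
  finally show "lin reading (dec_cyc d (Inr i) G [(z, k), (k, X), (X, z)]) = (0 :: _ \<Rightarrow>\<^sub>0 'b)" .
qed

lemma reading_cycle:
  assumes V: "x \<in> V" "y \<in> V" "z \<in> V" and cw: "clockwise d x y z"
  shows "lin reading (dec_cyc d (Inr i) G [(x, y), (y, z), (z, x)]) = (lifted_cycles x y z :: _ \<Rightarrow>\<^sub>0 'b::comm_ring_1)"
proof -
  note s = V_snd[OF V(1)] V_snd[OF V(2)] V_snd[OF V(3)]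
  have cw2: "clockwise d y z x" and cw3: "clockwise d z x y"
    using clockwise_rotate[OF s cw] clockwise_rotate[OF s(2,3,1) clockwise_rotate[OF s cw]] by auto
  have ne: "x \<noteq> y" "y \<noteq> z" "z \<noteq> x" and f: "fst x = fst y" "fst y = fst z"
    using clockwise_distinct[OF s cw] by auto
  \<comment> \<open>an arrow opposite to one of \<open>A\<close> has length \<open>d - 1\<close>, too long for a clockwise triangle\<close>
  have opp: "(b, a) \<notin> A" if "clockwise d a b c" "a \<in> V" "b \<in> V" "c \<in> V" for a b c
  proof
    assume "(b, a) \<in> A"
    then have "ear a" "b = next_side d a" using A_iff by auto
    then have "cd a b = int d - 1" using ear_pair(2) by simp
    moreover have "clock_dist d a c < d"
      using clock_dist_pos[OF V_snd[OF that(2)] V_snd[OF that(4)]] clockwise_distinct[OF V_snd[OF that(2)] V_snd[OF that(3)] V_snd[OF that(4)] that(1)] by simp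
    ultimately show False using that(1) by (simp add: clockwise_def)
  qed
  have o: "(y, x) \<notin> A" "(z, y) \<notin> A" "(x, z) \<notin> A"
    using opp[OF cw V] opp[OF cw2 V(2,3,1)] opp[OF cw3 V(3,1,2)] by auto
  have dead: "lifts k = {}" if "(k, X) \<in> A" for k X using lifts_dead dead_iff that by blast
  have src: "src G (k, X) \<noteq> Inr i" if "(k, X) \<in> A" for k X
  proof -
    have "k \<in> V" using that A_iff by blast
    then show ?thesis using G_src[of k X] A_not_ear(1)[OF that] by simp
  qed
  consider (1) "(x, y) \<in> A" | (2) "(y, z) \<in> A" "(x, y) \<notin> A" | (3) "(z, x) \<in> A" "(x, y) \<notin> A"
    | (0) "(x, y) \<notin> A" "(y, z) \<notin> A" "(z, x) \<notin> A" by blast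
  then show ?thesis
  proof cases
    case 1
    have zx: "(z, x) \<notin> A" using A_iff[of z x] A_not_ear(1)[OF 1] by simp
    have "dec_cyc d (Inr i) G [(x, y), (y, z), (z, x)] = (dec (Inr i) G [(x, y), (y, z), (z, x)] :: _ \<Rightarrow>\<^sub>0 'b)"
      using zx src[OF 1] by (simp add: dec_cyc_def Let_def del: dec.simps)
    then show ?thesis using reading_cycle_apex(1)[OF V(2,3,1) ne(2,3) f(2,1) 1] dead[OF 1]
      by (simp add: lifted_cycles_def)
  next
    case 2
    then show ?thesis using reading_cycle_apex(2)[OF V(3,1,2) ne(3,1) _ _ 2(1)] f dead[OF 2(1)]
      by (simp add: lifted_cycles_def)
  next
    case 3
    have "dec_cyc d (Inr i) G [(x, y), (y, z), (z, x)] = (dec (Inr i) G [(z, x), (x, y), (y, z)] :: _ \<Rightarrow>\<^sub>0 'b)"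
      using 3 src[OF 3(1)] by (simp add: dec_cyc_def Let_def del: dec.simps)
    then show ?thesis using reading_cycle_apex(1)[OF V(1,2,3) ne(1,2) f(1) _ 3(1)] f dead[OF 3(1)]
      by (simp add: lifted_cycles_def)
  next
    case 0
    then show ?thesis by (intro reading_cycle_generic V ne f o)
  qed
qed

text \<open>The contribution of the terms \<open>\<alpha> \<phi> \<phi>\<^sup>o\<^sup>p \<alpha>\<^sup>*\<close>.\<close>

lemma out_not_A: "(Y, y) \<in> mut_out d (Inr i) G \<Longrightarrow> (Y, y) \<notin> A \<and> (y, Y) \<notin> A"
  using A_not_ear(1)[of Y y] A_not_ear(2)[of y Y] by (auto simp: out_iff)

lemma reading_extra:
  assumes X: "ear X" "X \<in> V'" and out: "(Y, y) \<in> mut_out d (Inr i) G"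
  shows "lin reading (word [Arr (apex X)] * dec (Inr i) G [(Y, y), opp G (Y, y)] * word [Star (apex X)]) =
     (if Y = X then \<Sum>y'\<in>lifts y. monom_word [g X y', g y' (next_side d X), g (next_side d X) X] (ear_sign y') else
       (0 :: _ \<Rightarrow>\<^sub>0 'b::comm_ring_1))"
proof -
  have a: "(Y, y) \<in> arrs G" "(y, Y) \<in> arrs G" and Y: "ear Y" "y \<noteq> next_side d Y"
    using out arrs_sym by (auto simp: out_iff)
  have V: "Y \<in> V" "y \<in> V" "Y \<noteq> y" using a by (auto simp: arr_iff)
  have n: "(Y, y) \<notin> A" "(y, Y) \<notin> A" using out_not_A[OF out] by auto
  have \<alpha>: "apex X \<in> A" using apex_A X by simp
  have fY: "Some (apex X) \<in> facs Y" "None \<in> facs Y" using \<alpha> Y by (auto simp: facs_def)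
  have lY: "live (Some (apex X)) Y \<longleftrightarrow> Y = X" "live None Y"
  proof -
    have "live (Some (apex X)) Y \<longleftrightarrow> \<not> dead Y \<and> other X \<noteq> Y"
      unfolding live_def apex_def option.inject by (metis snd_conv)
    then show "live (Some (apex X)) Y \<longleftrightarrow> Y = X"
      using ear_not_dead[OF Y(1)] ear_other(3)[OF X(1)] ear_other(4)[OF X(1) Y(1)] by metis
    show "live None Y" using ear_not_dead[OF Y(1)] unfolding live_def by blast
  qed
  let ?v = "\<lambda>m. [Arr (apex X), Arr (Y, y)] @ insertion m @ [Arr (y, Y), Star (apex X)]"
  let ?c = "\<lambda>m. [Cmp (Some (apex X)) (Y, y) m, Cmp m (y, Y) None, Dual (apex X)]"
  have rd: "read_symbs A None (?v m) = ?c m" if "m \<in> facs y" for m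
    using that by (cases rule: facs_cases) (simp_all add: \<alpha> n insertion_def)
  have "dec (Inr i) G [(Y, y), opp G (Y, y)] =
      (\<Sum>m\<in>facs y. monom_word ((Arr (Y, y) # insertion m) @ [Arr (y, Y)]) (insertion_sign m :: 'b))"
    by (simp add: dec2[OF a(1) n(1)] G_simps(2) word_single single_times_word del: dec.simps(3))
  then have "lin reading (word [Arr (apex X)] * dec (Inr i) G [(Y, y), opp G (Y, y)] * word [Star (apex X)]) =
      (\<Sum>m\<in>facs y. scl (insertion_sign m) (reading (?v m) :: _ \<Rightarrow>\<^sub>0 'b))"
    by (simp add: lin_sum sum_distrib_left sum_distrib_right word_single single_times_word)
  also have "\<dots> = (\<Sum>m\<in>facs y. if live m y then if Y = X then monom_word (?c m) (insertion_sign m) else 0 else 0)"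
  proof (intro sum.cong refl)
    fix m assume m: "m \<in> facs y"
    have "Dual (apex X) \<notin> killed" by (simp add: sup_iff sup_base_Cmp)
    then have "set (?c m) \<inter> killed = {} \<longleftrightarrow> live m y \<and> Y = X"
      using Cmp_facs_iff(2)[OF a(1) n fY(1) m] Cmp_facs_iff(2)[OF a(2) n(2,1) m fY(2)] lY by auto
    then show "scl (insertion_sign m) (reading (?v m) :: _ \<Rightarrow>\<^sub>0 'b) =
        (if live m y then if Y = X then monom_word (?c m) (insertion_sign m) else 0 else 0)"
      unfolding reading_def rd[OF m] by (simp add: word_single)
  qed
  also have "\<dots> = (\<Sum>y'\<in>lifts y. if Y = X then monom_word (?c (fac y')) (insertion_sign (fac y')) else 0)"
    by (rule sum_lifts[OF V(2)])
  also have "\<dots> = (\<Sum>y'\<in>lifts y. if Y = X then monom_word [g X y', g y' (next_side d X), g (next_side d X) X] (ear_sign y') else 0)"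
  proof (intro sum.cong refl)
    fix y' assume "y' \<in> lifts y"
    then have c: "core y' = y" by (simp add: lifts_def)
    have "fac X = Some (apex X)" "fac (next_side d X) = None" using X(1) ear_core(5)[OF X(1)] by (simp_all add: fac_def)
    then have "Y = X \<Longrightarrow> ?c (fac y') = [g X y', g y' (next_side d X), g (next_side d X) X]"
      using c V(3) ear_core[OF X(1)] by (simp add: g_def)
    then show "(if Y = X then monom_word (?c (fac y')) (insertion_sign (fac y')) else 0) =
        (if Y = X then monom_word [g X y', g y' (next_side d X), g (next_side d X) X] (ear_sign y' :: 'b) else 0)"
      by (simp add: insertion_sign_fac)
  qed
  finally show ?thesis by simp
qed

text \<open>
  The triangles of the new polygons that contain both sides of an ear, each listed in the rotation
  that is produced by the mutation.
\<close>

definition extra_triples :: "(side \<times> side \<times> side) set" where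
  "extra_triples = {(X, y, z). ear X \<and> X \<in> V' \<and> y \<in> V' \<and> core y \<noteq> X \<and> fst y = fst X \<and> z = next_side d X}"

lemma core_fst_eq: "core y' = y \<Longrightarrow> fst y' = fst y"
  using core_simps by metis

lemma extra_sum:
  "(\<Sum>\<alpha>\<in>A. \<Sum>\<phi>\<in>mut_out d (Inr i) G. scl (of_int (mut_osgn d (Inr i) G (Cmp None \<phi> None)))
        (lin reading (word [Arr \<alpha>] * dec (Inr i) G [\<phi>, opp G \<phi>] * word [Star \<alpha>]))) =
   (\<Sum>(X, y, z)\<in>extra_triples. monom_word [g X y, g y z, g z X]
      (psign (int d + 1) * of_int (\<sigma> (X, core y)) * ear_sign y :: 'b::comm_ring_1))"
proof -
  let ?EV = "{X \<in> V'. ear X}"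
  let ?m = "\<lambda>X y'. monom_word [g X y', g y' (next_side d X), g (next_side d X) X]
      (psign (int d + 1) * of_int (\<sigma> (X, core y')) * ear_sign y' :: 'b)"
  let ?O = "\<lambda>X. {y. (X, y) \<in> arrs G \<and> y \<noteq> next_side d X}"
  have fout: "finite (mut_out d (Inr i) G)"
    by (rule finite_subset[of _ "V \<times> V"]) (auto simp: mut_out_def arr_iff finite_V)
  have fO: "finite (?O X)" for X by (rule finite_subset[of _ V]) (auto simp: arr_iff finite_V)
  have inj: "inj_on apex ?EV" using apex_inj by (auto intro: inj_onI)
  have inner: "(\<Sum>\<phi>\<in>mut_out d (Inr i) G. scl (of_int (mut_osgn d (Inr i) G (Cmp None \<phi> None)))
        (lin reading (word [Arr (apex X)] * dec (Inr i) G [\<phi>, opp G \<phi>] * word [Star (apex X)]))) =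
      (\<Sum>y'\<in>{y' \<in> V'. core y' \<noteq> X \<and> fst y' = fst X}. ?m X y')" if X: "X \<in> ?EV" for X
  proof -
    have eX: "ear X" "X \<in> V'" using X by auto
    have XV: "X \<in> V" using ear_V[OF eX(1)] .
    let ?F = "\<lambda>\<phi>. scl (of_int (mut_osgn d (Inr i) G (Cmp None \<phi> None)))
        (lin reading (word [Arr (apex X)] * dec (Inr i) G [\<phi>, opp G \<phi>] * word [Star (apex X)]) :: _ \<Rightarrow>\<^sub>0 'b)"
    have F: "?F (Y, y) = (if Y = X then \<Sum>y'\<in>lifts y. ?m X y' else 0)" if o: "(Y, y) \<in> mut_out d (Inr i) G" for Y y
    proof (cases "Y = X")
      case True
      have "src G (X, y) = Inr i" using G_src[OF XV] eX by simp
      then have s: "mut_osgn d (Inr i) G (Cmp None (Y, y) None) = psign (int d + 1) * \<sigma> (X, y)"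
        using True by (simp add: G_simps(3))
      show ?thesis unfolding s reading_extra[OF eX o] using True
        by (simp add: scl_sum) (rule sum.cong, auto simp: lifts_def)
    next
      case False
      then show ?thesis unfolding reading_extra[OF eX o] by simp
    qed
    have "(\<Sum>\<phi>\<in>mut_out d (Inr i) G. ?F \<phi>) = (\<Sum>\<phi>\<in>{\<phi> \<in> mut_out d (Inr i) G. fst \<phi> = X}. \<Sum>y'\<in>lifts (snd \<phi>). ?m X y')"
      unfolding sum.inter_filter[OF fout]
    proof (intro sum.cong refl)
      fix \<phi> assume "\<phi> \<in> mut_out d (Inr i) G"
      then show "?F \<phi> = (if fst \<phi> = X then \<Sum>y'\<in>lifts (snd \<phi>). ?m X y' else 0)"
        using F[of "fst \<phi>" "snd \<phi>"] by simp
    qed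
    also have "\<dots> = (\<Sum>y\<in>?O X. \<Sum>y'\<in>lifts y. ?m X y')"
    proof (rule sum.reindex_bij_witness[of _ "Pair X" snd])
      fix y assume "y \<in> ?O X"
      then show "(X, y) \<in> {\<phi> \<in> mut_out d (Inr i) G. fst \<phi> = X}" using eX by (simp add: out_iff)
    next
      fix \<phi> assume "\<phi> \<in> {\<phi> \<in> mut_out d (Inr i) G. fst \<phi> = X}"
      then have o: "(X, snd \<phi>) \<in> mut_out d (Inr i) G" and e: "(X, snd \<phi>) = \<phi>" by auto
      show "snd \<phi> \<in> ?O X" using o unfolding out_iff by blast
      show "(X, snd \<phi>) = \<phi>" by (rule e)
    qed (simp_all)
    also have "\<dots> = (\<Sum>y\<in>?O X. \<Sum>y'\<in>{y' \<in> {y' \<in> V'. core y' \<noteq> X \<and> fst y' = fst X}. core y' = y}. ?m X y')"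
    proof (intro sum.cong refl)
      fix y assume "y \<in> ?O X"
      then have "y \<noteq> X" "fst y = fst X" by (auto simp: arr_iff)
      then show "lifts y = {y' \<in> {y' \<in> V'. core y' \<noteq> X \<and> fst y' = fst X}. core y' = y}"
        unfolding lifts_def using core_fst_eq by (intro Collect_cong) (metis (mono_tags, lifting) mem_Collect_eq)
    qed
    also have "\<dots> = (\<Sum>y'\<in>{y' \<in> V'. core y' \<noteq> X \<and> fst y' = fst X}. ?m X y')"
    proof (rule sum.group)
      show "finite {y' \<in> V'. core y' \<noteq> X \<and> fst y' = fst X}" using finite_V' by simp
      show "core ` {y' \<in> V'. core y' \<noteq> X \<and> fst y' = fst X} \<subseteq> ?O X"
      proof (rule image_subsetI)
        fix y' assume y': "y' \<in> {y' \<in> V'. core y' \<noteq> X \<and> fst y' = fst X}"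
        have y: "y' \<in> V'" "core y' \<noteq> X" "fst y' = fst X" using y' by blast+
        have c: "core y' \<noteq> next_side d X" "core y' \<in> V" "fst (core y') = fst X"
        proof -
          show cV: "core y' \<in> V" by (rule core_V[OF y(1)])
          show "core y' \<noteq> next_side d X" using core_not_dead[OF y(1)] cV eX(1) unfolding dead_def ear_def by metis
          show "fst (core y') = fst X" unfolding core_simps(9) by (rule y(3))
        qed
        show "core y' \<in> ?O X" unfolding mem_Collect_eq arr_iff using c y(2) XV by metis
      qed
    qed (rule fO)
    finally show ?thesis .
  qed
  have "(\<Sum>\<alpha>\<in>A. \<Sum>\<phi>\<in>mut_out d (Inr i) G. scl (of_int (mut_osgn d (Inr i) G (Cmp None \<phi> None)))
        (lin reading (word [Arr \<alpha>] * dec (Inr i) G [\<phi>, opp G \<phi>] * word [Star \<alpha>]) :: _ \<Rightarrow>\<^sub>0 'b)) =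
      (\<Sum>X\<in>?EV. \<Sum>y'\<in>{y' \<in> V'. core y' \<noteq> X \<and> fst y' = fst X}. ?m X y')"
    by (rule trans[OF arg_cong[where f = "\<lambda>B. sum (\<lambda>\<alpha>. _ \<alpha>) B", OF A_eq]],
        rule trans[OF sum.reindex[OF inj]]) (unfold comp_def, intro sum.cong refl inner)
  also have "\<dots> = (\<Sum>(X, y')\<in>Sigma ?EV (\<lambda>X. {y' \<in> V'. core y' \<noteq> X \<and> fst y' = fst X}). ?m X y')"
    using finite_V' by (intro sum.Sigma) auto
  also have "\<dots> = (\<Sum>(X, y, z)\<in>extra_triples. monom_word [g X y, g y z, g z X]
      (psign (int d + 1) * of_int (\<sigma> (X, core y)) * ear_sign y :: 'b))"
  proof (rule sum.reindex_bij_witness[of _ "\<lambda>t. (fst t, fst (snd t))" "\<lambda>t. (fst t, snd t, next_side d (fst t))"])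
    fix t assume "t \<in> extra_triples"
    then obtain X y where "t = (X, y, next_side d X)" "ear X" "X \<in> V'" "y \<in> V'" "core y \<noteq> X" "fst y = fst X"
      unfolding extra_triples_def by blast
    then show "(fst t, fst (snd t)) \<in> Sigma ?EV (\<lambda>X. {y' \<in> V'. core y' \<noteq> X \<and> fst y' = fst X})"
      "(fst (fst t, fst (snd t)), snd (fst t, fst (snd t)), next_side d (fst (fst t, fst (snd t)))) = t"
      by (simp_all del: split_paired_Ex split_paired_All)
  next
    fix t assume t: "t \<in> Sigma ?EV (\<lambda>X. {y' \<in> V'. core y' \<noteq> X \<and> fst y' = fst X})"
    then obtain X y where "t = (X, y)" "ear X" "X \<in> V'" "y \<in> V'" "core y \<noteq> X" "fst y = fst X" by blast
    then show "(fst t, snd t, next_side d (fst t)) \<in> extra_triples" unfolding extra_triples_def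
      by (simp del: split_paired_Ex split_paired_All)
  qed (simp_all add: case_prod_beta)
  finally show ?thesis .
qed

end

definition trip :: "nat \<Rightarrow> side set \<Rightarrow> (side \<times> side \<times> side) set" where
  "trip d B = {(x, y, z). x \<in> B \<and> y \<in> B \<and> z \<in> B \<and> clockwise d x y z}"

lemma trip_iff: "(x, y, z) \<in> trip d B \<longleftrightarrow> x \<in> B \<and> y \<in> B \<and> z \<in> B \<and> clockwise d x y z"
  by (simp add: trip_def)

context flip_quiver
begin

definition spread :: "side \<Rightarrow> side \<Rightarrow> side \<Rightarrow> bool" where
  "spread x y z \<longleftrightarrow> core x \<noteq> core y \<and> core y \<noteq> core z \<and> core x \<noteq> core z"

text \<open>
  The coefficients of the mutated potential. The other rotations of the extra triangles get
  coefficient \<open>0\<close>.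
\<close>

definition new_om :: "(side \<Rightarrow> side \<Rightarrow> side \<Rightarrow> 'k::comm_ring_1) \<Rightarrow> side \<Rightarrow> side \<Rightarrow> side \<Rightarrow> 'k" where
  "new_om om x y z =
     (if spread x y z then ear_sign x * ear_sign y * ear_sign z * psign (int d * step x) * om (core x) (core y) (core z)
      else if (x, y, z) \<in> extra_triples then psign (int d + 1) * of_int (\<sigma> (x, core y)) * ear_sign y else 0)"

lemma extra_not_spread: "(x, y, z) \<in> extra_triples \<Longrightarrow> \<not> spread x y z"
  using ear_core(1,2) unfolding extra_triples_def spread_def mem_Collect_eq split_conv by metis

lemma extra_clockwise:
  assumes "(x, y, z) \<in> extra_triples"
  shows "(x, y, z) \<in> trip d V'"
proof -
  have e: "ear x" "x \<in> V'" "y \<in> V'" "core y \<noteq> x" "fst y = fst x" and z: "z = next_side d x"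
    using assms unfolding extra_triples_def mem_Collect_eq split_conv by blast+
  have zV: "z \<in> V'" unfolding z by (rule V'_next[OF e(1)])
  have fz: "fst z = fst x" unfolding z by (simp add: next_side_def)
  have ne: "y \<noteq> x" "y \<noteq> z" using e(4) ear_core(1,2)[OF e(1)] z by metis+
  note s = V'_snd[OF e(2)] V'_snd[OF e(3)] V'_snd[OF zV]
  have "cd x z = int d - 1" unfolding z by (rule ear_pair(2)[OF e(1)])
  moreover have "0 < clock_dist d x y" "clock_dist d x y < d"
    using clock_dist_pos[OF s(1,2)] ne(1) e(5) by metis+
  moreover have "cd x y \<noteq> cd x z"
    using clock_dist_eq_iff[OF s e(5)[symmetric] fz[symmetric]] ne(2) by linarith
  ultimately have "0 < clock_dist d x y" "clock_dist d x y < clock_dist d x z" by linarith+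
  then have "clockwise d x y z" unfolding clockwise_def using e(5) fz by metis
  then show ?thesis using e zV by (simp only: trip_iff)
qed

text \<open>
  Triangles with three different cores are grouped by their cores and come from the decompositions
  of the old cycles; the remaining nonzero coefficients come from the additional terms of the
  mutated potential.
\<close>

theorem mutation'_potential_triangles:
  "mutation'_potential d P \<sigma> i (\<Sum>(x, y, z)\<in>trip d V. monom_word [(x, y), (y, z), (z, x)] (om x y z)) =
     (\<Sum>(x, y, z)\<in>trip d V'. monom_word [g x y, g y z, g z x] (new_om om x y z :: 'b::comm_ring_1))"
proof -
  let ?F = "\<lambda>(x, y, z). monom_word [g x y, g y z, g z x] (new_om om x y z :: 'b)"
  let ?C = "\<lambda>t. (core (fst t), core (fst (snd t)), core (snd (snd t)))"
  define D where "D = {t \<in> trip d V'. spread (fst t) (fst (snd t)) (snd (snd t))}"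
  have fin: "finite (trip d V')" "finite (trip d V)"
    using finite_V' finite_V by (auto intro: finite_subset[of _ "V' \<times> V' \<times> V'"] finite_subset[of _ "V \<times> V \<times> V"] simp: trip_def)
  have sub: "extra_triples \<subseteq> trip d V'"
  proof
    fix t assume t: "t \<in> extra_triples"
    obtain x y z where e: "t = (x, y, z)" by (rule prod_cases3)
    show "t \<in> trip d V'" using extra_clockwise t unfolding e by blast
  qed
  have finD: "finite D" unfolding D_def using fin(1) by simp
  have fibre: "(\<Sum>t\<in>{t \<in> D. ?C t = s}. ?F t) = scl (case s of (x, y, z) \<Rightarrow> om x y z) (case s of (x, y, z) \<Rightarrow> lifted_cycles x y z)"
    if "s \<in> trip d V" for s
  proof -
    obtain x y z where s: "s = (x, y, z)" by (rule prod_cases3)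
    have xyz: "x \<in> V" "y \<in> V" "z \<in> V" "clockwise d x y z" using that unfolding s trip_iff by blast+
    note sn = V_snd[OF xyz(1)] V_snd[OF xyz(2)] V_snd[OF xyz(3)]
    have ne: "x \<noteq> y" "y \<noteq> z" "x \<noteq> z" using clockwise_distinct[OF sn xyz(4)] by auto
    have mem: "(x', y', z') \<in> {t \<in> D. ?C t = s} \<longleftrightarrow> (x', y', z') \<in> lifts x \<times> lifts y \<times> lifts z" for x' y' z'
    proof
      assume "(x', y', z') \<in> {t \<in> D. ?C t = s}"
      then show "(x', y', z') \<in> lifts x \<times> lifts y \<times> lifts z"
        unfolding D_def s mem_Collect_eq trip_iff lifts_def mem_Times_iff fst_conv snd_conv prod.inject by blast
    next
      assume "(x', y', z') \<in> lifts x \<times> lifts y \<times> lifts z"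
      then have l: "x' \<in> V'" "y' \<in> V'" "z' \<in> V'" and c: "core x' = x" "core y' = y" "core z' = z"
        unfolding lifts_def mem_Collect_eq mem_Times_iff fst_conv snd_conv by blast+
      have "clockwise d x' y' z'"
        using clockwise_core[OF V'_snd[OF l(1)] V'_snd[OF l(2)] V'_snd[OF l(3)]] ne xyz(4) unfolding c by blast
      then show "(x', y', z') \<in> {t \<in> D. ?C t = s}"
        unfolding D_def s mem_Collect_eq trip_iff spread_def fst_conv snd_conv prod.inject c using l ne by blast
    qed
    have eq: "{t \<in> D. ?C t = s} = lifts x \<times> lifts y \<times> lifts z"
    proof (rule set_eqI)
      fix t :: "side \<times> side \<times> side"
      obtain x' y' z' where t: "t = (x', y', z')" by (rule prod_cases3)
      show "t \<in> {t \<in> D. ?C t = s} \<longleftrightarrow> t \<in> lifts x \<times> lifts y \<times> lifts z" unfolding t by (rule mem)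
    qed
    have "(\<Sum>t\<in>{t \<in> D. ?C t = s}. ?F t) = (\<Sum>x'\<in>lifts x. \<Sum>y'\<in>lifts y. \<Sum>z'\<in>lifts z. ?F (x', y', z'))"
      unfolding eq by (simp only: sum.cartesian_product case_prod_unfold prod.collapse)
    also have "\<dots> = scl (om x y z) (lifted_cycles x y z)"
      unfolding lifted_cycles_def scl_sum
    proof (intro sum.cong refl)
      fix x' y' z' assume "x' \<in> lifts x" "y' \<in> lifts y" "z' \<in> lifts z"
      then have c: "core x' = x" "core y' = y" "core z' = z" unfolding lifts_def by blast+
      have "spread x' y' z'" unfolding spread_def c using ne by blast
      then show "?F (x', y', z') = scl (om x y z) (monom_word [g x' y', g y' z', g z' x']
          (ear_sign x' * ear_sign y' * ear_sign z' * psign (int d * step x')))"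
        by (simp add: new_om_def c scl_single mult_ac)
    qed
    finally show ?thesis by (simp only: s split_conv)
  qed
  have img: "?C ` D \<subseteq> trip d V"
  proof (rule image_subsetI)
    fix t assume "t \<in> D"
    obtain x y z where t: "t = (x, y, z)" by (rule prod_cases3)
    have xyz: "x \<in> V'" "y \<in> V'" "z \<in> V'" "clockwise d x y z" and sp: "spread x y z"
      using \<open>t \<in> D\<close> unfolding D_def t mem_Collect_eq trip_iff fst_conv snd_conv by blast+
    have "clockwise d (core x) (core y) (core z)"
      using clockwise_core[OF V'_snd[OF xyz(1)] V'_snd[OF xyz(2)] V'_snd[OF xyz(3)]] sp xyz(4) unfolding spread_def by blast
    then show "?C t \<in> trip d V" unfolding t fst_conv snd_conv trip_iff using core_V xyz by blast
  qed
  have "(\<Sum>t\<in>trip d V'. ?F t) = (\<Sum>t\<in>D \<union> extra_triples. ?F t)"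
  proof (rule sum.mono_neutral_right[OF fin(1)])
    show "D \<union> extra_triples \<subseteq> trip d V'" using sub unfolding D_def by blast
    show "\<forall>t\<in>trip d V' - (D \<union> extra_triples). ?F t = 0"
    proof
      fix t assume t: "t \<in> trip d V' - (D \<union> extra_triples)"
      obtain x y z where e: "t = (x, y, z)" by (rule prod_cases3)
      have "\<not> spread x y z" "(x, y, z) \<notin> extra_triples"
        using t unfolding D_def e Diff_iff Un_iff mem_Collect_eq fst_conv snd_conv by blast+
      then show "?F t = 0" unfolding e split_conv new_om_def by simp
    qed
  qed
  also have "\<dots> = (\<Sum>t\<in>D. ?F t) + (\<Sum>t\<in>extra_triples. ?F t)"
  proof (rule sum.union_disjoint[OF finD])
    show "finite extra_triples" by (rule finite_subset[OF sub fin(1)])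
    show "D \<inter> extra_triples = {}"
    proof (rule equals0I)
      fix t assume t: "t \<in> D \<inter> extra_triples"
      obtain x y z where e: "t = (x, y, z)" by (rule prod_cases3)
      show False using t extra_not_spread[of x y z] unfolding D_def e Int_iff mem_Collect_eq fst_conv snd_conv by blast
    qed
  qed
  also have "(\<Sum>t\<in>D. ?F t) = (\<Sum>s\<in>trip d V. \<Sum>t\<in>{t \<in> D. ?C t = s}. ?F t)"
    by (rule sum.group[OF finD fin(2) img, symmetric])
  also have "\<dots> = lin (\<lambda>c. lin reading (dec_cyc d (Inr i) G c))
      (\<Sum>(x, y, z)\<in>trip d V. monom_word [(x, y), (y, z), (z, x)] (om x y z))"
    unfolding lin_sum
  proof (intro sum.cong refl)
    fix s assume "s \<in> trip d V"
    note f = fibre[OF this]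
    obtain x y z where e: "s = (x, y, z)" by (rule prod_cases3)
    have "x \<in> V" "y \<in> V" "z \<in> V" "clockwise d x y z" using \<open>s \<in> trip d V\<close> unfolding e trip_iff by blast+
    note rc = reading_cycle[OF this]
    show "(\<Sum>t\<in>{t \<in> D. ?C t = s}. ?F t) = lin (\<lambda>c. lin reading (dec_cyc d (Inr i) G c))
        (case s of (x, y, z) \<Rightarrow> monom_word [(x, y), (y, z), (z, x)] (om x y z))"
      unfolding f unfolding e split_conv lin_single rc ..
  qed
  also have "(\<Sum>t\<in>extra_triples. ?F t) = (\<Sum>(X, y, z)\<in>extra_triples. monom_word [g X y, g y z, g z X]
      (psign (int d + 1) * of_int (\<sigma> (X, core y)) * ear_sign y :: 'b))"
  proof (intro sum.cong refl)
    fix t assume t: "t \<in> extra_triples"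
    obtain x y z where e: "t = (x, y, z)" by (rule prod_cases3)
    show "?F t = (case t of (X, y, z) \<Rightarrow> monom_word [g X y, g y z, g z X]
      (psign (int d + 1) * of_int (\<sigma> (X, core y)) * ear_sign y :: 'b))"
      using t extra_not_spread[of x y z] unfolding e split_conv new_om_def by simp
  qed
  finally show ?thesis unfolding mutation'_potential_lin extra_sum ..
qed

end

section \<open>Quivers whose arrows are pairs of sides\<close>

lemma clock_dist_bounds:
  assumes "snd x < d" "snd y < d" "fst x = fst y" "x \<noteq> y"
  shows "0 < clock_dist d x y" "clock_dist d x y < d" "clock_dist d x y + clock_dist d y x = d"
  using assms by (auto simp: clock_dist_alt prod_eq_iff split: if_splits)

lemma clockwise_cases:
  assumes "snd x < d" "snd y < d" "snd z < d" "fst x = fst y" "fst y = fst z" "x \<noteq> y" "y \<noteq> z" "z \<noteq> x"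
  shows "clockwise d x y z \<longleftrightarrow> clock_dist d x y + clock_dist d y z + clock_dist d z x = d"
  using assms by (cases x; cases y; cases z) (auto simp: clockwise_def clock_dist_alt split: if_splits)

text \<open>
  The conditions on the signs of opposites in a graded quiver.
\<close>

definition good_signs :: "nat \<Rightarrow> side set \<Rightarrow> (side \<Rightarrow> side \<Rightarrow> int) \<Rightarrow> bool" where
  "good_signs d V sg \<longleftrightarrow> (\<forall>x\<in>V. \<forall>y\<in>V. x \<noteq> y \<longrightarrow> fst x = fst y \<longrightarrow> sg x y \<in> {1, - 1} \<and>
     sg x y * sg y x = - psign ((1 - int (clock_dist d x y)) * (1 - int (clock_dist d y x))))"

definition quads_vanish ::
    "nat \<Rightarrow> side set \<Rightarrow> (side \<Rightarrow> side \<Rightarrow> int) \<Rightarrow> (side \<Rightarrow> side \<Rightarrow> side \<Rightarrow> 'k::comm_ring_1) \<Rightarrow> bool" where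
  "quads_vanish d V sg om \<longleftrightarrow> (\<forall>x\<in>V. \<forall>p\<in>V. \<forall>q\<in>V. \<forall>z\<in>V.
     clockwise d x q z \<longrightarrow> clockwise d x p q \<longrightarrow> quad_coeff d sg om x p q z = 0)"

lemma quad_coeff_cong:
  assumes "\<And>x y. \<lbrakk>x \<in> V; y \<in> V; x \<noteq> y; fst x = fst y\<rbrakk> \<Longrightarrow> sg x y = sg' x y"
    and "\<And>x y z. \<lbrakk>x \<in> V; y \<in> V; z \<in> V; clockwise d x y z\<rbrakk> \<Longrightarrow> om x y z = om' x y z"
    and V: "x \<in> V" "p \<in> V" "q \<in> V" "z \<in> V" "\<And>v. v \<in> V \<Longrightarrow> snd v < d"
    and cw: "clockwise d x q z" "clockwise d x p q"
  shows "quad_coeff d sg om x p q z = quad_coeff d sg' om' x p q z"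
proof -
  note s = V(5)[OF V(1)] V(5)[OF V(2)] V(5)[OF V(3)] V(5)[OF V(4)]
  have cw': "clockwise d x p z" "clockwise d p q z" using clockwise_quad[OF s] cw by blast+
  have st: "struct_coeff d sg om a b c = struct_coeff d sg' om' a b c"
    if t: "a \<in> V" "b \<in> V" "c \<in> V" "clockwise d a b c" for a b c
  proof -
    note s = V(5)[OF t(1)] V(5)[OF t(2)] V(5)[OF t(3)]
    have r: "clockwise d b c a" "clockwise d c a b"
      using clockwise_rotate[OF s t(4)] clockwise_rotate[OF s(2,3,1) clockwise_rotate[OF s t(4)]] by blast+
    have "sg a c = sg' a c" using assms(1)[OF t(1,3)] clockwise_distinct[OF s t(4)] by simp
    then show ?thesis
      using assms(2)[OF t] assms(2)[OF t(2,3,1) r(1)] assms(2)[OF t(3,1,2) r(2)]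
      by (simp only: struct_coeff_def cyc_coeff_def)
  qed
  show ?thesis
    using st[OF V(1,3,4) cw(1)] st[OF V(1,2,3) cw(2)] st[OF V(1,2,4) cw'(1)] st[OF V(2,3,4) cw'(2)]
    by (simp only: quad_coeff_def)
qed

text \<open>
  In addition to the arrows, \<open>s\<close> names the vertex at each side; sides that are glued
  share a vertex.
\<close>

locale sided_quiver = triangle_quiver d Q V a for d and Q :: "('v, 'e) gquiver" and V and a +
  fixes s :: "side \<Rightarrow> 'v"
  assumes verts_eq: "verts Q = s ` V"
    and src_a: "\<lbrakk>x \<in> V; y \<in> V; x \<noteq> y; fst x = fst y\<rbrakk> \<Longrightarrow> src Q (a x y) = s x"
    and tgt_a: "\<lbrakk>x \<in> V; y \<in> V; x \<noteq> y; fst x = fst y\<rbrakk> \<Longrightarrow> tgt Q (a x y) = s y"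
begin

lemma triples_trip: "triples = trip d V"
  by (simp only: triples_def trip_def)

lemma finite_arrs: "finite (arrs Q)"
proof -
  have "arrs Q \<subseteq> (\<lambda>(x, y). a x y) ` (V \<times> V)" unfolding arrs_eq by auto
  then show ?thesis by (rule finite_subset) (simp add: finV)
qed

lemma arr_a: "\<lbrakk>x \<in> V; y \<in> V; x \<noteq> y; fst x = fst y\<rbrakk> \<Longrightarrow> a x y \<in> arrs Q"
  unfolding arrs_eq by blast

lemma graded_iff: "graded_quiver d Q \<longleftrightarrow> good_signs d V sg"
proof
  assume gr: "graded_quiver d Q"
  show "good_signs d V sg"
    unfolding good_signs_def
  proof (intro ballI impI)
    fix x y assume xy: "x \<in> V" "y \<in> V" "x \<noteq> y" "fst x = fst y"
    have "sg x y \<in> {1, - 1} \<and> sg x y * osgn Q (opp Q (a x y)) = - psign (deg Q (a x y) * deg Q (opp Q (a x y)))"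
      using gr arr_a[OF xy] unfolding graded_quiver_def by blast
    then show "sg x y \<in> {1, - 1} \<and>
        sg x y * sg y x = - psign ((1 - int (clock_dist d x y)) * (1 - int (clock_dist d y x)))"
      unfolding opp_a[OF xy] deg_a[OF xy] deg_a[OF xy(2,1) xy(3)[symmetric] xy(4)[symmetric]] .
  qed
next
  assume sg: "good_signs d V sg"
  show "graded_quiver d Q"
    unfolding graded_quiver_def
  proof (intro conjI ballI)
    show "finite (verts Q)" unfolding verts_eq using finV by simp
    show "finite (arrs Q)" by (rule finite_arrs)
    fix \<phi> assume "\<phi> \<in> arrs Q"
    then obtain x y where xy: "x \<in> V" "y \<in> V" "x \<noteq> y" "fst x = fst y" and \<phi>: "\<phi> = a x y" unfolding arrs_eq by blast
    note yx = xy(2,1) xy(3)[symmetric] xy(4)[symmetric]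
    note b = clock_dist_bounds[OF snd_less[OF xy(1)] snd_less[OF xy(2)] xy(4,3)]
    note simps = \<phi> opp_a[OF xy] opp_a[OF yx] deg_a[OF xy] deg_a[OF yx] src_a[OF xy] src_a[OF yx] tgt_a[OF xy] tgt_a[OF yx]
    show "src Q \<phi> \<in> verts Q" "tgt Q \<phi> \<in> verts Q" "opp Q (opp Q \<phi>) = \<phi>" "src Q (opp Q \<phi>) = tgt Q \<phi>"
      "tgt Q (opp Q \<phi>) = src Q \<phi>" unfolding simps verts_eq using xy by blast+
    show "2 - int d \<le> deg Q \<phi>" "deg Q \<phi> \<le> 0" "deg Q (opp Q \<phi>) = 2 - int d - deg Q \<phi>"
      unfolding simps using b by linarith+
    show "opp Q \<phi> \<in> arrs Q" unfolding simps by (rule arr_a[OF yx])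
    show "osgn Q \<phi> \<in> {1, - 1}" "osgn Q \<phi> * osgn Q (opp Q \<phi>) = - psign (deg Q \<phi> * deg Q (opp Q \<phi>))"
      unfolding simps using sg xy unfolding good_signs_def by blast+
  qed
qed

lemma bracket_zero_quads: "bracket_zero d Q (tri_potential om) \<longleftrightarrow> quads_vanish d V sg om"
  unfolding bracket_zero_iff quads_vanish_def triples_trip trip_iff by blast

lemma triple_cycle:
  assumes "(x, y, z) \<in> triples"
  shows "is_cycle Q [a x y, a y z, a z x]"
proof -
  note t = triplesD[OF assms]
  have "{n. n < 3} = {0, 1, 2 :: nat}" by auto
  then have n: "(\<forall>n<3. R n) \<longleftrightarrow> R 0 \<and> R 1 \<and> R (2::nat)" for R by (metis insert_iff mem_Collect_eq singletonD)
  have l: "length [a x y, a y z, a z x] = 3" by simp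
  show ?thesis
    unfolding is_cycle_def l n
    using arr_a[OF t(1,2,4,7)] arr_a[OF t(2,3,5,8)] arr_a[OF t(3,1,6,9)]
      src_a[OF t(1,2,4,7)] src_a[OF t(2,3,5,8)] src_a[OF t(3,1,6,9)]
      tgt_a[OF t(1,2,4,7)] tgt_a[OF t(2,3,5,8)] tgt_a[OF t(3,1,6,9)] by simp
qed

lemma keys_tri_potential:
  assumes "c \<in> Poly_Mapping.keys (tri_potential om)"
  obtains x y z where "(x, y, z) \<in> triples" "c = [a x y, a y z, a z x]"
proof -
  have "Poly_Mapping.lookup (tri_potential om) c \<noteq> 0" using assms by (simp add: in_keys_iff)
  then have "\<exists>t\<in>triples. Poly_Mapping.lookup (case t of (x, y, z) \<Rightarrow> monom_word [a x y, a y z, a z x] (om x y z)) c \<noteq> 0"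
    unfolding tri_potential_def lookup_sum by (meson sum.neutral)
  then obtain t where t: "t \<in> triples" "Poly_Mapping.lookup (case t of (x, y, z) \<Rightarrow> monom_word [a x y, a y z, a z x] (om x y z)) c \<noteq> 0" ..
  obtain x y z where e: "t = (x, y, z)" by (rule prod_cases3)
  have "c = [a x y, a y z, a z x]" using t(2) unfolding e split_conv lookup_single when_def by metis
  then show ?thesis using that t(1) e by blast
qed

lemma qsp_iff: "qsp d Q (tri_potential om) \<longleftrightarrow> good_signs d V sg \<and> quads_vanish d V sg om"
proof -
  have "is_cycle Q c \<and> wdeg Q c = 3 - int d" if "c \<in> Poly_Mapping.keys (tri_potential om)" for c
    using keys_tri_potential[OF that] triple_cycle triple_cycle_degree by metis
  then show ?thesis unfolding qsp_def graded_iff bracket_zero_quads by blast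
qed

end

text \<open>
  Such a quiver is determined by its sides, vertex names and signs, so matching the arrows of
  equal pairs of sides is an isomorphism.
\<close>

lemma sided_quiver_iso:
  fixes Q :: "('v, 'e) gquiver" and Q' :: "('v, 'f) gquiver" and om :: "side \<Rightarrow> side \<Rightarrow> side \<Rightarrow> 'k::comm_ring_1"
  assumes "sided_quiver d Q V a s" "sided_quiver d Q' V a' s"
    and sg: "\<And>x y. \<lbrakk>x \<in> V; y \<in> V; x \<noteq> y; fst x = fst y\<rbrakk> \<Longrightarrow> osgn Q (a x y) = osgn Q' (a' x y)"
  shows "\<exists>f. qsp_iso f Q (triangle_quiver.tri_potential d V a om) Q' (triangle_quiver.tri_potential d V a' om)"
proof -
  interpret q: sided_quiver d Q V a s by fact
  interpret q': sided_quiver d Q' V a' s by fact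
  define E where "E = {(x, y). x \<in> V \<and> y \<in> V \<and> x \<noteq> y \<and> fst x = fst y}"
  define f where "f \<phi> = (let p = inv_into E (\<lambda>p. a (fst p) (snd p)) \<phi> in a' (fst p) (snd p))" for \<phi>
  have E: "p \<in> E \<Longrightarrow> fst p \<in> V \<and> snd p \<in> V \<and> fst p \<noteq> snd p \<and> fst (fst p) = fst (snd p)" for p
    by (auto simp: E_def)
  have inj: "inj_on (\<lambda>p. a (fst p) (snd p)) E"
  proof (rule inj_onI)
    fix p p' assume "p \<in> E" "p' \<in> E" "a (fst p) (snd p) = a (fst p') (snd p')"
    then have "fst p = fst p' \<and> snd p = snd p'" using E[of p] E[of p'] q.a_inj by blast
    then show "p = p'" by (simp add: prod_eq_iff)
  qed
  have fa: "f (a x y) = a' x y" if "x \<in> V" "y \<in> V" "x \<noteq> y" "fst x = fst y" for x y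
  proof -
    have "(x, y) \<in> E" using that unfolding E_def by blast
    from inv_into_f_f[OF inj this] show ?thesis by (simp only: f_def Let_def fst_conv snd_conv)
  qed
  have word: "lin (\<lambda>c. word (map f c)) (q.tri_potential om) = q'.tri_potential om"
    unfolding q.tri_potential_def q'.tri_potential_def lin_sum q.triples_trip q'.triples_trip
  proof (intro sum.cong refl)
    fix t assume t: "t \<in> trip d V"
    obtain x y z where e: "t = (x, y, z)" by (rule prod_cases3)
    note D = q.triplesD[OF t[unfolded e, folded q.triples_trip]]
    show "lin (\<lambda>c. word (map f c)) (case t of (x, y, z) \<Rightarrow> monom_word [a x y, a y z, a z x] (om x y z)) =
      (case t of (x, y, z) \<Rightarrow> monom_word [a' x y, a' y z, a' z x] (om x y z))"
      unfolding e split_conv lin_single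
      by (simp add: fa[OF D(1,2,4,7)] fa[OF D(2,3,5,8)] fa[OF D(3,1,6,9)] word_single)
  qed
  have "qsp_iso f Q (q.tri_potential om) Q' (q'.tri_potential om)"
    unfolding qsp_iso_def
  proof (intro conjI ballI)
    show "verts Q = verts Q'" unfolding q.verts_eq q'.verts_eq ..
    show "bij_betw f (arrs Q) (arrs Q')"
    proof (rule bij_betw_imageI)
      show "inj_on f (arrs Q)"
      proof (rule inj_onI)
        fix \<phi> \<psi> assume "\<phi> \<in> arrs Q" "\<psi> \<in> arrs Q" and eq: "f \<phi> = f \<psi>"
        then obtain x y x' y' where xy: "x \<in> V" "y \<in> V" "x \<noteq> y" "fst x = fst y" and \<phi>: "\<phi> = a x y"
          and xy': "x' \<in> V" "y' \<in> V" "x' \<noteq> y'" "fst x' = fst y'" and \<psi>: "\<psi> = a x' y'" unfolding q.arrs_eq by blast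
        show "\<phi> = \<psi>" using eq q'.a_inj[OF xy xy'] unfolding \<phi> \<psi> fa[OF xy] fa[OF xy'] by blast
      qed
      show "f ` arrs Q = arrs Q'"
      proof (intro equalityI subsetI)
        fix \<psi> assume "\<psi> \<in> f ` arrs Q"
        then obtain x y where xy: "x \<in> V" "y \<in> V" "x \<noteq> y" "fst x = fst y" and "\<psi> = f (a x y)" unfolding q.arrs_eq by blast
        then show "\<psi> \<in> arrs Q'" using fa[OF xy] q'.arr_a[OF xy] by simp
      next
        fix \<psi> assume "\<psi> \<in> arrs Q'"
        then obtain x y where xy: "x \<in> V" "y \<in> V" "x \<noteq> y" "fst x = fst y" and "\<psi> = a' x y" unfolding q'.arrs_eq by blast
        then show "\<psi> \<in> f ` arrs Q" using fa[OF xy] q.arr_a[OF xy] by (metis imageI)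
      qed
    qed
    show "cyc_eq Q' (lin (\<lambda>c. word (map f c)) (q.tri_potential om)) (q'.tri_potential om)"
      unfolding cyc_eq_def word by (simp add: cyc_null.zero)
    fix \<phi> assume "\<phi> \<in> arrs Q"
    then obtain x y where xy: "x \<in> V" "y \<in> V" "x \<noteq> y" "fst x = fst y" and \<phi>: "\<phi> = a x y" unfolding q.arrs_eq by blast
    note yx = xy(2,1) xy(3)[symmetric] xy(4)[symmetric]
    show "src Q' (f \<phi>) = src Q \<phi>" "tgt Q' (f \<phi>) = tgt Q \<phi>" "deg Q' (f \<phi>) = deg Q \<phi>"
      "opp Q' (f \<phi>) = f (opp Q \<phi>)" "osgn Q' (f \<phi>) = osgn Q \<phi>"
      unfolding \<phi> fa[OF xy] q.opp_a[OF xy] q'.opp_a[OF xy] fa[OF yx] q.deg_a[OF xy] q'.deg_a[OF xy]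
        q.src_a[OF xy] q'.src_a[OF xy] q.tgt_a[OF xy] q'.tgt_a[OF xy] sg[OF xy] by (rule refl)+
  qed
  then show ?thesis by (rule exI[where x = f])
qed

section \<open>The QsP of a d-angulation in terms of signs\<close>

definition arc_sides :: "nat \<Rightarrow> ('a, 'v) polygons \<Rightarrow> side set" where
  "arc_sides d P = {x \<in> sides d P. label P x \<noteq> None}"

definition polygon_sides :: "nat \<Rightarrow> ('a, 'v) polygons \<Rightarrow> nat \<Rightarrow> side set" where
  "polygon_sides d P r = {x. fst x = r \<and> snd x < d \<and> label P x \<noteq> None}"

lemma card_between: "card {m::nat. 0 < m \<and> m < n} = n - 1"
proof -
  have "{m::nat. 0 < m \<and> m < n} = {0<..<n}" by auto
  then show ?thesis by simp
qed

lemma polygon_deg: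
  assumes "snd x < d" "snd y < d" "x \<noteq> y" "fst x = fst y"
  shows "deg (polygon_quiver d P \<sigma> r) (x, y) = 1 - int (clock_dist d x y)"
  using clock_dist_bounds(1)[OF assms(1,2,4,3)]
  by (simp add: polygon_quiver_def Let_def card_between clock_dist_def)

lemma polygon_simps: "verts (polygon_quiver d P \<sigma> r) = polygon_sides d P r"
  "arrs (polygon_quiver d P \<sigma> r) = {(x, y). x \<in> polygon_sides d P r \<and> y \<in> polygon_sides d P r \<and> x \<noteq> y}"
  "src (polygon_quiver d P \<sigma> r) = fst" "tgt (polygon_quiver d P \<sigma> r) = snd"
  "opp (polygon_quiver d P \<sigma> r) = prod.swap" "osgn (polygon_quiver d P \<sigma> r) = \<sigma>"
  by (auto simp: polygon_quiver_def polygon_sides_def label_def Let_def)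

lemma finite_polygon_sides: "finite (polygon_sides d P r)"
  by (rule finite_subset[of _ "{r} \<times> {..<d}"]) (auto simp: polygon_sides_def)

lemma polygon_sidesD: "x \<in> polygon_sides d P r \<Longrightarrow> fst x = r" "x \<in> polygon_sides d P r \<Longrightarrow> snd x < d"
  by (simp_all add: polygon_sides_def)

lemma polygon_sided_quiver: "sided_quiver d (polygon_quiver d P \<sigma> r) (polygon_sides d P r) Pair (\<lambda>x. x)"
proof unfold_locales
  show "finite (polygon_sides d P r)" by (rule finite_polygon_sides)
  show "x \<in> polygon_sides d P r \<Longrightarrow> snd x < d" for x by (rule polygon_sidesD)
  show "arrs (polygon_quiver d P \<sigma> r) =
      {(x, y) | x y. x \<in> polygon_sides d P r \<and> y \<in> polygon_sides d P r \<and> x \<noteq> y \<and> fst x = fst y}"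
      (is "?L = ?R")
  proof (rule set_eqI)
    fix p :: "side \<times> side"
    obtain x y where p: "p = (x, y)" by (cases p) blast
    have "p \<in> ?R \<longleftrightarrow> x \<in> polygon_sides d P r \<and> y \<in> polygon_sides d P r \<and> x \<noteq> y \<and> fst x = fst y"
      unfolding p by blast
    also have "\<dots> \<longleftrightarrow> p \<in> ?L" unfolding p polygon_simps mem_Collect_eq split_conv using polygon_sidesD(1) by metis
    finally show "p \<in> ?L \<longleftrightarrow> p \<in> ?R" ..
  qed
  show "deg (polygon_quiver d P \<sigma> r) (x, y) = 1 - int (clock_dist d x y)"
    if "x \<in> polygon_sides d P r" "y \<in> polygon_sides d P r" "x \<noteq> y" "fst x = fst y" for x y
    by (rule polygon_deg[OF polygon_sidesD(2)[OF that(1)] polygon_sidesD(2)[OF that(2)] that(3,4)])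
qed (simp_all add: polygon_simps)

lemma arc_sides_eq: "arc_sides d P = (\<Union>r<npoly P. polygon_sides d P r)"
  unfolding arc_sides_def polygon_sides_def sides_def by (auto simp: mem_Times_iff)

lemma arc_sides_in: "x \<in> arc_sides d P \<longleftrightarrow> fst x < npoly P \<and> x \<in> polygon_sides d P (fst x)"
  unfolding arc_sides_def polygon_sides_def sides_def mem_Times_iff by simp

lemma pre_sided_quiver: "sided_quiver d (pre_quiver d P \<sigma>) (arc_sides d P) Pair (\<lambda>x. x)"
proof unfold_locales
  show "finite (arc_sides d P)" unfolding arc_sides_eq using finite_polygon_sides by blast
  show "x \<in> arc_sides d P \<Longrightarrow> snd x < d" for x using arc_sides_in polygon_sidesD(2) by blast
  show "arrs (pre_quiver d P \<sigma>) =
      {(x, y) | x y. x \<in> arc_sides d P \<and> y \<in> arc_sides d P \<and> x \<noteq> y \<and> fst x = fst y}" (is "?L = ?R")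
  proof (rule set_eqI)
    fix p :: "side \<times> side"
    obtain x y where p: "p = (x, y)" by (cases p) blast
    have "p \<in> ?L \<longleftrightarrow> (\<exists>r\<in>{..<npoly P}. p \<in> arrs (polygon_quiver d P \<sigma> r))"
      by (simp add: pre_quiver_def)
    also have "\<dots> \<longleftrightarrow> (\<exists>r. r < npoly P \<and> x \<in> polygon_sides d P r \<and> y \<in> polygon_sides d P r \<and> x \<noteq> y)"
      unfolding p polygon_simps Bex_def lessThan_iff mem_Collect_eq split_conv ..
    also have "\<dots> \<longleftrightarrow> x \<in> arc_sides d P \<and> y \<in> arc_sides d P \<and> x \<noteq> y \<and> fst x = fst y"
    proof
      assume "\<exists>r. r < npoly P \<and> x \<in> polygon_sides d P r \<and> y \<in> polygon_sides d P r \<and> x \<noteq> y"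
      then obtain r where r: "r < npoly P" "x \<in> polygon_sides d P r" "y \<in> polygon_sides d P r" "x \<noteq> y" by blast
      have "fst x = r" "fst y = r" using polygon_sidesD(1)[OF r(2)] polygon_sidesD(1)[OF r(3)] .
      then show "x \<in> arc_sides d P \<and> y \<in> arc_sides d P \<and> x \<noteq> y \<and> fst x = fst y"
        unfolding arc_sides_in using r by simp
    next
      assume "x \<in> arc_sides d P \<and> y \<in> arc_sides d P \<and> x \<noteq> y \<and> fst x = fst y"
      then show "\<exists>r. r < npoly P \<and> x \<in> polygon_sides d P r \<and> y \<in> polygon_sides d P r \<and> x \<noteq> y"
        unfolding arc_sides_in by (intro exI[of _ "fst x"]) metis
    qed
    also have "\<dots> \<longleftrightarrow> p \<in> ?R" unfolding p by blast
    finally show "p \<in> ?L \<longleftrightarrow> p \<in> ?R" .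
  qed
  show "deg (pre_quiver d P \<sigma>) (x, y) = 1 - int (clock_dist d x y)"
    if "x \<in> arc_sides d P" "y \<in> arc_sides d P" "x \<noteq> y" "fst x = fst y" for x y
  proof -
    have "snd x < d" "snd y < d" using that arc_sides_in polygon_sidesD(2) by blast+
    from polygon_deg[OF this that(3,4)] show ?thesis by (simp add: pre_quiver_def)
  qed
qed (simp_all add: pre_quiver_def polygon_simps arc_sides_eq)

lemma surface_sided_quiver:
  "sided_quiver d (surface_quiver d P \<sigma>) (arc_sides d P) Pair (\<lambda>x. the (label P x))"
proof -
  interpret p: sided_quiver d "pre_quiver d P \<sigma>" "arc_sides d P" Pair "\<lambda>x. x" by (rule pre_sided_quiver)
  show ?thesis
  proof unfold_locales
    show "arrs (surface_quiver d P \<sigma>) =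
        {(x, y) | x y. x \<in> arc_sides d P \<and> y \<in> arc_sides d P \<and> x \<noteq> y \<and> fst x = fst y}"
      using p.arrs_eq by (simp add: surface_quiver_def glue_def)
    show "verts (surface_quiver d P \<sigma>) = (\<lambda>x. the (label P x)) ` arc_sides d P"
      using p.verts_eq by (simp add: surface_quiver_def glue_def)
    show "deg (surface_quiver d P \<sigma>) (x, y) = 1 - int (clock_dist d x y)"
      if "x \<in> arc_sides d P" "y \<in> arc_sides d P" "x \<noteq> y" "fst x = fst y" for x y
      using p.deg_a[OF that] by (simp add: surface_quiver_def glue_def)
  qed (simp_all add: p.finV p.snd_less surface_quiver_def glue_def pre_quiver_def)
qed

lemma length_three: "length c = 3 \<Longrightarrow> \<exists>p q r. c = [p, q, r]"
  by (auto simp: length_Suc_conv numeral_3_eq_3)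

text \<open>
  This translates the degree condition on 3-cycles into cyclic order: a 3-cycle has
  degree \<open>3 - d\<close> exactly if it runs clockwise once around its polygon.
\<close>

lemma polygon_cycles:
  assumes d: "3 \<le> d"
  shows "is_cycle (polygon_quiver d P \<sigma> r) c \<and> length c = 3 \<and> wdeg (polygon_quiver d P \<sigma> r) c = 3 - int d \<longleftrightarrow>
     (\<exists>x y z. (x, y, z) \<in> trip d (polygon_sides d P r) \<and> c = [(x, y), (y, z), (z, x)])"
proof
  interpret q: sided_quiver d "polygon_quiver d P \<sigma> r" "polygon_sides d P r" Pair "\<lambda>x. x"
    by (rule polygon_sided_quiver)
  show "is_cycle (polygon_quiver d P \<sigma> r) c \<and> length c = 3 \<and> wdeg (polygon_quiver d P \<sigma> r) c = 3 - int d"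
    if ex: "\<exists>x y z. (x, y, z) \<in> trip d (polygon_sides d P r) \<and> c = [(x, y), (y, z), (z, x)]"
  proof -
    obtain x y z where t: "(x, y, z) \<in> trip d (polygon_sides d P r)" and c: "c = [(x, y), (y, z), (z, x)]"
      using ex by blast
    show ?thesis
      using q.triple_cycle[unfolded q.triples_trip, OF t] q.triple_cycle_degree[unfolded q.triples_trip, OF t] unfolding c by simp
  qed
  assume c: "is_cycle (polygon_quiver d P \<sigma> r) c \<and> length c = 3 \<and> wdeg (polygon_quiver d P \<sigma> r) c = 3 - int d"
  then obtain \<alpha> \<beta> \<phi> where c3: "c = [\<alpha>, \<beta>, \<phi>]" using length_three by blast
  have cyc: "is_cycle (polygon_quiver d P \<sigma> r) [\<alpha>, \<beta>, \<phi>]" using c c3 by simp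
  have t: "\<forall>n<length [\<alpha>, \<beta>, \<phi>]. snd ([\<alpha>, \<beta>, \<phi>] ! n) = fst ([\<alpha>, \<beta>, \<phi>] ! (Suc n mod length [\<alpha>, \<beta>, \<phi>]))"
    by (rule cyc[unfolded is_cycle_def polygon_simps, THEN conjunct2, THEN conjunct2])
  have n: "snd \<alpha> = fst \<beta>" "snd \<beta> = fst \<phi>" "snd \<phi> = fst \<alpha>"
  proof -
    show "snd \<alpha> = fst \<beta>" using t[rule_format, of 0] by simp
    show "snd \<beta> = fst \<phi>" using t[rule_format, of 1] by (simp add: numeral_2_eq_2)
    show "snd \<phi> = fst \<alpha>" using t[rule_format, of 2] by simp
  qed
  have "set [\<alpha>, \<beta>, \<phi>] \<subseteq> arrs (polygon_quiver d P \<sigma> r)"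
    by (rule cyc[unfolded is_cycle_def, THEN conjunct2, THEN conjunct1])
  then have arr: "\<alpha> \<in> arrs (polygon_quiver d P \<sigma> r)" "\<beta> \<in> arrs (polygon_quiver d P \<sigma> r)" "\<phi> \<in> arrs (polygon_quiver d P \<sigma> r)"
    unfolding list.set by blast+
  define x y z where "x = fst \<alpha>" and "y = fst \<beta>" and "z = fst \<phi>"
  have e: "\<alpha> = (x, y)" "\<beta> = (y, z)" "\<phi> = (z, x)"
    by (rule prod_eqI; simp only: fst_conv snd_conv x_def y_def z_def n)+
  have V: "x \<in> polygon_sides d P r" "y \<in> polygon_sides d P r" "z \<in> polygon_sides d P r" and ne: "x \<noteq> y" "y \<noteq> z" "z \<noteq> x"
    using arr[unfolded e polygon_simps mem_Collect_eq split_conv] by blast+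
  note s = polygon_sidesD(2)[OF V(1)] polygon_sidesD(2)[OF V(2)] polygon_sidesD(2)[OF V(3)]
  have f: "fst x = fst y" "fst y = fst z" "fst z = fst x"
    by (simp_all add: polygon_sidesD(1)[OF V(1)] polygon_sidesD(1)[OF V(2)] polygon_sidesD(1)[OF V(3)])
  have "wdeg (polygon_quiver d P \<sigma> r) [\<alpha>, \<beta>, \<phi>] = 3 - int d" using c c3 by simp
  then have "(1 - int (clock_dist d x y)) + ((1 - int (clock_dist d y z)) + (1 - int (clock_dist d z x))) = 3 - int d"
    unfolding wdeg_def e
    by (simp add: polygon_deg[OF s(1,2) ne(1) f(1)] polygon_deg[OF s(2,3) ne(2) f(2)] polygon_deg[OF s(3,1) ne(3) f(3)])
  then have "clock_dist d x y + clock_dist d y z + clock_dist d z x = d" by linarith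
  then have "clockwise d x y z" using clockwise_cases[OF s f(1,2) ne] by blast
  then have "(x, y, z) \<in> trip d (polygon_sides d P r)" unfolding trip_iff using V by blast
  then show "\<exists>x y z. (x, y, z) \<in> trip d (polygon_sides d P r) \<and> c = [(x, y), (y, z), (z, x)]"
    unfolding c3 e by blast
qed

definition one_unit :: "'k::comm_ring_1 \<Rightarrow> 'k \<Rightarrow> 'k \<Rightarrow> bool" where
  "one_unit a b c \<longleftrightarrow> a \<in> {1, - 1} \<and> b = 0 \<and> c = 0 \<or> a = 0 \<and> b \<in> {1, - 1} \<and> c = 0 \<or> a = 0 \<and> b = 0 \<and> c \<in> {1, - 1}"

text \<open>
  Choosing one representative of every 3-cycle with a sign amounts to coefficients of which
  exactly one among three rotations is a sign and the others vanish.
\<close>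

definition unit_choice :: "nat \<Rightarrow> side set \<Rightarrow> (side \<Rightarrow> side \<Rightarrow> side \<Rightarrow> 'k::comm_ring_1) \<Rightarrow> bool" where
  "unit_choice d V om \<longleftrightarrow> (\<forall>x\<in>V. \<forall>y\<in>V. \<forall>z\<in>V. clockwise d x y z \<longrightarrow> one_unit (om x y z) (om y z x) (om z x y))"

lemma one_unit_values: "one_unit a b c \<Longrightarrow> a \<noteq> 0 \<Longrightarrow> a \<in> {1, - 1}"
  by (auto simp: one_unit_def)

lemma one_unit_pattern: "one_unit a b c \<Longrightarrow>
    a \<noteq> 0 \<and> \<not> b \<noteq> 0 \<and> \<not> c \<noteq> 0 \<or> \<not> a \<noteq> 0 \<and> b \<noteq> 0 \<and> \<not> c \<noteq> 0 \<or> \<not> a \<noteq> 0 \<and> \<not> b \<noteq> 0 \<and> c \<noteq> 0"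
  by (auto simp: one_unit_def)

lemma ex1_of_three: "\<lbrakk>p \<noteq> q; q \<noteq> r; r \<noteq> p\<rbrakk> \<Longrightarrow> (\<exists>!c. c \<in> T \<and> (c = p \<or> c = q \<or> c = r)) \<longleftrightarrow>
    p \<in> T \<and> q \<notin> T \<and> r \<notin> T \<or> p \<notin> T \<and> q \<in> T \<and> r \<notin> T \<or> p \<notin> T \<and> q \<notin> T \<and> r \<in> T"
  by (cases "p \<in> T"; cases "q \<in> T"; cases "r \<in> T") auto

lemma rotate3: "(\<exists>n. c = rotate n [p, q, r]) \<longleftrightarrow> c = [p, q, r] \<or> c = [q, r, p] \<or> c = [r, p, q]"
proof
  assume "\<exists>n. c = rotate n [p, q, r]"
  then obtain n where n: "c = rotate n [p, q, r]" ..
  have "rotate n [p, q, r] = rotate (n mod length [p, q, r]) [p, q, r]" by (rule rotate_conv_mod)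
  then have "c = rotate (n mod 3) [p, q, r]" using n by simp
  moreover have "n mod 3 = 0 \<or> n mod 3 = 1 \<or> n mod 3 = 2" by presburger
  ultimately show "c = [p, q, r] \<or> c = [q, r, p] \<or> c = [r, p, q]" by (elim disjE) (simp_all add: numeral_2_eq_2)
next
  have "rotate 0 [p, q, r] = [p, q, r]" "rotate 1 [p, q, r] = [q, r, p]" "rotate 2 [p, q, r] = [r, p, q]"
    by (simp_all add: numeral_2_eq_2)
  then show "c = [p, q, r] \<or> c = [q, r, p] \<or> c = [r, p, q] \<Longrightarrow> \<exists>n. c = rotate n [p, q, r]" by metis
qed

definition cyc3 :: "side \<times> side \<times> side \<Rightarrow> (side \<times> side) list" where
  "cyc3 t = (case t of (x, y, z) \<Rightarrow> [(x, y), (y, z), (z, x)])"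

lemma cyc3_eq: "cyc3 (x, y, z) = [(x, y), (y, z), (z, x)]"
  by (simp add: cyc3_def)

lemma inj_cyc3: "cyc3 t = cyc3 t' \<Longrightarrow> t = t'"
  unfolding cyc3_def by (cases t rule: prod_cases3; cases t' rule: prod_cases3) (simp only: split_conv list.inject prod.inject)

text \<open>
  The set of representatives is the support of the coefficients, and the bracket condition becomes
  the quadruple relations.
\<close>

lemma polygon_potential_iff:
  fixes P :: "('a, 'v) polygons" and W :: "(side \<times> side) list \<Rightarrow>\<^sub>0 'k::comm_ring_1" and r :: nat
  assumes d: "3 \<le> d"
  defines "V \<equiv> polygon_sides d P r"
  shows "polygon_potential d P \<sigma> r W \<longleftrightarrow> good_signs d V (\<lambda>x y. \<sigma> (x, y)) \<and>
     (\<exists>om. unit_choice d V om \<and> quads_vanish d V (\<lambda>x y. \<sigma> (x, y)) om \<and>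
       W = (\<Sum>(x, y, z)\<in>trip d V. monom_word [(x, y), (y, z), (z, x)] (om x y z)))"
    (is "?L \<longleftrightarrow> ?S \<and> (\<exists>om. ?R om)")
proof -
  interpret q: sided_quiver d "polygon_quiver d P \<sigma> r" V Pair "\<lambda>x. x"
    unfolding V_def by (rule polygon_sided_quiver)
  have sg: "(\<lambda>x y. osgn (polygon_quiver d P \<sigma> r) (x, y)) = (\<lambda>x y. \<sigma> (x, y))" by (simp add: polygon_simps)
  have sd: "x \<in> V \<Longrightarrow> snd x < d" for x using q.snd_less .
  have fin: "finite (trip d V)" using q.finite_triples unfolding q.triples_trip .
  have tri: "q.tri_potential om = (\<Sum>t\<in>trip d V. monom_word (cyc3 t) (case t of (x, y, z) \<Rightarrow> om x y z))"
    for om :: "side \<Rightarrow> side \<Rightarrow> side \<Rightarrow> 'k"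
    unfolding q.tri_potential_def q.triples_trip cyc3_def case_prod_unfold ..
  have qsp: "qsp d (polygon_quiver d P \<sigma> r) (q.tri_potential om) \<longleftrightarrow> ?S \<and> quads_vanish d V (\<lambda>x y. \<sigma> (x, y)) om"
    for om :: "side \<Rightarrow> side \<Rightarrow> side \<Rightarrow> 'k"
    unfolding q.qsp_iff sg ..
  have W: "(\<Sum>(x, y, z)\<in>trip d V. monom_word [(x, y), (y, z), (z, x)] (om x y z)) = q.tri_potential om"
    for om :: "side \<Rightarrow> side \<Rightarrow> side \<Rightarrow> 'k"
    unfolding q.tri_potential_def q.triples_trip ..
  define C where "C = {c. is_cycle (polygon_quiver d P \<sigma> r) c \<and> length c = 3 \<and>
                  wdeg (polygon_quiver d P \<sigma> r) c = 3 - int d}"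
  have C: "C = cyc3 ` trip d V"
  proof (rule set_eqI)
    fix c
    have "c \<in> C \<longleftrightarrow> (\<exists>x y z. (x, y, z) \<in> trip d V \<and> c = cyc3 (x, y, z))"
      unfolding C_def mem_Collect_eq polygon_cycles[OF d] V_def cyc3_eq ..
    also have "\<dots> \<longleftrightarrow> c \<in> cyc3 ` trip d V"
    proof
      assume "c \<in> cyc3 ` trip d V"
      then obtain t where t: "t \<in> trip d V" "c = cyc3 t" by blast
      obtain x y z where "t = (x, y, z)" by (rule prod_cases3)
      then show "\<exists>x y z. (x, y, z) \<in> trip d V \<and> c = cyc3 (x, y, z)" using t by blast
    qed blast
    finally show "c \<in> C \<longleftrightarrow> c \<in> cyc3 ` trip d V" .
  qed
  have rot: "(y, z, x) \<in> trip d V \<and> (z, x, y) \<in> trip d V \<and> x \<noteq> y \<and> y \<noteq> z \<and> x \<noteq> z" if "(x, y, z) \<in> trip d V" for x y z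
  proof -
    have t: "x \<in> V" "y \<in> V" "z \<in> V" "clockwise d x y z" using that unfolding trip_iff by blast+
    note s = sd[OF t(1)] sd[OF t(2)] sd[OF t(3)]
    show ?thesis using clockwise_rotate[OF s t(4)] clockwise_rotate[OF s(2,3,1) clockwise_rotate[OF s t(4)]]
      clockwise_distinct[OF s t(4)] t unfolding trip_iff by blast
  qed
  have pick: "(\<exists>!c'. c' \<in> T \<and> (\<exists>n. c' = rotate n (cyc3 (x, y, z)))) \<longleftrightarrow>
      (cyc3 (x, y, z) \<in> T \<and> cyc3 (y, z, x) \<notin> T \<and> cyc3 (z, x, y) \<notin> T \<or>
       cyc3 (x, y, z) \<notin> T \<and> cyc3 (y, z, x) \<in> T \<and> cyc3 (z, x, y) \<notin> T \<or>
       cyc3 (x, y, z) \<notin> T \<and> cyc3 (y, z, x) \<notin> T \<and> cyc3 (z, x, y) \<in> T)"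
    if "(x, y, z) \<in> trip d V" for x y z T
  proof -
    have "cyc3 (x, y, z) \<noteq> cyc3 (y, z, x)" "cyc3 (y, z, x) \<noteq> cyc3 (z, x, y)" "cyc3 (z, x, y) \<noteq> cyc3 (x, y, z)"
      using inj_cyc3 rot[OF that] by blast+
    from ex1_of_three[OF this] show ?thesis unfolding cyc3_eq rotate3 .
  qed
  have inj: "inj_on cyc3 (trip d V)" by (rule inj_onI) (rule inj_cyc3)
  have finC: "finite C" unfolding C using fin by simp
  show ?thesis
  proof
    assume L: ?L
    then obtain T \<epsilon> where T: "T \<subseteq> C" "\<forall>c\<in>C. \<exists>!c'. c' \<in> T \<and> (\<exists>n. c' = rotate n c)"
        "\<forall>c\<in>T. \<epsilon> c \<in> {1, - 1 :: 'k}" "W = (\<Sum>c\<in>T. scl (\<epsilon> c) (word c))"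
      unfolding polygon_potential_def Let_def C_def[symmetric] by blast
    define om where "om = (\<lambda>x y z. if cyc3 (x, y, z) \<in> T then \<epsilon> (cyc3 (x, y, z)) else 0)"
    have "W = (\<Sum>c\<in>C. if c \<in> T then monom_word c (\<epsilon> c) else 0)"
      unfolding T(4) by (rule sum.mono_neutral_cong_left[OF finC T(1)]) (simp_all add: word_single)
    also have "\<dots> = (\<Sum>t\<in>trip d V. if cyc3 t \<in> T then monom_word (cyc3 t) (\<epsilon> (cyc3 t)) else 0)"
      by (simp only: C sum.reindex[OF inj] comp_def)
    also have "\<dots> = q.tri_potential om" unfolding tri
    proof (rule sum.cong[OF refl])
      fix t assume "t \<in> trip d V"
      obtain x y z where e: "t = (x, y, z)" by (rule prod_cases3)
      show "(if cyc3 t \<in> T then monom_word (cyc3 t) (\<epsilon> (cyc3 t)) else 0) = monom_word (cyc3 t) (case t of (x, y, z) \<Rightarrow> om x y z)"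
        unfolding e split_conv om_def by simp
    qed
    finally have WT: "W = q.tri_potential om" .
    moreover have "unit_choice d V om"
      unfolding unit_choice_def
    proof (intro ballI impI)
      fix x y z assume "x \<in> V" "y \<in> V" "z \<in> V" "clockwise d x y z"
      then have t: "(x, y, z) \<in> trip d V" unfolding trip_iff by blast
      then have "cyc3 (x, y, z) \<in> C" unfolding C by blast
      with T(2) have "\<exists>!c'. c' \<in> T \<and> (\<exists>n. c' = rotate n (cyc3 (x, y, z)))" by blast
      then show "one_unit (om x y z) (om y z x) (om z x y)"
        unfolding pick[OF t] one_unit_def om_def using T(3) by (elim disjE) simp_all
    qed
    moreover have "?S \<and> quads_vanish d V (\<lambda>x y. \<sigma> (x, y)) om"
      using L unfolding polygon_potential_def WT qsp by blast
    ultimately show "?S \<and> (\<exists>om. ?R om)" unfolding W by blast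
  next
    assume "?S \<and> (\<exists>om. ?R om)"
    then obtain om where S: ?S and om: "unit_choice d V om" "quads_vanish d V (\<lambda>x y. \<sigma> (x, y)) om" "W = q.tri_potential om"
      unfolding W by blast
    define T where "T = cyc3 ` {t \<in> trip d V. (case t of (x, y, z) \<Rightarrow> om x y z) \<noteq> 0}"
    define \<epsilon> where "\<epsilon> c = (case inv_into (trip d V) cyc3 c of (x, y, z) \<Rightarrow> om x y z)" for c
    have \<epsilon>: "\<epsilon> (cyc3 t) = (case t of (x, y, z) \<Rightarrow> om x y z)" if "t \<in> trip d V" for t
      unfolding \<epsilon>_def inv_into_f_f[OF inj that] ..
    have TT: "cyc3 (x, y, z) \<in> T \<longleftrightarrow> om x y z \<noteq> 0" if "(x, y, z) \<in> trip d V" for x y z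
    proof
      assume "cyc3 (x, y, z) \<in> T"
      then obtain t where "cyc3 (x, y, z) = cyc3 t" "(case t of (x, y, z) \<Rightarrow> om x y z) \<noteq> 0" unfolding T_def by blast
      moreover from this(1) have "t = (x, y, z)" using inj_cyc3 by metis
      ultimately show "om x y z \<noteq> 0" by simp
    next
      assume "om x y z \<noteq> 0"
      then show "cyc3 (x, y, z) \<in> T" unfolding T_def using that by (intro imageI) simp
    qed
    have unit: "one_unit (om x y z) (om y z x) (om z x y)" if "(x, y, z) \<in> trip d V" for x y z
      using om(1) that unfolding unit_choice_def trip_iff by blast
    have "T \<subseteq> C" unfolding T_def C by blast
    moreover have "\<forall>c\<in>C. \<exists>!c'. c' \<in> T \<and> (\<exists>n. c' = rotate n c)"
    proof
      fix c assume "c \<in> C"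
      then obtain t where t: "t \<in> trip d V" "c = cyc3 t" unfolding C by blast
      obtain x y z where e: "t = (x, y, z)" by (rule prod_cases3)
      note t' = t(1)[unfolded e]
      note r = rot[OF t']
      show "\<exists>!c'. c' \<in> T \<and> (\<exists>n. c' = rotate n c)"
        unfolding t(2) e pick[OF t'] TT[OF t'] TT[OF r[THEN conjunct1]] TT[OF r[THEN conjunct2, THEN conjunct1]]
        by (rule one_unit_pattern[OF unit[OF t']])
    qed
    moreover have "\<forall>c\<in>T. \<epsilon> c \<in> {1, - 1}"
    proof
      fix c assume "c \<in> T"
      then obtain t where t: "t \<in> trip d V" "c = cyc3 t" "(case t of (x, y, z) \<Rightarrow> om x y z) \<noteq> 0" unfolding T_def by blast
      obtain x y z where e: "t = (x, y, z)" by (rule prod_cases3)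
      show "\<epsilon> c \<in> {1, - 1}"
        using t(3) one_unit_values[OF unit[OF t(1)[unfolded e]]] unfolding t(2) \<epsilon>[OF t(1)] unfolding e split_conv by blast
    qed
    moreover have "W = (\<Sum>c\<in>T. scl (\<epsilon> c) (word c))"
    proof -
      have "W = (\<Sum>t\<in>{t \<in> trip d V. (case t of (x, y, z) \<Rightarrow> om x y z) \<noteq> 0}. monom_word (cyc3 t) (case t of (x, y, z) \<Rightarrow> om x y z))"
        unfolding om(3) tri by (rule sum.mono_neutral_right[OF fin]) (blast, simp)
      also have "\<dots> = (\<Sum>t\<in>{t \<in> trip d V. (case t of (x, y, z) \<Rightarrow> om x y z) \<noteq> 0}. scl (\<epsilon> (cyc3 t)) (word (cyc3 t)))"
        by (rule sum.cong[OF refl]) (simp only: mem_Collect_eq \<epsilon> word_single scl_single mult_1_right)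
      also have "\<dots> = (\<Sum>c\<in>T. scl (\<epsilon> c) (word c))"
        unfolding T_def by (subst sum.reindex[OF inj_on_subset[OF inj]]) (blast, simp only: comp_def)
      finally show ?thesis .
    qed
    moreover have "qsp d (polygon_quiver d P \<sigma> r) W" unfolding om(3) qsp using S om(2) by blast
    ultimately show ?L unfolding polygon_potential_def Let_def C_def[symmetric] by blast
  qed
qed

lemma trip_arc_sides: "trip d (arc_sides d P) = (\<Union>r<npoly P. trip d (polygon_sides d P r))"
proof (rule set_eqI)
  fix t :: "side \<times> side \<times> side"
  obtain x y z where e: "t = (x, y, z)" by (rule prod_cases3)
  show "t \<in> trip d (arc_sides d P) \<longleftrightarrow> t \<in> (\<Union>r<npoly P. trip d (polygon_sides d P r))"
  proof
    assume "t \<in> trip d (arc_sides d P)"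
    then have V: "x \<in> arc_sides d P" "y \<in> arc_sides d P" "z \<in> arc_sides d P" and cw: "clockwise d x y z"
      unfolding e trip_iff by blast+
    have "fst y = fst x" "fst z = fst x" using cw unfolding clockwise_def by simp_all
    then have "fst x < npoly P" "(x, y, z) \<in> trip d (polygon_sides d P (fst x))"
      using V[unfolded arc_sides_in] cw unfolding trip_iff by simp_all
    then show "t \<in> (\<Union>r<npoly P. trip d (polygon_sides d P r))" unfolding e by blast
  next
    assume "t \<in> (\<Union>r<npoly P. trip d (polygon_sides d P r))"
    then obtain r where r: "r < npoly P" "(x, y, z) \<in> trip d (polygon_sides d P r)" unfolding e by blast
    have V: "polygon_sides d P r \<subseteq> arc_sides d P" unfolding arc_sides_eq using r(1) by blast
    show "t \<in> trip d (arc_sides d P)" using r(2) V unfolding e trip_iff by blast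
  qed
qed

lemma unit_choice_cong:
  assumes "unit_choice d V om" "\<And>x y z. \<lbrakk>x \<in> V; y \<in> V; z \<in> V\<rbrakk> \<Longrightarrow> om x y z = om' x y z"
  shows "unit_choice d V om'"
  unfolding unit_choice_def
proof (intro ballI impI)
  fix x y z assume V: "x \<in> V" "y \<in> V" "z \<in> V" and "clockwise d x y z"
  then have "one_unit (om x y z) (om y z x) (om z x y)" using assms(1) unfolding unit_choice_def by blast
  then show "one_unit (om' x y z) (om' y z x) (om' z x y)"
    unfolding assms(2)[OF V] assms(2)[OF V(2,3,1)] assms(2)[OF V(3,1,2)] .
qed

lemma quads_vanish_cong:
  assumes "quads_vanish d V sg om" "\<And>x y z. \<lbrakk>x \<in> V; y \<in> V; z \<in> V\<rbrakk> \<Longrightarrow> om x y z = om' x y z"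
    and "\<And>x. x \<in> V \<Longrightarrow> snd x < d"
  shows "quads_vanish d V sg om'"
  unfolding quads_vanish_def
proof (intro ballI impI)
  fix x p q z assume V: "x \<in> V" "p \<in> V" "q \<in> V" "z \<in> V" and cw: "clockwise d x q z" "clockwise d x p q"
  have "quad_coeff d sg om x p q z = quad_coeff d sg om' x p q z"
    by (rule quad_coeff_cong[OF refl assms(2) V assms(3) cw])
  then show "quad_coeff d sg om' x p q z = 0" using assms(1) V cw unfolding quads_vanish_def by metis
qed

text \<open>
  Triples and quadruples never leave a polygon, so the conditions for the polygons can be stated
  for all sides at once.
\<close>

theorem surface_potential_iff:
  fixes P :: "('a, 'v) polygons" and W :: "(side \<times> side) list \<Rightarrow>\<^sub>0 'k::comm_ring_1" and r :: nat
  assumes d: "3 \<le> d"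
  defines "V \<equiv> arc_sides d P"
  shows "surface_potential d P \<sigma> W \<longleftrightarrow> good_signs d V (\<lambda>x y. \<sigma> (x, y)) \<and>
     (\<exists>om. unit_choice d V om \<and> quads_vanish d V (\<lambda>x y. \<sigma> (x, y)) om \<and>
       W = (\<Sum>(x, y, z)\<in>trip d V. monom_word [(x, y), (y, z), (z, x)] (om x y z)))"
    (is "_ \<longleftrightarrow> ?S \<and> (\<exists>om. ?R om)")
proof -
  let ?V = "polygon_sides d P"
  let ?f = "\<lambda>om (x, y, z). monom_word [(x, y), (y, z), (z, x)] (om x y z :: 'k)"
  have inV: "x \<in> V \<longleftrightarrow> fst x < npoly P \<and> x \<in> ?V (fst x)" for x unfolding V_def by (rule arc_sides_in)
  have VI: "x \<in> V" if "r < npoly P" "x \<in> ?V r" for r x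
    unfolding V_def arc_sides_eq using that by blast
  have VD: "fst x < npoly P" "x \<in> ?V (fst x)" if "x \<in> V" for x using that inV by blast+
  have cwD: "fst y = fst x" "fst z = fst x" if "clockwise d x y z" for x y z using that unfolding clockwise_def by simp_all
  have sg: "?S \<longleftrightarrow> (\<forall>r<npoly P. good_signs d (?V r) (\<lambda>x y. \<sigma> (x, y)))"
  proof
    show "?S \<Longrightarrow> \<forall>r<npoly P. good_signs d (?V r) (\<lambda>x y. \<sigma> (x, y))" unfolding good_signs_def using VI by blast
    assume g: "\<forall>r<npoly P. good_signs d (?V r) (\<lambda>x y. \<sigma> (x, y))"
    show ?S unfolding good_signs_def
    proof (intro ballI impI)
      fix x y assume xy: "x \<in> V" "y \<in> V" "x \<noteq> y" "fst x = fst y"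
      have y: "y \<in> ?V (fst x)" unfolding xy(4) by (rule VD(2)[OF xy(2)])
      show "\<sigma> (x, y) \<in> {1, - 1} \<and>
          \<sigma> (x, y) * \<sigma> (y, x) = - psign ((1 - int (clock_dist d x y)) * (1 - int (clock_dist d y x)))"
        by (rule g[rule_format, OF VD(1)[OF xy(1)], unfolded good_signs_def, THEN bspec, THEN bspec, THEN mp, THEN mp,
            OF VD(2)[OF xy(1)] y xy(3,4)])
    qed
  qed
  have uc: "unit_choice d V om \<longleftrightarrow> (\<forall>r<npoly P. unit_choice d (?V r) om)" for om :: "side \<Rightarrow> side \<Rightarrow> side \<Rightarrow> 'k"
  proof
    show "unit_choice d V om \<Longrightarrow> \<forall>r<npoly P. unit_choice d (?V r) om" unfolding unit_choice_def using VI by blast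
    assume g: "\<forall>r<npoly P. unit_choice d (?V r) om"
    show "unit_choice d V om" unfolding unit_choice_def
    proof (intro ballI impI)
      fix x y z assume V: "x \<in> V" "y \<in> V" "z \<in> V" and cw: "clockwise d x y z"
      have y: "y \<in> ?V (fst x)" using VD(2)[OF V(2)] unfolding cwD(1)[OF cw] .
      have z: "z \<in> ?V (fst x)" using VD(2)[OF V(3)] unfolding cwD(2)[OF cw] .
      show "one_unit (om x y z) (om y z x) (om z x y)"
        by (rule g[rule_format, OF VD(1)[OF V(1)], unfolded unit_choice_def, THEN bspec, THEN bspec, THEN bspec, THEN mp,
            OF VD(2)[OF V(1)] y z cw])
    qed
  qed
  have qv: "quads_vanish d V s om \<longleftrightarrow> (\<forall>r<npoly P. quads_vanish d (?V r) s om)" for s and om :: "side \<Rightarrow> side \<Rightarrow> side \<Rightarrow> 'k"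
  proof
    show "quads_vanish d V s om \<Longrightarrow> \<forall>r<npoly P. quads_vanish d (?V r) s om" unfolding quads_vanish_def using VI by blast
    assume g: "\<forall>r<npoly P. quads_vanish d (?V r) s om"
    show "quads_vanish d V s om" unfolding quads_vanish_def
    proof (intro ballI impI)
      fix x p q z assume V: "x \<in> V" "p \<in> V" "q \<in> V" "z \<in> V" and cw: "clockwise d x q z" "clockwise d x p q"
      have p: "p \<in> ?V (fst x)" using VD(2)[OF V(2)] unfolding cwD(1)[OF cw(2)] .
      have q: "q \<in> ?V (fst x)" using VD(2)[OF V(3)] unfolding cwD(1)[OF cw(1)] .
      have z: "z \<in> ?V (fst x)" using VD(2)[OF V(4)] unfolding cwD(2)[OF cw(1)] .
      show "quad_coeff d s om x p q z = 0"
        by (rule g[rule_format, OF VD(1)[OF V(1)], unfolded quads_vanish_def, THEN bspec, THEN bspec, THEN bspec, THEN bspec,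
            THEN mp, THEN mp, OF VD(2)[OF V(1)] p q z cw])
    qed
  qed
  have fin: "finite (trip d (?V r))" for r
    by (rule finite_subset[of _ "?V r \<times> ?V r \<times> ?V r"]) (auto simp: trip_def finite_polygon_sides)
  have W: "(\<Sum>t\<in>trip d V. ?f om t) = (\<Sum>r<npoly P. \<Sum>t\<in>trip d (?V r). ?f om t)" for om
    unfolding V_def trip_arc_sides
  proof (rule sum.UNION_disjoint)
    show "\<forall>r\<in>{..<npoly P}. \<forall>r'\<in>{..<npoly P}. r \<noteq> r' \<longrightarrow> trip d (?V r) \<inter> trip d (?V r') = {}"
    proof (intro ballI impI equals0I)
      fix r r' t assume n: "r \<noteq> r'" and t: "t \<in> trip d (?V r) \<inter> trip d (?V r')"
      obtain x y z where e: "t = (x, y, z)" by (rule prod_cases3)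
      show False using t n polygon_sidesD(1) unfolding e Int_iff trip_iff by metis
    qed
  qed (simp_all add: fin)
  show ?thesis
  proof
    assume "surface_potential d P \<sigma> W"
    then obtain Wr where Wr: "\<forall>r<npoly P. polygon_potential d P \<sigma> r (Wr r)" "W = (\<Sum>r<npoly P. Wr r)"
      unfolding surface_potential_def by blast
    define R where "R r om \<longleftrightarrow> unit_choice d (?V r) om \<and> quads_vanish d (?V r) (\<lambda>x y. \<sigma> (x, y)) om \<and>
        Wr r = (\<Sum>t\<in>trip d (?V r). ?f om t)" for r om
    have pot: "good_signs d (?V r) (\<lambda>x y. \<sigma> (x, y)) \<and> (\<exists>om. R r om)" if "r < npoly P" for r
      unfolding R_def by (rule Wr(1)[rule_format, OF that, unfolded polygon_potential_iff[OF d]])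
    then have "\<forall>r. \<exists>om. r < npoly P \<longrightarrow> R r om" by blast
    from choice[OF this] obtain om where om: "\<forall>r. r < npoly P \<longrightarrow> R r (om r)" ..
    define om' where "om' x y z = om (fst x) x y z" for x y z
    have e: "om r x y z = om' x y z" if "x \<in> ?V r" "y \<in> ?V r" "z \<in> ?V r" for r x y z
      unfolding om'_def polygon_sidesD(1)[OF that(1)] ..
    have part: "unit_choice d (?V r) om'" "quads_vanish d (?V r) (\<lambda>x y. \<sigma> (x, y)) om'" "Wr r = (\<Sum>t\<in>trip d (?V r). ?f om' t)"
      if r: "r < npoly P" for r
    proof -
      note o = om[rule_format, OF r, unfolded R_def]
      show "unit_choice d (?V r) om'" by (rule unit_choice_cong[OF o[THEN conjunct1] e])
      show "quads_vanish d (?V r) (\<lambda>x y. \<sigma> (x, y)) om'"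
        by (rule quads_vanish_cong[OF o[THEN conjunct2, THEN conjunct1] e polygon_sidesD(2)])
      have "Wr r = (\<Sum>t\<in>trip d (?V r). ?f (om r) t)" by (rule o[THEN conjunct2, THEN conjunct2])
      also have "\<dots> = (\<Sum>t\<in>trip d (?V r). ?f om' t)"
      proof (rule sum.cong[OF refl])
        fix t assume t: "t \<in> trip d (?V r)"
        obtain x y z where q: "t = (x, y, z)" by (rule prod_cases3)
        have V: "x \<in> ?V r" "y \<in> ?V r" "z \<in> ?V r" using t unfolding q trip_iff by blast+
        show "?f (om r) t = ?f om' t" unfolding q split_conv e[OF V] ..
      qed
      finally show "Wr r = (\<Sum>t\<in>trip d (?V r). ?f om' t)" .
    qed
    have "(\<Sum>r<npoly P. Wr r) = (\<Sum>r<npoly P. \<Sum>t\<in>trip d (?V r). ?f om' t)"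
    proof (rule sum.cong[OF refl])
      fix r assume "r \<in> {..<npoly P}"
      then have "r < npoly P" by simp
      then show "Wr r = (\<Sum>t\<in>trip d (?V r). ?f om' t)" by (rule part(3))
    qed
    then have "W = (\<Sum>t\<in>trip d V. ?f om' t)" unfolding Wr(2) W .
    moreover have "unit_choice d V om'" "quads_vanish d V (\<lambda>x y. \<sigma> (x, y)) om'" unfolding uc qv using part(1,2) by blast+
    ultimately have R: "?R om'" by blast
    have S: ?S unfolding sg using pot by blast
    show "?S \<and> (\<exists>om. ?R om)" by (rule conjI[OF S], rule exI[of _ om'], rule R)
  next
    assume a: "?S \<and> (\<exists>om. ?R om)"
    from conjunct2[OF a] obtain om where om: "?R om" ..
    have S: "\<forall>r<npoly P. good_signs d (?V r) (\<lambda>x y. \<sigma> (x, y))" using conjunct1[OF a] unfolding sg .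
    have u: "\<forall>r<npoly P. unit_choice d (?V r) om" using om[THEN conjunct1] unfolding uc .
    have q: "\<forall>r<npoly P. quads_vanish d (?V r) (\<lambda>x y. \<sigma> (x, y)) om" using om[THEN conjunct2, THEN conjunct1] unfolding qv .
    have eq: "W = (\<Sum>r<npoly P. \<Sum>t\<in>trip d (?V r). ?f om t)" by (rule trans[OF om[THEN conjunct2, THEN conjunct2] W])
    have pp: "\<forall>r<npoly P. polygon_potential d P \<sigma> r (\<Sum>t\<in>trip d (?V r). ?f om t)"
    proof (intro allI impI)
      fix r assume r: "r < npoly P"
      show "polygon_potential d P \<sigma> r (\<Sum>t\<in>trip d (?V r). ?f om t)"
        unfolding polygon_potential_iff[OF d]
        by (rule conjI[OF S[rule_format, OF r]], rule exI[of _ om],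
            rule conjI[OF u[rule_format, OF r] conjI[OF q[rule_format, OF r] refl]])
    qed
    show "surface_potential d P \<sigma> W"
      unfolding surface_potential_def
      by (rule exI[of _ "\<lambda>r. \<Sum>t\<in>trip d (?V r). ?f om t"], rule conjI[OF pp eq])
  qed
qed

section \<open>The mutation is the QsP of the flip\<close>

context flip_quiver
begin

abbreviation "mu_quiver \<equiv> mutation'_quiver d P \<sigma> i"

abbreviation "new_sign x y \<equiv> mut_osgn d (Inr i) G (g x y)"

definition new_vertex :: "side \<Rightarrow> 'v" where
  "new_vertex x = the (label P (flip_side d u w x))"

text \<open>
  The gluing that completes the mutation, on the vertices of the partially glued quiver.
\<close>

definition unglue :: "side + 'v \<Rightarrow> 'v" where
  "unglue x = (case x of Inl y \<Rightarrow> the (label P y) | Inr j \<Rightarrow> j)"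

lemma mu_simps: "arrs mu_quiver = arrs QM - killed" "src mu_quiver m = unglue (mut_src G m)"
  "tgt mu_quiver m = unglue (mut_tgt G m)" "deg mu_quiver = mut_deg d (Inr i) G" "opp mu_quiver = mut_opp G"
  "osgn mu_quiver = mut_osgn d (Inr i) G" "verts mu_quiver = unglue ` verts G"
  by (simp_all add: mutation'_quiver_def Let_def glue_def mut_quiver_def unglue_def[abs_def])

lemma unglue_src: "x \<in> V \<Longrightarrow> unglue (src G (x, y)) = the (label P x)"
  and unglue_tgt: "y \<in> V \<Longrightarrow> unglue (tgt G (x, y)) = the (label P y)"
proof -
  show "unglue (src G (x, y)) = the (label P x)" if V: "x \<in> V"
    using G_src[OF V, of y] label_ear[OF V] by (cases "ear x") (simp_all add: unglue_def)
  show "unglue (tgt G (x, y)) = the (label P y)" if V: "y \<in> V"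
    using G_tgt[OF V, of x] label_ear[OF V] by (cases "ear y") (simp_all add: unglue_def)
qed

lemma new_vertex_simps: "ear X \<Longrightarrow> new_vertex X = the (label P (next_side d (other X)))"
  "ear X \<Longrightarrow> new_vertex (next_side d X) = the (label P X)"
  "\<lbrakk>\<not> ear x; step x = 0\<rbrakk> \<Longrightarrow> new_vertex x = the (label P x)"
  by (simp_all add: new_vertex_def flip_side_simps)

lemma ear_label: "ear X \<Longrightarrow> the (label P X) = i"
  using label_ear[OF ear_V, of X] by simp

lemma unglue_apex: "\<lbrakk>ear X; X \<in> V'\<rbrakk> \<Longrightarrow> unglue (src G (apex X)) = new_vertex X"
  unfolding apex_def new_vertex_simps by (rule unglue_src) (simp only: V'_ear)

text \<open>
  A composite starts where its left factor does. For the new side \<open>X\<close> of an ear this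
  is the old side after the other side of \<open>i\<close>, and for the next side it is
  \<open>i\<close>, as prescribed by the relabelling of the flip.
\<close>

lemma src_g:
  assumes xy: "x \<in> V'" "y \<in> V'" "x \<noteq> y" "fst x = fst y"
  shows "unglue (mut_src G (g x y)) = new_vertex x"
proof (cases "core x = core y")
  case True
  obtain X where X: "ear X" "x = next_side d X \<and> y = X \<or> x = X \<and> y = next_side d X"
    using same_core[OF xy(3) True] by blast
  from X(2) show ?thesis
  proof
    assume e: "x = next_side d X \<and> y = X"
    have "unglue (mut_src G (g x y)) = unglue (tgt G (apex X))" using e g_ear(1)[OF X(1)] by simp
    also have "\<dots> = the (label P (other X))"
      unfolding apex_def by (rule unglue_tgt[OF ear_V[OF ear_other(1)[OF X(1)]]])
    also have "\<dots> = new_vertex x"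
      using e new_vertex_simps(2)[OF X(1)] ear_label[OF X(1)] ear_label[OF ear_other(1)[OF X(1)]] by simp
    finally show ?thesis .
  next
    assume e: "x = X \<and> y = next_side d X"
    have "unglue (mut_src G (g x y)) = unglue (src G (apex X))" using e g_ear(2)[OF X(1)] by simp
    also have "\<dots> = new_vertex x" using unglue_apex[OF X(1)] xy(1) e by blast
    finally show ?thesis .
  qed
next
  case False
  have g: "g x y = Cmp (fac x) (core x, core y) (fac y)" unfolding g_def using False by (simp only: if_False)
  show ?thesis
  proof (cases x rule: side_kinds)
    case ear
    then show ?thesis unfolding g using unglue_apex[OF ear(1) xy(1)] by (simp only: mut_src.simps)
  next
    case (nxt X)
    have "unglue (mut_src G (g x y)) = the (label P X)"
      unfolding g nxt(6) mut_src.simps nxt(3) by (rule unglue_src[OF ear_V[OF nxt(1)]])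
    also have "\<dots> = new_vertex x" unfolding nxt(2) new_vertex_simps(2)[OF nxt(1)] ..
    finally show ?thesis .
  next
    case ord
    have "x \<in> V" using V'_ord[OF ord(1,3)] xy(1) by blast
    then have "unglue (mut_src G (g x y)) = the (label P x)"
      unfolding g ord(4) mut_src.simps ord(2) by (rule unglue_src)
    also have "\<dots> = new_vertex x" unfolding new_vertex_simps(3)[OF ord(1,3)] ..
    finally show ?thesis .
  qed
qed

lemma mut_tgt_opp: "mut_tgt G m = mut_src G (mut_opp G m)"
proof -
  have t: "tgt G \<phi> = src G (opp G \<phi>)" for \<phi> by (simp add: glued_at_def glue_def pre_quiver_def)
  show ?thesis
  proof (cases m)
    case (Cmp l \<phi> r)
    then show ?thesis by (cases l; cases r) (simp_all add: t)
  qed simp_all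
qed

lemma flip_side_image: "flip_side d u w ` V' = V"
proof
  have "flip_side d u w x \<in> sides d P" if "x \<in> sides d P" for x
    using that uw_sides next_sides[OF uw_sides(1)] next_sides[OF uw_sides(2)] unfolding flip_side_def by simp
  then show "flip_side d u w ` V' \<subseteq> V" unfolding V_def V'_def by blast
  have pre: "\<exists>x\<in>sides d P. flip_side d u w x = y" if y: "y \<in> sides d P" for y
  proof (cases "ear y")
    case True
    then show ?thesis using flip_side_simps(2)[OF True] next_sides[OF y] by blast
  next
    case False
    show ?thesis
    proof (cases "\<exists>X. ear X \<and> y = next_side d X")
      case True
      then obtain X where X: "ear X" "y = next_side d X" by blast
      have "flip_side d u w (other X) = y"
        using flip_side_simps(1)[OF ear_other(1)[OF X(1)]] ear_other(2)[OF X(1)] X(2) by simp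
      moreover have "other X \<in> sides d P" using ear_V[OF ear_other(1)[OF X(1)]] unfolding V_def by blast
      ultimately show ?thesis by blast
    next
      case n: False
      have "step y = 0" using n ear_simps(1,2) unfolding step_def by metis
      then show ?thesis using flip_side_simps(3)[OF False] y by blast
    qed
  qed
  show "V \<subseteq> flip_side d u w ` V'"
  proof
    fix y assume "y \<in> V"
    then have y: "y \<in> sides d P" "label P y \<noteq> None" unfolding V_def by blast+
    obtain x where x: "x \<in> sides d P" "flip_side d u w x = y" using pre[OF y(1)] by blast
    then have "x \<in> V'" unfolding V'_def using y(2) by blast
    then show "y \<in> flip_side d u w ` V'" using x(2) by blast
  qed
qed

lemma mu_sided_quiver: "sided_quiver d mu_quiver V' g new_vertex"
proof unfold_locales
  show "finite V'" by (rule finite_V')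
  show "x \<in> V' \<Longrightarrow> snd x < d" for x by (rule V'_snd)
  show "arrs mu_quiver = {g x y | x y. x \<in> V' \<and> y \<in> V' \<and> x \<noteq> y \<and> fst x = fst y}"
    unfolding mu_simps by (rule remaining_arrs)
  show "x = x' \<and> y = y'" if "x \<noteq> y" "x' \<noteq> y'" "g x y = g x' y'" for x y x' y'
    by (rule g_inj[OF that])
  show "verts mu_quiver = new_vertex ` V'"
  proof -
    have G: "verts G = (\<lambda>x. if label P x = Some i then Inr i else Inl x) ` V"
    proof -
      interpret p: sided_quiver d "pre_quiver d P \<sigma>" "arc_sides d P" Pair "\<lambda>x. x" by (rule pre_sided_quiver)
      show ?thesis using p.verts_eq by (simp add: glued_at_def glue_def arc_sides_def V_def)
    qed
    have "verts mu_quiver = (\<lambda>x. the (label P x)) ` V"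
      unfolding mu_simps G image_image by (rule image_cong[OF refl]) (simp add: unglue_def)
    also have "\<dots> = new_vertex ` V'"
      unfolding flip_side_image[symmetric] image_image new_vertex_def ..
    finally show ?thesis .
  qed
  fix x y assume xy: "x \<in> V'" "y \<in> V'" "x \<noteq> y" "fst x = fst y"
  note yx = xy(2,1) xy(3)[symmetric] xy(4)[symmetric]
  show "deg mu_quiver (g x y) = 1 - cd x y" unfolding mu_simps by (rule deg_g[OF xy])
  show "opp mu_quiver (g x y) = g y x" unfolding mu_simps by (rule opp_g[OF xy(3)])
  show "src mu_quiver (g x y) = new_vertex x" unfolding mu_simps by (rule src_g[OF xy])
  show "tgt mu_quiver (g x y) = new_vertex y"
    unfolding mu_simps mut_tgt_opp opp_g[OF xy(3)] by (rule src_g[OF yx])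
qed

lemma new_om_ear:
  assumes X: "ear X" "X \<in> V'" and y: "y \<in> V'" "core y \<noteq> X" "fst y = fst X"
  shows "new_om om X y (next_side d X) = psign (int d + 1) * of_int (\<sigma> (X, core y)) * (ear_sign y :: 'k::comm_ring_1)"
    "new_om om (next_side d X) X y = (0 :: 'k)" "new_om om y (next_side d X) X = (0 :: 'k)"
proof -
  have c: "core X = X" "core (next_side d X) = X" "\<not> ear (next_side d X)" using ear_core(1,2,5)[OF X(1)] .
  have s: "\<not> spread X y (next_side d X)" "\<not> spread (next_side d X) X y" "\<not> spread y (next_side d X) X"
    unfolding spread_def c by simp_all
  have "(X, y, next_side d X) \<in> extra_triples"
    unfolding extra_triples_def mem_Collect_eq split_conv using X y by blast
  then show "new_om om X y (next_side d X) = psign (int d + 1) * of_int (\<sigma> (X, core y)) * (ear_sign y :: 'k)"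
    unfolding new_om_def using s(1) by (simp only: if_False if_True)
  have "(next_side d X, X, y) \<notin> extra_triples"
    unfolding extra_triples_def mem_Collect_eq split_conv using c(3) by blast
  then show "new_om om (next_side d X) X y = (0 :: 'k)"
    unfolding new_om_def using s(2) by (simp only: if_False)
  have "(y, next_side d X, X) \<notin> extra_triples"
    unfolding extra_triples_def mem_Collect_eq split_conv using ear_core(5)[of y] X(1) by metis
  then show "new_om om y (next_side d X) X = (0 :: 'k)"
    unfolding new_om_def using s(3) by (simp only: if_False)
qed

lemma new_quads_vanish:
  fixes om :: "side \<Rightarrow> side \<Rightarrow> side \<Rightarrow> 'k::comm_ring_1"
  assumes "quads_vanish d V (\<lambda>x y. \<sigma> (x, y)) om"
  shows "quads_vanish d V' new_sign (new_om om)"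
proof -
  interpret s: flip_signs d u w V V' "\<lambda>x y. \<sigma> (x, y)" new_sign om "new_om om"
  proof unfold_locales
    fix x y z X p q :: side
    show "x \<in> V \<Longrightarrow> snd x < d" "x \<in> V' \<Longrightarrow> snd x < d" "x \<in> V' \<Longrightarrow> core x \<in> V"
      by (erule V_snd V'_snd core_V)+
    show "\<lbrakk>x \<in> V; y \<in> V; x \<noteq> y; fst x = fst y\<rbrakk> \<Longrightarrow> \<sigma> (x, y) = 1 \<or> \<sigma> (x, y) = - 1"
      by (rule \<sigma>_one, unfold arr_iff) blast
    show "\<lbrakk>x \<in> V; y \<in> V; x \<noteq> y; fst x = fst y\<rbrakk> \<Longrightarrow> \<sigma> (x, y) * \<sigma> (y, x) = - psign ((1 - cd x y) * (1 - cd y x))"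
      by (rule \<sigma>_op, unfold arr_iff) blast
    show "\<lbrakk>x \<in> V'; y \<in> V'; core x \<noteq> core y; fst x = fst y\<rbrakk> \<Longrightarrow>
        new_sign x y = ear_sign x * ear_sign y * psign ((int d + 1) * step x) * \<sigma> (core x, core y)"
      by (rule osgn_g)
    show "X = u \<or> X = w \<Longrightarrow> new_sign (next_side d X) X = 1" "X = u \<or> X = w \<Longrightarrow> new_sign X (next_side d X) = - 1"
      using osgn_g_ear[of X] unfolding ear_def by blast+
    show "\<lbrakk>x \<in> V'; y \<in> V'; z \<in> V'; core x \<noteq> core y; core y \<noteq> core z; core x \<noteq> core z; clockwise d x y z\<rbrakk> \<Longrightarrow>
        new_om om x y z = ear_sign x * ear_sign y * ear_sign z * psign (int d * step x) * om (core x) (core y) (core z)"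
      unfolding new_om_def spread_def by (simp only: simp_thms if_True)
    show "\<lbrakk>X = u \<or> X = w; X \<in> V'; y \<in> V'; core y \<noteq> X; fst y = fst X\<rbrakk> \<Longrightarrow>
        new_om om X y (next_side d X) = psign (int d + 1) * of_int (\<sigma> (X, core y)) * ear_sign y"
      "\<lbrakk>X = u \<or> X = w; X \<in> V'; y \<in> V'; core y \<noteq> X; fst y = fst X\<rbrakk> \<Longrightarrow> new_om om (next_side d X) X y = 0"
      "\<lbrakk>X = u \<or> X = w; X \<in> V'; y \<in> V'; core y \<noteq> X; fst y = fst X\<rbrakk> \<Longrightarrow> new_om om y (next_side d X) X = 0"
      using new_om_ear[of X y om] unfolding ear_def by blast+
    show "\<lbrakk>x \<in> V; p \<in> V; q \<in> V; z \<in> V; clockwise d x q z; clockwise d x p q\<rbrakk> \<Longrightarrow>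
        quad_coeff d (\<lambda>x y. \<sigma> (x, y)) om x p q z = 0"
      using assms unfolding quads_vanish_def by blast
  qed
  show ?thesis unfolding quads_vanish_def using s.quad_flip by blast
qed

lemma ear_sign_cases: "ear_sign x = (1 :: 'k::comm_ring_1) \<or> ear_sign x = (- 1 :: 'k)"
  by (simp add: ear_sign_def)

lemma psign_cases: "psign n = (1 :: 'k::comm_ring_1) \<or> psign n = (- 1 :: 'k)"
  by (simp add: psign_def)

text \<open>
  Moving a side by one step changes the exponent \<open>(1 - a) (1 - b)\<close> by the parity of
  \<open>D + 1\<close>, because \<open>a + b = D\<close>.
\<close>

lemma new_sign_parity:
  fixes s t a b :: int
  assumes "s = 0 \<or> s = 1" "t = 0 \<or> t = 1" "a + b = D"
  shows "even ((D + 1) * s + (D + 1) * t + (1 - a) * (1 - b) - (1 - (a + s - t)) * (1 - (b + t - s)))"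
proof -
  have b: "b = D - a" using assms(3) by simp
  consider "s = t" | "s = 1" "t = 0" | "s = 0" "t = 1" using assms by blast
  then show ?thesis
  proof cases
    case 1
    have "(D + 1) * s + (D + 1) * t + (1 - a) * (1 - b) - (1 - (a + s - t)) * (1 - (b + t - s)) = 2 * ((D + 1) * t)"
      unfolding 1 by (simp add: algebra_simps)
    then show ?thesis by (simp only: even_mult_iff even_numeral simp_thms)
  next
    case 2
    have "(D + 1) * s + (D + 1) * t + (1 - a) * (1 - b) - (1 - (a + s - t)) * (1 - (b + t - s)) = 2 * (1 + a)"
      unfolding b 2 by (simp add: algebra_simps)
    then show ?thesis by (simp only: even_mult_iff even_numeral simp_thms)
  next
    case 3
    have "(D + 1) * s + (D + 1) * t + (1 - a) * (1 - b) - (1 - (a + s - t)) * (1 - (b + t - s)) = 2 * (1 + D - a)"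
      unfolding b 3 by (simp add: algebra_simps)
    then show ?thesis by (simp only: even_mult_iff even_numeral simp_thms)
  qed
qed

lemma new_good_signs: "good_signs d V' new_sign"
  unfolding good_signs_def
proof (intro ballI impI)
  fix x y assume xy: "x \<in> V'" "y \<in> V'" "x \<noteq> y" "fst x = fst y"
  note yx = xy(2,1) xy(3)[symmetric] xy(4)[symmetric]
  show "new_sign x y \<in> {1, - 1} \<and> new_sign x y * new_sign y x = - psign ((1 - cd x y) * (1 - cd y x))"
  proof (cases "core x = core y")
    case True
    obtain X where X: "ear X" "x = next_side d X \<and> y = X \<or> x = X \<and> y = next_side d X"
      using same_core[OF xy(3) True] by blast
    have z: "1 - cd (next_side d X) X = 0" using ear_pair(1)[OF X(1)] by simp
    from X(2) show ?thesis
    proof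
      assume "x = next_side d X \<and> y = X"
      then have e: "x = next_side d X" "y = X" by blast+
      show ?thesis unfolding e osgn_g_ear[OF X(1)] z by (simp add: psign_def)
    next
      assume "x = X \<and> y = next_side d X"
      then have e: "x = X" "y = next_side d X" by blast+
      show ?thesis unfolding e osgn_g_ear[OF X(1)] z by (simp add: psign_def)
    qed
  next
    case False
    note F = False[symmetric]
    have s: "snd x < d" "snd y < d" "snd (core x) < d" "snd (core y) < d" using V'_snd xy core_snd by blast+
    have fc: "fst (core x) = fst (core y)" using xy(4) by simp
    have a: "(core x, core y) \<in> arrs G" "(core y, core x) \<in> arrs G"
      using core_arrs(1)[OF xy(1,2) False xy(4)] core_arrs(1)[OF yx(1,2) F yx(4)] .
    have op: "\<sigma> (core x, core y) * \<sigma> (core y, core x) = - psign ((1 - cd (core x) (core y)) * (1 - cd (core y) (core x)))"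
      by (rule \<sigma>_op[OF a(1)])
    have es: "ear_sign x * ear_sign x = (1::int)" "ear_sign y * ear_sign y = (1::int)" by (simp_all add: ear_sign_def)
    have "new_sign x y * new_sign y x = (ear_sign x * ear_sign x) * (ear_sign y * ear_sign y) *
        (psign ((int d + 1) * step x) * psign ((int d + 1) * step y)) * (\<sigma> (core x, core y) * \<sigma> (core y, core x))"
      unfolding osgn_g[OF xy(1,2) False xy(4)] osgn_g[OF yx(1,2) F yx(4)] by (simp only: mult_ac)
    also have "\<dots> = - psign ((int d + 1) * step x + (int d + 1) * step y +
        (1 - cd (core x) (core y)) * (1 - cd (core y) (core x)))"
      unfolding es op psign_add by simp
    also have "\<dots> = - psign ((1 - cd x y) * (1 - cd y x))"
    proof -
      have "cd (core x) (core y) + cd (core y) (core x) = int d" by (rule clock_dist_sum[OF s(3,4) fc False])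
      from new_sign_parity[OF step01[of x] step01[of y] this]
      show ?thesis unfolding clock_dist_core[OF s(1,2) xy(4) False] clock_dist_core[OF s(2,1) yx(4) F]
        by (intro arg_cong[where f = uminus] psign_cong)
    qed
    finally have 1: "new_sign x y * new_sign y x = - psign ((1 - cd x y) * (1 - cd y x))" .
    have "new_sign x y \<in> {1, - 1}"
      unfolding osgn_g[OF xy(1,2) False xy(4)]
      using ear_sign_cases[of x, where 'k = int] ear_sign_cases[of y, where 'k = int]
        psign_cases[of "(int d + 1) * step x", where 'k = int] \<sigma>_one[OF a(1)]
      by (elim disjE) (simp_all only: insert_iff mult_1_left mult_1_right mult_minus_left mult_minus_right minus_minus simp_thms)
    with 1 show ?thesis by blast
  qed
qed

lemma one_unit_scale:
  "\<lbrakk>k = 1 \<or> k = - 1; l = 1 \<or> l = - 1; m = 1 \<or> m = - 1; one_unit a b c\<rbrakk> \<Longrightarrow> one_unit (k * a) (l * b) (m * c)"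
  by (elim disjE) (auto simp: one_unit_def)

lemma unit_mult: "\<lbrakk>k = 1 \<or> k = - 1; l = 1 \<or> l = - 1\<rbrakk> \<Longrightarrow> k * l = 1 \<or> k * l = (- 1 :: 'k::comm_ring_1)"
  by (elim disjE) simp_all

text \<open>
  Scaling by signs preserves the condition for triangles with different cores, and an extra
  triangle has its nonzero coefficient at the rotation that starts with the side of the ear.
\<close>

lemma new_unit_choice:
  fixes om :: "side \<Rightarrow> side \<Rightarrow> side \<Rightarrow> 'k::comm_ring_1"
  assumes om: "unit_choice d V om"
  shows "unit_choice d V' (new_om om)"
  unfolding unit_choice_def
proof (intro ballI impI)
  have same: "one_unit (new_om om x y z) (new_om om y z x) (new_om om z x y)"
    if V: "x \<in> V'" "y \<in> V'" "z \<in> V'" and cw: "clockwise d x y z" and c: "core x = core y" for x y z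
  proof -
    note s = V'_snd[OF V(1)] V'_snd[OF V(2)] V'_snd[OF V(3)]
    obtain X where X: "X = u \<or> X = w" "x = next_side d X" "y = X" using same_core_clockwise[OF s cw c] by blast
    have e: "ear X" using X(1) unfolding ear_def .
    have d3: "x \<noteq> y" "y \<noteq> z" "x \<noteq> z" "fst x = fst y" "fst y = fst z" using clockwise_distinct[OF s cw] by blast+
    have cz: "core z \<noteq> X"
    proof
      assume "core z = X"
      then have "core X = core z" using ear_core(1)[OF e] by simp
      then obtain Z where "ear Z" "X = next_side d Z \<and> z = Z \<or> X = Z \<and> z = next_side d Z"
        using same_core[of X z] d3(2) X(3) by blast
      then show False using ear_core(5)[of Z] e d3(3) X(2) by blast
    qed
    have XV: "X \<in> V'" using V(2) X(3) by simp
    have fz: "fst z = fst X" using d3(5) X(3) by simp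
    note v = new_om_ear[OF e XV V(3) cz fz, of om]
    have "(X, core z) \<in> arrs G" unfolding arr_iff using ear_V[OF e] core_V[OF V(3)] cz fz by simp
    then have "\<sigma> (X, core z) = 1 \<or> \<sigma> (X, core z) = - 1" by (rule \<sigma>_one)
    then have "of_int (\<sigma> (X, core z)) = (1::'k) \<or> of_int (\<sigma> (X, core z)) = (- 1::'k)" by (elim disjE) simp_all
    then have "new_om om X z (next_side d X) = 1 \<or> new_om om X z (next_side d X) = - 1"
      unfolding v(1) by (intro unit_mult psign_cases ear_sign_cases)
    then show ?thesis unfolding X(2,3) v(2,3) one_unit_def by simp
  qed
  have rot: "one_unit b c a \<Longrightarrow> one_unit a b c" for a b c :: 'k by (auto simp: one_unit_def)
  fix x y z assume V: "x \<in> V'" "y \<in> V'" "z \<in> V'" and cw: "clockwise d x y z"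
  note s = V'_snd[OF V(1)] V'_snd[OF V(2)] V'_snd[OF V(3)]
  have cw2: "clockwise d y z x" by (rule clockwise_rotate[OF s cw])
  have cw3: "clockwise d z x y" by (rule clockwise_rotate[OF s(2,3,1) cw2])
  show "one_unit (new_om om x y z) (new_om om y z x) (new_om om z x y)"
  proof (cases "spread x y z")
    case True
    then have sp: "spread x y z" "spread y z x" "spread z x y" unfolding spread_def by auto
    have n: "core x \<noteq> core y" "core y \<noteq> core z" "core x \<noteq> core z" using True unfolding spread_def by blast+
    have "clockwise d (core x) (core y) (core z)" using clockwise_core[OF s n] cw by blast
    then have "one_unit (om (core x) (core y) (core z)) (om (core y) (core z) (core x)) (om (core z) (core x) (core y))"
      using om core_V[OF V(1)] core_V[OF V(2)] core_V[OF V(3)] unfolding unit_choice_def by blast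
    then show ?thesis
      unfolding new_om_def if_P[OF sp(1)] if_P[OF sp(2)] if_P[OF sp(3)]
      by (intro one_unit_scale unit_mult psign_cases ear_sign_cases)
  next
    case False
    then consider "core x = core y" | "core y = core z" | "core z = core x" unfolding spread_def by metis
    then show ?thesis
    proof cases
      case 1
      show ?thesis by (rule same[OF V cw 1])
    next
      case 2
      show ?thesis by (rule rot[OF same[OF V(2,3,1) cw2 2]])
    next
      case 3
      show ?thesis by (rule rot[OF rot[OF same[OF V(3,1,2) cw3 3]]])
    qed
  qed
qed

theorem mutation'_surface_qsp:
  fixes P' :: "('b, 'v) polygons" and W :: "(side \<times> side) list \<Rightarrow>\<^sub>0 'k::comm_ring_1"
  assumes W: "surface_potential d P \<sigma> W"
    and P': "sides d P' = sides d P" "\<And>x. label P' x = label P (flip_side d u w x)"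
  shows "\<exists>\<sigma>' W' f. qsp d mu_quiver (mutation'_potential d P \<sigma> i W) \<and> surface_potential d P' \<sigma>' W' \<and>
    qsp_iso f mu_quiver (mutation'_potential d P \<sigma> i W) (surface_quiver d P' \<sigma>') W'"
proof -
  have V: "arc_sides d P = V" "arc_sides d P' = V'"
    unfolding arc_sides_def V_def V'_def P' by (rule refl)+
  obtain om where om: "unit_choice d V om" "quads_vanish d V (\<lambda>x y. \<sigma> (x, y)) om"
      "W = (\<Sum>(x, y, z)\<in>trip d V. monom_word [(x, y), (y, z), (z, x)] (om x y z))"
    using W unfolding surface_potential_iff[OF d3] V by blast
  define \<sigma>' where "\<sigma>' p = new_sign (fst p) (snd p)" for p
  have \<sigma>': "(\<lambda>x y. \<sigma>' (x, y)) = new_sign" by (simp add: \<sigma>'_def)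
  interpret M: sided_quiver d mu_quiver V' g new_vertex by (rule mu_sided_quiver)
  have sS: "sided_quiver d (surface_quiver d P' \<sigma>') V' Pair new_vertex"
    using surface_sided_quiver[of d P' \<sigma>'] unfolding V P'(2) new_vertex_def[abs_def] .
  interpret S: sided_quiver d "surface_quiver d P' \<sigma>'" V' Pair new_vertex by (rule sS)
  have MW: "mutation'_potential d P \<sigma> i W = M.tri_potential (new_om om)"
    unfolding om(3) mutation'_potential_triangles M.tri_potential_def M.triples_trip ..
  have Msg: "M.sg = new_sign" unfolding mu_simps ..
  have "qsp d mu_quiver (mutation'_potential d P \<sigma> i W)"
    unfolding MW M.qsp_iff Msg using new_good_signs new_quads_vanish[OF om(2)] by blast
  moreover have "surface_potential d P' \<sigma>' (S.tri_potential (new_om om))"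
    unfolding surface_potential_iff[OF d3] V(2) \<sigma>' S.tri_potential_def S.triples_trip
    using new_good_signs new_quads_vanish[OF om(2)] new_unit_choice[OF om(1)] by blast
  moreover obtain f where "qsp_iso f mu_quiver (M.tri_potential (new_om om)) (surface_quiver d P' \<sigma>') (S.tri_potential (new_om om))"
  proof -
    have "osgn mu_quiver (g x y) = osgn (surface_quiver d P' \<sigma>') (x, y)" for x y
      by (simp add: mu_simps surface_quiver_def glue_def pre_quiver_def \<sigma>'_def)
    from sided_quiver_iso[OF mu_sided_quiver sS this] show ?thesis using that by blast
  qed
  ultimately show ?thesis unfolding MW by blast
qed

end

theorem theorem2p16:
  fixes d :: nat
    and S :: "'a::t2_space set" and \<A> :: "('a set \<times> ('a \<Rightarrow> complex)) set" and M :: "'a set"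
    and I :: "'v set" and \<gamma> :: "'v \<Rightarrow> real \<Rightarrow> 'a" and P :: "('a, 'v) polygons"
    and i :: 'v and \<gamma>' :: "real \<Rightarrow> 'a"
    and \<sigma> :: "side \<times> side \<Rightarrow> int"
    and W :: "(side \<times> side) list \<Rightarrow>\<^sub>0 'k::alg_closed_field"
  assumes "3 \<le> d"
    and "marked_surface S \<A> M"
    and "d_angulation d S \<A> M I \<gamma> P"
    and "i \<in> I"
    and "is_flip d S \<A> M \<gamma> P i \<gamma>'"
    and "surface_potential d P \<sigma> W"
  shows "associated_qsp d S \<A> M I (\<gamma>(i := \<gamma>'))
           (mutation'_quiver d P \<sigma> i) (mutation'_potential d P \<sigma> i W)"
proof -
  obtain u w where uw: "left_side d \<gamma> P i u" "right_side d \<gamma> P i w"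
    using assms(5) unfolding is_flip_def by blast
  interpret F: flippable d S \<A> M I \<gamma> P i u w
    by (rule flippable.intro[OF assms(1-4) uw])
  have label_i: "label P x = Some i \<longleftrightarrow> x = u \<or> x = w" if x: "x \<in> sides d P" for x
  proof
    show "label P x = Some i \<Longrightarrow> x = u \<or> x = w" by (rule F.labelled_sides[OF x])
  next
    assume "x = u \<or> x = w"
    then show "label P x = Some i" using F.u_side(2) F.w_side(2) by blast
  qed
  have graded: "graded_quiver d (pre_quiver d P \<sigma>)"
  proof -
    have "(\<lambda>x y. osgn (pre_quiver d P \<sigma>) (x, y)) = (\<lambda>x y. \<sigma> (x, y))" by (simp add: pre_quiver_def)
    moreover have "good_signs d (arc_sides d P) (\<lambda>x y. \<sigma> (x, y))"
      using assms(6) unfolding surface_potential_iff[OF assms(1)] by blast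
    ultimately show ?thesis by (simp only: sided_quiver.graded_iff[OF pre_sided_quiver])
  qed
  interpret Q: flip_quiver d u w P i \<sigma>
  proof unfold_locales
    show "3 \<le> d" by (rule assms(1))
    show "snd u < d" "snd w < d" using F.sidesD[OF F.u_side(1)] F.sidesD[OF F.w_side(1)] by blast+
    show "u \<noteq> w" "next_side d u \<noteq> w" "next_side d w \<noteq> u"
      by (rule F.u_neq_w F.next_u_neq_w F.next_w_neq_u)+
    show "u \<in> sides d P" "w \<in> sides d P" by (rule F.u_side(1) F.w_side(1))+
    show "label P x = Some i \<longleftrightarrow> x = u \<or> x = w" if "x \<in> sides d P" for x by (rule label_i[OF that])
    show "graded_quiver d (pre_quiver d P \<sigma>)" by (rule graded)
  qed
  have P': "sides d (flip_polygons d P u w) = sides d P"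
    "label (flip_polygons d P u w) x = label P (flip_side d u w x)" for x
    by (simp_all add: flip_polygons_def sides_def label_def)
  obtain \<sigma>' W' f where q: "qsp d (mutation'_quiver d P \<sigma> i) (mutation'_potential d P \<sigma> i W)"
      "surface_potential d (flip_polygons d P u w) \<sigma>' W'"
      "qsp_iso f (mutation'_quiver d P \<sigma> i) (mutation'_potential d P \<sigma> i W)
         (surface_quiver d (flip_polygons d P u w) \<sigma>') W'"
    using Q.mutation'_surface_qsp[OF assms(6) P'] by blast
  have hom: "\<forall>a\<in>I. homotopic_paths S ((\<gamma>(i := flip_arc d P u w)) a) ((\<gamma>(i := \<gamma>')) a)"
  proof
    fix a assume a: "a \<in> I"
    show "homotopic_paths S ((\<gamma>(i := flip_arc d P u w)) a) ((\<gamma>(i := \<gamma>')) a)"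
    proof (cases "a = i")
      case True
      then show ?thesis using F.d_angulation_flip(1)[OF assms(5)] by simp
    next
      case False
      then show ?thesis using F.arc_facts(5,6)[OF a] by (simp add: homotopic_paths_refl)
    qed
  qed
  show ?thesis
    unfolding associated_qsp_def
    by (rule conjI[OF q(1)], rule exI[of _ "\<gamma>(i := flip_arc d P u w)"], rule exI[of _ "flip_polygons d P u w"],
        rule exI[of _ \<sigma>'], rule exI[of _ W'], rule exI[of _ f],
        intro conjI hom F.d_angulation_flip(2)[OF assms(5)] q(2,3))
qed

end
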